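(* Let $\Gamma$ be a decay function on $\mathbb{Z}^m$, let $U\subset \ell^\infty(\mathbb{R}^n)$ be an open set with $0\in U$, and let $\mathfrak{a}\in L(\mathbb{R}^n,\mathbb{R}^n)$ have eigenvalues $\lambda_1,\ldots,\lambda_n\in\mathbb{C}$ (with $\operatorname{Spec}(\mathfrak{a})=\{\lambda_1,\ldots,\lambda_n\}$). Put $\alpha=\min_i|\lambda_i|$, $\beta=\max_i|\lambda_i|$, $\nu=\frac{\log\alpha}{\log\beta}$ and $r_0=[\nu]+1$, where $[\cdot]$ denotes the integer part. Assume (H1) $0<|\lambda_i|<1$ for $1\le i\le n$; (H2) $\lambda_i\neq\lambda_1^{k_1}\cdots\lambda_n^{k_n}$ for all $1\le i\le n$ and all $k=(k_1,\ldots,k_n)$ with nonnegative integer entries and $2\le|k|\le r_0$, where $|k|=k_1+\cdots+k_n$. Let $r\ge r_0$ be an integer. Then there is $\varepsilon>0$, depending only on $\mathfrak{a}$, $\Gamma$, $r$ and the norm on $\mathbb{R}^n$, such that the following holds. Let $F\in C^r_\Gamma(U,\ell^\infty(\mathbb{R}^n))$ be of the form $F=F_0+F_1$, where $F_0$ is an uncoupled map, $F_0(0)=F_1(0)=0$, $A=DF_0(0)$, $B=DF_1(0)$, $M=A+B$, and $A_{ij}=\mathfrak{a}\,\delta_{ij}$ for all $i,j\in\mathbb{Z}^m$. If $\|B\|_\Gamma<\varepsilon$, then there exists $R\in C^r_\Gamma(\ell^\infty(\mathbb{R}^n),\ell^\infty(\mathbb{R}^n))$ such that $R(0)=0$, $DR(0)=\operatorname{Id}$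 and $$R\circ F=M R$$ in some neighborhood $U_1\subseteq U$ of $0$ in $\ell^\infty(\mathbb{R}^n)$.
   Context: Fix integers $n,m\ge1$ and a norm $\|\cdot\|$ on $\mathbb{R}^n$. $\ell^\infty(\mathbb{R}^n)$ is the Banach space of bounded families $x=(x_i)_{i\in\mathbb{Z}^m}$, $x_i\in\mathbb{R}^n$, with norm $\|x\|_\infty=\sup_i\|x_i\|$. Decay function: $\Gamma:\mathbb{Z}^m\to\mathbb{R}^+=(0,\infty)$ with $\sum_{k}\Gamma(k)\le1$ and $\sum_k\Gamma(i-k)\Gamma(k-j)\le\Gamma(i-j)$ for all $i,j\in\mathbb{Z}^m$. Linear maps with decay: for a bounded linear map $A$ of $\ell^\infty(\mathbb{R}^n)$ let $\|A\|$ be the operator norm, $\gamma(A)=\sup_{i,k\in\mathbb{Z}^m}\sup\{\|(Au)_i\|\,\Gamma(i-k)^{-1}: \|u\|_\infty\le1,\ u_j=0 \text{ for } j\ne k\}$ and $\|A\|_\Gamma=\max\{\|A\|,\gamma(A)\}$; $L_\Gamma$ is the set of $A$ with $\|A\|_\Gamma<\infty$. Multilinear maps with decay: $L^k_\Gamma$ is the space of bounded $k$-linear maps $A:\ell^\infty(\mathbb{R}^n)^k\to\ell^\infty(\mathbb{R}^n)$ with $\|A\|_\Gamma=\max\{\|A\|,\gamma(A)\}<\infty$, where $\gamma(A)=\max_{1\le p\le k}\sup_{i,l\in\mathbb{Z}^m}\sup\|A(v_1,\ldots,v_{p-1},w,v_p,\ldots,v_{k-1})_i\|\,\Gamma(i-l)^{-1}$,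 the inner supremum being over $w$ with $\|w\|_\infty\le1$, $w_j=0$ for $j\neq l$, and $v_q$ with $\|v_q\|_\infty\le1$. For $V\subset\ell^\infty(\mathbb{R}^n)$ open and an integer $r\ge1$, $C^r_\Gamma(V,\ell^\infty(\mathbb{R}^n))$ is the space of maps $F\in C^r(V,\ell^\infty(\mathbb{R}^n))$ (Fréchet sense) with $\sup_{x\in V}\|F(x)\|_\infty<\infty$, $D^jF(x)\in L^j_\Gamma$ for all $x\in V$ and $\sup_{x\in V}\|D^jF(x)\|_\Gamma<\infty$ for $1\le j\le r$; its norm is the maximum of these suprema. A map $F_0:U\to\ell^\infty(\mathbb{R}^n)$ is uncoupled if, for each $i$, the component $(F_0(x))_i$ depends only on $x_i$. $A_{ij}=\mathrm{proj}_i A\,\mathrm{emb}_j$ is the $(i,j)$ block of $A$, where $\mathrm{proj}_i$ is projection onto the $i$-th node and $\mathrm{emb}_j$ the embedding of $\mathbb{R}^n$ as the $j$-th node; thus here $(Au)_i=\mathfrak{a}u_i$. $F_0,F_1$ are maps $U\to\ell^\infty(\mathbb{R}^n)$ differentiable at $0$. *)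

theory Defs
  imports "HOL-Analysis.Analysis"
begin

definition is_norm :: "('a::real_vector \<Rightarrow> real) \<Rightarrow> bool" where
  "is_norm N \<longleftrightarrow>
     (\<forall>x. 0 \<le> N x) \<and> (\<forall>x. N x = 0 \<longleftrightarrow> x = 0) \<and>
     (\<forall>c x. N (c *\<^sub>R x) = \<bar>c\<bar> * N x) \<and> (\<forall>x y. N (x + y) \<le> N x + N y)"

(* int^'m carries the discrete topology, so a bounded continuous function on it is just a
   bounded family (lemma bounded_family). The norm built into the type is the sup norm
   coming from the Euclidean norm; the sup norm for the given norm N is linf_norm N. They are
   equivalent (lemma linf_norm_equivalent), so the library's open sets and Frechet derivatives
   are the right ones for N as well; every quantitative notion below uses linf_norm N. *)
type_synonym ('m, 'n) linf = "(int^'m) \<Rightarrow>\<^sub>C (real^'n)"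

lemma bounded_family:
  fixes f :: "int^'m \<Rightarrow> real^'n"
  shows "f \<in> bcontfun \<longleftrightarrow> bounded (range f)"
proof -
  have "open {x}" for x :: "int^'m"
  proof -
    have "open {y. \<forall>i. y $ i \<in> {x $ i}}"
      by (intro open_vector_box allI) (rule open_discrete)
    moreover have "{y. \<forall>i. y $ i \<in> {x $ i}} = {x}"
      by (auto simp: vec_eq_iff)
    ultimately show ?thesis by simp
  qed
  then have "open S" for S :: "(int^'m) set"
    using open_UN[of S "\<lambda>x. {x}"] by simp
  then have "continuous_on UNIV f"
    by (simp add: continuous_on_open_vimage)
  then show ?thesis by (simp add: bcontfun_def)
qed

definition linf_norm :: "(real^'n \<Rightarrow> real) \<Rightarrow> ('m::finite, 'n::finite) linf \<Rightarrow> real" where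
  "linf_norm N x = (SUP i. N (apply_bcontfun x i))"

definition emb :: "int^'m \<Rightarrow> real^'n \<Rightarrow> ('m::finite, 'n::finite) linf" where
  "emb j u = Bcontfun (\<lambda>i. if i = j then u else 0)"

lemma apply_emb: "apply_bcontfun (emb j u) i = (if i = j then u else 0)"
proof -
  have "range (\<lambda>i. if i = j then u else 0) \<subseteq> {u, 0}" by auto
  then have "(\<lambda>i. if i = j then u else 0) \<in> bcontfun"
    unfolding bounded_family by (rule bounded_subset[rotated]) simp
  then show ?thesis by (simp add: emb_def Bcontfun_inverse)
qed

(* The summability of the convolution follows from that of \<Gamma>. *)
definition decay_function :: "(int^'m \<Rightarrow> real) \<Rightarrow> bool" where
  "decay_function \<Gamma> \<longleftrightarrow>
     (\<forall>k. 0 < \<Gamma> k) \<and> \<Gamma> summable_on UNIV \<and> (\<Sum>\<^sub>\<infinity>k. \<Gamma> k) \<le> 1 \<and>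
     (\<forall>i j. (\<Sum>\<^sub>\<infinity>k. \<Gamma> (i - k) * \<Gamma> (k - j)) \<le> \<Gamma> (i - j))"

definition op_norm :: "(real^'n \<Rightarrow> real) \<Rightarrow> (('m::finite, 'n::finite) linf \<Rightarrow> ('m::finite, 'n::finite) linf) \<Rightarrow> ennreal" where
  "op_norm N A = (SUP u\<in>{u. linf_norm N u \<le> 1}. ennreal (linf_norm N (A u)))"

definition op_gamma ::
  "(real^'n \<Rightarrow> real) \<Rightarrow> (int^'m \<Rightarrow> real) \<Rightarrow> (('m::finite, 'n::finite) linf \<Rightarrow> ('m::finite, 'n::finite) linf) \<Rightarrow> ennreal" where
  "op_gamma N \<Gamma> A =
     (SUP i. SUP k. SUP u\<in>{u. linf_norm N u \<le> 1 \<and> (\<forall>j. j \<noteq> k \<longrightarrow> apply_bcontfun u j = 0)}.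
        ennreal (N (apply_bcontfun (A u) i) * inverse (\<Gamma> (i - k))))"

(* The case k = 1 of ml_Gamma_norm below (lemma ml_Gamma_norm_1). *)
definition Gamma_norm ::
  "(real^'n \<Rightarrow> real) \<Rightarrow> (int^'m \<Rightarrow> real) \<Rightarrow> (('m::finite, 'n::finite) linf \<Rightarrow> ('m::finite, 'n::finite) linf) \<Rightarrow> ennreal" where
  "Gamma_norm N \<Gamma> A = max (op_norm N A) (op_gamma N \<Gamma> A)"

(* A k-linear map is encoded as a function on lists of which only the values on lists of length k matter. *)
definition multilinear :: "nat \<Rightarrow> ('a::real_vector list \<Rightarrow> 'b::real_vector) \<Rightarrow> bool" where
  "multilinear k A \<longleftrightarrow>
     (\<forall>vs p. length vs = k \<longrightarrow> p < k \<longrightarrow> linear (\<lambda>w. A (vs[p := w])))"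

definition ml_norm ::
  "(real^'n \<Rightarrow> real) \<Rightarrow> nat \<Rightarrow> (('m::finite, 'n::finite) linf list \<Rightarrow> ('m::finite, 'n::finite) linf) \<Rightarrow> ennreal" where
  "ml_norm N k A =
     (SUP vs\<in>{vs. length vs = k \<and> (\<forall>v\<in>set vs. linf_norm N v \<le> 1)}. ennreal (linf_norm N (A vs)))"

definition ml_gamma ::
  "(real^'n \<Rightarrow> real) \<Rightarrow> (int^'m \<Rightarrow> real) \<Rightarrow> nat \<Rightarrow> (('m::finite, 'n::finite) linf list \<Rightarrow> ('m::finite, 'n::finite) linf) \<Rightarrow> ennreal"
  where
  "ml_gamma N \<Gamma> k A =
     (SUP p\<in>{..<k}. SUP i. SUP l.
      SUP w\<in>{w. linf_norm N w \<le> 1 \<and> (\<forall>j. j \<noteq> l \<longrightarrow> apply_bcontfun w j = 0)}.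
      SUP vs\<in>{vs. length vs = k - 1 \<and> (\<forall>v\<in>set vs. linf_norm N v \<le> 1)}.
        ennreal (N (apply_bcontfun (A (take p vs @ w # drop p vs)) i) * inverse (\<Gamma> (i - l))))"

definition ml_Gamma_norm ::
  "(real^'n \<Rightarrow> real) \<Rightarrow> (int^'m \<Rightarrow> real) \<Rightarrow> nat \<Rightarrow> (('m::finite, 'n::finite) linf list \<Rightarrow> ('m::finite, 'n::finite) linf) \<Rightarrow> ennreal"
  where
  "ml_Gamma_norm N \<Gamma> k A = max (ml_norm N k A) (ml_gamma N \<Gamma> k A)"

definition L_Gamma ::
  "(real^'n \<Rightarrow> real) \<Rightarrow> (int^'m \<Rightarrow> real) \<Rightarrow> nat \<Rightarrow> (('m::finite, 'n::finite) linf list \<Rightarrow> ('m::finite, 'n::finite) linf) set" where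
  "L_Gamma N \<Gamma> k = {A. multilinear k A \<and> ml_norm N k A < \<infinity> \<and> ml_Gamma_norm N \<Gamma> k A < \<infinity>}"

(* D j x is the j-th derivative of F at x, as a j-linear map. The third conjunct says that
   y \<mapsto> D j y, with values in the bounded j-linear maps under the operator norm, has at x the
   Frechet derivative h \<mapsto> D (Suc j) x (h, ...); the fourth that all derivatives are
   continuous. For open V the derivatives are determined by F, and D 1 x is the library's
   derivative (lemma Cr_derivs_has_derivative). *)
definition Cr_derivs ::
  "(real^'n \<Rightarrow> real) \<Rightarrow> nat \<Rightarrow> ('m::finite, 'n::finite) linf set \<Rightarrow> (('m::finite, 'n::finite) linf \<Rightarrow> ('m::finite, 'n::finite) linf)
     \<Rightarrow> (nat \<Rightarrow> ('m::finite, 'n::finite) linf \<Rightarrow> ('m::finite, 'n::finite) linf list \<Rightarrow> ('m::finite, 'n::finite) linf) \<Rightarrow> bool" where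
  "Cr_derivs N r V F D \<longleftrightarrow>
     (\<forall>x\<in>V. D 0 x [] = F x) \<and>
     (\<forall>j\<le>r. \<forall>x\<in>V. multilinear j (D j x) \<and> ml_norm N j (D j x) < \<infinity>) \<and>
     (\<forall>j<r. \<forall>x\<in>V. \<forall>e>0. \<exists>d>0. \<forall>y\<in>V. linf_norm N (y - x) < d \<longrightarrow>
        ml_norm N j (\<lambda>vs. D j y vs - D j x vs - D (Suc j) x ((y - x) # vs))
          \<le> ennreal (e * linf_norm N (y - x))) \<and>
     (\<forall>j\<le>r. \<forall>x\<in>V. \<forall>e>0. \<exists>d>0. \<forall>y\<in>V. linf_norm N (y - x) < d \<longrightarrow>
        ml_norm N j (\<lambda>vs. D j y vs - D j x vs) \<le> ennreal e)"

definition C_Gamma ::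
  "(real^'n \<Rightarrow> real) \<Rightarrow> (int^'m \<Rightarrow> real) \<Rightarrow> nat \<Rightarrow> ('m::finite, 'n::finite) linf set
     \<Rightarrow> (('m::finite, 'n::finite) linf \<Rightarrow> ('m::finite, 'n::finite) linf) set" where
  "C_Gamma N \<Gamma> r V = {F. \<exists>D. Cr_derivs N r V F D \<and>
     (SUP x\<in>V. ennreal (linf_norm N (F x))) < \<infinity> \<and>
     (\<forall>j\<in>{1..r}. (\<forall>x\<in>V. D j x \<in> L_Gamma N \<Gamma> j) \<and>
        (SUP x\<in>V. ml_Gamma_norm N \<Gamma> j (D j x)) < \<infinity>)}"

definition uncoupled :: "('m::finite, 'n::finite) linf set \<Rightarrow> (('m::finite, 'n::finite) linf \<Rightarrow> ('m::finite, 'n::finite) linf) \<Rightarrow> bool" where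
  "uncoupled U F \<longleftrightarrow> (\<forall>i. \<forall>x\<in>U. \<forall>y\<in>U. apply_bcontfun x i = apply_bcontfun y i \<longrightarrow>
     apply_bcontfun (F x) i = apply_bcontfun (F y) i)"

(* Eigenvalues of the complexification of a. *)
definition Spec :: "(real^'n \<Rightarrow> real^'n) \<Rightarrow> complex set" where
  "Spec a = {z. \<exists>v::complex^'n. v \<noteq> 0 \<and> map_matrix of_real (matrix a) *v v = z *s v}"

lemma is_norm_equivalent:
  fixes N :: "real^'n \<Rightarrow> real"
  assumes N: "is_norm N"
  obtains c C where "0 < c" "0 < C" "\<And>x. c * norm x \<le> N x" "\<And>x. N x \<le> C * norm x"
proof -
  have pos: "0 \<le> N x" and zero: "N x = 0 \<longleftrightarrow> x = 0" and hom: "N (s *\<^sub>R x) = \<bar>s\<bar> * N x"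
    and tri: "N (x + y) \<le> N x + N y" for x y s
    using N by (auto simp: is_norm_def)
  have sum_le: "N (sum f S) \<le> (\<Sum>i\<in>S. N (f i))" if "finite S" for f :: "'n \<Rightarrow> real^'n" and S
    using that
  proof induction
    case empty show ?case using zero[of 0] by simp
  next
    case (insert s S) then show ?case using tri[of "f s" "sum f S"] by simp
  qed
  define C where "C = (\<Sum>i\<in>UNIV. N (axis i 1)) + 1"
  have C0: "0 < C" unfolding C_def using sum_nonneg[of UNIV "\<lambda>i. N (axis i 1)"] pos by (simp add: add_nonneg_pos)
  have up: "N x \<le> C * norm x" for x
  proof -
    have "x = (\<Sum>i\<in>UNIV. (x $ i) *\<^sub>R axis i 1)"
      using basis_expansion[of x] by (simp add: scalar_mult_eq_scaleR)
    then have "N x \<le> (\<Sum>i\<in>UNIV. N ((x $ i) *\<^sub>R axis i 1))" using sum_le[of UNIV] by (metis finite)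
    also have "\<dots> \<le> (\<Sum>i\<in>UNIV. norm x * N (axis i 1))"
      by (intro sum_mono) (auto simp: hom intro!: mult_right_mono component_le_norm_cart pos)
    also have "\<dots> \<le> C * norm x"
      by (simp add: C_def sum_distrib_left[symmetric] algebra_simps)
    finally show ?thesis .
  qed
  have diff: "\<bar>N x - N y\<bar> \<le> N (x - y)" for x y
    using tri[of "x - y" y] tri[of "y - x" x] hom[of "-1" "x - y"] by simp
  have cont: "continuous_on (sphere 0 1) N"
  proof -
    have "C-lipschitz_on (sphere 0 1) N"
      using C0 order_trans[OF diff up] by (intro lipschitz_onI) (auto simp: dist_real_def dist_norm)
    then show ?thesis by (rule lipschitz_on_continuous_on)
  qed
  obtain b :: "real^'n" where b: "norm b = 1" using vector_choose_size[of 1] by auto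
  then have "sphere (0::real^'n) 1 \<noteq> {}" by auto
  then obtain z where z: "z \<in> sphere 0 1" "\<And>y. y \<in> sphere 0 1 \<Longrightarrow> N z \<le> N y"
    using continuous_attains_inf[OF compact_sphere _ cont] by blast
  have c0: "0 < N z" using z(1) pos[of z] zero[of z] by (cases "z = 0") auto
  have "N z * norm x \<le> N x" for x
  proof (cases "x = 0")
    case False
    have "N z \<le> N (inverse (norm x) *\<^sub>R x)" using False by (intro z(2)) simp
    then show ?thesis using False by (simp add: hom field_simps)
  qed (use zero[of 0] in simp)
  with that c0 C0 up show ?thesis by blast
qed

lemma linf_norm_equivalent:
  fixes N :: "real^'n \<Rightarrow> real"
  assumes "is_norm N"
  obtains c C where "0 < c" "0 < C"
    "\<And>x :: ('m::finite, 'n) linf. c * norm x \<le> linf_norm N x"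
    "\<And>x :: ('m::finite, 'n::finite) linf. linf_norm N x \<le> C * norm x"
proof -
  obtain c C where cC: "0 < c" "0 < C" "\<And>x. c * norm x \<le> N x" "\<And>x. N x \<le> C * norm x"
    using is_norm_equivalent[OF assms] by blast
  have le: "N (apply_bcontfun x i) \<le> C * norm x" for x :: "('m::finite, 'n::finite) linf" and i
    using order_trans[OF cC(4) mult_left_mono[OF norm_bounded]] cC(2) by simp
  then have "linf_norm N x \<le> C * norm x" for x :: "('m::finite, 'n::finite) linf"
    unfolding linf_norm_def by (intro cSUP_least) auto
  moreover have "c * norm x \<le> linf_norm N x" for x :: "('m::finite, 'n::finite) linf"
  proof -
    have "bdd_above (range (\<lambda>i. N (apply_bcontfun x i)))"
      using le by (auto intro!: bdd_aboveI2)
    then have "norm (apply_bcontfun x i) \<le> linf_norm N x / c" for i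
      using order_trans[OF cC(3) cSUP_upper[of i UNIV "\<lambda>i. N (apply_bcontfun x i)"]] cC(1)
      by (simp add: linf_norm_def field_simps)
    from norm_bound[OF this] show ?thesis using cC(1) by (simp add: field_simps)
  qed
  ultimately show ?thesis using that cC(1,2) by blast
qed

lemma Cr_derivs_has_derivative:
  fixes N :: "real^'n \<Rightarrow> real" and F :: "('m::finite, 'n) linf \<Rightarrow> ('m, 'n) linf"
  assumes N: "is_norm N" and D: "Cr_derivs N r V F D" and r: "1 \<le> r" and V: "open V" and x: "x \<in> V"
  shows "(F has_derivative (\<lambda>h. D 1 x [h])) (at x)"
proof -
  obtain c C where cC: "0 < c" "0 < C" "\<And>x :: ('m, 'n) linf. c * norm x \<le> linf_norm N x"
      "\<And>x :: ('m, 'n) linf. linf_norm N x \<le> C * norm x"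
    using linf_norm_equivalent[OF N] by blast
  have nonneg: "0 \<le> linf_norm N v" for v :: "('m, 'n) linf"
    using cC(1) cC(3)[of v] by (meson mult_nonneg_nonneg less_imp_le norm_ge_zero order_trans)
  have ml: "multilinear 1 (D 1 x)" and fin: "ml_norm N 1 (D 1 x) < \<infinity>"
    using D r x by (auto simp: Cr_derivs_def)
  have lin: "linear (\<lambda>h. D 1 x [h])"
    using ml unfolding multilinear_def by (elim allE[of _ "[0]"] allE[of _ "0::nat"]) simp
  obtain K where K: "ml_norm N 1 (D 1 x) = ennreal K" "0 \<le> K"
    using fin by (cases "ml_norm N 1 (D 1 x)") auto
  have Kb: "linf_norm N (D 1 x [v]) \<le> K" if "linf_norm N v \<le> 1" for v
  proof -
    have "ennreal (linf_norm N (D 1 x [v])) \<le> ennreal K"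
      unfolding K(1)[symmetric] ml_norm_def using that by (intro SUP_upper) auto
    then show ?thesis using K(2) by simp
  qed
  have bl: "bounded_linear (\<lambda>h. D 1 x [h])"
  proof (rule bounded_linear_intro[where K = "K * C / c"])
    show "D 1 x [u + v] = D 1 x [u] + D 1 x [v]" for u v using linear_add[OF lin] .
    show "D 1 x [s *\<^sub>R u] = s *\<^sub>R D 1 x [u]" for s u using linear_scale[OF lin] .
    show "norm (D 1 x [u]) \<le> norm u * (K * C / c)" for u
    proof (cases "u = 0")
      case True then show ?thesis using linear_0[OF lin] by simp
    next
      case False
      define s where "s = inverse (C * norm u)"
      have s: "0 < s" using False cC(2) by (simp add: s_def)
      have "linf_norm N (s *\<^sub>R u) \<le> 1"
        using order_trans[OF cC(4)[of "s *\<^sub>R u"]] s False cC(2) by (simp add: s_def field_simps)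
      from Kb[OF this] have "c * norm (s *\<^sub>R D 1 x [u]) \<le> K"
        using cC(3)[of "s *\<^sub>R D 1 x [u]"] linear_scale[OF lin, of s u] by simp
      then show ?thesis using s False cC(1,2) by (simp add: s_def field_simps)
    qed
  qed
  have "(F has_derivative (\<lambda>h. D 1 x [h])) (at x within V)"
  proof (rule has_derivative_within_alt[THEN iffD2], intro conjI bl allI impI)
    fix e :: real assume e: "0 < e"
    define e' where "e' = e * c / C"
    have e': "0 < e'" using e cC by (simp add: e'_def)
    have "\<forall>j<r. \<forall>x\<in>V. \<forall>e>0. \<exists>d>0. \<forall>y\<in>V. linf_norm N (y - x) < d \<longrightarrow>
        ml_norm N j (\<lambda>vs. D j y vs - D j x vs - D (Suc j) x ((y - x) # vs))
          \<le> ennreal (e * linf_norm N (y - x))"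
      using D unfolding Cr_derivs_def by (elim conjE)
    from this[rule_format, of 0 x e'] r x e' obtain d where d: "0 < d" and
      dd: "\<And>y. y \<in> V \<Longrightarrow> linf_norm N (y - x) < d \<Longrightarrow>
        ml_norm N 0 (\<lambda>vs. D 0 y vs - D 0 x vs - D (Suc 0) x ((y - x) # vs))
          \<le> ennreal (e' * linf_norm N (y - x))"
      by auto
    have "norm (F y - F x - D 1 x [y - x]) \<le> e * norm (y - x)"
      if y: "y \<in> V" and n: "norm (y - x) < d / C" for y
    proof -
      have "linf_norm N (y - x) < d"
        using order_le_less_trans[OF cC(4)[of "y - x"], of d] n cC(2) by (simp add: field_simps)
      have "ennreal (linf_norm N (F y - F x - D 1 x [y - x])) \<le> ennreal (e' * linf_norm N (y - x))"
      proof -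
        have "D 0 y [] = F y" "D 0 x [] = F x" using D x y by (auto simp: Cr_derivs_def)
        then have "ennreal (linf_norm N (F y - F x - D 1 x [y - x]))
            \<le> ml_norm N 0 (\<lambda>vs. D 0 y vs - D 0 x vs - D (Suc 0) x ((y - x) # vs))"
          unfolding ml_norm_def by (intro SUP_upper2[of "[]"]) auto
        also note dd[OF y \<open>linf_norm N (y - x) < d\<close>]
        finally show ?thesis .
      qed
      then have "linf_norm N (F y - F x - D 1 x [y - x]) \<le> e' * linf_norm N (y - x)"
        using e' nonneg by (simp add: ennreal_le_iff)
      also have "\<dots> \<le> e' * (C * norm (y - x))"
        using e' cC(4) by (intro mult_left_mono) auto
      also have "\<dots> = c * (e * norm (y - x))" using cC(2) by (simp add: e'_def)
      finally have "c * norm (F y - F x - D 1 x [y - x]) \<le> c * (e * norm (y - x))"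
        using cC(3) order_trans by blast
      then show ?thesis using cC(1) by simp
    qed
    then show "\<exists>d>0. \<forall>y\<in>V. norm (y - x) < d \<longrightarrow>
        norm (F y - F x - D 1 x [y - x]) \<le> e * norm (y - x)"
      using d cC(2) by (intro exI[of _ "d / C"]) auto
  qed
  then show ?thesis using V x at_within_open by metis
qed

lemma ml_Gamma_norm_1:
  fixes A :: "('m::finite, 'n::finite) linf \<Rightarrow> ('m, 'n) linf"
  shows "ml_Gamma_norm N \<Gamma> 1 (\<lambda>vs. A (hd vs)) = Gamma_norm N \<Gamma> A"
proof -
  have "{vs :: ('m, 'n) linf list. length vs = 1 \<and> (\<forall>v\<in>set vs. linf_norm N v \<le> 1)} = (\<lambda>v. [v]) ` {v. linf_norm N v \<le> 1}"
    by (auto simp: length_Suc_conv)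
  then have "ml_norm N 1 (\<lambda>vs. A (hd vs)) = op_norm N A"
    unfolding ml_norm_def op_norm_def by (simp only: image_image list.sel)
  moreover have "{vs :: ('m, 'n) linf list. vs = [] \<and> (\<forall>v\<in>set vs. linf_norm N v \<le> 1)} = {[]}"
    by auto
  then have "ml_gamma N \<Gamma> 1 (\<lambda>vs. A (hd vs)) = op_gamma N \<Gamma> A"
    by (simp add: ml_gamma_def op_gamma_def lessThan_Suc)
  ultimately show ?thesis by (simp add: ml_Gamma_norm_def Gamma_norm_def)
qed

end

theory Submission
  imports Defs "HOL-Computational_Algebra.Fundamental_Theorem_Algebra" "HOL-Combinatorics.Permutations"
begin

text \<open>A bound on \<open>\<gamma>(A)\<close> says that \<open>A\<close> is bounded for each of the weighted sup norms with weight
  \<open>\<Gamma> (\<cdot> - l)\<close>, as long as one argument is measured in that norm and the others in the plain sup norm;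
  so all bounds are taken uniformly over this set of weights, and compositions cause no trouble.

  In a norm on \<open>\<real>\<^sup>n\<close> adapted to \<open>\<aa>\<close> one has \<open>l \<beta>' ^ q < 1\<close> with \<open>q = r\<^sub>0\<close>, \<open>l = \<parallel>M\<^sup>-\<^sup>1\<parallel>\<close> and
  \<open>\<beta>' > \<parallel>M\<parallel>\<close>. For \<open>2 \<le> j < q\<close> the homological equation \<open>M P - P (M\<cdot>, \<dots>, M\<cdot>) = Q\<close> in \<open>j\<close>-linear maps is
  solvable: for \<open>M = A\<close> by nonresonance, and for small \<open>B\<close> by perturbation. This gives a polynomial
  \<open>P\<close> with \<open>DP(0) = Id\<close> for which \<open>g = M\<^sup>-\<^sup>1 \<circ> P \<circ> F - P\<close> vanishes to order \<open>q - 1\<close> at \<open>0\<close>. On such \<open>g\<close> the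
  operator \<open>T h = M\<^sup>-\<^sup>1 \<circ> h \<circ> F\<close> contracts, hence \<open>R = P + \<Sum>k. T\<^sup>k g\<close> converges in \<open>C\<^sup>r\<close> near \<open>0\<close>
  and satisfies \<open>M\<^sup>-\<^sup>1 \<circ> R \<circ> F = R\<close>. Composing \<open>R\<close> with a cutoff of the identity applied coordinate by
  coordinate, which is uncoupled, makes it global.\<close>

section \<open>An adapted norm\<close>

text \<open>The eigenvalue hypotheses are complex, while the maps are real and act on an
  infinite-dimensional space, where no basis of monomials diagonalizes the homological operator.
  Annihilating products of factors need only the finite matrix of \<open>a\<close> and give
  constants independent of the node and of the weight.

  The hypotheses meet in the exponent \<open>q\<close>: \<open>q > \<nu>\<close> means
  \<open>\<beta> ^ q < \<alpha>\<close>, which leaves room for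
  \<open>h \<mapsto> M\<^sup>-\<^sup>1 \<circ> h \<circ> F\<close> to contract on maps flat to order
  \<open>q - 1\<close>; derivatives of order \<open>i > q\<close> gain
  \<open>\<beta> ^ i \<le> \<beta> ^ q\<close> without any flatness.

  The radius \<open>\<epsilon>\<close> has to be fixed before \<open>U\<close>, \<open>F\<close> and
  \<open>B\<close>. It is constrained only by the bound for \<open>M\<close>, its inverse, and
  finitely many homological equations, whose constants come from \<open>a\<close>, the norms and the
  set of weights. The nonlinear bounds of \<open>F\<close> influence only the size of the
  neighborhood. Two norms on the nodes are in play, the given one and the adapted one; the factors
  lost between them go into \<open>\<epsilon>\<close> and into the bounds for derivatives.\<close>

lemma nontrivial_combination:
  fixes u :: "nat \<Rightarrow> 'a::euclidean_space"
  assumes "DIM('a) \<le> n"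
  obtains c k where "k \<le> n" "c k \<noteq> (0::real)" "(\<Sum>k\<le>n. c k *\<^sub>R u k) = 0"
proof (cases "inj_on u {..n}")
  case True
  then have "card (u ` {..n}) = Suc n" by (simp add: card_image)
  then have "dependent (u ` {..n})"
    using assms independent_bound[of "u ` {..n}"] by auto
  then obtain f v where f: "v \<in> u ` {..n}" "f v \<noteq> 0" "(\<Sum>v\<in>u ` {..n}. f v *\<^sub>R v) = 0"
    by (auto simp: dependent_finite)
  from f(1) obtain k where "k \<le> n" "v = u k" by auto
  moreover have "(\<Sum>k\<le>n. f (u k) *\<^sub>R u k) = 0"
    using f(3) True by (simp add: sum.reindex)
  ultimately show ?thesis using f(2) that[of k "\<lambda>k. f (u k)"] by simp
next
  case False
  then obtain i j where ij: "i \<le> n" "j \<le> n" "i \<noteq> j" "u i = u j" by (auto simp: inj_on_def)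
  define c where "c = (\<lambda>k. if k = i then 1 else if k = j then -1 else (0::real))"
  have "(\<Sum>k\<le>n. c k *\<^sub>R u k) = (\<Sum>k\<in>{i,j}. c k *\<^sub>R u k)"
    using ij by (intro sum.mono_neutral_right) (auto simp: c_def)
  also have "\<dots> = 0" using ij by (simp add: c_def)
  finally show ?thesis using that[of i c] ij by (simp add: c_def)
qed

section \<open>Annihilating a complex matrix by a product of factors \<open>X - \<mu>\<close> over a
  list\<close>

primrec root_op :: "complex^'n^'n \<Rightarrow> complex list \<Rightarrow> complex^'n \<Rightarrow> complex^'n" where
  "root_op X [] v = v"
| "root_op X (\<mu> # \<mu>s) v = root_op X \<mu>s (X *v v - \<mu> *s v)"

lemma root_op_add: "root_op X \<mu>s (v + w) = root_op X \<mu>s v + root_op X \<mu>s w"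
proof (induction \<mu>s arbitrary: v w)
  case (Cons \<mu> \<mu>s)
  have "X *v (v + w) - \<mu> *s (v + w) = (X *v v - \<mu> *s v) + (X *v w - \<mu> *s w)"
    by (simp add: matrix_vector_right_distrib vector_add_ldistrib)
  then show ?case by (simp only: root_op.simps Cons.IH)
qed simp

lemma root_op_scale: "root_op X \<mu>s (c *s v) = c *s root_op X \<mu>s v"
proof (induction \<mu>s arbitrary: v)
  case (Cons \<mu> \<mu>s)
  have "X *v (c *s v) - \<mu> *s (c *s v) = c *s (X *v v - \<mu> *s v)"
    by (simp add: vector_scalar_commute vector_smult_assoc vec.scale_right_diff_distrib mult.commute)
  then show ?case by (simp only: root_op.simps Cons.IH)
qed simp

lemma root_op_0 [simp]: "root_op X \<mu>s 0 = 0"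
  using root_op_scale[of X \<mu>s 0 0] by simp

lemma root_op_diff: "root_op X \<mu>s (v - w) = root_op X \<mu>s v - root_op X \<mu>s w"
  using root_op_add[of X \<mu>s "v - w" w] by (simp add: algebra_simps)

lemma root_op_sum: "root_op X \<mu>s (sum f S) = (\<Sum>s\<in>S. root_op X \<mu>s (f s))"
  by (induction S rule: infinite_finite_induct) (auto simp: root_op_add)

lemma root_op_commute: "root_op X \<mu>s (X *v v) = X *v root_op X \<mu>s v"
proof (induction \<mu>s arbitrary: v)
  case (Cons \<mu> \<mu>s)
  have "X *v (X *v v) - \<mu> *s (X *v v) = X *v (X *v v - \<mu> *s v)"
    by (simp add: matrix_vector_mult_diff_distrib vector_scalar_commute)
  then show ?case using Cons by simp
qed simp

lemma root_op_append: "root_op X (\<mu>s @ \<nu>s) v = root_op X \<nu>s (root_op X \<mu>s v)"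
  by (induction \<mu>s arbitrary: v) auto

lemma root_op_swap: "root_op X \<mu>s (root_op X \<nu>s v) = root_op X \<nu>s (root_op X \<mu>s v)"
  by (induction \<nu>s arbitrary: v) (auto simp: root_op_diff root_op_commute root_op_scale)

definition poly_act :: "complex^'n^'n \<Rightarrow> complex poly \<Rightarrow> complex^'n \<Rightarrow> complex^'n" where
  "poly_act X p v = (\<Sum>k\<le>degree p. coeff p k *s ((\<lambda>w. X *v w) ^^ k) v)"

lemma poly_act_alt:
  assumes "degree p \<le> n"
  shows "poly_act X p v = (\<Sum>k\<le>n. coeff p k *s ((\<lambda>w. X *v w) ^^ k) v)"
  unfolding poly_act_def
  by (rule sum.mono_neutral_left) (use assms in \<open>auto simp: coeff_eq_0\<close>)

lemma poly_act_factor: "poly_act X ([:-\<mu>, 1:] * p) v = poly_act X p (X *v v - \<mu> *s v)"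
proof -
  define n where "n = degree p"
  let ?P = "\<lambda>k v. ((\<lambda>w. X *v w) ^^ k) v"
  have P: "?P k (X *v v) = ?P (Suc k) v" for k v by (simp add: funpow_swap1)
  have lin: "?P k (v - \<mu> *s w) = ?P k v - \<mu> *s ?P k w" for k v w
    by (induction k) (simp_all add: matrix_vector_mult_diff_distrib vector_scalar_commute)
  have "degree ([:-\<mu>, 1:] * p) \<le> Suc n"
    using degree_mult_le[of "[:-\<mu>, 1:]" p] by (simp add: n_def)
  then have "poly_act X ([:-\<mu>, 1:] * p) v = (\<Sum>k\<le>Suc n. coeff ([:-\<mu>, 1:] * p) k *s ?P k v)"
    by (rule poly_act_alt)
  also have "\<dots> = (\<Sum>k\<le>Suc n. (coeff (pCons 0 p) k - \<mu> * coeff p k) *s ?P k v)"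
    by (intro sum.cong refl) (simp add: mult_pCons_left)
  also have "\<dots> = (\<Sum>k\<le>Suc n. coeff (pCons 0 p) k *s ?P k v) - (\<Sum>k\<le>Suc n. (\<mu> * coeff p k) *s ?P k v)"
    by (simp add: vector_sub_rdistrib sum_subtractf del: sum.atMost_Suc)
  also have "(\<Sum>k\<le>Suc n. coeff (pCons 0 p) k *s ?P k v) = (\<Sum>k\<le>n. coeff p k *s ?P (Suc k) v)"
    by (subst sum.atMost_Suc_shift) simp
  also have "(\<Sum>k\<le>Suc n. (\<mu> * coeff p k) *s ?P k v) = (\<Sum>k\<le>n. (\<mu> * coeff p k) *s ?P k v)"
    by (simp add: n_def coeff_eq_0)
  also have "(\<Sum>k\<le>n. coeff p k *s ?P (Suc k) v) - (\<Sum>k\<le>n. (\<mu> * coeff p k) *s ?P k v)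
      = (\<Sum>k\<le>n. coeff p k *s ?P k (X *v v - \<mu> *s v))"
    by (simp add: lin P[symmetric] sum_subtractf[symmetric] vec.scale_right_diff_distrib
        vector_smult_assoc mult.commute del: funpow.simps)
  also have "\<dots> = poly_act X p (X *v v - \<mu> *s v)" by (simp add: poly_act_def n_def)
  finally show ?thesis .
qed

text \<open>A root is split off until the polynomial is a nonzero constant, which annihilates a
  vector only if that vector is zero. The roots collected on the way form the list.\<close>

lemma root_list_of_poly:
  assumes "p \<noteq> 0" "poly_act X p v = 0"
  shows "\<exists>\<mu>s. root_op X \<mu>s v = 0"
  using assms
proof (induction "degree p" arbitrary: p v)
  case 0
  then obtain c where "p = [:c:]" using degree_eq_zeroE by metis
  then have "root_op X [] v = 0" using 0 by (simp add: poly_act_def vector_mul_eq_0)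
  then show ?case by blast
next
  case (Suc n)
  then have "\<not> constant (poly p)" by (simp add: constant_degree)
  then obtain \<mu> where "poly p \<mu> = 0" using fundamental_theorem_of_algebra by blast
  then obtain q where q: "p = [:-\<mu>, 1:] * q" by (auto simp: poly_eq_0_iff_dvd elim: dvdE)
  then have "q \<noteq> 0" using Suc.prems by auto
  then have "degree p = degree q + 1"
    unfolding q by (subst degree_mult_eq) auto
  moreover have "poly_act X q (X *v v - \<mu> *s v) = 0"
    using Suc.prems(2) unfolding q poly_act_factor .
  ultimately obtain \<mu>s where "root_op X \<mu>s (X *v v - \<mu> *s v) = 0"
    using Suc.hyps(1)[of q] Suc.hyps(2) \<open>q \<noteq> 0\<close> by auto
  then have "root_op X (\<mu> # \<mu>s) v = 0" by simp
  then show ?case by blast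
qed

text \<open>The iterates of \<open>X\<close> on \<open>v\<close>, one more of them than the real
  dimension, are linearly dependent already over the reals, and a dependence is a nonzero polynomial
  annihilating \<open>v\<close>.\<close>

lemma root_list_vector: fixes v :: "complex^'n" shows "\<exists>\<mu>s. root_op X \<mu>s v = 0"
proof -
  let ?N = "DIM(complex^'n)"
  obtain c k where c: "k \<le> ?N" "c k \<noteq> 0" "(\<Sum>k\<le>?N. c k *\<^sub>R ((\<lambda>w. X *v w) ^^ k) v) = 0"
    using nontrivial_combination[OF order_refl, where u = "\<lambda>k. ((\<lambda>w. X *v w) ^^ k) v"] by blast
  define p where "p = (\<Sum>k\<le>?N. monom (complex_of_real (c k)) k)"
  have cf: "coeff p l = (if l \<le> ?N then of_real (c l) else 0)" for l
    unfolding p_def coeff_sum by (simp add: if_distrib sum.If_cases cong: if_cong)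
  have "coeff p k \<noteq> 0" using c by (simp add: cf)
  then have "p \<noteq> 0" by auto
  have "degree p \<le> ?N" by (rule degree_le) (simp add: cf)
  then have "poly_act X p v = (\<Sum>k\<le>?N. c k *\<^sub>R ((\<lambda>w. X *v w) ^^ k) v)"
    unfolding poly_act_alt[OF \<open>degree p \<le> ?N\<close>]
    by (intro sum.cong refl) (auto simp: cf vec_eq_iff scaleR_conv_of_real[where 'a = complex])
  with c(3) \<open>p \<noteq> 0\<close> show ?thesis using root_list_of_poly by metis
qed

text \<open>If \<open>\<mu>\<close> is not an eigenvalue, \<open>X - \<mu>\<close> is injective and
  commutes with the other factors, so it can be cancelled from the product.\<close>

lemma root_op_filter:
  assumes "root_op X \<mu>s v = 0"
  shows "root_op X (filter (\<lambda>\<mu>. \<exists>v. v \<noteq> 0 \<and> X *v v = \<mu> *s v) \<mu>s) v = 0"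
  using assms
proof (induction \<mu>s arbitrary: v)
  case (Cons \<mu> \<mu>s)
  let ?f = "filter (\<lambda>\<mu>. \<exists>v. v \<noteq> 0 \<and> X *v v = \<mu> *s v)"
  have "root_op X (?f \<mu>s) (X *v v - \<mu> *s v) = 0" using Cons by simp
  then have "X *v root_op X (?f \<mu>s) v = \<mu> *s root_op X (?f \<mu>s) v"
    by (simp add: root_op_diff root_op_commute root_op_scale)
  then show ?case using Cons by auto
qed simp

text \<open>A substitute for the Cayley--Hamilton theorem.\<close>

lemma eigenvalue_list:
  fixes X :: "complex^'n^'n"
  obtains \<mu>s where "\<And>\<mu>. \<mu> \<in> set \<mu>s \<Longrightarrow> \<exists>v. v \<noteq> 0 \<and> X *v v = \<mu> *s v" "\<And>v. root_op X \<mu>s v = 0"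
proof -
  obtain ms where ms: "\<And>v. root_op X (ms v) v = 0" using root_list_vector by metis
  obtain xs :: "'n list" where xs: "set xs = UNIV" using finite_list[OF finite] by blast
  \<comment> \<open>One list per basis vector. The factors commute, so the list that kills a given
    basis vector may be applied to it before all others.\<close>
  define \<mu>s where "\<mu>s = concat (map (\<lambda>s. ms (axis s 1)) xs)"
  have *: "root_op X (concat (map (\<lambda>s. ms (axis s 1)) ys)) (axis s 1) = 0" if "s \<in> set ys" for s ys
    using that
  proof (induction ys)
    case (Cons r ys)
    have "root_op X (concat (map (\<lambda>s. ms (axis s 1)) (r # ys))) (axis s 1)
        = root_op X (ms (axis r 1)) (root_op X (concat (map (\<lambda>s. ms (axis s 1)) ys)) (axis s 1))"
      by (simp add: root_op_append root_op_swap)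
    moreover have "r = s \<Longrightarrow> root_op X (concat (map (\<lambda>s. ms (axis s 1)) (r # ys))) (axis s 1) = 0"
      by (simp add: root_op_append ms)
    ultimately show ?case using Cons by (cases "r = s") auto
  qed simp
  have "root_op X \<mu>s v = 0" for v
  proof -
    have "v = (\<Sum>s\<in>UNIV. v $ s *s axis s 1)" using basis_expansion[of v] by simp
    then have "root_op X \<mu>s v = (\<Sum>s\<in>UNIV. v $ s *s root_op X \<mu>s (axis s 1))"
      by (metis (no_types, lifting) root_op_sum root_op_scale sum.cong)
    also have "\<dots> = 0" using * xs by (simp add: \<mu>s_def)
    finally show ?thesis .
  qed
  then show ?thesis using that[OF _ root_op_filter] by auto
qed

section \<open>Complexification and the norm adapted to \<open>a\<close>\<close>

definition cplx :: "real^'n \<Rightarrow> complex^'n" where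
  "cplx y = (\<chi> s. complex_of_real (y $ s))"

lemma cplx_add: "cplx (x + y) = cplx x + cplx y" by (simp add: cplx_def vec_eq_iff)
lemma cplx_scale: "cplx (c *\<^sub>R x) = complex_of_real c *s cplx x" by (simp add: cplx_def vec_eq_iff)
lemma cplx_0 [simp]: "cplx x = 0 \<longleftrightarrow> x = 0" by (simp add: cplx_def vec_eq_iff)

definition cmat :: "(real^'n \<Rightarrow> real^'n) \<Rightarrow> complex^'n^'n" where
  "cmat a = map_matrix of_real (matrix a)"

lemma cmat_cplx: assumes "linear a" shows "cmat a *v cplx y = cplx (a y)"
proof -
  have "a y = matrix a *v y" using matrix_vector_mul(2)[OF assms] by simp
  then show ?thesis
    by (simp add: cmat_def cplx_def map_matrix_def vec_eq_iff matrix_vector_mult_def)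
qed

lemma Re_cmat:
  assumes "linear a"
  shows "(\<chi> s. Re ((cmat a *v z) $ s)) = a (\<chi> s. Re (z $ s))"
proof -
  have "a (\<chi> s. Re (z $ s)) = matrix a *v (\<chi> s. Re (z $ s))" using matrix_vector_mul(2)[OF assms] by simp
  then show ?thesis
    by (simp add: cmat_def map_matrix_def vec_eq_iff matrix_vector_mult_def)
qed

lemma norm_scale_complex: "norm (c *s v) = cmod c * norm v" for v :: "complex^'n"
  by (simp add: norm_vec_def norm_mult L2_set_right_distrib)

text \<open>With \<open>u\<^sub>k\<close> the product of the first \<open>k\<close> factors \<open>a - \<mu>\<close> applied to \<open>y\<close> one has
  \<open>a u\<^sub>k = \<mu> u\<^sub>k + u\<^sub>k\<^sub>+\<^sub>1\<close>, so a weight \<open>t ^ k\<close> with \<open>t\<close> large makes the nilpotent part small.\<close>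

lemma adapted_norm:
  fixes a :: "real^'n \<Rightarrow> real^'n"
  assumes lin: "linear a" and \<delta>: "0 < \<delta>"
    and spec: "\<And>z. z \<in> Spec a \<Longrightarrow> \<alpha> \<le> cmod z \<and> cmod z \<le> \<beta>"
  obtains N where "is_norm N" "\<And>y. N (a y) \<le> (\<beta> + \<delta>) * N y" "\<And>y. (\<alpha> - \<delta>) * N y \<le> N (a y)"
proof -
  let ?X = "cmat a"
  obtain \<mu>s where ev: "\<And>\<mu>. \<mu> \<in> set \<mu>s \<Longrightarrow> \<exists>v. v \<noteq> 0 \<and> ?X *v v = \<mu> *s v"
    and kill: "\<And>v. root_op ?X \<mu>s v = 0" using eigenvalue_list by blast
  have sp: "\<alpha> \<le> cmod \<mu> \<and> cmod \<mu> \<le> \<beta>" if "\<mu> \<in> set \<mu>s" for \<mu>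
    using spec[of \<mu>] ev[OF that] by (auto simp: Spec_def cmat_def)
  define l where "l = length \<mu>s"
  define u where "u k v = root_op ?X (take k \<mu>s) v" for k v
  have "l \<noteq> 0" using kill[of "axis undefined 1"] by (auto simp: l_def axis_eq_0_iff)
  have u0: "u 0 v = v" and ul: "u l v = 0" for v by (auto simp: u_def l_def kill)
  have step: "?X *v u k v = \<mu>s ! k *s u k v + u (Suc k) v" if "k < l" for k v
    using that by (simp add: u_def l_def take_Suc_conv_app_nth root_op_append)
  \<comment> \<open>The weight for which passing from \<open>u k\<close> to \<open>u (Suc k)\<close>
    costs exactly a factor \<open>\<delta>\<close>.\<close>
  define t where "t = inverse \<delta>"
  have t: "0 < t" using \<delta> by (simp add: t_def)
  have t_pow: "t ^ k = \<delta> * t ^ Suc k" for k using \<delta> by (simp add: t_def)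
  define n where "n v = (\<Sum>k<l. t ^ k * norm (u k v))" for v
  \<comment> \<open>The chain ends in \<open>u l v = 0\<close>, so shifting the weighted sum by one
    only loses the nonnegative term \<open>norm v\<close>.\<close>
  have shift: "(\<Sum>k<l. t ^ k * norm (u (Suc k) v)) \<le> \<delta> * n v" for v
  proof -
    have "(\<Sum>k<l. t ^ k * norm (u (Suc k) v)) = \<delta> * (\<Sum>k<l. t ^ Suc k * norm (u (Suc k) v))"
      unfolding sum_distrib_left by (intro sum.cong refl) (subst t_pow, simp)
    also have "(\<Sum>k<l. t ^ Suc k * norm (u (Suc k) v)) = (\<Sum>k<Suc l. t ^ k * norm (u k v)) - norm v"
      by (subst sum.lessThan_Suc_shift) (simp add: u0)
    also have "\<delta> * \<dots> \<le> \<delta> * n v" using \<delta> by (simp add: n_def ul)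
    finally show ?thesis .
  qed
  have uX: "u k (?X *v v) = ?X *v u k v" for k v by (simp add: u_def root_op_commute)
  have up: "n (?X *v v) \<le> (\<beta> + \<delta>) * n v" for v
  proof -
    have "n (?X *v v) \<le> (\<Sum>k<l. t ^ k * (\<beta> * norm (u k v) + norm (u (Suc k) v)))"
      unfolding n_def uX
    proof (intro sum_mono mult_left_mono)
      fix k assume "k \<in> {..<l}"
      then have k: "k < l" by simp
      have "norm (?X *v u k v) \<le> cmod (\<mu>s ! k) * norm (u k v) + norm (u (Suc k) v)"
        unfolding step[OF k] by (metis norm_scale_complex norm_triangle_ineq)
      also have "\<dots> \<le> \<beta> * norm (u k v) + norm (u (Suc k) v)"
        using sp k by (auto simp: l_def intro!: mult_right_mono)
      finally show "norm (?X *v u k v) \<le> \<beta> * norm (u k v) + norm (u (Suc k) v)" .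
    qed (use t in auto)
    also have "\<dots> = \<beta> * n v + (\<Sum>k<l. t ^ k * norm (u (Suc k) v))"
      by (simp add: n_def sum_distrib_left sum.distrib algebra_simps)
    also have "\<dots> \<le> (\<beta> + \<delta>) * n v" using shift[of v] by (simp add: algebra_simps)
    finally show ?thesis .
  qed
  have low: "(\<alpha> - \<delta>) * n v \<le> n (?X *v v)" for v
  proof -
    have "(\<alpha> - \<delta>) * n v \<le> \<alpha> * n v - (\<Sum>k<l. t ^ k * norm (u (Suc k) v))"
      using shift[of v] by (simp add: algebra_simps)
    also have "\<dots> = (\<Sum>k<l. t ^ k * (\<alpha> * norm (u k v) - norm (u (Suc k) v)))"
      by (simp add: n_def sum_distrib_left sum_subtractf algebra_simps)
    also have "\<dots> \<le> n (?X *v v)"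
      unfolding n_def uX
    proof (intro sum_mono mult_left_mono)
      fix k assume "k \<in> {..<l}"
      then have k: "k < l" by simp
      have "\<alpha> * norm (u k v) - norm (u (Suc k) v) \<le> cmod (\<mu>s ! k) * norm (u k v) - norm (u (Suc k) v)"
        using sp k by (auto simp: l_def intro!: mult_right_mono)
      also have "\<dots> \<le> norm (?X *v u k v)"
        unfolding step[OF k] using norm_diff_ineq[of "\<mu>s ! k *s u k v" "u (Suc k) v"]
        by (simp add: norm_scale_complex)
      finally show "\<alpha> * norm (u k v) - norm (u (Suc k) v) \<le> norm (?X *v u k v)" .
    qed (use t in auto)
    finally show ?thesis .
  qed
  \<comment> \<open>The norm on the real space is the restriction of \<open>n\<close> along
    \<open>cplx\<close>, which intertwines \<open>a\<close> with its complex matrix; definiteness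
    comes from the summand \<open>k = 0\<close>.\<close>
  have "is_norm (\<lambda>y. n (cplx y))"
    unfolding is_norm_def
  proof (intro conjI allI)
    fix x y :: "real^'n" and c :: real
    show "0 \<le> n (cplx x)" unfolding n_def using t by (intro sum_nonneg) auto
    show "n (cplx x) = 0 \<longleftrightarrow> x = 0"
    proof
      assume "n (cplx x) = 0"
      then have "\<forall>k\<in>{..<l}. t ^ k * norm (u k (cplx x)) = 0"
        unfolding n_def using t by (subst (asm) sum_nonneg_eq_0_iff) auto
      then show "x = 0" using \<open>l \<noteq> 0\<close> u0 by (auto dest: bspec[of _ _ 0])
    next
      assume "x = 0" then show "n (cplx x) = 0"
        by (simp add: n_def u_def cplx_def zero_vec_def[symmetric])
    qed
    show "n (cplx (c *\<^sub>R x)) = \<bar>c\<bar> * n (cplx x)"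
      by (simp add: n_def u_def cplx_scale root_op_scale norm_scale_complex sum_distrib_left mult.left_commute)
    show "n (cplx (x + y)) \<le> n (cplx x) + n (cplx y)"
      unfolding n_def sum.distrib[symmetric] u_def cplx_add root_op_add
      using t by (intro sum_mono) (auto simp: distrib_left[symmetric] norm_triangle_ineq)
  qed
  then show ?thesis using that[of "\<lambda>y. n (cplx y)"] up low by (metis cmat_cplx lin)
qed

section \<open>Multilinear maps on lists\<close>

lemma multilinearD: "multilinear j A \<Longrightarrow> length vs = j \<Longrightarrow> p < j \<Longrightarrow> linear (\<lambda>w. A (vs[p := w]))"
  by (simp add: multilinear_def)

lemma multilinear_0 [simp]: "multilinear 0 A" by (simp add: multilinear_def)

lemma multilinear_zero [simp]: "multilinear j (\<lambda>_. 0)"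
  by (simp add: multilinear_def linear_zero)

lemma multilinear_add: "multilinear j A \<Longrightarrow> multilinear j B \<Longrightarrow> multilinear j (\<lambda>vs. A vs + B vs)"
  by (simp add: multilinear_def linear_compose_add)

lemma multilinear_compose: "linear L \<Longrightarrow> multilinear j A \<Longrightarrow> multilinear j (\<lambda>vs. L (A vs))"
  unfolding multilinear_def using linear_compose[unfolded o_def] by blast

lemma multilinear_scaleR: "multilinear j A \<Longrightarrow> multilinear j (\<lambda>vs. c *\<^sub>R A vs)"
  by (rule multilinear_compose[OF linear_scale_self])

lemma multilinear_uminus: "multilinear j A \<Longrightarrow> multilinear j (\<lambda>vs. - A vs)"
  using multilinear_scaleR[of j A "-1"] by simp

lemma multilinear_diff: "multilinear j A \<Longrightarrow> multilinear j B \<Longrightarrow> multilinear j (\<lambda>vs. A vs - B vs)"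
  using multilinear_add[of j A "\<lambda>vs. - B vs"] multilinear_uminus[of j B] by simp

lemma multilinear_sum: "(\<And>s. s \<in> S \<Longrightarrow> multilinear j (A s)) \<Longrightarrow> multilinear j (\<lambda>vs. \<Sum>s\<in>S. A s vs)"
  by (induction S rule: infinite_finite_induct) (auto intro: multilinear_add)

lemma multilinear_Cons: assumes "multilinear (Suc j) A" shows "multilinear j (\<lambda>vs. A (h # vs))"
  unfolding multilinear_def
proof (intro allI impI)
  fix vs :: "'a list" and p assume "length vs = j" "p < j"
  then show "linear (\<lambda>w. A (h # vs[p := w]))"
    using multilinearD[OF assms, of "h # vs" "Suc p"] by simp
qed

lemma multilinear_cong:
  assumes "multilinear j A" "\<And>vs. length vs = j \<Longrightarrow> A vs = B vs"
  shows "multilinear j B"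
  using assms by (simp add: multilinear_def)

lemma multilinear_map:
  fixes T :: "'c::real_vector \<Rightarrow> 'a::real_vector"
  assumes "multilinear j A" "linear T" shows "multilinear j (\<lambda>vs. A (map T vs))"
  unfolding multilinear_def map_update
proof (intro allI impI)
  fix vs :: "'c list" and p assume "length vs = j" "p < j"
  then have "linear (\<lambda>w. A ((map T vs)[p := w]))" by (intro multilinearD[OF assms(1)]) auto
  from linear_compose[OF assms(2) this] show "linear (\<lambda>w. A ((map T vs)[p := T w]))"
    by (simp add: o_def)
qed

lemma multilinear_eq_0:
  assumes "multilinear j A" "length vs = j" "0 \<in> set vs" shows "A vs = 0"
proof -
  obtain p where p: "p < j" "vs ! p = 0" using assms(2,3) by (auto simp: in_set_conv_nth)
  have "A (vs[p := 0]) = 0" using linear_0[OF multilinearD[OF assms(1,2) p(1)]] .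
  then show ?thesis using p(2) by (metis list_update_id)
qed

text \<open>The arguments are exchanged one at a time from the left: before slot \<open>p\<close>
  they are already those of \<open>us\<close>, after it still those of \<open>ws\<close>.\<close>

lemma multilinear_telescope:
  assumes A: "multilinear j A" and us: "length us = j" and ws: "length ws = j"
  shows "A us - A ws = (\<Sum>p<j. A (take p us @ (us ! p - ws ! p) # drop (Suc p) ws))"
proof -
  have "A (take k us @ drop k ws) - A ws = (\<Sum>p<k. A (take p us @ (us ! p - ws ! p) # drop (Suc p) ws))"
    if "k \<le> j" for k
    using that
  proof (induction k)
    case (Suc k)
    then have k: "k < j" by simp
    let ?v = "take k us @ us ! k # drop (Suc k) ws"
    have upd: "?v[k := w] = take k us @ w # drop (Suc k) ws" for w
      using k us by (simp add: list_update_append)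
    have "linear (\<lambda>w. A (?v[k := w]))" using k us ws by (intro multilinearD[OF A]) auto
    then have "A (take k us @ (us ! k - ws ! k) # drop (Suc k) ws)
        = A (take k us @ us ! k # drop (Suc k) ws) - A (take k us @ ws ! k # drop (Suc k) ws)"
      unfolding upd by (rule linear_diff)
    moreover have "take k us @ us ! k # drop (Suc k) ws = take (Suc k) us @ drop (Suc k) ws"
      using k us by (simp add: take_Suc_conv_app_nth)
    moreover have "take k us @ ws ! k # drop (Suc k) ws = take k us @ drop k ws"
      using k ws by (simp add: Cons_nth_drop_Suc)
    ultimately show ?case using Suc by (simp add: algebra_simps)
  qed simp
  from this[of j] show ?thesis using us ws by simp
qed

section \<open>Operator norm bounds for multilinear maps\<close>

definition opb :: "nat \<Rightarrow> real \<Rightarrow> ('a::real_normed_vector list \<Rightarrow> 'b::real_normed_vector) \<Rightarrow> bool" where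
  "opb j K A \<longleftrightarrow> (\<forall>vs. length vs = j \<longrightarrow> norm (A vs) \<le> K * prod_list (map norm vs))"

lemma opbD: "opb j K A \<Longrightarrow> length vs = j \<Longrightarrow> norm (A vs) \<le> K * prod_list (map norm vs)"
  by (simp add: opb_def)

lemma prod_list_nonneg_real: "(\<And>c. c \<in> set cs \<Longrightarrow> 0 \<le> c) \<Longrightarrow> 0 \<le> prod_list cs" for cs :: "real list"
  by (induction cs) auto

lemma prod_list_norm_nonneg [simp]: "0 \<le> prod_list (map norm vs)"
  by (rule prod_list_nonneg_real) auto

lemma prod_list_mono_real:
  fixes cs ds :: "real list"
  assumes "length cs = length ds" "\<And>p. p < length cs \<Longrightarrow> 0 \<le> cs ! p \<and> cs ! p \<le> ds ! p"
  shows "prod_list cs \<le> prod_list ds"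
  using assms
proof (induction cs ds rule: list_induct2)
  case (Cons x xs y ys)
  have "0 \<le> prod_list xs"
    using Cons.prems by (intro prod_list_nonneg_real) (force simp: in_set_conv_nth)
  moreover have "prod_list xs \<le> prod_list ys" using Cons.prems by (intro Cons.IH) force
  moreover have "0 \<le> x" "x \<le> y" using Cons.prems[of 0] by auto
  ultimately show ?case by (simp add: mult_mono)
qed simp

lemma prod_list_update_mult: "p < length cs \<Longrightarrow> prod_list (cs[p := e * cs ! p]) = e * prod_list cs"
  for cs :: "'a::comm_monoid_mult list"
  by (induction cs arbitrary: p) (auto simp: nth_Cons' mult_ac split: nat.splits elim: less_SucE)

lemma opb_mono: "opb j K A \<Longrightarrow> K \<le> L \<Longrightarrow> opb j L A"
  unfolding opb_def by (blast intro: order_trans mult_right_mono prod_list_norm_nonneg)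

lemma opb_add: "opb j K A \<Longrightarrow> opb j L B \<Longrightarrow> opb j (K + L) (\<lambda>vs. A vs + B vs)"
  unfolding opb_def by (auto simp: distrib_right intro!: norm_triangle_mono)

lemma opb_uminus: "opb j K A \<Longrightarrow> opb j K (\<lambda>vs. - A vs)"
  unfolding opb_def by auto

lemma opb_diff: "opb j K A \<Longrightarrow> opb j L B \<Longrightarrow> opb j (K + L) (\<lambda>vs. A vs - B vs)"
  using opb_add[OF _ opb_uminus] by fastforce

lemma opb_compose: "bounded_linear L \<Longrightarrow> opb j K A \<Longrightarrow> opb j (onorm L * K) (\<lambda>vs. L (A vs))"
  unfolding opb_def mult.assoc
  by (blast intro: order_trans[OF onorm] mult_left_mono onorm_pos_le)

lemma opb_list:
  assumes "opb j K A" "0 \<le> K" "length vs = j" "length cs = j" "\<And>p. p < j \<Longrightarrow> norm (vs ! p) \<le> cs ! p"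
  shows "norm (A vs) \<le> K * prod_list cs"
proof -
  have "prod_list (map norm vs) \<le> prod_list cs"
    using assms by (intro prod_list_mono_real) auto
  then show ?thesis using opbD[OF assms(1,3)] assms(2) by (meson mult_left_mono order_trans)
qed

text \<open>A relative error \<open>e\<close> in every slot, measured against the common majorants
  \<open>cs\<close>, costs a factor \<open>j * e\<close> by telescoping. The continuity estimates
  for multilinear expressions rest on this.\<close>

lemma opb_telescope:
  assumes A: "multilinear j A" "opb j K A" "0 \<le> K" and us: "length us = j" and ws: "length ws = j"
    and cs: "length cs = j" and e: "0 \<le> e"
    and b: "\<And>p. p < j \<Longrightarrow> norm (us ! p) \<le> cs ! p" "\<And>p. p < j \<Longrightarrow> norm (ws ! p) \<le> cs ! p"
      "\<And>p. p < j \<Longrightarrow> norm (us ! p - ws ! p) \<le> e * cs ! p"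
  shows "norm (A us - A ws) \<le> real j * K * e * prod_list cs"
proof -
  have "norm (A (take p us @ (us ! p - ws ! p) # drop (Suc p) ws)) \<le> K * e * prod_list cs" if p: "p < j" for p
  proof -
    have "norm (A (take p us @ (us ! p - ws ! p) # drop (Suc p) ws)) \<le> K * prod_list (cs[p := e * cs ! p])"
    proof (rule opb_list[OF A(2,3)])
      fix q assume q: "q < j"
      show "norm ((take p us @ (us ! p - ws ! p) # drop (Suc p) ws) ! q) \<le> cs[p := e * cs ! p] ! q"
        using b(1)[OF q] b(2)[OF q] b(3)[OF p] p q us ws cs
        by (cases q p rule: linorder_cases)
          (auto simp: nth_append nth_list_update nth_Cons' less_diff_conv Suc_diff_Suc)
    qed (use p us ws cs in auto)
    then show ?thesis using p cs by (simp add: prod_list_update_mult mult.assoc)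
  qed
  then have "norm (A us - A ws) \<le> (\<Sum>p<j. K * e * prod_list cs)"
    unfolding multilinear_telescope[OF A(1) us ws] by (intro sum_norm_le) auto
  then show ?thesis by (simp add: mult.assoc)
qed

section \<open>Differentiating multilinear expressions with moving arguments\<close>

lemma has_derivative_lipschitz_at:
  assumes "(f has_derivative f') (at x)"
  obtains L where "0 \<le> L" "\<forall>\<^sub>F y in nhds x. norm (f y - f x) \<le> L * norm (y - x)"
proof -
  have bl: "bounded_linear f'" using assms has_derivative_bounded_linear by blast
  from assms obtain d where d: "0 < d" "\<And>y. norm (y - x) < d \<Longrightarrow> norm (f y - f x - f' (y - x)) \<le> 1 * norm (y - x)"
    unfolding has_derivative_at_alt by (meson zero_less_one)
  have "norm (f y - f x) \<le> (1 + onorm f') * norm (y - x)" if "norm (y - x) < d" for y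
    using d(2)[OF that] onorm[OF bl, of "y - x"] norm_triangle_ineq[of "f y - f x - f' (y - x)" "f' (y - x)"]
    by (simp add: algebra_simps)
  moreover have "0 \<le> 1 + onorm f'" using onorm_pos_le[OF bl] by simp
  ultimately show ?thesis using that d(1) by (auto simp: eventually_nhds_metric dist_norm)
qed

lemma has_derivative_zero_iff:
  "(f has_derivative (\<lambda>_. 0)) (at x) \<longleftrightarrow> (\<forall>e>0. \<forall>\<^sub>F y in nhds x. norm (f y - f x) \<le> e * norm (y - x))"
  unfolding has_derivative_at_alt eventually_nhds_metric dist_norm by simp

lemma has_derivative_zeroI:
  assumes "\<forall>\<^sub>F y in nhds x. norm (f y - f x) \<le> C * norm (y - x) ^ 2"
  shows "(f has_derivative (\<lambda>_. 0)) (at x)"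
  unfolding has_derivative_zero_iff
proof (intro allI impI)
  fix e :: real assume e: "0 < e"
  obtain d where d: "0 < d" "\<And>y. norm (y - x) < d \<Longrightarrow> norm (f y - f x) \<le> C * norm (y - x) ^ 2"
    using assms by (auto simp: eventually_nhds_metric dist_norm)
  define d' where "d' = min d (e / (\<bar>C\<bar> + 1))"
  have "norm (f y - f x) \<le> e * norm (y - x)" if y: "norm (y - x) < d'" for y
  proof -
    have "norm (f y - f x) \<le> C * norm (y - x) ^ 2" using d(2) y by (simp add: d'_def)
    also have "\<dots> \<le> (\<bar>C\<bar> + 1) * norm (y - x) ^ 2" by (intro mult_right_mono) auto
    also have "\<dots> = ((\<bar>C\<bar> + 1) * norm (y - x)) * norm (y - x)" by (simp add: power2_eq_square)
    also have "\<dots> \<le> e * norm (y - x)"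
    proof (rule mult_right_mono)
      have "norm (y - x) < e / (\<bar>C\<bar> + 1)" using y by (simp add: d'_def)
      then show "(\<bar>C\<bar> + 1) * norm (y - x) \<le> e" by (simp add: field_simps add_pos_nonneg)
    qed simp
    finally show ?thesis .
  qed
  moreover have "0 < d'" using d(1) e by (simp add: d'_def add_nonneg_pos)
  ultimately show "\<forall>\<^sub>F y in nhds x. norm (f y - f x) \<le> e * norm (y - x)"
    by (auto simp: eventually_nhds_metric dist_norm)
qed

lemma bounded_linear_slot:
  assumes A: "multilinear j A" "opb j K A" and vs: "length vs = j" and p: "p < j"
  shows "bounded_linear (\<lambda>w. A (vs[p := w]))"
proof (rule bounded_linear_intro)
  fix v w :: 'a and c :: real
  have lin: "linear (\<lambda>w. A (vs[p := w]))" by (rule multilinearD[OF A(1) vs p])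
  show "A (vs[p := v + w]) = A (vs[p := v]) + A (vs[p := w])" using linear_add[OF lin] .
  show "A (vs[p := c *\<^sub>R v]) = c *\<^sub>R A (vs[p := v])" using linear_scale[OF lin] .
  define cs where "cs = (map norm vs)[p := 1]"
  have "map norm (vs[p := v]) = cs[p := norm v * cs ! p]" using p vs by (simp add: cs_def map_update)
  then have "prod_list (map norm (vs[p := v])) = norm v * prod_list cs"
    using prod_list_update_mult[of p cs "norm v"] p vs by (simp add: cs_def)
  then show "norm (A (vs[p := v])) \<le> norm v * (K * prod_list cs)"
    using opbD[OF A(2), of "vs[p := v]"] vs by (simp add: algebra_simps)
qed

text \<open>The product rule. Each term of the telescoped difference contains one increment;
  freezing its other arguments at \<open>x\<close> costs a second increment, hence a quadratic
  error, and what remains is a bounded linear map of one moving argument.\<close>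

lemma has_derivative_multilinear:
  fixes A :: "'b::real_normed_vector list \<Rightarrow> 'c::real_normed_vector"
    and ws :: "'a::real_normed_vector \<Rightarrow> 'b list"
  assumes A: "multilinear j A" "opb j K A" and len: "\<And>y. length (ws y) = j"
    and d: "\<And>p. p < j \<Longrightarrow> ((\<lambda>y. ws y ! p) has_derivative ws' p) (at x)"
  shows "((\<lambda>y. A (ws y)) has_derivative (\<lambda>h. \<Sum>p<j. A ((ws x)[p := ws' p h]))) (at x)"
proof -
  define K' where "K' = max K 0"
  have K': "opb j K' A" "0 \<le> K'" using opb_mono[OF A(2)] by (auto simp: K'_def)
  define \<delta> where "\<delta> y p = ws y ! p - ws x ! p" for y p
  have "\<forall>p. \<exists>L. p < j \<longrightarrow> 0 \<le> L \<and> (\<forall>\<^sub>F y in nhds x. norm (\<delta> y p) \<le> L * norm (y - x))"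
    unfolding \<delta>_def by (metis has_derivative_lipschitz_at[OF d])
  then obtain L where L: "\<And>p. p < j \<Longrightarrow> 0 \<le> L p"
      "\<And>p. p < j \<Longrightarrow> \<forall>\<^sub>F y in nhds x. norm (\<delta> y p) \<le> L p * norm (y - x)"
    by metis
  define S where "S = (\<Sum>p<j. L p)"
  have LS: "L p \<le> S" if "p < j" for p
    unfolding S_def using that L(1) by (intro member_le_sum) auto
  have S0: "0 \<le> S" unfolding S_def using L(1) by (intro sum_nonneg) auto
  have ev1: "\<forall>\<^sub>F y in nhds x. \<forall>p\<in>{..<j}. norm (\<delta> y p) \<le> L p * norm (y - x)"
    by (rule eventually_ball_finite) (auto intro: L(2))
  have ev2: "\<forall>\<^sub>F y in nhds x. norm (y - x) < 1"
    by (auto simp: eventually_nhds_metric dist_norm intro!: exI[of _ 1])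
  have ev: "\<forall>\<^sub>F y in nhds x. norm (y - x) < 1 \<and> (\<forall>p<j. norm (\<delta> y p) \<le> S * norm (y - x))"
    using ev1 ev2
  proof eventually_elim
    case (elim y)
    then show ?case using LS by (auto intro: order_trans[OF _ mult_right_mono])
  qed
  \<comment> \<open>The summand \<open>S\<close> covers the increments, which are at most
    \<open>S\<close> when \<open>norm (y - x) < 1\<close>; so \<open>M\<close> majorizes the
    arguments at \<open>y\<close> as well as those at \<open>x\<close>.\<close>
  define M where "M = 1 + S + (\<Sum>p<j. norm (ws x ! p))"
  have M: "1 \<le> M" "0 < M" using S0 sum_nonneg[of "{..<j}" "\<lambda>p. norm (ws x ! p)"] by (auto simp: M_def)
  have Mx: "norm (ws x ! p) \<le> M - S" if "p < j" for p
    using member_le_sum[of p "{..<j}" "\<lambda>p. norm (ws x ! p)"] that by (simp add: M_def)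
  let ?T = "\<lambda>p y. A (take p (ws y) @ \<delta> y p # drop (Suc p) (ws x))"
  let ?L = "\<lambda>p y. A ((ws x)[p := \<delta> y p])"
  have upd: "(ws x)[p := w] = take p (ws x) @ w # drop (Suc p) (ws x)" if "p < j" for p w
    using that len by (simp add: upd_conv_take_nth_drop)
  have T0: "((\<lambda>y. ?T p y - ?L p y) has_derivative (\<lambda>_. 0)) (at x)" if p: "p < j" for p
  proof (rule has_derivative_zeroI)
    have T00: "?T p x - ?L p x = 0" using p by (simp add: upd)
    show "\<forall>\<^sub>F y in nhds x. norm (?T p y - ?L p y - (?T p x - ?L p x))
        \<le> (real j * K' * S * (S / M) * M ^ j) * norm (y - x) ^ 2"
      using ev
    proof eventually_elim
      case (elim y)
      \<comment> \<open>Slot \<open>p\<close> holds the increment itself, whose majorant is its own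
        norm; written as a multiple of \<open>M\<close>, it factors out of the product.\<close>
      define cs where "cs = (replicate j M)[p := (norm (\<delta> y p) / M) * replicate j M ! p]"
      have cs: "length cs = j" "prod_list cs = (norm (\<delta> y p) / M) * M ^ j"
        unfolding cs_def using p by (simp, subst prod_list_update_mult) (simp_all add: prod_list_replicate)
      have csp: "cs ! q = (if q = p then norm (\<delta> y p) else M)" if "q < j" for q
        using that p M by (simp add: cs_def nth_list_update)
      have b: "norm (ws y ! q) \<le> M" if "q < j" for q
      proof -
        have "S * norm (y - x) \<le> S" using elim S0 by (simp add: mult_left_le)
        then have "norm (\<delta> y q) \<le> S" using elim that by (meson order_trans)
        then show ?thesis using Mx[OF that] norm_triangle_sub[of "ws y ! q" "ws x ! q"] by (simp add: \<delta>_def)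
      qed
      have bx: "norm (ws x ! q) \<le> M" if "q < j" for q using Mx[OF that] S0 by simp
      have "norm (?T p y - ?L p y) \<le> real j * K' * (S * norm (y - x)) * prod_list cs"
        unfolding upd[OF p]
      proof (rule opb_telescope[OF A(1) K'])
        show "0 \<le> S * norm (y - x)" using S0 by simp
        fix q assume q: "q < j"
        let ?us = "take p (ws y) @ \<delta> y p # drop (Suc p) (ws x)"
        let ?vs = "take p (ws x) @ \<delta> y p # drop (Suc p) (ws x)"
        have u: "?us ! q = (if q < p then ws y ! q else if q = p then \<delta> y p else ws x ! q)"
          and v: "?vs ! q = (if q = p then \<delta> y p else ws x ! q)"
          using p q len[of x] len[of y] by (auto simp: nth_append nth_Cons')
        show "norm (?us ! q) \<le> cs ! q" "norm (?vs ! q) \<le> cs ! q"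
          unfolding u v csp[OF q] using b[OF q] bx[OF q] by auto
        have "norm (\<delta> y q) \<le> S * norm (y - x) * M"
          using elim q M(1) S0 by (auto intro: order_trans[OF _ mult_left_mono[of 1 M, simplified]])
        then show "norm (?us ! q - ?vs ! q) \<le> S * norm (y - x) * cs ! q"
          unfolding u v csp[OF q] using S0 M by (auto simp: \<delta>_def)
      qed (use p len cs in auto)
      also have "\<dots> = (real j * K' * S * M ^ j / M) * (norm (y - x) * norm (\<delta> y p))"
        by (simp add: cs)
      also have "\<dots> \<le> (real j * K' * S * M ^ j / M) * (norm (y - x) * (S * norm (y - x)))"
        using elim p K' S0 M by (intro mult_left_mono) auto
      finally show ?case unfolding T00 by (simp add: power2_eq_square mult_ac)
    qed
  qed
  have L': "((\<lambda>y. ?L p y) has_derivative (\<lambda>h. A ((ws x)[p := ws' p h]))) (at x)" if p: "p < j" for p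
  proof -
    have "((\<lambda>y. \<delta> y p) has_derivative ws' p) (at x)"
      unfolding \<delta>_def using has_derivative_diff[OF d[OF p] has_derivative_const] by simp
    then show ?thesis
      by (rule bounded_linear.has_derivative[OF bounded_linear_slot[OF A len p]])
  qed
  have "((\<lambda>y. A (ws x) + (\<Sum>p<j. (?T p y - ?L p y) + ?L p y)) has_derivative
      (\<lambda>h. 0 + (\<Sum>p<j. 0 + A ((ws x)[p := ws' p h])))) (at x)"
    by (intro has_derivative_add has_derivative_const has_derivative_sum T0 L') auto
  moreover have "A (ws x) + (\<Sum>p<j. (?T p y - ?L p y) + ?L p y) = A (ws y)" for y
    by (simp add: \<delta>_def flip: multilinear_telescope[OF A(1) len[of y] len[of x]])
  ultimately show ?thesis by simp
qed

section \<open>Jets\<close>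

definition opcont :: "nat \<Rightarrow> 'a::real_normed_vector set \<Rightarrow> ('a \<Rightarrow> 'b::real_normed_vector list \<Rightarrow> 'c::real_normed_vector) \<Rightarrow> bool" where
  "opcont j V \<Phi> \<longleftrightarrow> (\<forall>x\<in>V. \<forall>e>0. \<exists>d>0. \<forall>y\<in>V. norm (y - x) < d \<longrightarrow> opb j e (\<lambda>vs. \<Phi> y vs - \<Phi> x vs))"

text \<open>The derivatives are only required to exist pointwise in \<open>vs\<close>; together with continuity in the
  operator norm this yields differentiability in the operator norm (\<open>jet_opdiff\<close>).\<close>

definition jet :: "nat \<Rightarrow> 'a::real_normed_vector set \<Rightarrow> (nat \<Rightarrow> 'a \<Rightarrow> 'a list \<Rightarrow> 'b::real_normed_vector) \<Rightarrow> bool" where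
  "jet r V D \<longleftrightarrow>
     (\<forall>j\<le>r. \<forall>x\<in>V. multilinear j (D j x) \<and> (\<exists>K. opb j K (D j x))) \<and>
     (\<forall>j<r. \<forall>x\<in>V. \<forall>vs. length vs = j \<longrightarrow>
        ((\<lambda>y. D j y vs) has_derivative (\<lambda>h. D (Suc j) x (h # vs))) (at x)) \<and>
     (\<forall>j\<le>r. opcont j V (D j))"

lemma jet_multilinear: "jet r V D \<Longrightarrow> j \<le> r \<Longrightarrow> x \<in> V \<Longrightarrow> multilinear j (D j x)"
  and jet_opb: "jet r V D \<Longrightarrow> j \<le> r \<Longrightarrow> x \<in> V \<Longrightarrow> \<exists>K. opb j K (D j x)"
  and jet_has_derivative: "jet r V D \<Longrightarrow> j < r \<Longrightarrow> x \<in> V \<Longrightarrow> length vs = j \<Longrightarrow>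
        ((\<lambda>y. D j y vs) has_derivative (\<lambda>h. D (Suc j) x (h # vs))) (at x)"
  and jet_opcont: "jet r V D \<Longrightarrow> j \<le> r \<Longrightarrow> opcont j V (D j)"
  by (auto simp: jet_def)

lemma opcontD: "opcont j V \<Phi> \<Longrightarrow> x \<in> V \<Longrightarrow> 0 < e \<Longrightarrow>
    \<exists>d>0. \<forall>y\<in>V. norm (y - x) < d \<longrightarrow> opb j e (\<lambda>vs. \<Phi> y vs - \<Phi> x vs)"
  by (simp add: opcont_def)

lemma opcont_add:
  assumes "opcont j V \<Phi>" "opcont j V \<Psi>" shows "opcont j V (\<lambda>x vs. \<Phi> x vs + \<Psi> x vs)"
  unfolding opcont_def
proof (intro ballI allI impI)
  fix x and e :: real assume x: "x \<in> V" and e: "0 < e"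
  obtain d1 where d1: "0 < d1" "\<And>y. y \<in> V \<Longrightarrow> norm (y - x) < d1 \<Longrightarrow> opb j (e / 2) (\<lambda>vs. \<Phi> y vs - \<Phi> x vs)"
    using opcontD[OF assms(1) x, of "e / 2"] e by auto
  obtain d2 where d2: "0 < d2" "\<And>y. y \<in> V \<Longrightarrow> norm (y - x) < d2 \<Longrightarrow> opb j (e / 2) (\<lambda>vs. \<Psi> y vs - \<Psi> x vs)"
    using opcontD[OF assms(2) x, of "e / 2"] e by auto
  have "opb j e (\<lambda>vs. \<Phi> y vs + \<Psi> y vs - (\<Phi> x vs + \<Psi> x vs))"
    if "y \<in> V" "norm (y - x) < min d1 d2" for y
    using opb_add[OF d1(2) d2(2), of y y] that by (simp add: add_diff_add)
  then show "\<exists>d>0. \<forall>y\<in>V. norm (y - x) < d \<longrightarrow> opb j e (\<lambda>vs. \<Phi> y vs + \<Psi> y vs - (\<Phi> x vs + \<Psi> x vs))"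
    using d1(1) d2(1) by (intro exI[of _ "min d1 d2"]) auto
qed

lemma opcont_const: "opcont j V (\<lambda>x vs. A vs)"
  by (auto simp: opcont_def opb_def intro!: exI[of _ 1])

lemma opcont_sum_list:
  "(\<And>s. s \<in> set S \<Longrightarrow> opcont j V (\<Phi> s)) \<Longrightarrow> opcont j V (\<lambda>x vs. \<Sum>s\<leftarrow>S. \<Phi> s x vs)"
  by (induction S) (auto intro: opcont_add opcont_const)

lemma opcont_compose:
  assumes "bounded_linear L" "opcont j V \<Phi>" shows "opcont j V (\<lambda>x vs. L (\<Phi> x vs))"
  unfolding opcont_def
proof (intro ballI allI impI)
  fix x and e :: real assume x: "x \<in> V" and e: "0 < e"
  have o: "0 < onorm L + 1" using onorm_pos_le[OF assms(1)] by simp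
  obtain d where d: "0 < d" "\<And>y. y \<in> V \<Longrightarrow> norm (y - x) < d \<Longrightarrow> opb j (e / (onorm L + 1)) (\<lambda>vs. \<Phi> y vs - \<Phi> x vs)"
    using opcontD[OF assms(2) x, of "e / (onorm L + 1)"] e o by auto
  have "opb j e (\<lambda>vs. L (\<Phi> y vs) - L (\<Phi> x vs))" if "y \<in> V" "norm (y - x) < d" for y
  proof -
    have "onorm L * (e / (onorm L + 1)) \<le> e" using e o by (simp add: field_simps)
    then show ?thesis
      using opb_mono[OF opb_compose[OF assms(1) d(2)[OF that]]]
      by (simp add: linear_diff[OF bounded_linear.linear[OF assms(1)]])
  qed
  then show "\<exists>d>0. \<forall>y\<in>V. norm (y - x) < d \<longrightarrow> opb j e (\<lambda>vs. L (\<Phi> y vs) - L (\<Phi> x vs))"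
    using d(1) by blast
qed

text \<open>Multilinearity of all derivatives is inherited from uniqueness of the derivative.\<close>

lemma jetI:
  fixes D :: "nat \<Rightarrow> 'a::real_normed_vector \<Rightarrow> 'a list \<Rightarrow> 'b::real_normed_vector"
  assumes V: "open V"
    and opb: "\<And>j x. j \<le> r \<Longrightarrow> x \<in> V \<Longrightarrow> \<exists>K. opb j K (D j x)"
    and deriv: "\<And>j x vs. j < r \<Longrightarrow> x \<in> V \<Longrightarrow> length vs = j \<Longrightarrow>
        ((\<lambda>y. D j y vs) has_derivative (\<lambda>h. D (Suc j) x (h # vs))) (at x)"
    and cont: "\<And>j. j \<le> r \<Longrightarrow> opcont j V (D j)"
  shows "jet r V D"
proof -
  have "multilinear j (D j x)" if "j \<le> r" "x \<in> V" for j x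
    using that
  proof (induction j arbitrary: x)
    case (Suc j)
    show ?case unfolding multilinear_def
    proof (intro allI impI)
      fix vs :: "'a list" and p assume "length vs = Suc j" and p: "p < Suc j"
      then obtain h us where vs: "vs = h # us" "length us = j" by (auto simp: length_Suc_conv)
      note der = deriv[of j x, OF _ Suc.prems(2)]
      show "linear (\<lambda>w. D (Suc j) x (vs[p := w]))"
      proof (cases p)
        case 0
        then show ?thesis using vs der[of us] Suc.prems(1)
          by (auto dest!: has_derivative_bounded_linear bounded_linear.linear)
      next
        case (Suc q)
        have lin: "linear (\<lambda>w. D j y (us[q := w]))" if "y \<in> V" for y
          using Suc.IH[OF _ that] Suc.prems(1) p vs(2) by (intro multilinearD) (auto simp: \<open>p = Suc q\<close>)
        show ?thesis
        proof (rule linearI)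
          fix v w :: 'a and c :: real
          have "((\<lambda>y. D j y (us[q := v + w])) has_derivative
              (\<lambda>h. D (Suc j) x (h # us[q := v]) + D (Suc j) x (h # us[q := w]))) (at x)"
            using Suc.prems(1) vs(2)
            by (intro has_derivative_transform_within_open[OF has_derivative_add[OF der der] V Suc.prems(2)])
              (simp_all add: linear_add[OF lin])
          from has_derivative_unique[OF this der] Suc.prems(1) vs(2)
          show "D (Suc j) x (vs[p := v + w]) = D (Suc j) x (vs[p := v]) + D (Suc j) x (vs[p := w])"
            by (simp add: vs(1) Suc fun_eq_iff)
          have "((\<lambda>y. D j y (us[q := c *\<^sub>R v])) has_derivative
              (\<lambda>h. c *\<^sub>R D (Suc j) x (h # us[q := v]))) (at x)"
            using Suc.prems(1) vs(2)
            by (intro has_derivative_transform_within_open[OF has_derivative_scaleR_right[OF der] V Suc.prems(2)])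
              (simp_all add: linear_scale[OF lin])
          from has_derivative_unique[OF this der] Suc.prems(1) vs(2)
          show "D (Suc j) x (vs[p := c *\<^sub>R v]) = c *\<^sub>R D (Suc j) x (vs[p := v])"
            by (simp add: vs(1) Suc fun_eq_iff)
        qed
      qed
    qed
  qed simp
  then show ?thesis using opb deriv cont by (simp add: jet_def)
qed

lemma jet_subset:
  assumes "jet r V D" "V' \<subseteq> V" shows "jet r V' D"
  using assms unfolding jet_def opcont_def by (meson subsetD)

lemma jet_add:
  assumes "jet r V D" "jet r V D'" shows "jet r V (\<lambda>j x vs. D j x vs + D' j x vs)"
  unfolding jet_def
proof (intro conjI allI ballI impI)
  fix j x assume j: "j \<le> r" and x: "x \<in> V"
  show "\<exists>K. opb j K (\<lambda>vs. D j x vs + D' j x vs)"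
    using jet_opb[OF assms(1) j x] jet_opb[OF assms(2) j x] opb_add by blast
qed (auto intro!: multilinear_add opcont_add has_derivative_add
    intro: jet_multilinear[OF assms(1)] jet_multilinear[OF assms(2)]
      jet_opcont[OF assms(1)] jet_opcont[OF assms(2)]
      jet_has_derivative[OF assms(1)] jet_has_derivative[OF assms(2)])

lemma jet_compose:
  assumes "bounded_linear L" "jet r V D" shows "jet r V (\<lambda>j x vs. L (D j x vs))"
  unfolding jet_def
proof (intro conjI allI ballI impI)
  fix j x assume j: "j \<le> r" and x: "x \<in> V"
  show "\<exists>K. opb j K (\<lambda>vs. L (D j x vs))"
    using jet_opb[OF assms(2) j x] opb_compose[OF assms(1)] by blast
qed (auto intro!: multilinear_compose[OF bounded_linear.linear[OF assms(1)]] opcont_compose[OF assms(1)]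
      bounded_linear.has_derivative[OF assms(1)]
    intro: jet_multilinear[OF assms(2)] jet_opcont[OF assms(2)] jet_has_derivative[OF assms(2)])

lemma jet_diff:
  assumes "jet r V D" "jet r V D'" shows "jet r V (\<lambda>j x vs. D j x vs - D' j x vs)"
  using jet_add[OF assms(1) jet_compose[OF bounded_linear_minus[OF bounded_linear_ident] assms(2)]] by simp

text \<open>The mean value inequality on a small ball for \<open>D j\<close> minus its linear part
  at \<open>x\<close>: the derivative of this difference is small uniformly in \<open>vs\<close>,
  because \<open>D (Suc j)\<close> is continuous in the operator norm.\<close>

lemma jet_opdiff:
  fixes D :: "nat \<Rightarrow> 'a::real_normed_vector \<Rightarrow> 'a list \<Rightarrow> 'b::real_normed_vector"
  assumes D: "jet r V D" and V: "open V" and j: "j < r" and x: "x \<in> V" and e: "0 < e"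
  shows "\<exists>d>0. \<forall>y. norm (y - x) < d \<longrightarrow>
    opb j (e * norm (y - x)) (\<lambda>vs. D j y vs - D j x vs - D (Suc j) x ((y - x) # vs))"
proof -
  obtain d0 where d0: "0 < d0" "ball x d0 \<subseteq> V" using V x openE by blast
  obtain d1 where d1: "0 < d1" "\<And>y. y \<in> V \<Longrightarrow> norm (y - x) < d1 \<Longrightarrow>
      opb (Suc j) e (\<lambda>vs. D (Suc j) y vs - D (Suc j) x vs)"
    using opcontD[OF jet_opcont[OF D] x e, of "Suc j"] j by auto
  define d where "d = min d0 d1"
  have in_ball: "z \<in> ball x d \<longleftrightarrow> norm (z - x) < d" for z by (simp add: dist_norm norm_minus_commute)
  have dV: "z \<in> V" if "norm (z - x) < d" for z
    using that d0(2) by (auto simp: d_def dist_norm norm_minus_commute)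
  have d: "0 < d" using d0(1) d1(1) by (simp add: d_def)
  have "opb j (e * norm (y - x)) (\<lambda>vs. D j y vs - D j x vs - D (Suc j) x ((y - x) # vs))"
    if y: "norm (y - x) < d" for y
    unfolding opb_def
  proof (intro allI impI)
    fix vs :: "'a list" assume vs: "length vs = j"
    have bl: "bounded_linear (\<lambda>h. D (Suc j) x (h # vs))"
      using jet_has_derivative[OF D j x vs] by (rule has_derivative_bounded_linear)
    let ?g = "\<lambda>z. D j z vs - D (Suc j) x ((z - x) # vs)"
    have "norm (?g y - ?g x) \<le> (e * prod_list (map norm vs)) * norm (y - x)"
    proof (rule differentiable_bound[OF convex_ball])
      fix z assume z: "z \<in> ball x d"
      then have zV: "z \<in> V" using dV in_ball by blast
      have "((\<lambda>z. D (Suc j) x ((z - x) # vs)) has_derivative (\<lambda>h. D (Suc j) x (h # vs))) (at z)"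
        by (rule bounded_linear.has_derivative[OF bl]) (auto intro!: derivative_eq_intros)
      from has_derivative_diff[OF jet_has_derivative[OF D j zV vs] this]
      show "(?g has_derivative (\<lambda>h. D (Suc j) z (h # vs) - D (Suc j) x (h # vs))) (at z within ball x d)"
        by (rule has_derivative_at_withinI)
      show "onorm (\<lambda>h. D (Suc j) z (h # vs) - D (Suc j) x (h # vs)) \<le> e * prod_list (map norm vs)"
      proof (rule onorm_bound)
        fix h
        have "opb (Suc j) e (\<lambda>vs. D (Suc j) z vs - D (Suc j) x vs)"
          using d1(2)[OF zV] z unfolding in_ball by (simp add: d_def)
        from opbD[OF this, of "h # vs"] vs
        show "norm (D (Suc j) z (h # vs) - D (Suc j) x (h # vs)) \<le> e * prod_list (map norm vs) * norm h"
          by (simp add: mult_ac)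
      qed (use e in simp)
    qed (use d y in \<open>auto simp: dist_norm norm_minus_commute\<close>)
    then show "norm (D j y vs - D j x vs - D (Suc j) x ((y - x) # vs)) \<le> e * norm (y - x) * prod_list (map norm vs)"
      using linear_0[OF bounded_linear.linear[OF bl]] by (simp add: algebra_simps)
  qed
  then show ?thesis using d by blast
qed

text \<open>Base point and arguments move together. The change of base point is replaced by its
  linear part, an expression with \<open>Suc i\<close> arguments to which the product rule applies;
  the remainder is negligible because \<open>jet_opdiff\<close> is uniform over bounded
  arguments.\<close>

lemma has_derivative_chain:
  assumes G: "jet r V' G" and V': "open V'" and i: "i < r" and fx: "f x \<in> V'"
    and f: "(f has_derivative f') (at x)" and len: "\<And>y. length (ws y) = i"
    and ws: "\<And>b. b < i \<Longrightarrow> ((\<lambda>y. ws y ! b) has_derivative ws' b) (at x)"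
  shows "((\<lambda>y. G i (f y) (ws y)) has_derivative
      (\<lambda>h. G (Suc i) (f x) (f' h # ws x) + (\<Sum>b<i. G i (f x) ((ws x)[b := ws' b h])))) (at x)"
proof -
  let ?R = "\<lambda>y. G i (f y) (ws y) - G i (f x) (ws y) - G (Suc i) (f x) ((f y - f x) # ws y)"
  have ml: "multilinear i (G i (f x))" "multilinear (Suc i) (G (Suc i) (f x))"
    using jet_multilinear[OF G _ fx] i by auto
  obtain K1 K2 where K: "opb i K1 (G i (f x))" "opb (Suc i) K2 (G (Suc i) (f x))"
    using jet_opb[OF G _ fx] i by (metis Suc_leI less_imp_le)
  have ml0: "G (Suc i) (f x) (0 # ws y) = 0" for y
    using multilinear_eq_0[OF ml(2), of "0 # ws y"] len by simp
  obtain L where L: "0 \<le> L" "\<forall>\<^sub>F y in nhds x. norm (f y - f x) \<le> L * norm (y - x)"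
    using has_derivative_lipschitz_at[OF f] .
  define M where "M = 1 + (\<Sum>b<i. norm (ws x ! b))"
  have M: "1 \<le> M" by (simp add: M_def sum_nonneg)
  have bM: "\<forall>\<^sub>F y in nhds x. norm (ws y ! b) \<le> M" if b: "b < i" for b
  proof -
    have "norm (ws x ! b) < M"
      using member_le_sum[of b "{..<i}" "\<lambda>b. norm (ws x ! b)"] b by (simp add: M_def)
    moreover have "((\<lambda>y. norm (ws y ! b)) \<longlongrightarrow> norm (ws x ! b)) (at x)"
      using has_derivative_continuous[OF ws[OF b]] by (simp add: continuous_within tendsto_norm)
    ultimately have "\<forall>\<^sub>F y in at x. norm (ws y ! b) < M" by (metis order_tendstoD(2))
    then show ?thesis using \<open>norm (ws x ! b) < M\<close>
      by (auto simp: eventually_at_filter elim!: eventually_mono)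
  qed
  have evM: "\<forall>\<^sub>F y in nhds x. \<forall>b\<in>{..<i}. norm (ws y ! b) \<le> M"
    by (rule eventually_ball_finite) (auto intro: bM)
  have "(?R has_derivative (\<lambda>_. 0)) (at x)"
    unfolding has_derivative_zero_iff
  proof (intro allI impI)
    fix e :: real assume e: "0 < e"
    \<comment> \<open>Compensates the Lipschitz constant of \<open>f\<close> at \<open>x\<close> and
      the bound \<open>M\<close> of the \<open>i\<close> arguments; \<open>L + 1\<close> replaces
      \<open>L\<close> to stay positive.\<close>
    define e' where "e' = e / ((L + 1) * M ^ i)"
    have e': "0 < e'" using e L(1) M by (simp add: e'_def)
    obtain d where d: "0 < d" "\<And>y. norm (y - f x) < d \<Longrightarrow>
        opb i (e' * norm (y - f x)) (\<lambda>vs. G i y vs - G i (f x) vs - G (Suc i) (f x) ((y - f x) # vs))"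
      using jet_opdiff[OF G V' i fx e'] by metis
    have "(f \<longlongrightarrow> f x) (at x)" using has_derivative_continuous[OF f] by (simp add: continuous_within)
    then have "\<forall>\<^sub>F y in nhds x. dist (f y) (f x) < d"
      using d(1) by (auto dest!: tendstoD[of _ _ _ d] simp: eventually_at_filter elim!: eventually_mono)
    then show "\<forall>\<^sub>F y in nhds x. norm (?R y - ?R x) \<le> e * norm (y - x)"
      using L(2) evM
    proof eventually_elim
      case (elim y)
      have "norm (?R y) \<le> (e' * norm (f y - f x)) * prod_list (replicate i M)"
        using elim e' len by (intro opb_list[OF d(2)]) (auto simp: dist_norm)
      also have "\<dots> \<le> (e' * ((L + 1) * norm (y - x))) * M ^ i"
      proof (unfold prod_list_replicate, intro mult_right_mono mult_left_mono)
        show "norm (f y - f x) \<le> (L + 1) * norm (y - x)" using elim(2) by (simp add: distrib_right add_increasing2)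
      qed (use less_imp_le[OF e'] M in simp_all)
      also have "\<dots> = e * norm (y - x)"
      proof -
        have "L + 1 \<noteq> 0" "M ^ i \<noteq> 0" using L(1) M by (auto simp: add_nonneg_eq_0_iff)
        then show ?thesis by (simp add: e'_def)
      qed
      finally have "norm (?R y) \<le> e * norm (y - x)" .
      moreover have "?R x = 0" by (simp add: ml0)
      ultimately show ?case by (simp only: diff_zero)
    qed
  qed
  moreover have "((\<lambda>y. G (Suc i) (f x) ((f y - f x) # ws y)) has_derivative
      (\<lambda>h. G (Suc i) (f x) (f' h # ws x))) (at x)"
  proof -
    have "((\<lambda>y. G (Suc i) (f x) ((f y - f x) # ws y)) has_derivative
      (\<lambda>h. \<Sum>p<Suc i. G (Suc i) (f x) (((f x - f x) # ws x)[p := (case p of 0 \<Rightarrow> f' | Suc b \<Rightarrow> ws' b) h]))) (at x)"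
    proof (rule has_derivative_multilinear[OF ml(2) K(2)])
      fix p assume "p < Suc i"
      then show "((\<lambda>y. ((f y - f x) # ws y) ! p) has_derivative (case p of 0 \<Rightarrow> f' | Suc b \<Rightarrow> ws' b)) (at x)"
        using ws has_derivative_diff[OF f has_derivative_const] by (cases p) auto
    qed (simp add: len)
    \<comment> \<open>At \<open>x\<close> the new argument \<open>f x - f x\<close> is zero, so
      every term in which another slot is differentiated drops out.\<close>
    moreover have "(\<Sum>p<Suc i. G (Suc i) (f x) (((f x - f x) # ws x)[p := (case p of 0 \<Rightarrow> f' | Suc b \<Rightarrow> ws' b) h]))
        = G (Suc i) (f x) (f' h # ws x)" for h
      by (subst sum.lessThan_Suc_shift) (simp add: multilinear_eq_0[OF ml(2)] len)
    ultimately show ?thesis by simp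
  qed
  moreover have "((\<lambda>y. G i (f x) (ws y)) has_derivative (\<lambda>h. \<Sum>b<i. G i (f x) ((ws x)[b := ws' b h]))) (at x)"
    by (rule has_derivative_multilinear[OF ml(1) K(1) len ws])
  ultimately have "((\<lambda>y. ?R y + (G (Suc i) (f x) ((f y - f x) # ws y) + G i (f x) (ws y))) has_derivative
      (\<lambda>h. 0 + (G (Suc i) (f x) (f' h # ws x) + (\<Sum>b<i. G i (f x) ((ws x)[b := ws' b h]))))) (at x)"
    by (intro has_derivative_add)
  then show ?thesis by (simp add: algebra_simps)
qed

section \<open>The higher chain rule\<close>

text \<open>The set partitions of \<open>{..<j}\<close>. Differentiating once more puts the new variable, which becomes
  number \<open>0\<close>, into a block of its own or into one of the existing blocks.\<close>

primrec parts :: "nat \<Rightarrow> nat list list list" where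
  "parts 0 = [[]]"
| "parts (Suc j) = concat (map (\<lambda>\<pi>. let \<rho> = map (map Suc) \<pi> in
     ([0] # \<rho>) # map (\<lambda>b. \<rho>[b := 0 # \<rho> ! b]) [0..<length \<rho>]) (parts j))"

lemma mset_concat_update:
  "b < length \<rho> \<Longrightarrow> mset (concat (\<rho>[b := x # \<rho> ! b])) = add_mset x (mset (concat \<rho>))"
  by (induction \<rho> arbitrary: b) (auto split: nat.splits)

lemma set_parts_Suc: "\<pi> \<in> set (parts (Suc j)) \<longleftrightarrow> (\<exists>\<sigma>\<in>set (parts j). \<pi> = [0] # map (map Suc) \<sigma> \<or>
    (\<exists>b<length \<sigma>. \<pi> = (map (map Suc) \<sigma>)[b := 0 # map (map Suc) \<sigma> ! b]))"
  by (fastforce simp: Let_def)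

lemma parts_mset: "\<pi> \<in> set (parts j) \<Longrightarrow> mset (concat \<pi>) = mset [0..<j]"
proof (induction j arbitrary: \<pi>)
  case (Suc j)
  then obtain \<sigma> where \<sigma>: "\<sigma> \<in> set (parts j)" and
    \<pi>: "\<pi> = [0] # map (map Suc) \<sigma> \<or> (\<exists>b<length \<sigma>. \<pi> = (map (map Suc) \<sigma>)[b := 0 # map (map Suc) \<sigma> ! b])"
    unfolding set_parts_Suc by blast
  have m: "mset (concat (map (map Suc) \<sigma>)) = mset (map Suc [0..<j])"
    using Suc.IH[OF \<sigma>] by (metis map_concat mset_map)
  have "mset (concat \<pi>) = add_mset 0 (mset (map Suc [0..<j]))"
    using \<pi>
  proof
    assume "\<pi> = [0] # map (map Suc) \<sigma>"
    then show ?thesis using m by simp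
  next
    assume "\<exists>b<length \<sigma>. \<pi> = (map (map Suc) \<sigma>)[b := 0 # map (map Suc) \<sigma> ! b]"
    then obtain b where "b < length \<sigma>" "\<pi> = (map (map Suc) \<sigma>)[b := 0 # map (map Suc) \<sigma> ! b]" by blast
    then show ?thesis using m mset_concat_update[of b "map (map Suc) \<sigma>" 0] by simp
  qed
  also have "\<dots> = mset (0 # map Suc [0..<j])" by simp
  also have "0 # map Suc [0..<j] = [0..<Suc j]" by (simp add: map_Suc_upt upt_conv_Cons del: upt_Suc)
  finally show ?case .
qed simp

lemma parts_nonempty: "\<pi> \<in> set (parts j) \<Longrightarrow> [] \<notin> set \<pi>"
proof (induction j arbitrary: \<pi>)
  case (Suc j)
  then obtain \<sigma> where \<sigma>: "\<sigma> \<in> set (parts j)" and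
    \<pi>: "\<pi> = [0] # map (map Suc) \<sigma> \<or> (\<exists>b<length \<sigma>. \<pi> = (map (map Suc) \<sigma>)[b := 0 # map (map Suc) \<sigma> ! b])"
    unfolding set_parts_Suc by blast
  show ?case using Suc.IH[OF \<sigma>] \<pi> by (auto dest!: set_update_subset_insert[THEN subsetD])
qed simp

lemma parts_set: "\<pi> \<in> set (parts j) \<Longrightarrow> \<Union> (set ` set \<pi>) = {..<j}"
  using mset_eq_setD[OF parts_mset, of \<pi> j] by (auto simp: set_eq_iff)

lemma parts_distinct: "\<pi> \<in> set (parts j) \<Longrightarrow> distinct (concat \<pi>)"
  using mset_eq_imp_distinct_iff[OF parts_mset] by simp

lemma parts_block:
  assumes "\<pi> \<in> set (parts j)" "S \<in> set \<pi>" shows "0 < length S" "length S \<le> j" "set S \<subseteq> {..<j}"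
proof -
  show "0 < length S" using parts_nonempty[OF assms(1)] assms(2) by (cases S) auto
  have "length (concat \<pi>) = j" using parts_mset[OF assms(1)] by (metis length_upt minus_nat.diff_0 size_mset)
  moreover have "length S \<le> length (concat \<pi>)"
    using assms(2) by (simp add: length_concat member_le_sum_list)
  ultimately show "length S \<le> j" by simp
  show "set S \<subseteq> {..<j}" using parts_set[OF assms(1)] assms(2) by auto
qed

lemma parts_length: assumes "\<pi> \<in> set (parts j)" shows "length \<pi> \<le> j"
proof -
  have "length (concat \<pi>) = j" using parts_mset[OF assms] by (metis length_upt minus_nat.diff_0 size_mset)
  moreover have "[] \<notin> set \<pi> \<Longrightarrow> length \<pi> \<le> length (concat \<pi>)"
  proof (induction \<pi>)
    case (Cons S \<pi>)
    then show ?case by (cases S) auto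
  qed simp
  ultimately show ?thesis using parts_nonempty[OF assms] by simp
qed

lemma parts_pos: "\<pi> \<in> set (parts j) \<Longrightarrow> 0 < j \<Longrightarrow> 0 < length \<pi>"
  using parts_set by fastforce

definition blocks :: "(nat \<Rightarrow> 'a \<Rightarrow> 'a list \<Rightarrow> 'b) \<Rightarrow> 'a \<Rightarrow> 'a list \<Rightarrow> nat list list \<Rightarrow> 'b list" where
  "blocks F x vs \<pi> = map (\<lambda>S. F (length S) x (map ((!) vs) S)) \<pi>"

text \<open>The jet of \<open>G \<circ> F\<close> by the formula of Faa di Bruno.\<close>

definition cmp :: "(nat \<Rightarrow> 'b \<Rightarrow> 'b list \<Rightarrow> 'c::comm_monoid_add) \<Rightarrow> (nat \<Rightarrow> 'a \<Rightarrow> 'a list \<Rightarrow> 'b) \<Rightarrow> nat \<Rightarrow> 'a \<Rightarrow> 'a list \<Rightarrow> 'c" where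
  "cmp G F j x vs = (\<Sum>\<pi>\<leftarrow>parts j. G (length \<pi>) (F 0 x []) (blocks F x vs \<pi>))"

lemma length_blocks [simp]: "length (blocks F x vs \<pi>) = length \<pi>" by (simp add: blocks_def)

lemma cmp_0: "cmp G F 0 x [] = G 0 (F 0 x []) []" by (simp add: cmp_def blocks_def)

lemma blocks_shift: "blocks F x (h # vs) (map (map Suc) \<pi>) = blocks F x vs \<pi>"
  by (simp add: blocks_def comp_def)

lemma blocks_update:
  assumes "b < length \<pi>"
  shows "blocks F x (h # vs) ((map (map Suc) \<pi>)[b := 0 # map (map Suc) \<pi> ! b])
    = (blocks F x vs \<pi>)[b := F (Suc (length (\<pi> ! b))) x (h # map ((!) vs) (\<pi> ! b))]"
  using assms blocks_shift[of F x h vs \<pi>] by (simp add: blocks_def map_update comp_def)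

lemma sum_list_concat_map: "(\<Sum>y\<leftarrow>concat (map g xs). f y) = (\<Sum>x\<leftarrow>xs. \<Sum>y\<leftarrow>g x. f y)"
  by (induction xs) auto

text \<open>The recursion of \<open>parts\<close> is matched with
  \<open>has_derivative_chain\<close>: the new block \<open>[0]\<close> comes from moving the base
  point of \<open>G\<close>, an enlarged block from moving the base point of that block of
  \<open>F\<close>.\<close>

lemma cmp_Suc:
  fixes G :: "nat \<Rightarrow> 'b \<Rightarrow> 'b list \<Rightarrow> 'c::comm_monoid_add"
  shows "cmp G F (Suc j) x (h # vs) = (\<Sum>\<pi>\<leftarrow>parts j.
     G (Suc (length \<pi>)) (F 0 x []) (F 1 x [h] # blocks F x vs \<pi>) +
     (\<Sum>b<length \<pi>. G (length \<pi>) (F 0 x [])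
        ((blocks F x vs \<pi>)[b := F (Suc (length (\<pi> ! b))) x (h # map ((!) vs) (\<pi> ! b))])))"
proof -
  have *: "blocks F x (h # vs) ([0] # map (map Suc) \<pi>) = F 1 x [h] # blocks F x vs \<pi>" for \<pi>
    using blocks_shift[of F x h vs \<pi>] by (simp add: blocks_def)
  have **: "(\<Sum>b\<leftarrow>[0..<n]. f b) = (\<Sum>b<n. f b)" for n and f :: "nat \<Rightarrow> 'c"
    by (simp add: interv_sum_list_conv_sum_set_nat atLeast0LessThan)
  have "(\<Sum>\<pi>'\<leftarrow>map (\<lambda>b. (map (map Suc) \<pi>)[b := 0 # map (map Suc) \<pi> ! b]) [0..<length \<pi>].
        G (length \<pi>') (F 0 x []) (blocks F x (h # vs) \<pi>'))
      = (\<Sum>b<length \<pi>. G (length \<pi>) (F 0 x [])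
        ((blocks F x vs \<pi>)[b := F (Suc (length (\<pi> ! b))) x (h # map ((!) vs) (\<pi> ! b))]))" for \<pi>
    unfolding map_map comp_def **[symmetric]
    by (intro arg_cong[of _ _ sum_list] map_cong refl) (simp add: blocks_update del: nth_map)
  then show ?thesis
    unfolding cmp_def parts.simps sum_list_concat_map by (simp add: Let_def *)
qed

lemma has_derivative_sum_list:
  "(\<And>s. s \<in> set S \<Longrightarrow> (f s has_derivative f' s) F) \<Longrightarrow>
    ((\<lambda>y. \<Sum>s\<leftarrow>S. f s y) has_derivative (\<lambda>h. \<Sum>s\<leftarrow>S. f' s h)) F"
  by (induction S) (auto intro: has_derivative_add)

text \<open>Every index lies in exactly one block, so bounds for the blocks multiply to the bound in
  the original arguments.\<close>

lemma prod_list_blocks: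
  fixes K :: real
  assumes "\<pi> \<in> set (parts j)" "length cs = j"
  shows "prod_list (map (\<lambda>S. K * prod_list (map ((!) cs) S)) \<pi>) = K ^ length \<pi> * prod_list cs"
proof -
  have "prod_list (map (\<lambda>S. K * prod_list (map f S)) \<pi>) = K ^ length \<pi> * prod_list (map f (concat \<pi>))"
    for f :: "nat \<Rightarrow> real" and \<pi> :: "nat list list"
    by (induction \<pi>) (auto simp: mult_ac)
  moreover have "mset (map ((!) cs) (concat \<pi>)) = mset (map ((!) cs) [0..<j])"
    using parts_mset[OF assms(1)] by (metis mset_map)
  then have "prod_list (map ((!) cs) (concat \<pi>)) = prod_list (map ((!) cs) [0..<j])"
    by (metis prod_mset_prod_list)
  moreover have "map ((!) cs) [0..<j] = cs" using map_nth[of cs] assms(2) by simp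
  ultimately show ?thesis by (simp only:)
qed

lemma opb_sum_list:
  "(\<And>s. s \<in> set S \<Longrightarrow> opb j (K s) (A s)) \<Longrightarrow> opb j (\<Sum>s\<leftarrow>S. K s) (\<lambda>vs. \<Sum>s\<leftarrow>S. A s vs)"
proof (induction S)
  case (Cons s S)
  then show ?case using opb_add[of j "K s" "A s"] by simp
qed (simp add: opb_def)

lemma block_bound:
  assumes \<pi>: "\<pi> \<in> set (parts j)" and b: "b < length \<pi>" and vs: "length vs = j"
    and A: "opb (length (\<pi> ! b)) K A"
  shows "norm (A (map ((!) vs) (\<pi> ! b))) \<le> map (\<lambda>S. K * prod_list (map ((!) (map norm vs)) S)) \<pi> ! b"
proof -
  have "map ((!) (map norm vs)) (\<pi> ! b) = map norm (map ((!) vs) (\<pi> ! b))"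
    using parts_block(3)[OF \<pi>, of "\<pi> ! b"] b vs by auto
  then show ?thesis using opbD[OF A, of "map ((!) vs) (\<pi> ! b)"] by (simp only: nth_map[OF b] length_map)
qed

text \<open>Differentiability is the chain rule for each partition. For continuity, the base point
  of \<open>G\<close> is moved first, with the arguments fixed, and then the arguments, with the
  base point fixed.\<close>

lemma jet_cmp:
  assumes V: "open V" and V': "open V'" and G: "jet r V' G" and F: "jet r V F"
    and maps: "\<And>x. x \<in> V \<Longrightarrow> F 0 x [] \<in> V'"
  shows "jet r V (cmp G F)"
proof (rule jetI[OF V])
  fix j x vs assume j: "j < r" and x: "x \<in> V" and vs: "length (vs :: 'a list) = j"
  show "((\<lambda>y. cmp G F j y vs) has_derivative (\<lambda>h. cmp G F (Suc j) x (h # vs))) (at x)"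
    unfolding cmp_def[of G F j] cmp_Suc
  proof (rule has_derivative_sum_list)
    fix \<pi> assume \<pi>: "\<pi> \<in> set (parts j)"
    have "((\<lambda>y. G (length \<pi>) (F 0 y []) (blocks F y vs \<pi>)) has_derivative
      (\<lambda>h. G (Suc (length \<pi>)) (F 0 x []) (F (Suc 0) x [h] # blocks F x vs \<pi>) +
       (\<Sum>b<length \<pi>. G (length \<pi>) (F 0 x []) ((blocks F x vs \<pi>)
         [b := F (Suc (length (\<pi> ! b))) x (h # map ((!) vs) (\<pi> ! b))])))) (at x)"
    proof (rule has_derivative_chain[OF G V'])
      show "length \<pi> < r" using parts_length[OF \<pi>] j by simp
      show "((\<lambda>y. F 0 y []) has_derivative (\<lambda>h. F (Suc 0) x [h])) (at x)"
        using jet_has_derivative[OF F _ x, of 0 "[]"] j by simp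
      fix b assume b: "b < length \<pi>"
      have "length (\<pi> ! b) \<le> j" using parts_block(2)[OF \<pi>] b by simp
      then show "((\<lambda>y. blocks F y vs \<pi> ! b) has_derivative
         (\<lambda>h. F (Suc (length (\<pi> ! b))) x (h # map ((!) vs) (\<pi> ! b)))) (at x)"
        using jet_has_derivative[OF F _ x, of "length (\<pi> ! b)" "map ((!) vs) (\<pi> ! b)"] b j
        by (simp add: blocks_def)
    qed (simp_all add: maps x)
    then show "((\<lambda>y. G (length \<pi>) (F 0 y []) (blocks F y vs \<pi>)) has_derivative
      (\<lambda>h. G (Suc (length \<pi>)) (F 0 x []) (F 1 x [h] # blocks F x vs \<pi>) +
       (\<Sum>b<length \<pi>. G (length \<pi>) (F 0 x []) ((blocks F x vs \<pi>)
         [b := F (Suc (length (\<pi> ! b))) x (h # map ((!) vs) (\<pi> ! b))])))) (at x)"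
      by simp
  qed
next
  have bound: "\<exists>K\<ge>1. \<forall>k\<le>r. opb k K (F k x) \<and> opb k K (G k (F 0 x []))" if x: "x \<in> V" for x
  proof -
    obtain KF where KF: "\<And>k. k \<le> r \<Longrightarrow> opb k (KF k) (F k x)" using jet_opb[OF F _ x] by metis
    obtain KG where KG: "\<And>k. k \<le> r \<Longrightarrow> opb k (KG k) (G k (F 0 x []))" using jet_opb[OF G _ maps[OF x]] by metis
    define K where "K = 1 + (\<Sum>k\<le>r. \<bar>KF k\<bar>) + (\<Sum>k\<le>r. \<bar>KG k\<bar>)"
    have nn: "0 \<le> (\<Sum>k\<le>r. \<bar>KF k\<bar>)" "0 \<le> (\<Sum>k\<le>r. \<bar>KG k\<bar>)" by (simp_all add: sum_nonneg)
    then have "1 \<le> K" by (simp add: K_def)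
    moreover have "KF k \<le> K \<and> KG k \<le> K" if "k \<le> r" for k
      using member_le_sum[of k "{..r}" "\<lambda>k. \<bar>KF k\<bar>"] member_le_sum[of k "{..r}" "\<lambda>k. \<bar>KG k\<bar>"] that
nn
        abs_ge_self[of "KF k"] abs_ge_self[of "KG k"]
      unfolding K_def by simp linarith
    ultimately show ?thesis using KF KG opb_mono by meson
  qed
  fix j assume j: "j \<le> r"
  show "\<exists>K. opb j K (cmp G F j x)" if x: "x \<in> V" for x
  proof -
    obtain K where K: "1 \<le> K" "\<And>k. k \<le> r \<Longrightarrow> opb k K (F k x)" "\<And>k. k \<le> r \<Longrightarrow> opb k K (G k (F 0 x []))"
      using bound[OF x] by blast
    have "opb j (K * K ^ length \<pi>) (\<lambda>vs. G (length \<pi>) (F 0 x []) (blocks F x vs \<pi>))"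
      if \<pi>: "\<pi> \<in> set (parts j)" for \<pi>
      unfolding opb_def
    proof (intro allI impI)
      fix vs :: "'a list" assume vs: "length vs = j"
      have "norm (G (length \<pi>) (F 0 x []) (blocks F x vs \<pi>))
          \<le> K * prod_list (map (\<lambda>S. K * prod_list (map ((!) (map norm vs)) S)) \<pi>)"
      proof (rule opb_list[OF K(3)])
        fix b assume b: "b < length \<pi>"
        have "length (\<pi> ! b) \<le> j" using parts_block(2)[OF \<pi>] b by simp
        then show "norm (blocks F x vs \<pi> ! b) \<le> map (\<lambda>S. K * prod_list (map ((!) (map norm vs)) S)) \<pi> ! b"
          using block_bound[OF \<pi> b vs K(2)] b j by (simp add: blocks_def)
      qed (use K(1) parts_length[OF \<pi>] j in auto)
      then show "norm (G (length \<pi>) (F 0 x []) (blocks F x vs \<pi>)) \<le> K * K ^ length \<pi> * prod_list (map norm vs)"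
        using prod_list_blocks[OF \<pi>, of "map norm vs" K] vs by (simp add: mult.assoc)
    qed
    then show ?thesis
      using opb_sum_list[of "parts j" j "\<lambda>\<pi>. K * K ^ length \<pi>"
          "\<lambda>\<pi> vs. G (length \<pi>) (F 0 x []) (blocks F x vs \<pi>)"]
      unfolding cmp_def by blast
  qed
  show "opcont j V (cmp G F j)"
    unfolding cmp_def
  proof (rule opcont_sum_list)
    fix \<pi> assume \<pi>: "\<pi> \<in> set (parts j)"
    let ?i = "length \<pi>"
    have i: "?i \<le> r" using parts_length[OF \<pi>] j by simp
    show "opcont j V (\<lambda>x vs. G ?i (F 0 x []) (blocks F x vs \<pi>))"
      unfolding opcont_def
    proof (intro ballI allI impI)
      fix x and e :: real assume x: "x \<in> V" and e: "0 < e"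
      obtain K where K: "1 \<le> K" "\<And>k. k \<le> r \<Longrightarrow> opb k K (F k x)" "\<And>k. k \<le> r \<Longrightarrow> opb k K (G k (F 0 x []))"
        using bound[OF x] by blast
      \<comment> \<open>The \<open>1\<close> pays for moving the base point of \<open>G\<close>,
        \<open>real ?i * K\<close> for the telescoping in the blocks, and \<open>K + 1\<close>
        bounds the blocks at both points.\<close>
      define C where "C = (1 + real ?i * K) * (K + 1) ^ ?i"
      have C: "0 < C" using K(1) by (simp add: C_def add_pos_nonneg)
      \<comment> \<open>The cap at \<open>1\<close> keeps the derivatives of \<open>F\<close> at
        \<open>y\<close> below \<open>K + 1\<close>.\<close>
      define e1 where "e1 = min 1 (e / C)"
      have e1: "0 < e1" "e1 \<le> 1" "e1 * C \<le> e" using e C by (auto simp: e1_def field_simps min_def)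
      obtain d1 where d1: "0 < d1" "\<And>z. z \<in> V' \<Longrightarrow> norm (z - F 0 x []) < d1 \<Longrightarrow>
          opb ?i e1 (\<lambda>vs. G ?i z vs - G ?i (F 0 x []) vs)"
        using opcontD[OF jet_opcont[OF G i] maps[OF x] e1(1)] by blast
      obtain d2 where d2: "0 < d2" "\<And>y. y \<in> V \<Longrightarrow> norm (y - x) < d2 \<Longrightarrow>
          opb 0 (d1 / 2) (\<lambda>vs. F 0 y vs - F 0 x vs)"
        using opcontD[OF jet_opcont[OF F] x, of 0 "d1 / 2"] d1(1) by auto
      have "\<exists>d>0. \<forall>y\<in>V. norm (y - x) < d \<longrightarrow> (\<forall>k\<le>n. opb k e1 (\<lambda>vs. F k y vs - F k x vs))" if "n \<le> r" for n
        using that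
      proof (induction n)
        case 0 show ?case using opcontD[OF jet_opcont[OF F] x e1(1), of 0] by simp
      next
        case (Suc n)
        then obtain d d' where "0 < d" "\<forall>y\<in>V. norm (y - x) < d \<longrightarrow> (\<forall>k\<le>n. opb k e1 (\<lambda>vs. F k y vs - F k x vs))"
          "0 < d'" "\<forall>y\<in>V. norm (y - x) < d' \<longrightarrow> opb (Suc n) e1 (\<lambda>vs. F (Suc n) y vs - F (Suc n) x vs)"
          using opcontD[OF jet_opcont[OF F] x e1(1), of "Suc n"] by auto
        then show ?case by (intro exI[of _ "min d d'"]) (auto simp: le_Suc_eq)
      qed
      from this[OF order_refl] obtain d3 where d3: "0 < d3"
        "\<And>y k. y \<in> V \<Longrightarrow> norm (y - x) < d3 \<Longrightarrow> k \<le> r \<Longrightarrow> opb k e1 (\<lambda>vs. F k y vs - F k x vs)"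
        by blast
      have "opb j e (\<lambda>vs. G ?i (F 0 y []) (blocks F y vs \<pi>) - G ?i (F 0 x []) (blocks F x vs \<pi>))"
        if y: "y \<in> V" and n: "norm (y - x) < min d2 d3" for y
        unfolding opb_def
      proof (intro allI impI)
        fix vs :: "'a list" assume vs: "length vs = j"
        define cs where "cs = map (\<lambda>S. (K + 1) * prod_list (map ((!) (map norm vs)) S)) \<pi>"
        have cs: "length cs = ?i" "prod_list cs = (K + 1) ^ ?i * prod_list (map norm vs)"
          using prod_list_blocks[OF \<pi>, of "map norm vs" "K + 1"] vs by (auto simp: cs_def)
        have b: "norm (blocks F y vs \<pi> ! b) \<le> cs ! b" "norm (blocks F x vs \<pi> ! b) \<le> cs ! b"
            "norm (blocks F y vs \<pi> ! b - blocks F x vs \<pi> ! b) \<le> e1 * cs ! b" if b: "b < ?i" for b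
        proof -
          have l: "length (\<pi> ! b) \<le> r" using parts_block(2)[OF \<pi>, of "\<pi> ! b"] b j by simp
          have ox: "opb (length (\<pi> ! b)) (K + 1) (F (length (\<pi> ! b)) x)"
            using opb_mono[OF K(2)[OF l]] by simp
          have od: "opb (length (\<pi> ! b)) e1 (\<lambda>vs. F (length (\<pi> ! b)) y vs - F (length (\<pi> ! b)) x vs)"
            using d3(2)[OF y _ l] n by simp
          have oy: "opb (length (\<pi> ! b)) (K + 1) (F (length (\<pi> ! b)) y)"
            using opb_mono[OF opb_add[OF od K(2)[OF l]], of "K + 1"] e1(2) by simp
          show "norm (blocks F y vs \<pi> ! b) \<le> cs ! b" "norm (blocks F x vs \<pi> ! b) \<le> cs ! b"
            using block_bound[OF \<pi> b vs oy] block_bound[OF \<pi> b vs ox] b by (auto simp: cs_def blocks_def)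
          let ?p = "prod_list (map ((!) (map norm vs)) (\<pi> ! b))"
          have "map ((!) (map norm vs)) (\<pi> ! b) = map norm (map ((!) vs) (\<pi> ! b))"
            using parts_block(3)[OF \<pi>, of "\<pi> ! b"] b vs by auto
          then have p0: "0 \<le> ?p" by (simp only: prod_list_norm_nonneg)
          have "norm (blocks F y vs \<pi> ! b - blocks F x vs \<pi> ! b) \<le> e1 * ?p"
            using block_bound[OF \<pi> b vs od] b by (auto simp: blocks_def)
          also have "\<dots> \<le> e1 * cs ! b"
            using e1(1) K(1) p0 b by (auto simp: cs_def mult_le_cancel_right1 intro!: mult_left_mono)
          finally show "norm (blocks F y vs \<pi> ! b - blocks F x vs \<pi> ! b) \<le> e1 * cs ! b" .
        qed
        have "opb ?i e1 (\<lambda>vs. G ?i (F 0 y []) vs - G ?i (F 0 x []) vs)"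
        proof (rule d1(2)[OF maps[OF y]])
          show "norm (F 0 y [] - F 0 x []) < d1"
            using opbD[OF d2(2)[OF y], of "[]"] n d1(1) by simp
        qed
        from opb_list[OF this, of "blocks F y vs \<pi>" cs]
        have 1: "norm (G ?i (F 0 y []) (blocks F y vs \<pi>) - G ?i (F 0 x []) (blocks F y vs \<pi>)) \<le> e1 * prod_list cs"
          using e1(1) cs(1) b(1) by simp
        have 2: "norm (G ?i (F 0 x []) (blocks F y vs \<pi>) - G ?i (F 0 x []) (blocks F x vs \<pi>))
            \<le> real ?i * K * e1 * prod_list cs"
          by (rule opb_telescope[OF jet_multilinear[OF G i maps[OF x]] K(3)[OF i]])
            (use K(1) e1(1) cs(1) b in auto)
        have "norm (G ?i (F 0 y []) (blocks F y vs \<pi>) - G ?i (F 0 x []) (blocks F x vs \<pi>))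
            \<le> e1 * prod_list cs + real ?i * K * e1 * prod_list cs"
          using norm_triangle_le[OF add_mono[OF 1 2]] by simp
        also have "\<dots> = (e1 * C) * prod_list (map norm vs)"
          by (simp add: cs(2) C_def algebra_simps)
        also have "\<dots> \<le> e * prod_list (map norm vs)"
          using e1(3) by (rule mult_right_mono) simp
        finally show "norm (G ?i (F 0 y []) (blocks F y vs \<pi>) - G ?i (F 0 x []) (blocks F x vs \<pi>))
            \<le> e * prod_list (map norm vs)" .
      qed
      then show "\<exists>d>0. \<forall>y\<in>V. norm (y - x) < d \<longrightarrow>
          opb j e (\<lambda>vs. G ?i (F 0 y []) (blocks F y vs \<pi>) - G ?i (F 0 x []) (blocks F x vs \<pi>))"
        using d2(1) d3(1) by (intro exI[of _ "min d2 d3"]) auto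
    qed
  qed
qed

section \<open>Symmetry, polynomials and series\<close>

lemma small_multiple: assumes "0 < e" "0 \<le> (c::real)" shows "\<exists>e'>0. e' * c \<le> e"
  using assms by (intro exI[of _ "e / (c + 1)"]) (auto simp: field_simps)

section \<open>Mean value inequality and symmetry of higher derivatives\<close>

lemma mvt_norm_bound:
  fixes f :: "real \<Rightarrow> 'a::real_normed_vector"
  assumes "\<And>t. t \<in> {0..1} \<Longrightarrow> (f has_vector_derivative f' t) (at t within {0..1})"
    and "\<And>t. t \<in> {0..1} \<Longrightarrow> norm (f' t) \<le> B"
  shows "norm (f 1 - f 0) \<le> B"
proof -
  have "norm (f 1 - f 0) \<le> B * norm (1 - 0 :: real)"
  proof (rule differentiable_bound[of "{0..1}" f "\<lambda>t h. h *\<^sub>R f' t"])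
    fix t :: real assume t: "t \<in> {0..1}"
    show "(f has_derivative (\<lambda>h. h *\<^sub>R f' t)) (at t within {0..1})"
      using assms(1)[OF t] by (simp add: has_vector_derivative_def)
    have "0 \<le> B" using assms(2)[OF t] norm_ge_zero order_trans by blast
    then show "onorm (\<lambda>h. h *\<^sub>R f' t) \<le> B"
    proof (rule onorm_bound)
      fix h :: real
      show "norm (h *\<^sub>R f' t) \<le> B * norm h"
        using mult_left_mono[OF assms(2)[OF t], of "\<bar>h\<bar>"] by (simp add: mult.commute)
    qed
  qed auto
  then show ?thesis by simp
qed

lemma has_vector_derivative_line:
  assumes "(f has_derivative f') (at (a + t *\<^sub>R v))"
  shows "((\<lambda>t. f (a + t *\<^sub>R v)) has_vector_derivative f' v) (at t within S)"
proof -
  have "((\<lambda>t. a + t *\<^sub>R v) has_vector_derivative v) (at t within S)"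
    by (auto intro!: derivative_eq_intros)
  from vector_derivative_diff_chain_within[OF this has_derivative_at_withinI[OF assms]]
  show ?thesis by (simp add: o_def)
qed

text \<open>Two nested mean value inequalities, along \<open>u\<close> and along \<open>v\<close>,
  reduce the error to the oscillation of the second derivative near \<open>x\<close>. The point is
  that the four values of \<open>D j\<close> are symmetric in \<open>u\<close> and
  \<open>v\<close>.\<close>

lemma second_difference:
  assumes D: "jet r V D" and V: "open V" and j: "Suc (Suc j) \<le> r" and x: "x \<in> V" and t: "length t = j" and e: "0 < e"
  shows "\<exists>d>0. \<forall>s. 0 < s \<and> s < d \<longrightarrow>
    norm (D j (x + s *\<^sub>R u + s *\<^sub>R v) t - D j (x + s *\<^sub>R u) t - D j (x + s *\<^sub>R v) t + D j x t
      - s\<^sup>2 *\<^sub>R D (Suc (Suc j)) x (v # u # t)) \<le> s\<^sup>2 * (e * (norm v * norm u * prod_list (map norm t)))"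
proof -
  let ?C = "norm v * norm u * prod_list (map norm t)"
  let ?J = "Suc (Suc j)"
  obtain d0 where d0: "0 < d0" "ball x d0 \<subseteq> V" using V x openE by blast
  obtain d1 where d1: "0 < d1" "\<And>y. y \<in> V \<Longrightarrow> norm (y - x) < d1 \<Longrightarrow> opb ?J e (\<lambda>vs. D ?J y vs - D ?J x vs)"
    using opcontD[OF jet_opcont[OF D j] x e] by blast
  \<comment> \<open>The whole parallelogram spanned by \<open>s *\<^sub>R u\<close> and
    \<open>s *\<^sub>R v\<close> at \<open>x\<close> stays in both balls.\<close>
  define d where "d = min d0 d1 / (norm u + norm v + 1)"
  have d: "0 < d" using d0(1) d1(1) by (simp add: d_def add_nonneg_pos)
  have near: "x + a *\<^sub>R u + b *\<^sub>R v \<in> V \<and> norm (x + a *\<^sub>R u + b *\<^sub>R v - x) < d1"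
    if s: "0 < s" "s < d" and a: "0 \<le> a" "a \<le> s" and b: "0 \<le> b" "b \<le> s" for s a b
  proof -
    have "norm (a *\<^sub>R u + b *\<^sub>R v) \<le> a * norm u + b * norm v"
      using norm_triangle_ineq[of "a *\<^sub>R u" "b *\<^sub>R v"] a(1) b(1) by simp
    also have "\<dots> \<le> s * norm u + s * norm v" using a b by (intro add_mono mult_right_mono) auto
    also have "\<dots> \<le> s * (norm u + norm v + 1)" using s by (simp add: algebra_simps)
    also have "\<dots> < min d0 d1" using s(2) by (simp add: d_def pos_less_divide_eq add_nonneg_pos)
    finally have n: "norm (a *\<^sub>R u + b *\<^sub>R v) < min d0 d1" .
    have eq: "x + a *\<^sub>R u + b *\<^sub>R v = x + (a *\<^sub>R u + b *\<^sub>R v)" by (simp add: add.assoc)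
    have "x + (a *\<^sub>R u + b *\<^sub>R v) \<in> ball x d0" using n unfolding mem_ball by (subst dist_commute) (simp add: dist_norm)
    then show ?thesis unfolding eq using n d0(2) by auto
  qed
  have "norm (D j (x + s *\<^sub>R u + s *\<^sub>R v) t - D j (x + s *\<^sub>R u) t - D j (x + s *\<^sub>R v) t + D j x t
      - s\<^sup>2 *\<^sub>R D ?J x (v # u # t)) \<le> s\<^sup>2 * (e * ?C)" if s: "0 < s" "s < d" for s
  proof -
    have ml: "multilinear ?J (D ?J x)" using jet_multilinear[OF D j x] .
    let ?K = "D ?J x (v # u # t)"
    have inner: "norm (D (Suc j) (x + (\<tau> * s) *\<^sub>R u + s *\<^sub>R v) (u # t) - D (Suc j) (x + (\<tau> * s) *\<^sub>R u) (u # t) - s *\<^sub>R ?K)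
        \<le> s * (e * ?C)" if \<tau>: "\<tau> \<in> {0..1}" for \<tau>
    proof -
      let ?a = "x + (\<tau> * s) *\<^sub>R u"
      let ?k = "\<lambda>\<sigma>. D (Suc j) (?a + \<sigma> *\<^sub>R (s *\<^sub>R v)) (u # t) - \<sigma> *\<^sub>R (s *\<^sub>R ?K)"
      have pt: "?a + \<sigma> *\<^sub>R (s *\<^sub>R v) \<in> V" "norm (?a + \<sigma> *\<^sub>R (s *\<^sub>R v) - x) < d1" if "\<sigma> \<in> {0..1}" for \<sigma>
        using near[OF s, of "\<tau> * s" "\<sigma> * s"] that \<tau> s by (auto simp: mult_left_le_one_le)
      have "norm (?k 1 - ?k 0) \<le> s * (e * ?C)"
      proof (rule mvt_norm_bound)
        fix \<sigma> :: real assume \<sigma>: "\<sigma> \<in> {0..1}"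
        let ?y = "?a + \<sigma> *\<^sub>R (s *\<^sub>R v)"
        have "((\<lambda>\<sigma>. D (Suc j) (?a + \<sigma> *\<^sub>R (s *\<^sub>R v)) (u # t)) has_vector_derivative D ?J ?y ((s *\<^sub>R v) # u # t)) (at \<sigma> within {0..1})"
          using j t by (intro has_vector_derivative_line jet_has_derivative[OF D _ pt(1)[OF \<sigma>]]) auto
        moreover have "((\<lambda>\<sigma>. \<sigma> *\<^sub>R (s *\<^sub>R ?K)) has_vector_derivative s *\<^sub>R ?K) (at \<sigma> within {0..1})"
          by (auto intro!: derivative_eq_intros)
        ultimately show "(?k has_vector_derivative D ?J ?y ((s *\<^sub>R v) # u # t) - s *\<^sub>R ?K) (at \<sigma> within {0..1})"
          by (rule has_vector_derivative_diff)
        have "s *\<^sub>R ?K = D ?J x ((s *\<^sub>R v) # u # t)"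
          using linear_scale[OF multilinearD[OF ml, of "v # u # t" 0], of s v] t by simp
        then show "norm (D ?J ?y ((s *\<^sub>R v) # u # t) - s *\<^sub>R ?K) \<le> s * (e * ?C)"
          using opbD[OF d1(2)[OF pt[OF \<sigma>]], of "(s *\<^sub>R v) # u # t"] t s by (simp add: mult_ac)
      qed
      then show ?thesis by (simp add: algebra_simps)
    qed
    let ?g = "\<lambda>\<tau>. D j ((x + s *\<^sub>R v) + \<tau> *\<^sub>R (s *\<^sub>R u)) t - D j (x + \<tau> *\<^sub>R (s *\<^sub>R u)) t - \<tau> *\<^sub>R (s\<^sup>2 *\<^sub>R ?K)"
    have "norm (?g 1 - ?g 0) \<le> s * (s * (e * ?C))"
    proof (rule mvt_norm_bound)
      fix \<tau> :: real assume \<tau>: "\<tau> \<in> {0..1}"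
      let ?y = "x + \<tau> *\<^sub>R (s *\<^sub>R u)"
      have ys: "(x + s *\<^sub>R v) + \<tau> *\<^sub>R (s *\<^sub>R u) = x + (\<tau> * s) *\<^sub>R u + s *\<^sub>R v" by simp
      have ys': "?y = x + (\<tau> * s) *\<^sub>R u" by simp
      have yV: "x + (\<tau> * s) *\<^sub>R u + s *\<^sub>R v \<in> V" "x + (\<tau> * s) *\<^sub>R u \<in> V"
        using near[OF s, of "\<tau> * s" s] near[OF s, of "\<tau> * s" 0] \<tau> s by (auto simp: mult_left_le_one_le)
      let ?z = "x + s *\<^sub>R v + \<tau> *\<^sub>R (s *\<^sub>R u)"
      have lin: "linear (\<lambda>w. D (Suc j) y (w # t))" if "y \<in> V" for y
        using multilinearD[OF jet_multilinear[OF D _ that], of "Suc j" "u # t" 0] j t by simp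
      have zV: "?z \<in> V" "?y \<in> V" unfolding ys ys' using yV by auto
      have "((\<lambda>\<tau>. D j ((x + s *\<^sub>R v) + \<tau> *\<^sub>R (s *\<^sub>R u)) t) has_vector_derivative D (Suc j) ?z ((s *\<^sub>R u) # t)) (at \<tau> within {0..1})"
        using j t by (intro has_vector_derivative_line jet_has_derivative[OF D _ zV(1)]) auto
      moreover have "((\<lambda>\<tau>. D j (x + \<tau> *\<^sub>R (s *\<^sub>R u)) t) has_vector_derivative D (Suc j) ?y ((s *\<^sub>R u) # t)) (at \<tau> within {0..1})"
        using j t by (intro has_vector_derivative_line jet_has_derivative[OF D _ zV(2)]) auto
      moreover have "((\<lambda>\<tau>. \<tau> *\<^sub>R (s\<^sup>2 *\<^sub>R ?K)) has_vector_derivative s\<^sup>2 *\<^sub>R ?K) (at \<tau> within {0..1})"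
        by (auto intro!: derivative_eq_intros)
      ultimately show "(?g has_vector_derivative
          D (Suc j) ?z ((s *\<^sub>R u) # t) - D (Suc j) ?y ((s *\<^sub>R u) # t) - s\<^sup>2 *\<^sub>R ?K) (at \<tau> within {0..1})"
        by (intro has_vector_derivative_diff)
      have "D (Suc j) ?z ((s *\<^sub>R u) # t) - D (Suc j) ?y ((s *\<^sub>R u) # t) - s\<^sup>2 *\<^sub>R ?K
          = s *\<^sub>R (D (Suc j) (x + (\<tau> * s) *\<^sub>R u + s *\<^sub>R v) (u # t) - D (Suc j) (x + (\<tau> * s) *\<^sub>R u) (u # t) - s *\<^sub>R ?K)"
        unfolding ys ys' linear_scale[OF lin[OF yV(1)]] linear_scale[OF lin[OF yV(2)]]
        by (simp add: scaleR_diff_right power2_eq_square)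
      then show "norm (D (Suc j) ?z ((s *\<^sub>R u) # t) - D (Suc j) ?y ((s *\<^sub>R u) # t) - s\<^sup>2 *\<^sub>R ?K) \<le> s * (s * (e * ?C))"
        using inner[OF \<tau>] s by simp
    qed
    moreover have "?g 1 - ?g 0 = D j (x + s *\<^sub>R u + s *\<^sub>R v) t - D j (x + s *\<^sub>R u) t - D j (x + s *\<^sub>R v) t + D j x t - s\<^sup>2 *\<^sub>R ?K"
      by (simp add: algebra_simps)
    ultimately have "norm (D j (x + s *\<^sub>R u + s *\<^sub>R v) t - D j (x + s *\<^sub>R u) t - D j (x + s *\<^sub>R v) t
        + D j x t - s\<^sup>2 *\<^sub>R ?K) \<le> s * (s * (e * ?C))"
      by (simp only:)
    also have "s * (s * (e * ?C)) = s\<^sup>2 * (e * ?C)" by (simp only: power2_eq_square mult.assoc)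
    finally show ?thesis .
  qed
  then show ?thesis using d by blast
qed

text \<open>Both orders of differentiation approximate the same second difference to within an
  arbitrarily small multiple of \<open>s\<^sup>2\<close>.\<close>

lemma jet_swap:
  assumes D: "jet r V D" and V: "open V" and j: "Suc (Suc j) \<le> r" and x: "x \<in> V" and t: "length t = j"
  shows "D (Suc (Suc j)) x (v # u # t) = D (Suc (Suc j)) x (u # v # t)"
proof -
  let ?C = "norm v * norm u * prod_list (map norm t)"
  let ?X = "D (Suc (Suc j)) x (v # u # t)" and ?Y = "D (Suc (Suc j)) x (u # v # t)"
  have "norm (?X - ?Y) \<le> e" if "0 < e" for e
  proof -
    have "0 \<le> 2 * ?C" by simp
    from small_multiple[OF that this] obtain e1 where "0 < e1" "e1 * (2 * ?C) \<le> e" by blast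
    then have e1: "0 < e1" "2 * (e1 * ?C) \<le> e" by (simp_all only: mult.left_commute)
    obtain d1 where d1: "0 < d1" "\<And>s. 0 < s \<Longrightarrow> s < d1 \<Longrightarrow>
      norm (D j (x + s *\<^sub>R u + s *\<^sub>R v) t - D j (x + s *\<^sub>R u) t - D j (x + s *\<^sub>R v) t + D j x t - s\<^sup>2 *\<^sub>R ?X)
        \<le> s\<^sup>2 * (e1 * ?C)"
      using second_difference[OF D V j x t e1(1), of u v] by blast
    obtain d2 where d2: "0 < d2" "\<And>s. 0 < s \<Longrightarrow> s < d2 \<Longrightarrow>
      norm (D j (x + s *\<^sub>R v + s *\<^sub>R u) t - D j (x + s *\<^sub>R v) t - D j (x + s *\<^sub>R u) t + D j x t - s\<^sup>2 *\<^sub>R ?Y)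
        \<le> s\<^sup>2 * (e1 * (norm u * norm v * prod_list (map norm t)))"
      using second_difference[OF D V j x t e1(1), of v u] by blast
    define s where "s = min d1 d2 / 2"
    have s: "0 < s" "s < d1" "s < d2" using d1(1) d2(1) by (auto simp: s_def)
    have sw: "x + s *\<^sub>R v + s *\<^sub>R u = x + s *\<^sub>R u + s *\<^sub>R v" by (simp add: algebra_simps)
    have "s\<^sup>2 * norm (?X - ?Y) = norm (s\<^sup>2 *\<^sub>R ?X - s\<^sup>2 *\<^sub>R ?Y)"
      by (simp flip: scaleR_diff_right)
    also have "\<dots> \<le> s\<^sup>2 * (e1 * ?C) + s\<^sup>2 * (e1 * ?C)"
      using norm_triangle_le_diff[OF add_mono[OF d2(2)[OF s(1,3)] d1(2)[OF s(1,2)]]]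
      by (simp add: sw algebra_simps)
    also have "\<dots> = s\<^sup>2 * (2 * (e1 * ?C))" by simp
    also have "\<dots> \<le> s\<^sup>2 * e" using e1(2) by (intro mult_left_mono) auto
    finally show ?thesis using s(1) by simp
  qed
  then have "norm (?X - ?Y) \<le> 0" by (rule field_le_epsilon) (simp add: add.commute)
  then show ?thesis by simp
qed

definition symm :: "nat \<Rightarrow> ('a list \<Rightarrow> 'b) \<Rightarrow> bool" where
  "symm j A \<longleftrightarrow> (\<forall>vs ws. length vs = j \<longrightarrow> mset vs = mset ws \<longrightarrow> A vs = A ws)"

lemma symmD: "symm j A \<Longrightarrow> length vs = j \<Longrightarrow> mset vs = mset ws \<Longrightarrow> A vs = A ws"
  unfolding symm_def by blast

text \<open>Differentiating the symmetry of \<open>D j\<close> gives the symmetry of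
  \<open>D (Suc j)\<close> in all arguments but the first. Together with the exchange of the first
  two arguments this generates all rearrangements.\<close>

lemma jet_symm:
  assumes D: "jet r V D" and V: "open V" and "j \<le> r" "x \<in> V"
  shows "symm j (D j x)"
  using assms(3,4)
proof (induction j arbitrary: x)
  case 0 then show ?case by (simp add: symm_def)
next
  case (Suc j)
  have tail: "D (Suc j) x (h # us) = D (Suc j) x (h # us')" if "length us = j" "mset us = mset us'" for h us us'
  proof -
    have l: "length us' = j" using that by (metis size_mset)
    have "((\<lambda>y. D j y us') has_derivative (\<lambda>h. D (Suc j) x (h # us))) (at x)"
      using Suc that
      by (intro has_derivative_transform_within_open[OF jet_has_derivative[OF D] V]) (auto intro: symmD)
    moreover have "((\<lambda>y. D j y us') has_derivative (\<lambda>h. D (Suc j) x (h # us'))) (at x)"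
      using Suc.prems l by (intro jet_has_derivative[OF D]) auto
    ultimately show ?thesis by (metis has_derivative_unique)
  qed
  show ?case unfolding symm_def
  proof (intro allI impI)
    fix vs ws :: "'a list" assume l: "length vs = Suc j" and m: "mset vs = mset ws"
    obtain a us where vs: "vs = a # us" "length us = j" using l by (auto simp: length_Suc_conv)
    have "length ws = Suc j" using l m by (metis size_mset)
    then obtain b us' where ws: "ws = b # us'" "length us' = j" by (auto simp: length_Suc_conv)
    show "D (Suc j) x vs = D (Suc j) x ws"
    proof (cases "a = b")
      case True
      then show ?thesis using tail[of us us' b] m vs ws by simp
    next
      case False
      have m': "add_mset a (mset us) = add_mset b (mset us')" using m vs ws by simp
      then have "b \<in> set us" using False by (metis insert_noteq_member set_mset_mset)
      \<comment> \<open>The entry \<open>b\<close> is moved to second place, exchanged with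
        \<open>a\<close>, and the new tail is rearranged.\<close>
      define t where "t = remove1 b us"
      have us: "mset us = add_mset b (mset t)" using \<open>b \<in> set us\<close> by (simp add: t_def)
      then have us': "mset us' = add_mset a (mset t)" using m' by (metis add_eq_conv_ex add_mset_commute add_mset_add_mset_same_iff False)
      have lt: "Suc (length t) = j" using arg_cong[OF us, of size] vs(2) by simp
      have "D (Suc j) x (a # us) = D (Suc j) x (a # b # t)" using us vs by (intro tail) auto
      also have "\<dots> = D (Suc j) x (b # a # t)"
        using jet_swap[OF D V, of "length t" x t a b] Suc.prems lt by simp
      also have "\<dots> = D (Suc j) x (b # us')" using us' lt by (intro tail) auto
      finally show ?thesis using vs ws by simp
    qed
  qed
qed

text \<open>For symmetric \<open>S\<close> these are the derivatives of
  \<open>x \<mapsto> S (x, \<dots>, x) / k!\<close>, normalized so that the derivative of order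
  \<open>k\<close> is \<open>S\<close> itself.\<close>

definition poly_jet :: "('a list \<Rightarrow> 'b::real_vector) \<Rightarrow> nat \<Rightarrow> nat \<Rightarrow> 'a \<Rightarrow> 'a list \<Rightarrow> 'b" where
  "poly_jet S k j x vs = (if j \<le> k then (1 / fact (k - j)) *\<^sub>R S (vs @ replicate (k - j) x) else 0)"

lemma divide_fact_le: "0 \<le> c \<Longrightarrow> c / fact n \<le> (c::real)"
  using fact_ge_1[of n, where 'a = real] by (auto simp: divide_le_eq mult_le_cancel_left1 simp del: fact_ge_1)

text \<open>By symmetry all \<open>k - j\<close> moving slots contribute the same term to the
  derivative, and the factor \<open>k - j\<close> turns \<open>1 / fact (k - j)\<close> into
  \<open>1 / fact (k - Suc j)\<close>.\<close>

lemma jet_poly_jet: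
  fixes S :: "'a::real_normed_vector list \<Rightarrow> 'b::real_normed_vector"
  assumes S: "multilinear k S" "opb k K S" and sy: "symm k S"
  shows "jet r UNIV (poly_jet S k)"
proof (rule jetI)
  define K' where "K' = max K 0"
  have K': "opb k K' S" "0 \<le> K'" using opb_mono[OF S(2)] by (auto simp: K'_def)
  fix j
  show "\<exists>B. opb j B (poly_jet S k j x)" for x
  proof (cases "j \<le> k")
    case True
    have "opb j (K' * norm x ^ (k - j)) (poly_jet S k j x)"
      unfolding opb_def
    proof (intro allI impI)
      fix vs :: "'a list" assume vs: "length vs = j"
      have "norm (poly_jet S k j x vs) \<le> norm (S (vs @ replicate (k - j) x))"
        using True by (simp add: poly_jet_def divide_fact_le)
      also have "\<dots> \<le> K' * norm x ^ (k - j) * prod_list (map norm vs)"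
        using opbD[OF K'(1), of "vs @ replicate (k - j) x"] True vs by (simp add: prod_list_replicate mult_ac)
      finally show "norm (poly_jet S k j x vs) \<le> K' * norm x ^ (k - j) * prod_list (map norm vs)" .
    qed
    then show ?thesis by blast
  qed (auto simp: poly_jet_def opb_def intro: exI[of _ 0])
  show "opcont j UNIV (poly_jet S k j)"
  proof (cases "j \<le> k")
    case True
    show ?thesis unfolding opcont_def
    proof (intro ballI allI impI)
      fix x :: 'a and e :: real assume e: "0 < e"
      define M where "M = norm x + 1"
      define C where "C = real k * K' * M ^ (k - j) + 1"
      have M: "1 \<le> M" by (simp add: M_def)
      have C: "0 < C" using K'(2) M by (simp add: C_def add_nonneg_pos)
      have "opb j e (\<lambda>vs. poly_jet S k j y vs - poly_jet S k j x vs)" if y: "norm (y - x) < min 1 (e / C)" for y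
        unfolding opb_def
      proof (intro allI impI)
        fix vs :: "'a list" assume vs: "length vs = j"
        let ?us = "vs @ replicate (k - j) y" and ?ws = "vs @ replicate (k - j) x"
        have ny: "norm y \<le> M" using y norm_triangle_sub[of y x] by (simp add: M_def)
        have "norm (S ?us - S ?ws) \<le> real k * K' * norm (y - x) * prod_list (map norm vs @ replicate (k - j) M)"
        proof (rule opb_telescope[OF S(1) K'])
          fix p assume p: "p < k"
          show "norm (?us ! p) \<le> (map norm vs @ replicate (k - j) M) ! p"
            "norm (?ws ! p) \<le> (map norm vs @ replicate (k - j) M) ! p"
            using p vs ny True by (auto simp: nth_append M_def)
          show "norm (?us ! p - ?ws ! p) \<le> norm (y - x) * (map norm vs @ replicate (k - j) M) ! p"
            using p vs M True by (auto simp: nth_append mult_le_cancel_left1)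
        qed (use vs True in auto)
        also have "\<dots> = (norm (y - x) * (C - 1)) * prod_list (map norm vs)"
          by (simp add: C_def prod_list_replicate mult_ac)
        also have "\<dots> \<le> e * prod_list (map norm vs)"
        proof (rule mult_right_mono)
          have "norm (y - x) * (C - 1) \<le> norm (y - x) * C" by (intro mult_left_mono) auto
          then show "norm (y - x) * (C - 1) \<le> e" using y C by (simp add: pos_less_divide_eq)
        qed simp
        finally have 1: "norm (S ?us - S ?ws) \<le> e * prod_list (map norm vs)" .
        have "poly_jet S k j y vs - poly_jet S k j x vs = (1 / fact (k - j)) *\<^sub>R (S ?us - S ?ws)"
          using True by (simp add: poly_jet_def scaleR_diff_right)
        moreover have "norm ((1 / fact (k - j)) *\<^sub>R (S ?us - S ?ws)) \<le> norm (S ?us - S ?ws)"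
          by (simp add: divide_fact_le)
        ultimately show "norm (poly_jet S k j y vs - poly_jet S k j x vs) \<le> e * prod_list (map norm vs)"
          using 1 by simp
      qed
      then show "\<exists>d>0. \<forall>y\<in>UNIV. norm (y - x) < d \<longrightarrow> opb j e (\<lambda>vs. poly_jet S k j y vs - poly_jet S k j x vs)"
        using e C by (intro exI[of _ "min 1 (e / C)"]) auto
    qed
  qed (auto simp: poly_jet_def opb_def opcont_def intro: exI[of _ 1])
  fix x :: 'a and vs :: "'a list" assume vs: "length vs = j"
  show "((\<lambda>y. poly_jet S k j y vs) has_derivative (\<lambda>h. poly_jet S k (Suc j) x (h # vs))) (at x)"
  proof (cases "j < k")
    case True
    define ws' where "ws' p = (if p < j then (\<lambda>_. 0) else (\<lambda>h::'a. h))" for p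
    have "((\<lambda>y. S (vs @ replicate (k - j) y)) has_derivative
        (\<lambda>h. \<Sum>p<k. S ((vs @ replicate (k - j) x)[p := ws' p h]))) (at x)"
    proof (rule has_derivative_multilinear[OF S])
      fix p assume "p < k"
      then show "((\<lambda>y. (vs @ replicate (k - j) y) ! p) has_derivative ws' p) (at x)"
        using vs by (auto simp: ws'_def nth_append)
    qed (use vs True in auto)
    moreover have "(\<Sum>p<k. S ((vs @ replicate (k - j) x)[p := ws' p h]))
        = real (k - j) *\<^sub>R S (h # vs @ replicate (k - Suc j) x)" for h
    proof -
      have "S ((vs @ replicate (k - j) x)[p := ws' p h])
          = (if p < j then 0 else S (h # vs @ replicate (k - Suc j) x))" if p: "p < k" for p
      proof (cases "p < j")
        case True
        then show ?thesis using vs \<open>j < k\<close>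
          by (auto simp: ws'_def intro!: multilinear_eq_0[OF S(1)] set_update_memI)
      next
        case False
        have "replicate (k - j) x = x # replicate (k - Suc j) x"
          using True by (metis Suc_diff_Suc replicate_Suc)
        moreover have "mset ((replicate (k - j) x)[q := h]) + {#x#} = add_mset h (mset (replicate (k - j) x))" if "q < k - j" for q
          using that by (simp add: mset_update)
        ultimately have "mset ((replicate (k - j) x)[p - j := h]) = add_mset h (mset (replicate (k - Suc j) x))"
          using p False by (metis add_mset_add_single add_mset_commute add_mset_add_mset_same_iff diff_less_mono linorder_not_less mset.simps(2))
        then have "mset ((vs @ replicate (k - j) x)[p := h]) = mset (h # vs @ replicate (k - Suc j) x)"
          using False vs by (simp add: list_update_append)
        then show ?thesis using False vs True by (auto simp: ws'_def intro!: symmD[OF sy])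
      qed
      then have "(\<Sum>p<k. S ((vs @ replicate (k - j) x)[p := ws' p h]))
          = (\<Sum>p<k. if p < j then 0 else S (h # vs @ replicate (k - Suc j) x))" by (intro sum.cong) auto
      also have "\<dots> = (\<Sum>p\<in>{j..<k}. S (h # vs @ replicate (k - Suc j) x))"
        by (intro sum.mono_neutral_cong_right) auto
      finally show ?thesis by (simp add: sum_constant_scaleR)
    qed
    ultimately have "((\<lambda>y. (1 / fact (k - j)) *\<^sub>R S (vs @ replicate (k - j) y)) has_derivative
        (\<lambda>h. (1 / fact (k - j)) *\<^sub>R real (k - j) *\<^sub>R S (h # vs @ replicate (k - Suc j) x))) (at x)"
      by (intro has_derivative_scaleR_right) simp
    moreover have "(1 / fact (k - j)) * real (k - j) = 1 / fact (k - Suc j)"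
      using True by (simp add: fact_reduce[of "k - j"] field_simps)
    ultimately show ?thesis using True by (simp add: poly_jet_def)
  next
    case False
    then have "(\<lambda>y. poly_jet S k j y vs) = (\<lambda>y. poly_jet S k j 0 vs)" "(\<lambda>h. poly_jet S k (Suc j) x (h # vs)) = (\<lambda>h. 0)"
      by (auto simp: poly_jet_def)
    then show ?thesis by simp
  qed
qed simp

text \<open>The majorant \<open>c\<close> makes the tails of all derivatives up to order
  \<open>r\<close> small in operator norm, uniformly on \<open>V\<close>; this gives termwise
  differentiation and continuity of the sum.\<close>

lemma jet_series:
  fixes D :: "nat \<Rightarrow> nat \<Rightarrow> 'a::real_normed_vector \<Rightarrow> 'a list \<Rightarrow> 'b::banach"
  assumes V: "open V" "convex V" and D: "\<And>n. jet r V (D n)"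
    and b: "\<And>n j x. j \<le> r \<Longrightarrow> x \<in> V \<Longrightarrow> opb j (c n) (D n j x)" and c: "summable c" "\<And>n. 0 \<le> c n"
  shows "jet r V (\<lambda>j x vs. \<Sum>n. D n j x vs)"
    and "\<And>j x vs. j \<le> r \<Longrightarrow> x \<in> V \<Longrightarrow> length vs = j \<Longrightarrow> (\<lambda>n. D n j x vs) sums (\<Sum>n. D n j x vs)"
proof -
  have bs: "norm (D n j x vs) \<le> c n * prod_list (map norm vs)" if "j \<le> r" "x \<in> V" "length vs = j" for j x vs n
    using opbD[OF b[OF that(1,2)] that(3)] .
  have sm: "summable (\<lambda>n. D n j x vs)" if "j \<le> r" "x \<in> V" "length vs = j" for j x vs
    by (rule summable_comparison_test'[OF summable_mult2[OF c(1)]]) (rule bs[OF that])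
  show sums: "(\<lambda>n. D n j x vs) sums (\<Sum>n. D n j x vs)" if "j \<le> r" "x \<in> V" "length vs = j" for j x vs
    using sm[OF that] by (rule summable_sums)
  have tail: "norm ((\<Sum>n. D n j x vs) - (\<Sum>n<m. D n j x vs)) \<le> (suminf c - sum c {..<m}) * prod_list (map norm vs)"
    if "j \<le> r" "x \<in> V" "length vs = j" for j x vs m
  proof -
    have "(\<Sum>n. D n j x vs) - (\<Sum>n<m. D n j x vs) = (\<Sum>n. D (n + m) j x vs)"
      using suminf_minus_initial_segment[OF sm[OF that]] by simp
    also have "norm \<dots> \<le> (\<Sum>n. c (n + m) * prod_list (map norm vs))"
    proof (rule norm_suminf_le)
      show "summable (\<lambda>n. c (n + m) * prod_list (map norm vs))"
        using c(1) by (intro summable_mult2 summable_ignore_initial_segment)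
    qed (rule bs[OF that])
    also have "\<dots> = (\<Sum>n. c (n + m)) * prod_list (map norm vs)"
      using c(1) by (intro suminf_mult2[symmetric] summable_ignore_initial_segment)
    finally show ?thesis using suminf_minus_initial_segment[OF c(1)] by simp
  qed
  have ct: "\<exists>m0. \<forall>m\<ge>m0. suminf c - sum c {..<m} < e" if "0 < e" for e
  proof -
    obtain m0 where "\<And>m. m \<ge> m0 \<Longrightarrow> norm (sum c {..<m} - suminf c) < e"
      using LIMSEQ_D[OF summable_LIMSEQ[OF c(1)] \<open>0 < e\<close>] by blast
    then show ?thesis by (metis abs_minus_commute abs_le_iff le_less_trans order_refl real_norm_def)
  qed
  show "jet r V (\<lambda>j x vs. \<Sum>n. D n j x vs)"
  proof (rule jetI[OF V(1)])
    fix j assume j: "j \<le> r"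
    have "opb j (suminf c) (\<lambda>vs. \<Sum>n. D n j x vs)" if "x \<in> V" for x
      unfolding opb_def using tail[OF j that, of _ 0] by simp
    then show "\<And>x. x \<in> V \<Longrightarrow> \<exists>K. opb j K (\<lambda>vs. \<Sum>n. D n j x vs)" by blast
    show "opcont j V (\<lambda>x vs. \<Sum>n. D n j x vs)"
      unfolding opcont_def
    proof (intro ballI allI impI)
      fix x and e :: real assume x: "x \<in> V" and e: "0 < e"
      obtain m where m: "suminf c - sum c {..<m} < e / 3" using ct[of "e / 3"] e by auto
      have "opcont j V (\<lambda>x vs. \<Sum>n\<leftarrow>[0..<m]. D n j x vs)"
        by (rule opcont_sum_list) (rule jet_opcont[OF D j])
      then have "opcont j V (\<lambda>x vs. \<Sum>n<m. D n j x vs)"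
        by (simp add: interv_sum_list_conv_sum_set_nat atLeast0LessThan)
      from opcontD[OF this x, of "e / 3"] e obtain d where d: "0 < d"
        "\<And>y. y \<in> V \<Longrightarrow> norm (y - x) < d \<Longrightarrow> opb j (e / 3) (\<lambda>vs. (\<Sum>n<m. D n j y vs) - (\<Sum>n<m. D n j x vs))" by auto
      have "opb j e (\<lambda>vs. (\<Sum>n. D n j y vs) - (\<Sum>n. D n j x vs))" if y: "y \<in> V" "norm (y - x) < d" for y
      proof -
        have t: "opb j (e / 3) (\<lambda>vs. (\<Sum>n. D n j z vs) - (\<Sum>n<m. D n j z vs))" if "z \<in> V" for z
        proof (rule opb_mono[OF _ less_imp_le[OF m]])
          show "opb j (suminf c - sum c {..<m}) (\<lambda>vs. (\<Sum>n. D n j z vs) - (\<Sum>n<m. D n j z vs))"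
            using tail[OF j that] by (simp add: opb_def)
        qed
        from opb_diff[OF opb_add[OF t[OF y(1)] d(2)[OF y]] t[OF x]] show ?thesis
          by (simp add: algebra_simps)
      qed
      then show "\<exists>d>0. \<forall>y\<in>V. norm (y - x) < d \<longrightarrow> opb j e (\<lambda>vs. (\<Sum>n. D n j y vs) - (\<Sum>n. D n j x vs))"
        using d(1) by blast
    qed
  next
    fix j x vs assume j: "j < r" and x: "x \<in> V" and vs: "length (vs :: 'a list) = j"
    have "\<exists>g. \<forall>x\<in>V. (\<lambda>n. D n j x vs) sums (g x) \<and> (g has_derivative (\<lambda>h. \<Sum>n. D n (Suc j) x (h # vs))) (at x within V)"
    proof (rule has_derivative_series[OF V(2), where f = "\<lambda>n y. D n j y vs" and f' = "\<lambda>n y h. D n (Suc j) y (h # vs)"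
          and g' = "\<lambda>y h. \<Sum>n. D n (Suc j) y (h # vs)"])
      fix n y assume "y \<in> V"
      then show "((\<lambda>y. D n j y vs) has_derivative (\<lambda>h. D n (Suc j) y (h # vs))) (at y within V)"
        by (rule has_derivative_at_withinI[OF jet_has_derivative[OF D j _ vs]])
    next
      fix e :: real assume e: "0 < e"
      obtain e' where e': "0 < e'" "e' * prod_list (map norm vs) \<le> e"
        using small_multiple[OF e prod_list_norm_nonneg] by blast
      obtain m0 where m0: "\<And>m. m \<ge> m0 \<Longrightarrow> suminf c - sum c {..<m} < e'" using ct[OF e'(1)] by blast
      have "norm ((\<Sum>i<m. D i (Suc j) y (h # vs)) - (\<Sum>n. D n (Suc j) y (h # vs))) \<le> e * norm h"
        if "m \<ge> m0" "y \<in> V" for m y h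
      proof -
        have "norm ((\<Sum>i<m. D i (Suc j) y (h # vs)) - (\<Sum>n. D n (Suc j) y (h # vs)))
            \<le> (suminf c - sum c {..<m}) * (norm h * prod_list (map norm vs))"
          using tail[of "Suc j" y "h # vs" m] j vs that by (simp add: norm_minus_commute)
        also have "\<dots> \<le> e' * (norm h * prod_list (map norm vs))"
          using m0[OF that(1)] by (intro mult_right_mono) auto
        also have "\<dots> = (e' * prod_list (map norm vs)) * norm h" by simp
        also have "\<dots> \<le> e * norm h" using e'(2) by (rule mult_right_mono) simp
        finally show ?thesis .
      qed
      then show "\<forall>\<^sub>F n in sequentially. \<forall>x\<in>V. \<forall>h. norm ((\<Sum>i<n. D i (Suc j) x (h # vs)) - (\<Sum>n. D n (Suc j) x (h # vs))) \<le> e * norm h"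
        unfolding eventually_sequentially by blast
    qed (use x sums[of j x vs] j vs in auto)
    then obtain g where g: "\<And>x. x \<in> V \<Longrightarrow> (\<lambda>n. D n j x vs) sums (g x)"
      "\<And>x. x \<in> V \<Longrightarrow> (g has_derivative (\<lambda>h. \<Sum>n. D n (Suc j) x (h # vs))) (at x within V)" by blast
    have "(g has_derivative (\<lambda>h. \<Sum>n. D n (Suc j) x (h # vs))) (at x)"
      using g(2)[OF x] at_within_open[OF x V(1)] by simp
    then show "((\<lambda>y. \<Sum>n. D n j y vs) has_derivative (\<lambda>h. \<Sum>n. D n (Suc j) x (h # vs))) (at x)"
      by (rule has_derivative_transform_within_open[OF _ V(1) x]) (auto dest: g(1) simp: sums_iff)
  qed
qed

section \<open>Bounds in weighted norms\<close>

lemma concat_map_if: "concat (map (\<lambda>x. if P x then [f x] else []) xs) = map f (filter P xs)"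
  by (induction xs) auto

text \<open>A partition into \<open>j\<close> blocks arises only when every variable opened a block
  of its own. It singles out the term of the composition formula with the highest derivative of the
  outer map.\<close>

lemma parts_full: "filter (\<lambda>\<pi>. length \<pi> = j) (parts j) = [map (\<lambda>q. [q]) [0..<j]]"
proof (induction j)
  case (Suc j)
  let ?s = "\<lambda>\<sigma>. [0] # map (map Suc) \<sigma>"
  have "filter (\<lambda>\<pi>. length \<pi> = Suc j) (parts (Suc j)) =
      concat (map (\<lambda>\<sigma>. if length \<sigma> = j then [?s \<sigma>] else []) (parts j))"
    unfolding parts.simps filter_concat map_map
  proof (intro arg_cong[of _ _ concat] map_cong refl)
    fix \<sigma> assume "\<sigma> \<in> set (parts j)"
    then have "length \<sigma> \<le> j" by (rule parts_length)
    then show "(filter (\<lambda>\<pi>. length \<pi> = Suc j) \<circ> (\<lambda>\<pi>. let \<rho> = map (map Suc) \<pi> in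
        ([0] # \<rho>) # map (\<lambda>b. \<rho>[b := 0 # \<rho> ! b]) [0..<length \<rho>])) \<sigma> = (if length \<sigma> = j then [?s \<sigma>] else [])"
      by (auto simp: Let_def filter_empty_conv)
  qed
  also have "\<dots> = map ?s (filter (\<lambda>\<pi>. length \<pi> = j) (parts j))"
    by (rule concat_map_if)
  also have "\<dots> = [map (\<lambda>q. [q]) (0 # map Suc [0..<j])]"
    unfolding Suc.IH by (simp add: comp_def)
  also have "0 # map Suc [0..<j] = [0..<Suc j]" by (simp add: map_Suc_upt upt_conv_Cons del: upt_Suc)
  finally show ?case .
qed simp

lemma sum_list_filter_split:
  "(\<Sum>x\<leftarrow>xs. f x) = (\<Sum>x\<leftarrow>filter P xs. f x) + (\<Sum>x\<leftarrow>filter (\<lambda>x. \<not> P x) xs. f x)"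
  for f :: "'a \<Rightarrow> 'b::comm_monoid_add"
  by (induction xs) (auto simp: algebra_simps)

text \<open>Separates the leading term from those that contain only derivatives of \<open>G\<close>
  of order below \<open>j\<close>.\<close>

lemma cmp_split:
  assumes "length vs = j"
  shows "cmp G F j x vs = G j (F 0 x []) (map (\<lambda>v. F 1 x [v]) vs) +
    (\<Sum>\<pi>\<leftarrow>filter (\<lambda>\<pi>. length \<pi> \<noteq> j) (parts j). G (length \<pi>) (F 0 x []) (blocks F x vs \<pi>))"
proof -
  have "map (\<lambda>q. F (Suc 0) x [vs ! q]) [0..<j] = map (\<lambda>v. F (Suc 0) x [v]) vs"
    using assms by (metis (no_types, lifting) map_map comp_def map_nth map_cong)
  then have "blocks F x vs (map (\<lambda>q. [q]) [0..<j]) = map (\<lambda>v. F 1 x [v]) vs"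
    by (simp add: blocks_def comp_def)
  then show ?thesis
    unfolding cmp_def by (subst sum_list_filter_split[of _ _ "\<lambda>\<pi>. length \<pi> = j"]) (simp add: parts_full)
qed

text \<open>The estimates use only that the weights are positive and that the constant weight is
  among them. The decay inequalities enter solely in the translation to and from the norms of the
  statement.\<close>

locale weights =
  fixes N :: "real^'n::finite \<Rightarrow> real" and W :: "(int^'m::finite \<Rightarrow> real) set"
  assumes N: "is_norm N" and one_W: "(\<lambda>_. 1) \<in> W" and W_pos: "\<And>\<omega> i. \<omega> \<in> W \<Longrightarrow> 0 < \<omega> i"
begin

lemma W_nonneg: "\<omega> \<in> W \<Longrightarrow> 0 \<le> \<omega> i" using W_pos less_imp_le by blast

abbreviation one :: "int^'m \<Rightarrow> real" where "one \<equiv> \<lambda>_. 1"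

text \<open>Comparison constants with the Euclidean norm, chosen once so that all bounds can refer
  to the same \<open>lo\<close> and \<open>hi\<close>.\<close>

definition norm_consts :: "real \<times> real" where
  "norm_consts = (SOME p. 0 < fst p \<and> 0 < snd p \<and> (\<forall>x. fst p * norm x \<le> N x) \<and> (\<forall>x. N x \<le> snd p * norm x))"

definition lo :: real where "lo = fst norm_consts"
definition hi :: real where "hi = snd norm_consts"

lemma lo_hi: "0 < lo" "0 < hi" "lo * norm x \<le> N x" "N x \<le> hi * norm x"
proof -
  obtain c C where "0 < c" "0 < C" "\<And>x. c * norm x \<le> N x" "\<And>x. N x \<le> C * norm x"
    using is_norm_equivalent[OF N] by blast
  then have "\<exists>p. 0 < fst p \<and> 0 < snd p \<and> (\<forall>x. fst p * norm x \<le> N x) \<and> (\<forall>x. N x \<le> snd p * norm x)"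
    by (intro exI[of _ "(c, C)"]) simp
  from someI_ex[OF this] show "0 < lo" "0 < hi" "lo * norm x \<le> N x" "N x \<le> hi * norm x"
    by (auto simp: lo_def hi_def norm_consts_def)
qed

lemma N_nonneg [simp]: "0 \<le> N x" and N_0 [simp]: "N 0 = 0" and N_scale: "N (c *\<^sub>R x) = \<bar>c\<bar> * N x"
  and N_triangle: "N (x + y) \<le> N x + N y" and N_eq_0: "N x = 0 \<longleftrightarrow> x = 0"
  using N by (auto simp: is_norm_def)

lemma N_continuous: "continuous_on UNIV N"
proof -
  have diff: "\<bar>N x - N y\<bar> \<le> N (x - y)" for x y
    using N_triangle[of "x - y" y] N_triangle[of "y - x" x] N_scale[of "-1" "x - y"] by simp
  have "hi-lipschitz_on UNIV N"
    using lo_hi order_trans[OF diff lo_hi(4)] by (intro lipschitz_onI) (auto simp: dist_real_def dist_norm)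
  then show ?thesis by (rule lipschitz_on_continuous_on)
qed

text \<open>The weighted sup norm of \<open>x\<close> is at most \<open>c\<close>. A predicate
  rather than a norm, since for a decaying weight that norm may be infinite.\<close>

definition wb :: "(int^'m \<Rightarrow> real) \<Rightarrow> real \<Rightarrow> ('m, 'n) linf \<Rightarrow> bool" where
  "wb \<omega> c x \<longleftrightarrow> (\<forall>i. N (apply_bcontfun x i) \<le> c * \<omega> i)"

lemma norm_apply_le_wb: "wb \<omega> c x \<Longrightarrow> norm (apply_bcontfun x i) \<le> c * \<omega> i / lo"
  unfolding pos_le_divide_eq[OF lo_hi(1)] mult.commute[of "norm _" lo] wb_def
  by (rule order_trans[OF lo_hi(3)]) (erule spec)

lemma wb_add: "wb \<omega> c x \<Longrightarrow> wb \<omega> d y \<Longrightarrow> wb \<omega> (c + d) (x + y)"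
  unfolding wb_def by (auto simp: distrib_right intro: order_trans[OF N_triangle add_mono])

lemma wb_scale: "wb \<omega> c x \<Longrightarrow> wb \<omega> (\<bar>s\<bar> * c) (s *\<^sub>R x)"
  unfolding wb_def by (auto simp: N_scale mult.assoc intro: mult_left_mono)

lemma wb_uminus: "wb \<omega> c x \<Longrightarrow> wb \<omega> c (- x)"
  using wb_scale[of \<omega> c x "-1"] by simp

lemma wb_mono: "\<omega> \<in> W \<Longrightarrow> wb \<omega> c x \<Longrightarrow> c \<le> d \<Longrightarrow> wb \<omega> d x"
  unfolding wb_def by (meson W_nonneg mult_right_mono order_trans)

lemma wb_zero: "\<omega> \<in> W \<Longrightarrow> 0 \<le> c \<Longrightarrow> wb \<omega> c 0"
  unfolding wb_def by (simp add: W_nonneg)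

lemma wb_one_nonneg: "wb one c x \<Longrightarrow> 0 \<le> c"
  unfolding wb_def mult_1_right by (rule order_trans[OF N_nonneg]) (erule spec)

lemma wb_sum: "\<omega> \<in> W \<Longrightarrow> (\<And>s. s \<in> S \<Longrightarrow> wb \<omega> (c s) (f s)) \<Longrightarrow> wb \<omega> (\<Sum>s\<in>S. c s) (\<Sum>s\<in>S. f s)"
  by (induction S rule: infinite_finite_induct) (auto intro: wb_zero wb_add)

lemma bounded_linear_component: "bounded_linear (\<lambda>x :: ('m, 'n) linf. apply_bcontfun x i)"
  by (rule bounded_linear_intro[where K = 1]) (auto simp: norm_bounded)

lemmas tendsto_component = bounded_linear.tendsto[OF bounded_linear_component]

lemma wb_limit:
  assumes "\<And>k. wb \<omega> (c k) (f k)" "c \<longlonglongrightarrow> d" "f \<longlonglongrightarrow> l" shows "wb \<omega> d l"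
  unfolding wb_def
proof
  fix i
  have "(\<lambda>k. N (apply_bcontfun (f k) i)) \<longlonglongrightarrow> N (apply_bcontfun l i)"
    using N_continuous tendsto_component[OF assms(3)]
    by (auto intro: continuous_on_tendsto_compose[where s = UNIV])
  moreover have "(\<lambda>k. c k * \<omega> i) \<longlonglongrightarrow> d * \<omega> i" by (intro tendsto_intros assms(2))
  ultimately show "N (apply_bcontfun l i) \<le> d * \<omega> i"
    using assms(1) by (intro LIMSEQ_le) (auto simp: wb_def)
qed

lemma wb_series:
  assumes "\<omega> \<in> W" "\<And>k. wb \<omega> (c k) (f k)" "summable c" "f sums l" shows "wb \<omega> (suminf c) l"
  by (rule wb_limit[OF wb_sum[OF assms(1,2)] summable_LIMSEQ[OF assms(3)] assms(4)[unfolded sums_def]])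

abbreviation nm :: "('m, 'n) linf \<Rightarrow> real" where "nm \<equiv> linf_norm N"

lemma bdd_N: "bdd_above (range (\<lambda>i. N (apply_bcontfun x i)))"
  using order_trans[OF lo_hi(4) mult_left_mono[OF norm_bounded]] lo_hi(2) by (auto intro!: bdd_aboveI2)

lemma nm_le_iff: "nm x \<le> c \<longleftrightarrow> wb one c x"
proof
  assume a: "nm x \<le> c"
  have "N (apply_bcontfun x i) \<le> nm x" for i
    unfolding linf_norm_def by (rule cSUP_upper[OF UNIV_I bdd_N])
  then show "wb one c x" using a order_trans unfolding wb_def mult_1_right by blast
next
  assume "wb one c x"
  then show "nm x \<le> c" unfolding linf_norm_def wb_def mult_1_right by (intro cSUP_least) auto
qed

lemma wb_nm: "wb one (nm x) x" by (rule nm_le_iff[THEN iffD1, OF order_refl])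

lemma nm_nonneg [simp]: "0 \<le> nm x" using wb_one_nonneg[OF wb_nm] .

lemma nm_scale_le: "nm (s *\<^sub>R x) \<le> \<bar>s\<bar> * nm x"
  unfolding nm_le_iff by (rule wb_scale[OF wb_nm])

lemma nm_triangle: "nm (x + y) \<le> nm x + nm y"
  unfolding nm_le_iff by (rule wb_add[OF wb_nm wb_nm])

lemma nm_0 [simp]: "nm 0 = 0"
  using nm_nonneg[of 0] nm_le_iff[of 0 0] wb_zero[OF one_W order_refl] by linarith

lemma wb_norm: "wb one (hi * norm x) x"
  unfolding wb_def mult_1_right
  by (intro allI order_trans[OF lo_hi(4) mult_left_mono[OF norm_bounded]] less_imp_le lo_hi(2))

lemma nm_le_norm: "nm x \<le> hi * norm x" by (rule nm_le_iff[THEN iffD2, OF wb_norm])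

lemma norm_le_wb: "wb one c x \<Longrightarrow> lo * norm x \<le> c"
proof -
  assume a: "wb one c x"
  have "norm (apply_bcontfun x i) \<le> c / lo" for i
    using norm_apply_le_wb[OF a] by simp
  from norm_bound[OF this] show ?thesis using lo_hi(1) by (simp add: field_simps)
qed

lemma norm_le_nm: "lo * norm x \<le> nm x" by (rule norm_le_wb[OF wb_nm])

lemma open_nm_ball: "open {x. nm x < \<rho>}"
proof (rule openI)
  fix x assume "x \<in> {x. nm x < \<rho>}"
  then have x: "nm x < \<rho>" by simp
  have "y \<in> {x. nm x < \<rho>}" if "y \<in> ball x ((\<rho> - nm x) / hi)" for y
  proof -
    have "nm y \<le> nm x + nm (y - x)" using nm_triangle[of x "y - x"] by simp
    also have "\<dots> \<le> nm x + hi * norm (y - x)" using nm_le_norm by simp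
    also have "\<dots> < \<rho>"
      using that lo_hi(2) by (simp add: dist_norm norm_minus_commute pos_less_divide_eq mult.commute)
    finally show ?thesis by simp
  qed
  then show "\<exists>e>0. ball x e \<subseteq> {x. nm x < \<rho>}"
    using x lo_hi(2) by (intro exI[of _ "(\<rho> - nm x) / hi"]) auto
qed

lemma convex_nm_ball: "convex {x. nm x < \<rho>}"
proof (rule convexI)
  fix x y :: "('m, 'n) linf" and u v :: real
  assume x: "x \<in> {x. nm x < \<rho>}" and y: "y \<in> {x. nm x < \<rho>}" and uv: "0 \<le> u" "0 \<le> v" "u + v = 1"
  have "nm (u *\<^sub>R x + v *\<^sub>R y) \<le> u * nm x + v * nm y"
    using nm_triangle[of "u *\<^sub>R x" "v *\<^sub>R y"] nm_scale_le[of u x] nm_scale_le[of v y] uv by simp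
  also have "\<dots> < \<rho>" using x y uv by (simp add: convex_bound_lt)
  finally show "u *\<^sub>R x + v *\<^sub>R y \<in> {x. nm x < \<rho>}" by simp
qed

text \<open>The price of passing from \<open>N\<close> to the Euclidean norm and back in the mean
  value inequality.\<close>

definition C0 :: real where "C0 = hi / lo"

lemma C0_pos: "0 < C0" using lo_hi by (simp add: C0_def)

text \<open>A weighted norm need not be controlled by the topology of the space, so the mean value
  inequality is applied in each component separately.\<close>

lemma wb_mvt:
  assumes \<omega>: "\<omega> \<in> W"
    and d: "\<And>t. t \<in> {0..1} \<Longrightarrow> (f has_vector_derivative f' t) (at t within {0..1})"
    and b: "\<And>t. t \<in> {0..1} \<Longrightarrow> wb \<omega> c (f' t)"
  shows "wb \<omega> (C0 * c) (f 1 - f 0)"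
  unfolding wb_def
proof
  fix i
  have "norm (apply_bcontfun (f 1) i - apply_bcontfun (f 0) i) \<le> c * \<omega> i / lo"
  proof (rule mvt_norm_bound)
    fix t :: real assume t: "t \<in> {0..1}"
    show "((\<lambda>t. apply_bcontfun (f t) i) has_vector_derivative apply_bcontfun (f' t) i) (at t within {0..1})"
      by (rule bounded_linear.has_vector_derivative[OF bounded_linear_component d[OF t]])
    show "norm (apply_bcontfun (f' t) i) \<le> c * \<omega> i / lo"
      by (rule norm_apply_le_wb[OF b[OF t]])
  qed
  then have "hi * norm (apply_bcontfun (f 1 - f 0) i) \<le> hi * (c * \<omega> i / lo)"
    using lo_hi(2) by (intro mult_left_mono) auto
  then show "N (apply_bcontfun (f 1 - f 0) i) \<le> C0 * c * \<omega> i"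
    using order_trans[OF lo_hi(4)] by (simp add: C0_def mult_ac)
qed

text \<open>\<open>pf \<omega> cs vs\<close>: one argument is measured in the weight \<open>\<omega>\<close>, all others in the sup norm. With
  \<open>\<omega> = \<Gamma> (\<cdot> - l)\<close> a bound \<open>mlb\<close> for all these \<open>\<omega>\<close> is equivalent to finiteness of \<open>\<gamma>\<close>, and it is
  visibly stable under composition.\<close>

definition pf :: "(int^'m \<Rightarrow> real) \<Rightarrow> real list \<Rightarrow> ('m, 'n) linf list \<Rightarrow> bool" where
  "pf \<omega> cs vs \<longleftrightarrow> length cs = length vs \<and>
     ((\<omega> = one \<and> (\<forall>q<length vs. wb one (cs ! q) (vs ! q))) \<or>
      (\<exists>p<length vs. wb \<omega> (cs ! p) (vs ! p) \<and> (\<forall>q<length vs. q \<noteq> p \<longrightarrow> wb one (cs ! q) (vs ! q))))"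

text \<open>For \<open>j = 0\<close> only the constant weight admits a \<open>pf\<close>, so the
  condition is then a plain sup bound on the value, as it must be: the values of the maps carry no
  decay.\<close>

definition mlb :: "nat \<Rightarrow> real \<Rightarrow> (('m, 'n) linf list \<Rightarrow> ('m, 'n) linf) \<Rightarrow> bool" where
  "mlb j K A \<longleftrightarrow> (\<forall>\<omega>\<in>W. \<forall>cs vs. length vs = j \<longrightarrow> pf \<omega> cs vs \<longrightarrow> wb \<omega> (K * prod_list cs) (A vs))"

lemma mlbD: "mlb j K A \<Longrightarrow> \<omega> \<in> W \<Longrightarrow> length vs = j \<Longrightarrow> pf \<omega> cs vs \<Longrightarrow> wb \<omega> (K * prod_list cs) (A vs)"
  unfolding mlb_def by blast

lemma pf_one: "length cs = length vs \<Longrightarrow> (\<And>q. q < length vs \<Longrightarrow> wb one (cs ! q) (vs ! q)) \<Longrightarrow> pf one cs vs"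
  unfolding pf_def by blast

lemma wb_nonneg: assumes "\<omega> \<in> W" "wb \<omega> c x" shows "0 \<le> c"
proof -
  have "0 \<le> c * \<omega> undefined" using assms(2) N_nonneg order_trans unfolding wb_def by blast
  then show ?thesis using W_pos[OF assms(1)] by (metis linorder_not_le mult_neg_pos)
qed

lemma mlb_opb:
  assumes "mlb j K A" shows "opb j (K * hi ^ j / lo) A"
  unfolding opb_def
proof (intro allI impI)
  fix vs :: "('m, 'n) linf list" assume vs: "length vs = j"
  have "pf one (map (\<lambda>v. hi * norm v) vs) vs" by (rule pf_one) (simp_all add: wb_norm)
  from mlbD[OF assms one_W vs this]
  have "lo * norm (A vs) \<le> K * prod_list (map (\<lambda>v. hi * norm v) vs)" by (rule norm_le_wb)
  also have "prod_list (map (\<lambda>v. hi * norm v) vs) = hi ^ length vs * prod_list (map norm vs)"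
    by (induction vs) auto
  finally show "norm (A vs) \<le> K * hi ^ j / lo * prod_list (map norm vs)"
    using vs lo_hi(1) by (simp add: field_simps)
qed

lemma mlb_add: "mlb j K A \<Longrightarrow> mlb j L B \<Longrightarrow> mlb j (K + L) (\<lambda>vs. A vs + B vs)"
  unfolding mlb_def by (auto simp: distrib_right intro!: wb_add)

lemma mlb_uminus: "mlb j K A \<Longrightarrow> mlb j K (\<lambda>vs. - A vs)"
  unfolding mlb_def by (auto intro!: wb_uminus)

lemma mlb_diff: "mlb j K A \<Longrightarrow> mlb j L B \<Longrightarrow> mlb j (K + L) (\<lambda>vs. A vs - B vs)"
  using mlb_add[of j K A L "\<lambda>vs. - B vs"] mlb_uminus by simp

lemma mlb_scale: "mlb j K A \<Longrightarrow> mlb j (\<bar>s\<bar> * K) (\<lambda>vs. s *\<^sub>R A vs)"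
  unfolding mlb_def by (auto simp: mult.assoc intro!: wb_scale)

lemma mlb_sum_list: "(\<And>s. s \<in> set S \<Longrightarrow> mlb j (K s) (A s)) \<Longrightarrow> mlb j (\<Sum>s\<leftarrow>S. K s) (\<lambda>vs. \<Sum>s\<leftarrow>S. A s vs)"
proof (induction S)
  case (Cons s S)
  then show ?case using mlb_add[of j "K s" "A s"] by simp
qed (simp add: mlb_def wb_zero)

lemma mlb_sum: "(\<And>s. s \<in> S \<Longrightarrow> mlb j (K s) (A s)) \<Longrightarrow> mlb j (\<Sum>s\<in>S. K s) (\<lambda>vs. \<Sum>s\<in>S. A s vs)"
proof (induction S rule: infinite_finite_induct)
  case (insert s S)
  then show ?case using mlb_add[of j "K s" "A s"] by simp
qed (simp_all add: mlb_def wb_zero)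

lemma mlb_zero: "mlb j 0 (\<lambda>_. 0)"
  by (simp add: mlb_def wb_zero)

lemma mlb_cong: "mlb j K A \<Longrightarrow> (\<And>vs. length vs = j \<Longrightarrow> A vs = B vs) \<Longrightarrow> mlb j K B"
  unfolding mlb_def by auto

lemma prod_list_pf_nonneg:
  assumes "\<omega> \<in> W" "pf \<omega> cs vs" shows "0 \<le> prod_list cs"
proof (rule prod_list_nonneg_real)
  fix c assume "c \<in> set cs"
  then obtain q where q: "q < length vs" "c = cs ! q" using assms(2) by (auto simp: in_set_conv_nth pf_def)
  then have "wb one c (vs ! q) \<or> wb \<omega> c (vs ! q)" using assms(2) by (auto simp: pf_def)
  then show "0 \<le> c" using wb_one_nonneg wb_nonneg[OF assms(1)] by blast
qed

lemma mlb_mono: "mlb j K A \<Longrightarrow> K \<le> L \<Longrightarrow> mlb j L A"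
  unfolding mlb_def by (blast intro: wb_mono mult_right_mono prod_list_pf_nonneg)

lemma pf_Cons: "wb one c x \<Longrightarrow> pf \<omega> cs vs \<Longrightarrow> pf \<omega> (c # cs) (x # vs)"
  unfolding pf_def by (auto simp: nth_Cons' less_Suc_eq_0_disj intro: exI[of _ "Suc _"])

text \<open>The linear case: one constant for every weighted norm at once. Such constants multiply
  under composition.\<close>

definition lb :: "real \<Rightarrow> (('m, 'n) linf \<Rightarrow> ('m, 'n) linf) \<Rightarrow> bool" where
  "lb K L \<longleftrightarrow> (\<forall>\<omega>\<in>W. \<forall>c x. wb \<omega> c x \<longrightarrow> wb \<omega> (K * c) (L x))"

lemma lbD: "lb K L \<Longrightarrow> \<omega> \<in> W \<Longrightarrow> wb \<omega> c x \<Longrightarrow> wb \<omega> (K * c) (L x)"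
  unfolding lb_def by blast

lemma mlb_1_iff: "mlb 1 K A \<longleftrightarrow> lb K (\<lambda>v. A [v])"
proof
  assume A: "mlb 1 K A"
  show "lb K (\<lambda>v. A [v])" unfolding lb_def
  proof (intro ballI allI impI)
    fix \<omega> c x assume "\<omega> \<in> W" "wb \<omega> c x"
    then show "wb \<omega> (K * c) (A [x])" using mlbD[OF A, of \<omega> "[x]" "[c]"] by (auto simp: pf_def)
  qed
next
  assume A: "lb K (\<lambda>v. A [v])"
  show "mlb 1 K A" unfolding mlb_def
  proof (intro ballI allI impI)
    fix \<omega> cs and vs :: "('m, 'n) linf list" assume \<omega>: "\<omega> \<in> W" and l: "length vs = 1" and p: "pf \<omega> cs vs"
    obtain v where v: "vs = [v]" using l by (auto simp: length_Suc_conv)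
    have "length cs = 1" using p l by (simp add: pf_def)
    then obtain c where c: "cs = [c]" by (auto simp: length_Suc_conv)
    have "wb \<omega> c v" using p by (auto simp: pf_def v c)
    then show "wb \<omega> (K * prod_list cs) (A vs)" using lbD[OF A \<omega>] by (simp add: v c)
  qed
qed

lemma mlb_compose: "lb L T \<Longrightarrow> mlb j K A \<Longrightarrow> mlb j (L * K) (\<lambda>vs. T (A vs))"
  unfolding mlb_def lb_def by (auto simp: mult.assoc)

lemma lb_nm: "lb K L \<Longrightarrow> nm (L x) \<le> K * nm x"
  unfolding nm_le_iff by (rule lbD[OF _ one_W wb_nm])

lemma lb_mono: "lb K L \<Longrightarrow> K \<le> K' \<Longrightarrow> lb K' L"
  unfolding lb_def by (blast intro: wb_mono mult_right_mono wb_nonneg)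

lemma lb_add: "lb K L \<Longrightarrow> lb K' L' \<Longrightarrow> lb (K + K') (\<lambda>x. L x + L' x)"
  unfolding lb_def by (auto simp: distrib_right intro: wb_add)

lemma lb_bounded_linear: assumes "linear L" "lb K L" shows "bounded_linear L"
proof (rule bounded_linear_intro)
  show "norm (L x) \<le> norm x * (K * hi / lo)" for x
  proof -
    have "lo * norm (L x) \<le> K * (hi * norm x)"
      by (rule norm_le_wb[OF lbD[OF assms(2) one_W wb_norm]])
    then show ?thesis using lo_hi(1) by (simp add: field_simps)
  qed
qed (use assms(1) in \<open>auto simp: linear_add linear_scale\<close>)

text \<open>The argument measured in \<open>\<omega>\<close> either belongs to the sublist or not;
  in the second case only plain bounds are left.\<close>

lemma pf_sub:
  assumes pf: "pf \<omega> cs vs" and S: "distinct S" "set S \<subseteq> {..<length vs}"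
  shows "pf \<omega> (map ((!) cs) S) (map ((!) vs) S) \<or> pf one (map ((!) cs) S) (map ((!) vs) S)"
proof (cases "\<forall>q\<in>set S. wb one (cs ! q) (vs ! q)")
  case True
  then have "pf one (map ((!) cs) S) (map ((!) vs) S)" by (intro pf_one) auto
  then show ?thesis by blast
next
  case False
  then obtain q where q: "q \<in> set S" "\<not> wb one (cs ! q) (vs ! q)" by blast
  then have "q < length vs" using S(2) by auto
  with pf q(2) have p: "wb \<omega> (cs ! q) (vs ! q)" "\<And>q'. q' < length vs \<Longrightarrow> q' \<noteq> q \<Longrightarrow> wb one (cs ! q') (vs ! q')"
    unfolding pf_def by metis+
  obtain t where t: "t < length S" "S ! t = q" using q(1) by (auto simp: in_set_conv_nth)
  have "S ! t' < length vs" if "t' < length S" for t' using S(2) that nth_mem by blast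
  moreover have "S ! t' \<noteq> q" if "t' < length S" "t' \<noteq> t" for t' using S(1) t that nth_eq_iff_index_eq by metis
  ultimately have "pf \<omega> (map ((!) cs) S) (map ((!) vs) S)"
    unfolding pf_def using p t by (intro conjI disjI2 exI[of _ t]) auto
  then show ?thesis by blast
qed

text \<open>Blocks are disjoint, so only one of them contains the weighted argument. Its value is
  measured in \<open>\<omega>\<close>, those of the other blocks in the sup norm, and the list of
  values is again of the required kind. This is why the bounds survive composition.\<close>

lemma pf_blocks:
  assumes \<pi>: "\<pi> \<in> set (parts j)" and \<omega>: "\<omega> \<in> W" and vs: "length vs = j" and pf: "pf \<omega> cs vs"
    and F: "\<And>S. S \<in> set \<pi> \<Longrightarrow> mlb (length S) (\<kappa> (length S)) (F (length S) x)"
  shows "pf \<omega> (map (\<lambda>S. \<kappa> (length S) * prod_list (map ((!) cs) S)) \<pi>) (blocks F x vs \<pi>)"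
proof -
  let ?c = "\<lambda>S. \<kappa> (length S) * prod_list (map ((!) cs) S)"
  let ?v = "\<lambda>S. F (length S) x (map ((!) vs) S)"
  have dS: "distinct S" "set S \<subseteq> {..<length vs}" if "S \<in> set \<pi>" for S
    using parts_distinct[OF \<pi>] parts_block(3)[OF \<pi> that] that vs by (auto simp: distinct_concat_iff)
  have one: "wb one (?c S) (?v S)" if "S \<in> set \<pi>" "pf one (map ((!) cs) S) (map ((!) vs) S)" for S
    using mlbD[OF F[OF that(1)] one_W _ that(2)] by simp
  have om: "wb \<omega> (?c S) (?v S)" if "S \<in> set \<pi>" "pf \<omega> (map ((!) cs) S) (map ((!) vs) S)" for S
    using mlbD[OF F[OF that(1)] \<omega> _ that(2)] by simp
  show ?thesis
  proof (cases "\<forall>S\<in>set \<pi>. pf one (map ((!) cs) S) (map ((!) vs) S)")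
    case True
    show ?thesis
    proof (cases "\<omega> = one")
      case om1: True
      show ?thesis unfolding om1 using one True by (intro pf_one) (auto simp: blocks_def)
    next
      case False
      \<comment> \<open>Even if plain bounds happen to hold in every block, one block has to be
        measured in \<open>\<omega>\<close>; it is the one containing the weighted index
        \<open>p\<close>.\<close>
      then obtain p where p: "p < j" "wb \<omega> (cs ! p) (vs ! p)" "\<And>q. q < j \<Longrightarrow> q \<noteq> p \<Longrightarrow> wb one (cs ! q) (vs ! q)"
        using pf vs by (auto simp: pf_def)
      obtain S where S: "S \<in> set \<pi>" "p \<in> set S" using parts_set[OF \<pi>] p(1) by auto
      obtain t where t: "t < length S" "S ! t = p" using S(2) by (auto simp: in_set_conv_nth)
      have "S ! t' < j" if "t' < length S" for t' using dS(2)[OF S(1)] vs that nth_mem by blast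
      moreover have "S ! t' \<noteq> p" if "t' < length S" "t' \<noteq> t" for t'
        using dS(1)[OF S(1)] t that nth_eq_iff_index_eq by metis
      ultimately have "pf \<omega> (map ((!) cs) S) (map ((!) vs) S)"
        unfolding pf_def using p t by (intro conjI disjI2 exI[of _ t]) auto
      from om[OF S(1) this] have 1: "wb \<omega> (?c S) (?v S)" .
      obtain b where b: "b < length \<pi>" "\<pi> ! b = S" using S(1) by (auto simp: in_set_conv_nth)
      show ?thesis unfolding pf_def
        using b 1 one True by (intro conjI disjI2 exI[of _ b]) (auto simp: blocks_def)
    qed
  next
    case False
    then obtain S where S: "S \<in> set \<pi>" "\<not> pf one (map ((!) cs) S) (map ((!) vs) S)" by blast
    then have 1: "wb \<omega> (?c S) (?v S)" using pf_sub[OF pf dS[OF S(1)]] om by blast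
    obtain b where b: "b < length \<pi>" "\<pi> ! b = S" using S(1) by (auto simp: in_set_conv_nth)
    have "\<exists>t<length S. \<not> wb one (cs ! (S ! t)) (vs ! (S ! t))"
      using S(2) pf_one[of "map ((!) cs) S" "map ((!) vs) S"] by auto
    then obtain q where q: "q \<in> set S" "\<not> wb one (cs ! q) (vs ! q)" using nth_mem by blast
    then have q': "q < length vs" using dS(2)[OF S(1)] by auto
    have h1: "pf one (map ((!) cs) S') (map ((!) vs) S')" if S': "S' \<in> set \<pi>" "S' \<noteq> S" for S'
    proof (rule pf_one)
      fix t assume "t < length (map ((!) vs) S')"
      then have t: "S' ! t \<in> set S'" "t < length S'" by auto
      have "set S \<inter> set S' = {}" using parts_distinct[OF \<pi>] S(1) S' by (auto simp: distinct_concat_iff)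
      then have "S' ! t \<noteq> q" "S' ! t < length vs" using q(1) t(1) dS(2)[OF S'(1)] by auto
      then have "wb one (cs ! (S' ! t)) (vs ! (S' ! t))"
        using pf q(2) q' unfolding pf_def by metis
      then show "wb one (map ((!) cs) S' ! t) (map ((!) vs) S' ! t)" using t(2) by simp
    qed simp
    have h2: "\<pi> ! b' \<noteq> S" if "b' < length \<pi>" "b' \<noteq> b" for b'
    proof -
      have "distinct \<pi>" using parts_distinct[OF \<pi>] parts_nonempty[OF \<pi>]
        by (simp add: distinct_concat_iff removeAll_id)
      then show ?thesis using b that nth_eq_iff_index_eq by metis
    qed
    have "wb one (?c (\<pi> ! b')) (?v (\<pi> ! b'))" if "b' < length \<pi>" "b' \<noteq> b" for b'
      by (rule one[OF nth_mem[OF that(1)] h1[OF nth_mem[OF that(1)] h2[OF that]]])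
    then show ?thesis unfolding pf_def
      using b 1 by (intro conjI disjI2 exI[of _ b]) (auto simp: blocks_def)
  qed
qed

lemma mlb_blocks:
  assumes \<pi>: "\<pi> \<in> set (parts j)" and G: "mlb (length \<pi>) K G"
    and F: "\<And>S. S \<in> set \<pi> \<Longrightarrow> mlb (length S) (\<kappa> (length S)) (F (length S) x)"
  shows "mlb j (K * prod_list (map (\<lambda>S. \<kappa> (length S)) \<pi>)) (\<lambda>vs. G (blocks F x vs \<pi>))"
  unfolding mlb_def
proof (intro ballI allI impI)
  fix \<omega> cs and vs :: "('m, 'n) linf list" assume \<omega>: "\<omega> \<in> W" and vs: "length vs = j" and pf: "pf \<omega> cs vs"
  have pfb: "pf \<omega> (map (\<lambda>S. \<kappa> (length S) * prod_list (map ((!) cs) S)) \<pi>) (blocks F x vs \<pi>)"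
    by (rule pf_blocks[OF \<pi> \<omega> vs pf]) (rule F)
  have "prod_list (map (\<lambda>S. \<kappa> (length S) * f S) \<pi>) = prod_list (map (\<lambda>S. \<kappa> (length S)) \<pi>) * prod_list (map (\<lambda>S. 1 * f S) \<pi>)"
    for f :: "nat list \<Rightarrow> real"
    by (induction \<pi>) auto
  moreover have "length cs = j" using pf vs by (simp add: pf_def)
  ultimately have "prod_list (map (\<lambda>S. \<kappa> (length S) * prod_list (map ((!) cs) S)) \<pi>)
      = prod_list (map (\<lambda>S. \<kappa> (length S)) \<pi>) * prod_list cs"
    using prod_list_blocks[OF \<pi>, of cs 1] by simp
  then show "wb \<omega> (K * prod_list (map (\<lambda>S. \<kappa> (length S)) \<pi>) * prod_list cs) (G (blocks F x vs \<pi>))"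
    using mlbD[OF G \<omega> _ pfb] by (simp add: mult.assoc)
qed

end

text \<open>The library makes bounded continuous functions complete only over metric spaces.\<close>

instantiation int :: metric_space
begin

definition dist_int :: "int \<Rightarrow> int \<Rightarrow> real" where
  "dist_int x y = real_of_int \<bar>x - y\<bar>"

definition uniformity_int :: "(int \<times> int) filter" where
  "uniformity_int = (INF e\<in>{0 <..}. principal {(x, y). dist x y < e})"

instance
proof
  fix U :: "int set"
  have "\<forall>\<^sub>F (x', y) in uniformity. x' = x \<longrightarrow> y \<in> U" if "x \<in> U" for x
  proof -
    have "y = x" if "dist x y < 1" for x y :: int
    proof -
      have "\<bar>x - y\<bar> < 1" using that unfolding dist_int_def by (metis of_int_1 of_int_less_iff)
      then show ?thesis by simp
    qed
    then show ?thesis unfolding uniformity_int_def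
      by (intro eventually_INF1[of 1]) (use that in \<open>auto simp: eventually_principal\<close>)
  qed
  then show "open U \<longleftrightarrow> (\<forall>x\<in>U. \<forall>\<^sub>F (x', y) in uniformity. x' = x \<longrightarrow> y \<in> U)"
    by (simp add: open_discrete)
qed (auto simp: uniformity_int_def dist_int_def)

end

instance bcontfun :: (metric_space, banach) banach ..

context weights
begin

section \<open>Taylor estimates and bounds for compositions\<close>

lemma mlb_eq: "mlb j K A \<Longrightarrow> K = L \<Longrightarrow> (\<And>vs. length vs = j \<Longrightarrow> A vs = B vs) \<Longrightarrow> mlb j L B"
  using mlb_cong by blast

text \<open>The mean value inequality on the segment from \<open>0\<close> to \<open>x\<close>. The
  direction \<open>x\<close> is an additional argument measured in the sup norm, so the weight stays
  with one of the old arguments.\<close>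

lemma jet_mvt_mlb:
  assumes D: "jet r V D" and V: "convex V" "0 \<in> V" and j: "j < r" and x: "x \<in> V"
    and b: "\<And>y. y \<in> V \<Longrightarrow> nm y \<le> nm x \<Longrightarrow> mlb (Suc j) K (D (Suc j) y)"
  shows "mlb j (C0 * (K * nm x)) (\<lambda>vs. D j x vs - D j 0 vs)"
  unfolding mlb_def
proof (intro ballI allI impI)
  fix \<omega> cs and vs :: "('m, 'n) linf list" assume \<omega>: "\<omega> \<in> W" and vs: "length vs = j" and pf: "pf \<omega> cs vs"
  have tx: "t *\<^sub>R x \<in> V" "nm (t *\<^sub>R x) \<le> nm x" if "t \<in> {0..1}" for t
  proof -
    show "t *\<^sub>R x \<in> V" using convexD[OF V(1) x V(2), of t "1 - t"] that by simp
    show "nm (t *\<^sub>R x) \<le> nm x"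
      using nm_scale_le[of t x] that mult_left_le_one_le[of "nm x" t] by simp
  qed
  have "wb \<omega> (C0 * (K * prod_list (nm x # cs))) (D j (0 + 1 *\<^sub>R x) vs - D j (0 + 0 *\<^sub>R x) vs)"
  proof (rule wb_mvt[OF \<omega>])
    fix t :: real assume t: "t \<in> {0..1}"
    show "((\<lambda>t. D j (0 + t *\<^sub>R x) vs) has_vector_derivative D (Suc j) (t *\<^sub>R x) (x # vs)) (at t within {0..1})"
      using jet_has_derivative[OF D j tx(1)[OF t] vs] by (intro has_vector_derivative_line) simp
    show "wb \<omega> (K * prod_list (nm x # cs)) (D (Suc j) (t *\<^sub>R x) (x # vs))"
      by (rule mlbD[OF b[OF tx[OF t]] \<omega>]) (use vs pf_Cons[OF wb_nm pf] in auto)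
  qed
  then show "wb \<omega> (C0 * (K * nm x) * prod_list cs) (D j x vs - D j 0 vs)" by (simp add: mult.assoc)
qed

text \<open>Taylor's estimate by descending induction from order \<open>q\<close>: each step down
  costs a factor \<open>C0\<close> and gains a factor \<open>nm x\<close>.\<close>

lemma jet_flat:
  assumes D: "jet r V D" and V: "convex V" "0 \<in> V" and q: "q \<le> r" and K: "0 \<le> K"
    and zero: "\<And>i vs. i < q \<Longrightarrow> length vs = i \<Longrightarrow> D i 0 vs = 0"
    and b: "\<And>y. y \<in> V \<Longrightarrow> mlb q K (D q y)"
  shows "i \<le> q \<Longrightarrow> x \<in> V \<Longrightarrow> mlb i (K * C0 ^ (q - i) * nm x ^ (q - i)) (D i x)"
proof (induction "q - i" arbitrary: i x)
  case 0
  then show ?case using b by simp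
next
  case (Suc m)
  then have i: "i < q" and m: "q - i = Suc m" "q - Suc i = m" by auto
  have "mlb i (C0 * ((K * C0 ^ m * nm x ^ m) * nm x)) (\<lambda>vs. D i x vs - D i 0 vs)"
  proof (rule jet_mvt_mlb[OF D V _ Suc.prems(2)])
    fix y assume y: "y \<in> V" "nm y \<le> nm x"
    have "mlb (Suc i) (K * C0 ^ m * nm y ^ m) (D (Suc i) y)"
      using Suc.hyps(1)[of "Suc i" y] m y i by simp
    then show "mlb (Suc i) (K * C0 ^ m * nm x ^ m) (D (Suc i) y)"
      by (rule mlb_mono) (use y K C0_pos in \<open>auto intro!: mult_left_mono power_mono\<close>)
  qed (use i q in auto)
  then show ?case
    by (rule mlb_eq) (use zero[OF i] m in simp_all)
qed

text \<open>No partition has more than \<open>r\<close> blocks and \<open>K\<close> is at least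
  \<open>1\<close>, so every term is at most \<open>B * K ^ r\<close>.\<close>

lemma mlb_cmp_general:
  assumes F: "\<And>k. 1 \<le> k \<Longrightarrow> k \<le> r \<Longrightarrow> mlb k K (F k x)" and K: "1 \<le> K" and j: "1 \<le> j" "j \<le> r"
    and G: "\<And>k. 1 \<le> k \<Longrightarrow> k \<le> r \<Longrightarrow> mlb k B (G k (F 0 x []))" and B: "0 \<le> B"
  shows "mlb j (real (length (parts j)) * (B * K ^ r)) (cmp G F j x)"
proof -
  have "mlb j (\<Sum>\<pi>\<leftarrow>parts j. B * K ^ r) (\<lambda>vs. \<Sum>\<pi>\<leftarrow>parts j. G (length \<pi>) (F 0 x []) (blocks F x vs \<pi>))"
  proof (rule mlb_sum_list)
    fix \<pi> assume \<pi>: "\<pi> \<in> set (parts j)"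
    have l: "1 \<le> length \<pi>" "length \<pi> \<le> r" using parts_length[OF \<pi>] parts_pos[OF \<pi>] j by (auto simp: Suc_le_eq)
    have "mlb j (B * prod_list (map (\<lambda>S. K) \<pi>)) (\<lambda>vs. G (length \<pi>) (F 0 x []) (blocks F x vs \<pi>))"
    proof (rule mlb_blocks[OF \<pi> G[OF l], where \<kappa> = "\<lambda>_. K"])
      fix S assume "S \<in> set \<pi>"
      from parts_block[OF \<pi> this] j show "mlb (length S) K (F (length S) x)" by (intro F) (auto simp: Suc_le_eq)
    qed
    then show "mlb j (B * K ^ r) (\<lambda>vs. G (length \<pi>) (F 0 x []) (blocks F x vs \<pi>))"
      by (rule mlb_mono) (use B K l in \<open>auto simp: map_replicate_const prod_list_replicate intro!: mult_left_mono power_increasing\<close>)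
  qed
  then show ?thesis unfolding cmp_def by (simp add: sum_list_triv)
qed

text \<open>The leading term of \<open>h \<circ> F\<close> contracts by \<open>\<beta> ^ q\<close>; all other terms involve lower
  derivatives of \<open>h\<close>, which the weight \<open>(1/\<eta>) ^ i\<close> makes negligible.\<close>

lemma mlb_transfer:
  assumes l: "lb l L" "0 \<le> l" and \<beta>: "0 \<le> \<beta>" "\<beta> \<le> 1" and K: "1 \<le> K" and \<eta>: "0 < \<eta>" "\<eta> \<le> 1" and H: "0 \<le> H"
    and x: "nm x \<le> 1" and Fx: "nm (F 0 x []) \<le> \<beta> * nm x"
    and F1: "mlb 1 \<beta> (F 1 x)" and F: "\<And>k. 1 \<le> k \<Longrightarrow> k \<le> r \<Longrightarrow> mlb k K (F k x)"
    and h: "\<And>i. i \<le> r \<Longrightarrow> mlb i (H * (1 / \<eta>) ^ i * nm (F 0 x []) ^ (q - i)) (h i (F 0 x []))"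
    and i: "i \<le> r"
  shows "mlb i (l * (\<beta> ^ q + \<eta> * (K ^ r * (\<Sum>j\<le>r. real (length (parts j))))) * H * (1 / \<eta>) ^ i * nm x ^ (q - i))
    (\<lambda>vs. L (cmp h F i x vs))"
proof -
  let ?y = "F 0 x []"
  let ?B = "H * (1 / \<eta>) ^ i * nm x ^ (q - i)"
  have B0: "0 \<le> ?B" using H \<eta> by simp
  have y1: "nm ?y \<le> nm x" using Fx \<beta> mult_right_mono[of \<beta> 1 "nm x"] by simp
  have full: "mlb i (?B * \<beta> ^ q) (\<lambda>vs. h i ?y (map (\<lambda>v. F 1 x [v]) vs))"
  proof -
    have \<pi>: "map (\<lambda>q. [q]) [0..<i] \<in> set (parts i)"
      using arg_cong[OF parts_full[of i], of set] by auto
    have eq: "blocks F x vs (map (\<lambda>q. [q]) [0..<i]) = map (\<lambda>v. F 1 x [v]) vs" if "length vs = i" for vs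
    proof -
      have "map (\<lambda>q. F (Suc 0) x [vs ! q]) [0..<i] = map (\<lambda>v. F (Suc 0) x [v]) vs"
        using that by (metis (no_types, lifting) map_map comp_def map_nth map_cong)
      then show ?thesis by (simp add: blocks_def comp_def)
    qed
    have "mlb i (H * (1 / \<eta>) ^ i * nm ?y ^ (q - i) * prod_list (map (\<lambda>S. \<beta>) (map (\<lambda>q. [q]) [0..<i])))
        (\<lambda>vs. h i ?y (blocks F x vs (map (\<lambda>q. [q]) [0..<i])))"
      using h[OF i] by (intro mlb_blocks[OF \<pi>, where \<kappa> = "\<lambda>_. \<beta>"]) (use F1 in auto)
    then have 1: "mlb i (H * (1 / \<eta>) ^ i * nm ?y ^ (q - i) * \<beta> ^ i) (\<lambda>vs. h i ?y (map (\<lambda>v. F 1 x [v]) vs))"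
      by (rule mlb_eq) (simp_all add: comp_def map_replicate_const prod_list_replicate eq)
    have "nm ?y ^ (q - i) * \<beta> ^ i \<le> (\<beta> * nm x) ^ (q - i) * \<beta> ^ i"
      using Fx \<beta> by (intro mult_right_mono power_mono) auto
    also have "\<dots> = nm x ^ (q - i) * \<beta> ^ (q - i + i)" by (simp add: power_mult_distrib power_add)
    \<comment> \<open>Subtraction truncates: for \<open>i > q\<close> the exponent of
      \<open>\<beta>\<close> is \<open>i\<close> instead of \<open>q\<close>, and
      \<open>\<beta> \<le> 1\<close> still gives the claim.\<close>
    also have "\<dots> \<le> nm x ^ (q - i) * \<beta> ^ q"
      using \<beta> by (intro mult_left_mono power_decreasing) auto
    finally have "H * (1 / \<eta>) ^ i * (nm ?y ^ (q - i) * \<beta> ^ i) \<le> H * (1 / \<eta>) ^ i * (nm x ^ (q - i) * \<beta> ^ q)"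
      using H \<eta> by (intro mult_left_mono) auto
    with 1 show ?thesis by (auto simp: mult_ac elim: mlb_mono)
  qed
  let ?P = "filter (\<lambda>\<pi>. length \<pi> \<noteq> i) (parts i)"
  have rest: "mlb i (\<Sum>\<pi>\<leftarrow>?P. ?B * (\<eta> * K ^ r)) (\<lambda>vs. \<Sum>\<pi>\<leftarrow>?P. h (length \<pi>) ?y (blocks F x vs \<pi>))"
  proof (rule mlb_sum_list)
    fix \<pi> assume "\<pi> \<in> set ?P"
    then have \<pi>: "\<pi> \<in> set (parts i)" and "length \<pi> \<noteq> i" by auto
    then have l: "length \<pi> < i" using parts_length[OF \<pi>] by simp
    have 1: "mlb i (H * (1 / \<eta>) ^ length \<pi> * nm ?y ^ (q - length \<pi>) * prod_list (map (\<lambda>S. K) \<pi>))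
        (\<lambda>vs. h (length \<pi>) ?y (blocks F x vs \<pi>))"
    proof (rule mlb_blocks[OF \<pi> h, where \<kappa> = "\<lambda>_. K"])
      show "length \<pi> \<le> r" using l i by simp
      fix S assume "S \<in> set \<pi>"
      from parts_block[OF \<pi> this] i show "mlb (length S) K (F (length S) x)" by (intro F) (auto simp: Suc_le_eq)
    qed
    \<comment> \<open>With fewer than \<open>i\<close> blocks at least one factor
      \<open>1 / \<eta>\<close> is missing; this is the gain \<open>\<eta>\<close>.\<close>
    have a: "(1 / \<eta>) ^ length \<pi> \<le> \<eta> * (1 / \<eta>) ^ i"
    proof -
      have "(1 / \<eta>) ^ length \<pi> \<le> (1 / \<eta>) ^ (i - 1)" using l \<eta> by (intro power_increasing) auto
      also have "\<dots> = \<eta> * (1 / \<eta>) ^ i" using l \<eta> by (cases i) auto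
      finally show ?thesis .
    qed
    \<comment> \<open>A derivative of lower order vanishes at least as fast at \<open>0\<close>, and
      \<open>nm x \<le> 1\<close>.\<close>
    have b: "nm ?y ^ (q - length \<pi>) \<le> nm x ^ (q - i)"
      using power_mono[OF y1, of "q - length \<pi>"] power_decreasing[of "q - i" "q - length \<pi>" "nm x"] x l by fastforce
    have "K ^ length \<pi> \<le> K ^ r" using K l i by (intro power_increasing) auto
    then have "(1 / \<eta>) ^ length \<pi> * nm ?y ^ (q - length \<pi>) * K ^ length \<pi> \<le> (\<eta> * (1 / \<eta>) ^ i) * nm x ^ (q - i) * K ^ r"
      using a b \<eta> K by (intro mult_mono) auto
    then have "H * ((1 / \<eta>) ^ length \<pi> * nm ?y ^ (q - length \<pi>) * K ^ length \<pi>) \<le> H * ((\<eta> * (1 / \<eta>) ^ i) * nm x ^ (q - i) * K ^ r)"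
      using H by (rule mult_left_mono)
    with 1 show "mlb i (?B * (\<eta> * K ^ r)) (\<lambda>vs. h (length \<pi>) ?y (blocks F x vs \<pi>))"
      by (elim mlb_mono) (simp add: map_replicate_const prod_list_replicate mult_ac)
  qed
  have "mlb i (?B * \<beta> ^ q + (\<Sum>\<pi>\<leftarrow>?P. ?B * (\<eta> * K ^ r))) (cmp h F i x)"
    by (rule mlb_cong[OF mlb_add[OF full rest]]) (simp add: cmp_split)
  then have "mlb i (l * (?B * \<beta> ^ q + (\<Sum>\<pi>\<leftarrow>?P. ?B * (\<eta> * K ^ r)))) (\<lambda>vs. L (cmp h F i x vs))"
    by (rule mlb_compose[OF l(1)])
  moreover have "(\<Sum>\<pi>\<leftarrow>?P. ?B * (\<eta> * K ^ r)) \<le> ?B * (\<eta> * (K ^ r * (\<Sum>j\<le>r. real (length (parts j)))))"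
  proof -
    have "real (length ?P) \<le> real (length (parts i))" by simp
    also have "\<dots> \<le> (\<Sum>j\<le>r. real (length (parts j)))" using i by (intro member_le_sum) auto
    finally have "?B * (\<eta> * K ^ r) * real (length ?P) \<le> ?B * (\<eta> * K ^ r) * (\<Sum>j\<le>r. real (length (parts j)))"
      using B0 \<eta> K by (intro mult_left_mono) auto
    then show ?thesis by (simp add: sum_list_triv mult_ac)
  qed
  then have "l * (?B * \<beta> ^ q + (\<Sum>\<pi>\<leftarrow>?P. ?B * (\<eta> * K ^ r)))
      \<le> l * (?B * \<beta> ^ q + ?B * (\<eta> * (K ^ r * (\<Sum>j\<le>r. real (length (parts j))))))"
    using l(2) by (intro mult_left_mono add_left_mono)
  ultimately show ?thesis by (elim mlb_mono) (simp add: algebra_simps)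
qed

section \<open>Linear equations solved by successive approximation\<close>

lemma multilinear_series:
  fixes P :: "nat \<Rightarrow> 'a::real_normed_vector list \<Rightarrow> 'b::real_normed_vector"
  assumes "\<And>n. multilinear j (P n)" "\<And>vs. length vs = j \<Longrightarrow> (\<lambda>n. P n vs) sums (S vs)"
  shows "multilinear j S"
  unfolding multilinear_def
proof (intro allI impI)
  fix vs :: "'a list" and p assume vs: "length vs = j" and p: "p < j"
  note lin = multilinearD[OF assms(1) vs p]
  have s: "(\<lambda>n. P n (vs[p := w])) sums S (vs[p := w])" for w using vs by (intro assms(2)) simp
  show "linear (\<lambda>w. S (vs[p := w]))"
  proof (rule linearI)
    fix v w :: 'a and c :: real
    show "S (vs[p := v + w]) = S (vs[p := v]) + S (vs[p := w])"
      using sums_unique2[OF s[of "v + w"]] sums_add[OF s[of v] s[of w]] by (simp add: linear_add[OF lin])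
    show "S (vs[p := c *\<^sub>R v]) = c *\<^sub>R S (vs[p := v])"
      using sums_unique2[OF s[of "c *\<^sub>R v"]] sums_scaleR_right[OF s[of v], of c] by (simp add: linear_scale[OF lin])
  qed
qed

text \<open>An approximate solution with residual at most \<open>\<theta>\<close> times the data is
  corrected by approximate solutions for the residuals. Both sequences decay geometrically, and the
  corrections sum to an exact solution with the weighted bounds intact.\<close>

lemma solve_by_approximation:
  assumes M: "bounded_linear M" and T: "linear T" and \<theta>: "0 \<le> \<theta>" "\<theta> < 1"
    and approx: "\<And>K Q. multilinear j Q \<Longrightarrow> mlb j K Q \<Longrightarrow>
       \<exists>P. multilinear j P \<and> mlb j (C * K) P \<and> mlb j (\<theta> * K) (\<lambda>vs. Q vs - (M (P vs) - P (map T vs)))"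
    and Q: "multilinear j Q" "mlb j K Q"
  shows "\<exists>P. multilinear j P \<and> mlb j (C * K / (1 - \<theta>)) P \<and> (\<forall>vs. length vs = j \<longrightarrow> M (P vs) - P (map T vs) = Q vs)"
proof -
  let ?L = "\<lambda>P vs. M (P vs) - P (map T vs)"
  \<comment> \<open>The choice depends on the bound \<open>K\<close> as well as on \<open>Q\<close>,
    since the guarantees are relative to \<open>K\<close>.\<close>
  define sol where "sol K Q = (SOME P. multilinear j P \<and> mlb j (C * K) P \<and> mlb j (\<theta> * K) (\<lambda>vs. Q vs - ?L P vs))" for K Q
  have sol: "multilinear j (sol K Q)" "mlb j (C * K) (sol K Q)" "mlb j (\<theta> * K) (\<lambda>vs. Q vs - ?L (sol K Q) vs)"
    if "multilinear j Q" "mlb j K Q" for K Q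
    using someI_ex[OF approx[OF that]] unfolding sol_def by blast+
  define R where "R = rec_nat Q (\<lambda>n R vs. R vs - ?L (sol (\<theta> ^ n * K) R) vs)"
  have R0: "R 0 = Q" and RS: "R (Suc n) = (\<lambda>vs. R n vs - ?L (sol (\<theta> ^ n * K) (R n)) vs)" for n
    by (simp_all add: R_def)
  have R: "multilinear j (R n) \<and> mlb j (\<theta> ^ n * K) (R n)" for n
  proof (induction n)
    case (Suc n)
    then have "mlb j (\<theta> * (\<theta> ^ n * K)) (R (Suc n))" unfolding RS using sol(3) by blast
    moreover have "multilinear j (R (Suc n))"
      unfolding RS using Suc sol(1)
      by (intro multilinear_diff multilinear_compose[OF bounded_linear.linear[OF M]] multilinear_map[OF _ T]) auto
    ultimately show ?case by (simp add: mult.assoc)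
  qed (use Q R0 in simp)
  define P where "P n = sol (\<theta> ^ n * K) (R n)" for n
  have P: "multilinear j (P n)" "mlb j (C * (\<theta> ^ n * K)) (P n)" for n
    using sol R by (auto simp: P_def)
  have geo: "summable (\<lambda>n. \<theta> ^ n)" "suminf (\<lambda>n. \<theta> ^ n) = 1 / (1 - \<theta>)"
    using \<theta> by (auto simp: summable_geometric suminf_geometric)
  have sm: "(\<lambda>n. P n vs) sums (\<Sum>n. P n vs)" if vs: "length vs = j" for vs
  proof (rule summable_sums)
    have bnd: "norm (P n vs) \<le> \<theta> ^ n * (C * K * hi ^ j / lo * prod_list (map norm vs))" for n
      using opbD[OF mlb_opb[OF P(2)] vs] by (simp add: mult_ac)
    show "summable (\<lambda>n. P n vs)"
      by (rule summable_comparison_test'[OF summable_mult2[OF geo(1)]]) (rule bnd)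
  qed
  have "multilinear j (\<lambda>vs. \<Sum>n. P n vs)" by (rule multilinear_series[OF P(1) sm])
  moreover have "mlb j (C * K / (1 - \<theta>)) (\<lambda>vs. \<Sum>n. P n vs)"
    unfolding mlb_def
  proof (intro ballI allI impI)
    fix \<omega> cs and vs :: "('m, 'n) linf list" assume \<omega>: "\<omega> \<in> W" and vs: "length vs = j" and pf: "pf \<omega> cs vs"
    have "wb \<omega> (\<Sum>n. \<theta> ^ n * (C * K * prod_list cs)) (\<Sum>n. P n vs)"
      using mlbD[OF P(2) \<omega> vs pf] sm[OF vs] summable_mult2[OF geo(1)]
      by (intro wb_series[OF \<omega>]) (auto simp: mult_ac)
    also have "(\<Sum>n. \<theta> ^ n * (C * K * prod_list cs)) = C * K / (1 - \<theta>) * prod_list cs"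
      using suminf_mult2[OF geo(1), of "C * K * prod_list cs"] geo(2) by simp
    finally show "wb \<omega> (C * K / (1 - \<theta>) * prod_list cs) (\<Sum>n. P n vs)" .
  qed
  moreover have "M (\<Sum>n. P n vs) - (\<Sum>n. P n (map T vs)) = Q vs" if vs: "length vs = j" for vs
  proof -
    have "(\<lambda>n. ?L (P n) vs) sums (M (\<Sum>n. P n vs) - (\<Sum>n. P n (map T vs)))"
      using vs by (intro sums_diff bounded_linear.sums[OF M] sm) auto
    moreover have "(\<lambda>n. ?L (P n) vs) sums (Q vs)"
    proof -
      have "(\<Sum>k<n. ?L (P k) vs) = Q vs - R n vs" for n
        by (induction n) (simp_all add: R0 RS P_def)
      moreover have "(\<lambda>n. R n vs) \<longlonglongrightarrow> 0"
      proof (rule Lim_null_comparison)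
        show "\<forall>\<^sub>F n in sequentially. norm (R n vs) \<le> \<theta> ^ n * (K * hi ^ j / lo * prod_list (map norm vs))"
          using opbD[OF mlb_opb[OF conjunct2[OF R]] vs] by (auto simp: mult_ac intro!: always_eventually)
        show "(\<lambda>n. \<theta> ^ n * (K * hi ^ j / lo * prod_list (map norm vs))) \<longlonglongrightarrow> 0"
          using \<theta> by (intro tendsto_mult_left_zero LIMSEQ_power_zero) auto
      qed
      then have "(\<lambda>n. Q vs - R n vs) \<longlonglongrightarrow> Q vs - 0" by (intro tendsto_intros)
      ultimately show ?thesis by (simp add: sums_def)
    qed
    ultimately show ?thesis by (rule sums_unique2)
  qed
  ultimately show ?thesis by blast
qed

text \<open>The right inverse is the solution for \<open>j = 1\<close> with \<open>hd\<close>, the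
  identity on lists of length one, as right-hand side and with \<open>T = 0\<close>, which removes
  the second term of the equation. It is also a left inverse because \<open>A x + B x = 0\<close>
  forces \<open>nm x \<le> l * b * nm x\<close>.\<close>

lemma perturbed_inverse:
  assumes A: "bounded_linear A" and B: "linear B" "lb b B" and Ai: "linear Ai" "lb l Ai" "0 \<le> l"
    and inv: "\<And>x. A (Ai x) = x" "\<And>x. Ai (A x) = x" and b: "0 \<le> b" "l * b < 1"
  obtains L where "linear L" "lb (l / (1 - l * b)) L" "\<And>x. A (L x) + B (L x) = x" "\<And>x. L (A x + B x) = x"
proof -
  have bB: "bounded_linear B" by (rule lb_bounded_linear[OF B])
  have M: "bounded_linear (\<lambda>x. A x + B x)" by (rule bounded_linear_add[OF A bB])
  have hd: "multilinear 1 hd" unfolding multilinear_def by (auto simp: length_Suc_conv linear_id[unfolded id_def])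
  have hb: "mlb 1 1 hd" unfolding mlb_1_iff lb_def by simp
  have "\<exists>P. multilinear 1 P \<and> mlb 1 (l * 1 / (1 - l * b)) P \<and>
      (\<forall>vs. length vs = 1 \<longrightarrow> (A (P vs) + B (P vs)) - P (map (\<lambda>_. 0) vs) = hd vs)"
  proof (rule solve_by_approximation[OF M linear_zero _ _ _ hd hb])
    fix K and Q :: "('m, 'n) linf list \<Rightarrow> ('m, 'n) linf" assume Q: "multilinear 1 Q" "mlb 1 K Q"
    let ?P = "\<lambda>vs. Ai (Q vs)"
    have P: "multilinear 1 ?P" "mlb 1 (l * K) ?P"
      using Q Ai by (auto intro: multilinear_compose mlb_compose)
    have Z: "?P (map (\<lambda>_. 0) vs) = 0" if "length vs = Suc 0" for vs
      by (rule multilinear_eq_0[OF P(1)]) (use that in \<open>auto simp: length_Suc_conv\<close>)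
    have "mlb 1 (l * b * K) (\<lambda>vs. Q vs - (A (?P vs) + B (?P vs) - ?P (map (\<lambda>_. 0) vs)))"
      by (rule mlb_eq[OF mlb_uminus[OF mlb_compose[OF B(2) P(2)]]]) (simp_all add: inv Z)
    then show "\<exists>P. multilinear 1 P \<and> mlb 1 (l * K) P \<and>
        mlb 1 (l * b * K) (\<lambda>vs. Q vs - (A (P vs) + B (P vs) - P (map (\<lambda>_. 0) vs)))"
      using P by blast
  qed (use b Ai(3) in auto)
  then obtain P where P: "multilinear 1 P" "mlb 1 (l / (1 - l * b)) P"
    "\<And>vs. length vs = 1 \<Longrightarrow> (A (P vs) + B (P vs)) - P (map (\<lambda>_. 0) vs) = hd vs" by auto
  have lin: "linear (\<lambda>v. P [v])" using multilinearD[OF P(1), of "[0]" 0] by simp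
  have MP: "A (P [x]) + B (P [x]) = x" for x
    using P(3)[of "[x]"] linear_0[OF lin] by simp
  have inj: "x = 0" if "A x + B x = 0" for x
  proof -
    have "Ai (A x + B x) = 0" using that linear_0[OF Ai(1)] by simp
    then have "x = - Ai (B x)" by (simp add: linear_add[OF Ai(1)] inv eq_neg_iff_add_eq_0)
    then have "nm x = nm (Ai (- B x))" by (simp add: linear_neg[OF Ai(1)])
    also have "\<dots> \<le> l * nm (- B x)" by (rule lb_nm[OF Ai(2)])
    also have "nm (- B x) \<le> b * nm x"
      unfolding nm_le_iff by (intro wb_uminus lbD[OF B(2) one_W wb_nm])
    finally have "nm x \<le> l * b * nm x" using Ai(3) by (simp add: mult.assoc mult_left_mono)
    then have "(1 - l * b) * nm x \<le> 0" by (simp add: algebra_simps)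
    then have "nm x \<le> 0" using b(2) by (simp add: mult_le_0_iff)
    then have "lo * norm x \<le> 0" using norm_le_nm[of x] by linarith
    then show ?thesis using lo_hi(1) by (simp add: mult_le_0_iff)
  qed
  have "P [A x + B x] = x" for x
  proof -
    have "A (P [A x + B x] - x) + B (P [A x + B x] - x) = 0"
      using MP[of "A x + B x"] by (simp add: linear_diff[OF bounded_linear.linear[OF A]] linear_diff[OF B(1)] algebra_simps)
    from inj[OF this] show ?thesis by simp
  qed
  moreover have "lb (l / (1 - l * b)) (\<lambda>v. P [v])" using P(2) unfolding mlb_1_iff .
  ultimately show ?thesis using that lin MP by blast
qed

end

section \<open>The homological equation\<close>

text \<open>Complexifying the values, the operator \<open>P \<mapsto> a P - c P (A\<cdot>, \<dots>, A\<cdot>, \<cdot>, \<dots>)\<close> with \<open>A\<close> in the first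
  \<open>k + 1\<close> slots is inverted by induction on \<open>k\<close>: the operator "\<open>A\<close> in slot \<open>k\<close>" is annihilated by a product of
  factors \<open>\<cdot> - \<mu>\<close>, \<open>\<mu> \<in> Spec a\<close>, and modulo the factor \<open>\<cdot> - \<mu>\<close> slot \<open>k\<close> may be replaced by the
  scalar \<open>\<mu>\<close>.\<close>

definition slot :: "('a \<Rightarrow> 'a) \<Rightarrow> nat \<Rightarrow> ('a list \<Rightarrow> 'b) \<Rightarrow> 'a list \<Rightarrow> 'b" where
  "slot A k P vs = P (vs[k := A (vs ! k)])"

definition slots :: "('a \<Rightarrow> 'a) \<Rightarrow> nat \<Rightarrow> ('a list \<Rightarrow> 'b) \<Rightarrow> 'a list \<Rightarrow> 'b" where
  "slots A k P vs = P (map A (take k vs) @ drop k vs)"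

lemma slots_Suc: "k < length vs \<Longrightarrow> slots A (Suc k) P vs = slots A k (slot A k P) vs"
  by (simp add: slots_def slot_def list_update_append take_Suc_conv_app_nth nth_append
      Cons_nth_drop_Suc[symmetric])

lemma slot_slots: "k < length vs \<Longrightarrow> slot A k (slots A k P) vs = slots A k (slot A k P) vs"
  by (simp add: slots_def slot_def list_update_append nth_append drop_update_swap)

definition factor :: "('a \<Rightarrow> 'a) \<Rightarrow> nat \<Rightarrow> complex \<Rightarrow> ('a list \<Rightarrow> complex^'n) \<Rightarrow> 'a list \<Rightarrow> complex^'n" where
  "factor A k \<mu> P vs = slot A k P vs - \<mu> *s P vs"

primrec factors :: "('a \<Rightarrow> 'a) \<Rightarrow> nat \<Rightarrow> complex list \<Rightarrow> ('a list \<Rightarrow> complex^'n) \<Rightarrow> 'a list \<Rightarrow> complex^'n" where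
  "factors A k [] P = P"
| "factors A k (\<mu> # \<mu>s) P = factors A k \<mu>s (factor A k \<mu> P)"

lemma factors_append: "factors A k (\<mu>s @ \<nu>s) P = factors A k \<nu>s (factors A k \<mu>s P)"
  by (induction \<mu>s arbitrary: P) auto

definition sylv :: "complex^'n^'n \<Rightarrow> ('a \<Rightarrow> 'a) \<Rightarrow> nat \<Rightarrow> complex \<Rightarrow> ('a list \<Rightarrow> complex^'n) \<Rightarrow> 'a list \<Rightarrow> complex^'n" where
  "sylv X A k c P vs = X *v P vs - c *s slots A k P vs"

lemma factor_cong:
  assumes "\<And>vs. length vs = j \<Longrightarrow> P vs = Q vs" "length vs = j" shows "factor A k \<mu> P vs = factor A k \<mu> Q vs"
  using assms by (simp add: factor_def slot_def)

lemma factors_cong: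
  assumes "\<And>vs. length vs = j \<Longrightarrow> P vs = Q vs" "length vs = j" shows "factors A k \<mu>s P vs = factors A k \<mu>s Q vs"
  using assms(1)
proof (induction \<mu>s arbitrary: P Q)
  case (Cons \<mu> \<mu>s)
  have "factors A k \<mu>s (factor A k \<mu> P) vs = factors A k \<mu>s (factor A k \<mu> Q) vs"
    by (rule Cons.IH) (rule factor_cong[OF Cons.prems])
  then show ?case by simp
qed (use assms(2) in simp)

lemma factor_diff: "factor A k \<mu> (\<lambda>vs. P vs - Q vs) = (\<lambda>vs. factor A k \<mu> P vs - factor A k \<mu> Q vs)"
  by (auto simp: factor_def slot_def vec.scale_right_diff_distrib)

lemma factors_diff: "factors A k \<mu>s (\<lambda>vs. P vs - Q vs) = (\<lambda>vs. factors A k \<mu>s P vs - factors A k \<mu>s Q vs)"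
  by (induction \<mu>s arbitrary: P Q) (auto simp: factor_diff)

lemma sylv_factor:
  assumes "length vs = j" "k < j"
  shows "sylv X A (Suc k) c (factor A k \<mu> P) vs = factor A k \<mu> (sylv X A (Suc k) c P) vs"
proof -
  have "slots A (Suc k) (slot A k P) vs = slot A k (slots A (Suc k) P) vs"
    using assms by (simp add: slots_Suc slot_slots[symmetric]) (simp add: slot_def slots_Suc)
  then have f2: "slots A (Suc k) (factor A k \<mu> P) vs = slot A k (slots A (Suc k) P) vs - \<mu> *s slots A (Suc k) P vs"
    by (simp add: slots_def factor_def)
  have f3: "factor A k \<mu> (sylv X A (Suc k) c P) vs
      = (X *v slot A k P vs - c *s slot A k (slots A (Suc k) P) vs) - \<mu> *s (X *v P vs - c *s slots A (Suc k) P vs)"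
    by (simp add: factor_def slot_def sylv_def)
  show ?thesis
    unfolding f3 sylv_def[of X A "Suc k" c "factor A k \<mu> P"] f2 factor_def[of A k \<mu> P]
    by (simp add: matrix_vector_mult_diff_distrib vector_scalar_commute vec.scale_right_diff_distrib
        vector_smult_assoc mult.commute)
qed

lemma sylv_factors:
  assumes "length vs = j" "k < j"
  shows "sylv X A (Suc k) c (factors A k \<mu>s P) vs = factors A k \<mu>s (sylv X A (Suc k) c P) vs"
proof (induction \<mu>s arbitrary: P)
  case (Cons \<mu> \<mu>s)
  have "factors A k \<mu>s (sylv X A (Suc k) c (factor A k \<mu> P)) vs = factors A k \<mu>s (factor A k \<mu> (sylv X A (Suc k) c P)) vs"
    by (rule factors_cong[OF _ assms(1)]) (rule sylv_factor[OF _ assms(2)])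
  then show ?case using Cons by simp
qed simp

lemma sylv_add: "sylv X A k c (\<lambda>vs. P vs + Q vs) vs = sylv X A k c P vs + sylv X A k c Q vs"
  by (simp add: sylv_def slots_def matrix_vector_right_distrib vector_add_ldistrib)

text \<open>Slot \<open>k\<close> is split as \<open>A = \<mu> + (A - \<mu>)\<close>: the scalar
  part joins \<open>c\<close>, the rest is one more \<open>factor\<close>, applied to an explicit
  map.\<close>

lemma sylv_step:
  assumes "length vs = j" "k < j"
  shows "sylv X A (Suc k) c P vs = sylv X A k (c * \<mu>) P vs - factor A k \<mu> (\<lambda>vs. c *s slots A k P vs) vs"
proof -
  have "slots A (Suc k) P vs = slot A k (slots A k P) vs"
    using assms by (simp add: slots_Suc slot_slots)
  moreover have "slot A k (\<lambda>vs. c *s slots A k P vs) vs = c *s slot A k (slots A k P) vs"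
    by (simp add: slot_def)
  ultimately show ?thesis
    unfolding sylv_def factor_def by (simp add: vector_smult_assoc mult.commute)
qed

text \<open>A real linear map \<open>f\<close> into a complex space extends to \<open>w \<mapsto> f w\<^sub>1 + \<i> f w\<^sub>2\<close> on the
  complexification; this turns the factors in the slot into the factors of \<open>a\<close> itself.\<close>

lemma factors_annihilate:
  fixes P :: "('m::finite, 'n::finite) linf list \<Rightarrow> complex^'n" and a :: "real^'n \<Rightarrow> real^'n"
  assumes a: "linear a" and A: "\<And>x i. apply_bcontfun (A x) i = a (apply_bcontfun x i)"
    and kill: "\<And>v. root_op (cmat a) \<mu>s v = 0"
    and P: "multilinear j P" and vs: "length vs = j" and k: "k < j"
  shows "factors A k \<mu>s P vs = 0"
proof -
  \<comment> \<open>Real and imaginary part of \<open>A - \<mu>\<close> applied to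
    \<open>w\<^sub>1 + \<i> w\<^sub>2\<close>.\<close>
  define step where "step \<mu> w = (A (fst w) - Re \<mu> *\<^sub>R fst w + Im \<mu> *\<^sub>R snd w, A (snd w) - Re \<mu> *\<^sub>R snd w - Im \<mu> *\<^sub>R fst w)"
    for \<mu> and w :: "('m, 'n) linf \<times> ('m, 'n) linf"
  define comp where "comp w i = (\<chi> s. Complex (apply_bcontfun (fst w) i $ s) (apply_bcontfun (snd w) i $ s))"
    for w :: "('m, 'n) linf \<times> ('m, 'n) linf" and i
  have comp_cplx: "comp w i = cplx (apply_bcontfun (fst w) i) + \<i> *s cplx (apply_bcontfun (snd w) i)" for w i
    by (simp add: comp_def cplx_def vec_eq_iff complex_eq_iff)
  have comp_step: "comp (step \<mu> w) i = cmat a *v comp w i - \<mu> *s comp w i" for \<mu> w i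
  proof -
    have "cmat a *v comp w i = cplx (a (apply_bcontfun (fst w) i)) + \<i> *s cplx (a (apply_bcontfun (snd w) i))"
      by (simp add: comp_cplx matrix_vector_right_distrib vector_scalar_commute cmat_cplx[OF a])
    then show ?thesis
      by (simp add: comp_def step_def A cplx_def vec_eq_iff complex_eq_iff algebra_simps)
  qed
  have fin: "fold step \<mu>s w = (0, 0)" for w
  proof -
    have "comp (fold step \<mu>s w) i = root_op (cmat a) \<mu>s (comp w i)" for i
      by (induction \<mu>s arbitrary: w) (simp_all add: comp_step)
    then have "comp (fold step \<mu>s w) i = 0" for i using kill by simp
    then have "apply_bcontfun (fst (fold step \<mu>s w)) i = 0" "apply_bcontfun (snd (fold step \<mu>s w)) i = 0" for i
      by (auto simp: comp_def vec_eq_iff complex_eq_iff)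
    then show ?thesis by (intro prod_eqI bcontfun_eqI) auto
  qed
  have lA: "linear A"
    by (rule linearI) (auto intro!: bcontfun_eqI simp: A linear_add[OF a] linear_scale[OF a])
  define ext where "ext P w = P (vs[k := fst w]) + \<i> *s P (vs[k := snd w])"
    for P :: "('m, 'n) linf list \<Rightarrow> complex^'n" and w
  have smult_R: "c *\<^sub>R z = complex_of_real c *s z" for c and z :: "complex^'n"
    by (simp add: vec_eq_iff scaleR_conv_of_real[where 'a = complex])
  have E: "ext (factors A k \<mu>s P) w = ext P (fold step \<mu>s w)" if "multilinear j P" for w P
    using that
  proof (induction \<mu>s arbitrary: P w)
    case (Cons \<mu> \<mu>s)
    note lin = multilinearD[OF Cons.prems vs k]
    have ms: "multilinear j (slot A k P)"
    proof -
      have "linear (\<lambda>w. slot A k P (us[p := w]))" if us: "length us = j" and p: "p < j" for us p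
      proof (cases "p = k")
        case True
        then show ?thesis using linear_compose[OF lA multilinearD[OF Cons.prems us k]] us k
          by (simp add: slot_def o_def)
      next
        case False
        then show ?thesis using multilinearD[OF Cons.prems, of "us[k := A (us ! k)]" p] us p
          by (simp add: slot_def list_update_swap)
      qed
      then show ?thesis by (simp add: multilinear_def)
    qed
    have ls: "linear (\<lambda>z. \<mu> *s z :: complex^'n)"
      by (rule linearI) (simp_all add: vector_add_ldistrib smult_R vector_smult_assoc mult.commute)
    have "multilinear j (factor A k \<mu> P)"
      unfolding factor_def[abs_def] by (rule multilinear_diff[OF ms multilinear_compose[OF ls Cons.prems]])
    then have "ext (factors A k (\<mu> # \<mu>s) P) w = ext (factor A k \<mu> P) (fold step \<mu>s w)"
      using Cons.IH by simp
    also have "\<dots> = ext P (step \<mu> (fold step \<mu>s w))"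
    proof -
      obtain w1 w2 where w: "fold step \<mu>s w = (w1, w2)" by force
      have e1: "ext P (step \<mu> (w1, w2)) = P (vs[k := A w1]) - Re \<mu> *\<^sub>R P (vs[k := w1]) + Im \<mu> *\<^sub>R P (vs[k := w2])
          + \<i> *s (P (vs[k := A w2]) - Re \<mu> *\<^sub>R P (vs[k := w2]) - Im \<mu> *\<^sub>R P (vs[k := w1]))"
        by (simp add: ext_def step_def linear_add[OF lin] linear_diff[OF lin] linear_scale[OF lin])
      have e2: "ext (factor A k \<mu> P) (w1, w2) = P (vs[k := A w1]) - \<mu> *s P (vs[k := w1])
          + \<i> *s (P (vs[k := A w2]) - \<mu> *s P (vs[k := w2]))"
        using vs k by (simp add: ext_def factor_def slot_def)
      show ?thesis unfolding w e1 e2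
        by (simp add: vec_eq_iff complex_eq_iff algebra_simps)
    qed
    \<comment> \<open>The factors reach the argument in the order opposite to that of
      \<open>fold\<close>; they commute.\<close>
    also have "step \<mu> (fold step \<mu>s w) = fold step (\<mu> # \<mu>s) w"
    proof -
      have st: "step \<mu> (step \<nu> w) = step \<nu> (step \<mu> w)" for \<nu> w
        by (simp add: step_def linear_add[OF lA] linear_diff[OF lA] linear_scale[OF lA] algebra_simps)
      have "fold step \<mu>s (step \<mu> w) = step \<mu> (fold step \<mu>s w)" for w
      proof (induction \<mu>s arbitrary: w)
        case (Cons \<nu> \<mu>s)
        then show ?case using st[of \<nu> w] by (metis fold_simps(2))
      qed simp
      then show ?thesis by simp
    qed
    finally show ?case .
  qed simp
  have "P (vs[k := 0]) = 0"
    using multilinear_eq_0[OF P, of "vs[k := 0]"] vs k by (simp add: set_update_memI)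
  then have Z: "factors A k \<mu>s P (vs[k := w1]) + \<i> *s factors A k \<mu>s P (vs[k := w2]) = 0" for w1 w2
    using E[OF P, of "(w1, w2)"] by (simp add: fin ext_def)
  \<comment> \<open>\<open>Z\<close> combines two values of a map not yet known to be linear in the
    slot. At \<open>w1 = w2 = 0\<close> it says that \<open>1 + \<i>\<close> times the value at
    \<open>0\<close> is zero; then \<open>w2 = 0\<close> leaves the value at any
    \<open>w1\<close>.\<close>
  have "factors A k \<mu>s P (vs[k := 0]) = 0"
  proof -
    have "(1 + \<i>) *s factors A k \<mu>s P (vs[k := 0]) = 0"
      using Z[of 0 0] by (simp add: vector_sadd_rdistrib)
    moreover have "1 + \<i> \<noteq> 0" by (simp add: complex_eq_iff)
    ultimately show ?thesis unfolding vector_mul_eq_0 by blast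
  qed
  then show ?thesis using Z[of "vs ! k" 0] by simp
qed

context weights
begin

text \<open>The counterpart of \<open>mlb\<close> for complexified values at a single node
  \<open>i\<close>. The equation is solved node by node, with a constant that must not depend on
  \<open>i\<close>.\<close>

definition cmlb :: "nat \<Rightarrow> int^'m \<Rightarrow> real \<Rightarrow> (('m, 'n) linf list \<Rightarrow> complex^'n) \<Rightarrow> bool" where
  "cmlb j i K P \<longleftrightarrow> (\<forall>\<omega>\<in>W. \<forall>cs vs. length vs = j \<longrightarrow> pf \<omega> cs vs \<longrightarrow> norm (P vs) \<le> K * (prod_list cs * \<omega> i))"

lemma cmlb_add: "cmlb j i K P \<Longrightarrow> cmlb j i L Q \<Longrightarrow> cmlb j i (K + L) (\<lambda>vs. P vs + Q vs)"
  unfolding cmlb_def by (auto simp: distrib_right intro!: norm_triangle_mono)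

lemma cmlb_scale: "cmlb j i K P \<Longrightarrow> cmlb j i (cmod c * K) (\<lambda>vs. c *s P vs)"
  unfolding cmlb_def by (auto simp: norm_scale_complex mult.assoc intro!: mult_left_mono)

lemma cmlb_diff: "cmlb j i K P \<Longrightarrow> cmlb j i L Q \<Longrightarrow> cmlb j i (K + L) (\<lambda>vs. P vs - Q vs)"
  unfolding cmlb_def distrib_right
  by (intro ballI allI impI norm_triangle_le_diff add_mono) auto

lemma linear_complex_scale: "linear (\<lambda>z :: complex^'k. c *s z)"
  by (rule linearI) (simp_all add: vector_add_ldistrib vec_eq_iff scaleR_conv_of_real[where 'a = complex])

text \<open>The scalar \<open>c\<close> collects the eigenvalues substituted for the slots
  eliminated so far. When no slot is left, \<open>solv 0 c\<close> asks that \<open>X - c\<close> be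
  invertible for \<open>c\<close> a product of \<open>j\<close> eigenvalues, and this is where
  \<open>nonres\<close> enters.\<close>

lemma sylvester_complex:
  fixes a :: "real^'n \<Rightarrow> real^'n" and A :: "('m, 'n) linf \<Rightarrow> ('m, 'n) linf"
  assumes a: "linear a" and A: "\<And>x i. apply_bcontfun (A x) i = a (apply_bcontfun x i)"
    and contr: "\<And>y. N (a y) \<le> N y"
    and nonres: "\<And>\<mu>s. length \<mu>s = j \<Longrightarrow> set \<mu>s \<subseteq> Spec a \<Longrightarrow> prod_list \<mu>s \<notin> Spec a"
  shows "\<exists>C\<ge>0. \<forall>i K Q. multilinear j Q \<longrightarrow> cmlb j i K Q \<longrightarrow>
    (\<exists>P. multilinear j P \<and> cmlb j i (C * K) P \<and> (\<forall>vs. length vs = j \<longrightarrow> sylv (cmat a) A j 1 P vs = Q vs))"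
proof -
  let ?X = "cmat a"
  define solv where "solv k c \<longleftrightarrow> (\<exists>C\<ge>0. \<forall>i K Q. multilinear j Q \<longrightarrow> cmlb j i K Q \<longrightarrow>
    (\<exists>P. multilinear j P \<and> cmlb j i (C * K) P \<and> (\<forall>vs. length vs = j \<longrightarrow> sylv ?X A k c P vs = Q vs)))" for k c
  have spec: "z \<in> Spec a \<longleftrightarrow> (\<exists>v. v \<noteq> 0 \<and> ?X *v v = z *s v)" for z by (simp add: Spec_def cmat_def)
  obtain \<mu>s where \<mu>s: "set \<mu>s \<subseteq> Spec a" and kill: "\<And>v. root_op ?X \<mu>s v = 0"
    using eigenvalue_list[of ?X] spec by (metis subsetI)
  have lA: "linear A"
    by (rule linearI) (auto intro!: bcontfun_eqI simp: A linear_add[OF a] linear_scale[OF a])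
  have wbA: "wb \<omega> c (A x)" if "wb \<omega> c x" for \<omega> c x
    using that contr order_trans unfolding wb_def A by blast
  have pfA: "pf \<omega> cs (vs[k := A (vs ! k)])" if "pf \<omega> cs vs" for \<omega> cs k and vs :: "('m, 'n) linf list"
  proof -
    have "wb \<omega>' c ((vs[k := A (vs ! k)]) ! q)" if "wb \<omega>' c (vs ! q)" "q < length vs" for \<omega>' c q
      using that by (cases "q = k") (auto intro: wbA)
    then show ?thesis using that unfolding pf_def length_list_update by meson
  qed
  have slot: "multilinear j (slot A k P)" "cmlb j i K P \<Longrightarrow> cmlb j i K (slot A k P)"
    if P: "multilinear j P" and k: "k < j" for k P i K
  proof -
    have "linear (\<lambda>w. slot A k P (us[p := w]))" if us: "length us = j" and p: "p < j" for us p
    proof (cases "p = k")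
      case True
      then show ?thesis using linear_compose[OF lA multilinearD[OF P us k]] us k
        by (simp add: slot_def o_def)
    next
      case False
      then show ?thesis using multilinearD[OF P, of "us[k := A (us ! k)]" p] us p
        by (simp add: slot_def list_update_swap)
    qed
    then show "multilinear j (slot A k P)" by (simp add: multilinear_def)
    show "cmlb j i K P \<Longrightarrow> cmlb j i K (slot A k P)"
      unfolding cmlb_def slot_def using pfA by simp
  qed
  have slots: "multilinear j (slots A k P) \<and> (\<forall>K i. cmlb j i K P \<longrightarrow> cmlb j i K (slots A k P))"
    if P: "multilinear j P" and k: "k \<le> j" for k P
    using k
  proof (induction k)
    case 0
    then show ?case using P by (simp add: slots_def)
  next
    case (Suc k)
    then have IH: "multilinear j (slots A k P)" "\<And>K i. cmlb j i K P \<Longrightarrow> cmlb j i K (slots A k P)" by auto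
    have eq: "slots A (Suc k) P vs = slot A k (slots A k P) vs" if "length vs = j" for vs
      using that Suc.prems by (simp add: slots_Suc slot_slots)
    have "multilinear j (slots A (Suc k) P)"
      by (rule multilinear_cong[OF slot(1)[OF IH(1)]]) (use Suc.prems eq in auto)
    moreover have "cmlb j i K (slots A (Suc k) P)" if "cmlb j i K P" for i K
      using slot(2)[OF IH(1) _ IH(2)[OF that], of k] Suc.prems eq unfolding cmlb_def by simp
    ultimately show ?case by blast
  qed
  have factor: "multilinear j (factor A k \<mu> P)" "cmlb j i K P \<Longrightarrow> cmlb j i ((1 + cmod \<mu>) * K) (factor A k \<mu> P)"
    if P: "multilinear j P" and k: "k < j" for k \<mu> P i K
    using multilinear_diff[OF slot(1)[OF P k] multilinear_compose[OF linear_complex_scale P]]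
      cmlb_diff[OF slot(2)[OF P k] cmlb_scale, of i K K P \<mu>]
    by (simp_all add: factor_def[abs_def] distrib_right)
  have factors: "multilinear j (factors A k \<nu>s P) \<and> (\<exists>c\<ge>0. \<forall>i K P. multilinear j P \<longrightarrow> cmlb j i K P \<longrightarrow> cmlb j i (c * K) (factors A k \<nu>s P))"
    if P: "multilinear j P" and k: "k < j" for k \<nu>s and P :: "('m, 'n) linf list \<Rightarrow> complex^'n"
    using P
  proof (induction \<nu>s arbitrary: P)
    case Nil
    then show ?case by (auto intro: exI[of _ 1])
  next
    case (Cons \<nu> \<nu>s)
    obtain c where c: "0 \<le> c" "\<And>i K P. multilinear j P \<Longrightarrow> cmlb j i K P \<Longrightarrow> cmlb j i (c * K) (factors A k \<nu>s P)"
      using Cons by blast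
    have "cmlb j i (c * (1 + cmod \<nu>) * K) (factors A k (\<nu> # \<nu>s) P)" if "multilinear j P" "cmlb j i K P" for i K P
      using c(2)[OF factor(1)[OF that(1) k] factor(2)[OF that(1) k that(2)]] by (simp add: mult.assoc)
    moreover have "0 \<le> c * (1 + cmod \<nu>)" using c(1) by simp
    ultimately show ?case using Cons.IH[OF factor(1)[OF Cons.prems k]] by auto
  qed
  have base: "solv 0 c" if "c \<notin> Spec a" for c
  proof -
    let ?Y = "?X - mat c"
    have Y: "?Y *v v = ?X *v v - c *s v" for v
    proof -
      have "(if i = j then c else 0) * v $ j = (if i = j then c * v $ j else 0)" for i j by simp
      then have "mat c *v v = c *s v"
        by (simp add: matrix_vector_mult_def mat_def vec_eq_iff)
      then show ?thesis by (simp add: matrix_vector_mult_diff_rdistrib)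
    qed
    have "\<forall>v. ?Y *v v = 0 \<longrightarrow> v = 0" using that unfolding Y spec by auto
    then obtain Z where Z: "Z ** ?Y = mat 1" by (auto simp: matrix_left_invertible_ker[symmetric])
    then have YZ: "?Y ** Z = mat 1" by (simp add: matrix_left_right_inverse)
    have bl: "bounded_linear (\<lambda>v :: complex^'n. Z *v v)" by (rule matrix_vector_mul_bounded_linear)
    then have lin: "linear (\<lambda>v :: complex^'n. Z *v v)" by (rule bounded_linear.linear)
    show ?thesis unfolding solv_def
    proof (intro exI[of _ "onorm (\<lambda>v. Z *v v)"] conjI onorm_pos_le[OF bl] allI impI)
      fix i K Q assume Q: "multilinear j Q" "cmlb j i K Q"
      have "?X *v (Z *v q) - c *s (Z *v q) = q" for q
      proof -
        have "?X *v (Z *v q) - c *s (Z *v q) = ?Y *v (Z *v q)" by (rule Y[symmetric])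
        also have "\<dots> = q" using YZ by (simp add: matrix_vector_mul_assoc del: matrix_vector_mult_diff_rdistrib)
        finally show ?thesis .
      qed
      moreover have "cmlb j i (onorm (\<lambda>v. Z *v v) * K) (\<lambda>vs. Z *v Q vs)"
        using Q(2) unfolding cmlb_def mult.assoc
        by (blast intro: order_trans[OF onorm[OF bl]] mult_left_mono onorm_pos_le[OF bl])
      ultimately show "\<exists>P. multilinear j P \<and> cmlb j i (onorm (\<lambda>v. Z *v v) * K) P \<and>
          (\<forall>vs. length vs = j \<longrightarrow> sylv ?X A 0 c P vs = Q vs)"
        using multilinear_compose[OF lin Q(1)]
        by (intro exI[of _ "\<lambda>vs. Z *v Q vs"]) (auto simp: sylv_def slots_def)
    qed
  qed
  have step: "solv (Suc k) c" if k: "k < j" and IH: "\<And>\<mu>. \<mu> \<in> Spec a \<Longrightarrow> solv k (c * \<mu>)" for k c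
  proof -
    \<comment> \<open>Backward induction along \<open>\<mu>s\<close>, with the factors in
      \<open>pre\<close> applied to the right-hand side: for the full list this side vanishes and
      \<open>0\<close> is a solution, for the empty list it is \<open>Q\<close>.\<close>
    have "\<exists>C\<ge>0. \<forall>i K Q. multilinear j Q \<longrightarrow> cmlb j i K Q \<longrightarrow>
      (\<exists>P. multilinear j P \<and> cmlb j i (C * K) P \<and> (\<forall>vs. length vs = j \<longrightarrow> sylv ?X A (Suc k) c P vs = factors A k pre Q vs))"
      if "pre @ post = \<mu>s" for pre post
      using that
    proof (induction post arbitrary: pre)
      case Nil
      then have "factors A k pre Q vs = 0" if "multilinear j Q" "length vs = j"
        for Q :: "('m, 'n) linf list \<Rightarrow> complex^'n" and vs
        using factors_annihilate[OF a A kill that k] by simp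
      then show ?case
        by (intro exI[of _ 0]) (auto simp: sylv_def slots_def cmlb_def intro!: exI[of _ "\<lambda>_. 0"])
    next
      case (Cons \<mu> post)
      then have "\<mu> \<in> Spec a" using \<mu>s by auto
      from IH[OF this] obtain C1 where C1: "0 \<le> C1"
        "\<And>i K Q. multilinear j Q \<Longrightarrow> cmlb j i K Q \<Longrightarrow>
          \<exists>P. multilinear j P \<and> cmlb j i (C1 * K) P \<and> (\<forall>vs. length vs = j \<longrightarrow> sylv ?X A k (c * \<mu>) P vs = Q vs)"
        unfolding solv_def by blast
      obtain C2 where C2: "0 \<le> C2"
        "\<And>i K Q. multilinear j Q \<Longrightarrow> cmlb j i K Q \<Longrightarrow>
          \<exists>P. multilinear j P \<and> cmlb j i (C2 * K) P \<and> (\<forall>vs. length vs = j \<longrightarrow> sylv ?X A (Suc k) c P vs = factors A k (pre @ [\<mu>]) Q vs)"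
        using Cons.IH[of "pre @ [\<mu>]"] Cons.prems by auto
      obtain c3 where c3: "0 \<le> c3" "\<And>i K P. multilinear j P \<Longrightarrow> cmlb j i K P \<Longrightarrow> cmlb j i (c3 * K) (factors A k pre P)"
        using factors[OF multilinear_zero k, of pre] by blast
      show ?case
      proof (intro exI[of _ "c3 * C1 + C2 * (cmod c * C1)"] conjI allI impI)
        show "0 \<le> c3 * C1 + C2 * (cmod c * C1)" using C1 C2 c3 by simp
        fix i K Q assume Q: "multilinear j Q" "cmlb j i K Q"
        obtain P' where P': "multilinear j P'" "cmlb j i (C1 * K) P'"
          "\<And>vs. length vs = j \<Longrightarrow> sylv ?X A k (c * \<mu>) P' vs = Q vs" using C1(2)[OF Q] by blast
        \<comment> \<open>\<open>P'\<close> solves the equation with \<open>\<mu>\<close> in place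
          of slot \<open>k\<close>. Its error is \<open>factor A k \<mu> Q2\<close>; after
          \<open>pre\<close> it carries one factor more than before, so the induction hypothesis
          supplies the correction \<open>P2\<close>.\<close>
        define Q2 where "Q2 vs = c *s slots A k P' vs" for vs
        have Q2: "multilinear j Q2" "cmlb j i (cmod c * (C1 * K)) Q2"
          using multilinear_compose[OF linear_complex_scale] slots[OF P'(1), of k] P'(2) k cmlb_scale
          unfolding Q2_def[abs_def] by auto
        obtain P2 where P2: "multilinear j P2" "cmlb j i (C2 * (cmod c * (C1 * K))) P2"
          "\<And>vs. length vs = j \<Longrightarrow> sylv ?X A (Suc k) c P2 vs = factors A k (pre @ [\<mu>]) Q2 vs"
          using C2(2)[OF Q2] by blast
        let ?P = "\<lambda>vs. factors A k pre P' vs + P2 vs"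
        have "sylv ?X A (Suc k) c ?P vs = factors A k pre Q vs" if vs: "length vs = j" for vs
        proof -
          have "sylv ?X A (Suc k) c (factors A k pre P') vs = factors A k pre (sylv ?X A (Suc k) c P') vs"
            by (rule sylv_factors[OF vs k])
          also have "\<dots> = factors A k pre (\<lambda>vs. Q vs - factor A k \<mu> Q2 vs) vs"
            using P'(3) by (intro factors_cong[OF _ vs]) (simp add: sylv_step[OF _ k, where \<mu> = \<mu>] Q2_def[abs_def])
          also have "\<dots> = factors A k pre Q vs - factors A k (pre @ [\<mu>]) Q2 vs"
          proof -
            have com: "factors A k pre (factor A k \<mu> R) = factor A k \<mu> (factors A k pre R)" for R
            proof (induction pre arbitrary: R)
              case (Cons \<nu> pre)
              have "factor A k \<nu> (factor A k \<mu> R) = factor A k \<mu> (factor A k \<nu> R)"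
                by (rule ext) (simp add: factor_def slot_def vec.scale_right_diff_distrib vector_smult_assoc mult.commute algebra_simps)
              then show ?case using Cons by simp
            qed simp
            show ?thesis by (simp add: factors_diff factors_append com)
          qed
          finally show ?thesis using P2(3)[OF vs] by (simp add: sylv_add)
        qed
        moreover have "multilinear j ?P" using factors[OF P'(1) k] P2(1) by (intro multilinear_add) auto
        moreover have "cmlb j i ((c3 * C1 + C2 * (cmod c * C1)) * K) ?P"
          using cmlb_add[OF c3(2)[OF P'(1,2)] P2(2)] by (simp add: algebra_simps)
        ultimately show "\<exists>P. multilinear j P \<and> cmlb j i ((c3 * C1 + C2 * (cmod c * C1)) * K) P \<and>
            (\<forall>vs. length vs = j \<longrightarrow> sylv ?X A (Suc k) c P vs = factors A k pre Q vs)" by blast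
      qed
    qed
    from this[of "[]" \<mu>s] show ?thesis unfolding solv_def by simp
  qed
  have "solv k (prod_list \<nu>s)" if "k \<le> j" "length \<nu>s = j - k" "set \<nu>s \<subseteq> Spec a" for k \<nu>s
    using that
  proof (induction k arbitrary: \<nu>s)
    case 0
    then show ?case using nonres base by simp
  next
    case (Suc k)
    show ?case
    proof (rule step)
      fix \<mu> assume "\<mu> \<in> Spec a"
      then show "solv k (prod_list \<nu>s * \<mu>)"
        using Suc.IH[of "\<mu> # \<nu>s"] Suc.prems by (simp add: mult.commute)
    qed (use Suc.prems in simp)
  qed
  from this[of j "[]"] show ?thesis by (simp add: solv_def)
qed

text \<open>The complexified equation is solved at each node separately, and real parts are taken,
  which commute with the real matrix of \<open>a\<close>. As the bounds are uniform in the node, the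
  values form a bounded family and satisfy the weighted estimates.\<close>

lemma sylvester:
  fixes a :: "real^'n \<Rightarrow> real^'n" and A :: "('m, 'n) linf \<Rightarrow> ('m, 'n) linf"
  assumes a: "linear a" and A: "\<And>x i. apply_bcontfun (A x) i = a (apply_bcontfun x i)"
    and contr: "\<And>y. N (a y) \<le> N y"
    and nonres: "\<And>\<mu>s. length \<mu>s = j \<Longrightarrow> set \<mu>s \<subseteq> Spec a \<Longrightarrow> prod_list \<mu>s \<notin> Spec a"
  shows "\<exists>C\<ge>0. \<forall>K Q. multilinear j Q \<longrightarrow> mlb j K Q \<longrightarrow>
    (\<exists>P. multilinear j P \<and> mlb j (C * K) P \<and> (\<forall>vs. length vs = j \<longrightarrow> A (P vs) - P (map A vs) = Q vs))"
proof -
  obtain C where C: "0 \<le> C" "\<And>i K Q. multilinear j Q \<Longrightarrow> cmlb j i K Q \<Longrightarrow>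
      \<exists>P. multilinear j P \<and> cmlb j i (C * K) P \<and> (\<forall>vs. length vs = j \<longrightarrow> sylv (cmat a) A j 1 P vs = Q vs)"
    using sylvester_complex[OF a A contr nonres] by blast
  have re_lin: "linear (\<lambda>z :: complex^'n. \<chi> s. Re (z $ s))" by (rule linearI) (simp_all add: vec_eq_iff)
  have re_norm: "norm (\<chi> s. Re (z $ s)) \<le> norm z" for z :: "complex^'n"
    unfolding norm_vec_def by (intro L2_set_mono) (auto simp: abs_Re_le_cmod)
  have cplx_lin: "linear (cplx :: real^'n \<Rightarrow> complex^'n)" by (rule linearI) (simp_all add: cplx_def vec_eq_iff scaleR_conv_of_real[where 'a = complex])
  have cplx_norm: "norm (cplx y) = norm y" for y :: "real^'n" by (simp add: cplx_def norm_vec_def)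
  show ?thesis
  proof (intro exI[of _ "hi * (C / lo)"] conjI allI impI)
    show "0 \<le> hi * (C / lo)" using C(1) lo_hi by simp
    fix K and Q :: "('m, 'n) linf list \<Rightarrow> ('m, 'n) linf" assume Q: "multilinear j Q" "mlb j K Q"
    have "\<exists>P. multilinear j P \<and> cmlb j i (C * (K / lo)) P \<and>
        (\<forall>vs. length vs = j \<longrightarrow> sylv (cmat a) A j 1 P vs = cplx (apply_bcontfun (Q vs) i))" for i
    proof (rule C(2))
      show "multilinear j (\<lambda>vs. cplx (apply_bcontfun (Q vs) i))"
        by (intro multilinear_compose[OF cplx_lin] multilinear_compose[OF bounded_linear.linear[OF bounded_linear_component] Q(1)])
      show "cmlb j i (K / lo) (\<lambda>vs. cplx (apply_bcontfun (Q vs) i))"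
        unfolding cmlb_def cplx_norm
      proof (intro ballI allI impI)
        fix \<omega> cs and vs :: "('m, 'n) linf list" assume "\<omega> \<in> W" "length vs = j" "pf \<omega> cs vs"
        then have "lo * norm (apply_bcontfun (Q vs) i) \<le> K * prod_list cs * \<omega> i"
          using mlbD[OF Q(2)] order_trans[OF lo_hi(3)] unfolding wb_def by blast
        then show "norm (apply_bcontfun (Q vs) i) \<le> K / lo * (prod_list cs * \<omega> i)"
          using lo_hi(1) by (simp add: field_simps)
      qed
    qed
    then obtain P where P: "\<And>i. multilinear j (P i)" "\<And>i. cmlb j i (C * (K / lo)) (P i)"
      "\<And>i vs. length vs = j \<Longrightarrow> sylv (cmat a) A j 1 (P i) vs = cplx (apply_bcontfun (Q vs) i)" by metis
    let ?re = "\<lambda>z :: complex^'n. \<chi> s. Re (z $ s)"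
    define R where "R vs = Bcontfun (\<lambda>i. ?re (P i vs))" for vs
    have R: "apply_bcontfun (R vs) i = ?re (P i vs)" if vs: "length vs = j" for vs i
    proof -
      have "norm (?re (P i vs)) \<le> C * (K / lo) * (prod_list (map nm vs) * 1)" for i
      proof -
        have "pf one (map nm vs) vs" by (rule pf_one) (simp_all add: wb_nm)
        then have "norm (P i vs) \<le> C * (K / lo) * (prod_list (map nm vs) * 1)"
          using P(2)[of i] one_W vs unfolding cmlb_def by blast
        then show ?thesis using re_norm order_trans by blast
      qed
      then have "(\<lambda>i. ?re (P i vs)) \<in> bcontfun"
        unfolding bounded_family bounded_iff by auto
      then show ?thesis by (simp add: R_def Bcontfun_inverse)
    qed
    have "multilinear j R"
      unfolding multilinear_def
    proof (intro allI impI)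
      fix vs :: "('m, 'n) linf list" and p assume vs: "length vs = j" and p: "p < j"
      have l: "linear (\<lambda>w. ?re (P i (vs[p := w])))" for i
        by (rule multilinearD[OF multilinear_compose[OF re_lin P(1)] vs p])
      show "linear (\<lambda>w. R (vs[p := w]))"
        using vs by (intro linearI bcontfun_eqI) (simp_all add: R linear_add[OF l] linear_scale[OF l])
    qed
    moreover have "mlb j (hi * (C / lo) * K) R"
      unfolding mlb_def wb_def
    proof (intro ballI allI impI)
      fix \<omega> cs i and vs :: "('m, 'n) linf list" assume \<omega>: "\<omega> \<in> W" and vs: "length vs = j" and pf: "pf \<omega> cs vs"
      have "norm (?re (P i vs)) \<le> C * (K / lo) * (prod_list cs * \<omega> i)"
        using P(2)[of i] \<omega> vs pf re_norm order_trans unfolding cmlb_def by blast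
      then have "hi * norm (apply_bcontfun (R vs) i) \<le> hi * (C * (K / lo) * (prod_list cs * \<omega> i))"
        unfolding R[OF vs] using lo_hi(2) by (intro mult_left_mono) auto
      then show "N (apply_bcontfun (R vs) i) \<le> hi * (C / lo) * K * prod_list cs * \<omega> i"
        using order_trans[OF lo_hi(4)] by (simp add: mult_ac)
    qed
    moreover have "A (R vs) - R (map A vs) = Q vs" if vs: "length vs = j" for vs
    proof (rule bcontfun_eqI)
      fix i
      have "cplx (apply_bcontfun (Q vs) i) = cmat a *v P i vs - P i (map A vs)"
        using P(3)[OF vs, of i] vs by (simp add: sylv_def slots_def)
      then have "?re (cplx (apply_bcontfun (Q vs) i)) = ?re (cmat a *v P i vs) - ?re (P i (map A vs))"
        by (simp add: vec_eq_iff)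
      moreover have "?re (cplx y) = y" for y by (simp add: cplx_def vec_eq_iff)
      ultimately show "apply_bcontfun (A (R vs) - R (map A vs)) i = apply_bcontfun (Q vs) i"
        using vs by (simp add: A R Re_cmat[OF a])
    qed
    ultimately show "\<exists>P. multilinear j P \<and> mlb j (hi * (C / lo) * K) P \<and>
        (\<forall>vs. length vs = j \<longrightarrow> A (P vs) - P (map A vs) = Q vs)" by blast
  qed
qed

end

section \<open>Local conjugacy\<close>

lemma multilinear_permute:
  assumes A: "multilinear j A" and \<sigma>: "\<sigma> permutes {..<j}"
  shows "multilinear j (\<lambda>vs. A (permute_list \<sigma> vs))"
  unfolding multilinear_def
proof (intro allI impI)
  fix vs :: "'a list" and p assume vs: "length vs = j" and p: "p < j"
  let ?q = "inv \<sigma> p"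
  have q: "?q < j" using permutes_in_image[OF permutes_inv[OF \<sigma>], of p] p by simp
  have "permute_list \<sigma> (vs[p := w]) = (permute_list \<sigma> vs)[?q := w]" for w
  proof (rule nth_equalityI)
    fix i assume "i < length (permute_list \<sigma> (vs[p := w]))"
    then have i: "i < j" using vs by simp
    have "\<sigma> i < j" using permutes_in_image[OF \<sigma>, of i] i by simp
    moreover have "p = \<sigma> i \<longleftrightarrow> ?q = i" using permutes_inverses[OF \<sigma>] by metis
    ultimately show "permute_list \<sigma> (vs[p := w]) ! i = (permute_list \<sigma> vs)[?q := w] ! i"
      using i vs \<sigma> by (auto simp: permute_list_nth nth_list_update)
  qed simp
  then show "linear (\<lambda>w. A (permute_list \<sigma> (vs[p := w])))"
    using multilinearD[OF A, of "permute_list \<sigma> vs" ?q] vs q by simp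
qed

text \<open>The homological equation is solved without regard to symmetry, but
  \<open>poly_jet\<close> needs a symmetric map. Averaging respects the equation, whose operator
  commutes with permutations of the arguments and whose right-hand side is symmetric.\<close>

definition symmetrize :: "nat \<Rightarrow> ('a list \<Rightarrow> 'b::real_vector) \<Rightarrow> 'a list \<Rightarrow> 'b" where
  "symmetrize j A vs = (1 / fact j) *\<^sub>R (\<Sum>\<sigma> | \<sigma> permutes {..<j}. A (permute_list \<sigma> vs))"

lemma symm_symmetrize: "symm j (symmetrize j A)"
  unfolding symm_def
proof (intro allI impI)
  fix vs ws :: "'a list" assume vs: "length vs = j" and m: "mset vs = mset ws"
  have ws: "length ws = j" using vs m by (metis size_mset)
  obtain \<tau> where \<tau>: "\<tau> permutes {..<j}" "permute_list \<tau> ws = vs"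
    using mset_eq_permutation[OF m] ws by metis
  have "(\<Sum>\<sigma> | \<sigma> permutes {..<j}. A (permute_list \<sigma> vs)) = (\<Sum>\<sigma> | \<sigma> permutes {..<j}. A (permute_list (\<tau> \<circ> \<sigma>) ws))"
    using permute_list_compose[of _ ws \<tau>] \<tau> ws by (intro sum.cong) auto
  also have "\<dots> = (\<Sum>\<sigma> | \<sigma> permutes {..<j}. A (permute_list \<sigma> ws))"
    by (rule setum_permutations_compose_left[OF \<tau>(1), of "\<lambda>\<sigma>. A (permute_list \<sigma> ws)", symmetric])
  finally show "symmetrize j A vs = symmetrize j A ws" by (simp add: symmetrize_def)
qed

lemma symmetrize_symm: assumes "symm j A" "length vs = j" shows "symmetrize j A vs = A vs"
proof -
  have "(\<Sum>\<sigma> | \<sigma> permutes {..<j}. A (permute_list \<sigma> vs)) = (\<Sum>\<sigma> | \<sigma> permutes {..<j}. A vs)"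
    using assms by (intro sum.cong refl symmD[OF assms(1)]) auto
  also have "\<dots> = fact j *\<^sub>R A vs"
    by (simp add: sum_constant_scaleR card_permutations[of "{..<j}" j])
  finally show ?thesis by (simp add: symmetrize_def)
qed

lemma multilinear_symmetrize: "multilinear j A \<Longrightarrow> multilinear j (symmetrize j A)"
  unfolding symmetrize_def[abs_def]
  by (intro multilinear_scaleR multilinear_sum multilinear_permute) auto

lemma cmp_add: "cmp (\<lambda>j x vs. G j x vs + H j x vs) F j x vs = cmp G F j x vs + cmp H F j x vs"
  by (simp add: cmp_def sum_list_addf)

context weights
begin

lemma mlb_permute:
  assumes A: "mlb j K A" and \<sigma>: "\<sigma> permutes {..<j}"
  shows "mlb j K (\<lambda>vs. A (permute_list \<sigma> vs))"
  unfolding mlb_def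
proof (intro ballI allI impI)
  fix \<omega> cs and vs :: "('m, 'n) linf list" assume \<omega>: "\<omega> \<in> W" and vs: "length vs = j" and pf: "pf \<omega> cs vs"
  have cs: "length cs = j" using pf vs by (simp add: pf_def)
  have \<sigma>i: "\<sigma> i < j" if "i < j" for i using permutes_in_image[OF \<sigma>, of i] that by simp
  have "pf \<omega> (permute_list \<sigma> cs) (permute_list \<sigma> vs)"
  proof (cases "\<omega> = one \<and> (\<forall>q<j. wb one (cs ! q) (vs ! q))")
    case True
    then show ?thesis using \<sigma> \<sigma>i vs cs unfolding pf_def by (auto simp: permute_list_nth)
  next
    case False
    then obtain p where p: "p < j" "wb \<omega> (cs ! p) (vs ! p)" "\<And>q. q < j \<Longrightarrow> q \<noteq> p \<Longrightarrow> wb one (cs ! q) (vs ! q)"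
      using pf vs unfolding pf_def by auto
    let ?q = "inv \<sigma> p"
    have q: "?q < j" using permutes_in_image[OF permutes_inv[OF \<sigma>], of p] p by simp
    have sq: "\<sigma> ?q = p" "\<And>i. i \<noteq> ?q \<Longrightarrow> \<sigma> i \<noteq> p" using permutes_inverses[OF \<sigma>] by metis+
    show ?thesis unfolding pf_def
      using p q sq \<sigma> \<sigma>i vs cs by (intro conjI disjI2 exI[of _ ?q]) (auto simp: permute_list_nth)
  qed
  from mlbD[OF A \<omega> _ this] vs have "wb \<omega> (K * prod_list (permute_list \<sigma> cs)) (A (permute_list \<sigma> vs))" by simp
  moreover have "mset (permute_list \<sigma> cs) = mset cs" using \<sigma> cs by simp
  then have "prod_list (permute_list \<sigma> cs) = prod_list cs" by (metis prod_mset_prod_list)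
  ultimately show "wb \<omega> (K * prod_list cs) (A (permute_list \<sigma> vs))" by simp
qed

lemma mlb_symmetrize:
  assumes "mlb j K A" shows "mlb j K (symmetrize j A)"
proof -
  have "mlb j (\<bar>1 / fact j\<bar> * (\<Sum>\<sigma> | \<sigma> permutes {..<j}. K)) (symmetrize j A)"
    unfolding symmetrize_def[abs_def] by (intro mlb_scale mlb_sum mlb_permute[OF assms]) simp
  then show ?thesis
    by (rule mlb_eq) (simp_all add: card_permutations[of "{..<j}" j])
qed

lemma pf_append_replicate:
  assumes "pf \<omega> cs vs" "wb one c x" shows "pf \<omega> (cs @ replicate k c) (vs @ replicate k x)"
proof -
  have "pf \<omega> (cs @ [c]) (vs @ [x])" if "pf \<omega> cs vs" for cs vs
    using that assms(2) unfolding pf_def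
    by (auto simp: nth_append less_Suc_eq intro: exI[of _ "_ :: nat"])
  then show ?thesis using assms(1)
    by (induction k) (auto simp: replicate_append_same[symmetric] simp flip: append_assoc)
qed

lemma mlb_poly_jet:
  assumes S: "mlb k K S" "0 \<le> K" and x: "nm x \<le> 1"
  shows "mlb i K (poly_jet S k i x)"
proof (cases "i \<le> k")
  case True
  have "mlb i K (\<lambda>vs. S (vs @ replicate (k - i) x))"
    unfolding mlb_def
  proof (intro ballI allI impI)
    fix \<omega> cs and vs :: "('m, 'n) linf list" assume \<omega>: "\<omega> \<in> W" and vs: "length vs = i" and pf: "pf \<omega> cs vs"
    have "pf \<omega> (cs @ replicate (k - i) 1) (vs @ replicate (k - i) x)"
      using x by (intro pf_append_replicate[OF pf]) (simp add: nm_le_iff[symmetric])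
    from mlbD[OF S(1) \<omega> _ this] vs True
    show "wb \<omega> (K * prod_list cs) (S (vs @ replicate (k - i) x))" by (simp add: prod_list_replicate)
  qed
  from mlb_scale[OF this, of "1 / fact (k - i)"] have "mlb i (\<bar>1 / fact (k - i)\<bar> * K) (poly_jet S k i x)"
    using True by (simp add: poly_jet_def[abs_def])
  moreover have "\<bar>1 / fact (k - i)\<bar> * K \<le> K" using divide_fact_le[OF S(2), of "k - i"] by simp
  ultimately show ?thesis by (rule mlb_mono)
qed (use S(2) in \<open>auto simp: poly_jet_def[abs_def] intro: mlb_mono[OF mlb_zero]\<close>)

text \<open>\<open>F\<close> minus its linear part vanishes to second order at \<open>0\<close>; by
  the Taylor estimate it is absorbed, on a small ball, by the gap between \<open>\<beta>0\<close>
  and \<open>\<beta>\<close>.\<close>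

lemma jet_small:
  assumes F: "jet r {x. nm x < \<rho>} F" and r: "2 \<le> r" and \<rho>: "0 < \<rho>"
    and M: "linear M" "lb \<beta>0 M" "\<beta>0 < \<beta>"
    and F0: "F 0 0 [] = 0" and F1: "\<And>h. F 1 0 [h] = M h"
    and K: "\<And>x. nm x < \<rho> \<Longrightarrow> mlb 2 K (F 2 x)" "0 \<le> K"
  obtains \<rho>' where "0 < \<rho>'" "\<rho>' \<le> \<rho>" "\<rho>' \<le> 1"
    "\<And>x. nm x < \<rho>' \<Longrightarrow> nm (F 0 x []) \<le> \<beta> * nm x" "\<And>x. nm x < \<rho>' \<Longrightarrow> mlb 1 \<beta> (F 1 x)"
proof -
  let ?V = "{x. nm x < \<rho>}"
  have bM: "bounded_linear M" by (rule lb_bounded_linear[OF M(1,2)])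
  define S where "S = (\<lambda>vs :: ('m, 'n) linf list. M (hd vs))"
  have hd: "multilinear 1 (hd :: ('m, 'n) linf list \<Rightarrow> _)" unfolding multilinear_def by (auto simp: length_Suc_conv linear_id[unfolded id_def])
  have "mlb 1 \<beta>0 S" unfolding mlb_1_iff S_def using M(2) by simp
  then have S: "multilinear 1 S" "mlb 1 \<beta>0 S" "symm 1 S"
    using multilinear_compose[OF M(1) hd] by (auto simp: S_def symm_def length_Suc_conv)
  define G where "G = (\<lambda>j x vs. F j x vs - poly_jet S 1 j x vs)"
  have pj: "poly_jet S 1 0 x [] = M x" "poly_jet S 1 1 x [h] = M h" "poly_jet S 1 2 x vs = 0" for x h vs
    by (simp_all add: poly_jet_def S_def)
  have G: "jet r ?V G"
    unfolding G_def by (rule jet_diff[OF F jet_subset[OF jet_poly_jet[OF S(1) mlb_opb[OF S(2)] S(3)]]]) simp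
  have flat: "mlb i (K * C0 ^ (2 - i) * nm x ^ (2 - i)) (G i x)" if "i \<le> 2" "nm x < \<rho>" for i x
  proof (rule jet_flat[OF G convex_nm_ball _ r K(2)])
    show "G i 0 vs = 0" if "i < 2" "length vs = i" for i vs
      using that by (auto simp: less_2_cases_iff G_def F0 F1[simplified] pj pj[simplified] linear_0[OF M(1)] length_Suc_conv)
    show "mlb 2 K (G 2 y)" if "y \<in> ?V" for y using K(1)[of y] that by (simp add: G_def pj[simplified])
  qed (use that \<rho> in auto)
  \<comment> \<open>Dominates the Taylor constants of the orders \<open>0\<close> and
    \<open>1\<close>; \<open>e\<close> then keeps \<open>c * nm x\<close> below the gap.\<close>
  define c where "c = K * (C0 + C0\<^sup>2)"
  have c: "0 \<le> c" "K * C0 \<le> c" "K * C0\<^sup>2 \<le> c" using K(2) C0_pos by (auto simp: c_def intro!: mult_left_mono)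
  obtain e where e: "0 < e" "e * c \<le> \<beta> - \<beta>0" using small_multiple[of "\<beta> - \<beta>0" c] M(3) c by auto
  define \<rho>' where "\<rho>' = min \<rho> (min 1 e)"
  show ?thesis
  proof (rule that)
    show "0 < \<rho>'" "\<rho>' \<le> \<rho>" "\<rho>' \<le> 1" using \<rho> e by (auto simp: \<rho>'_def)
    fix x assume x: "nm x < \<rho>'"
    then have x': "nm x < \<rho>" "nm x \<le> 1" "nm x \<le> e" by (auto simp: \<rho>'_def)
    have cx: "c * nm x \<le> \<beta> - \<beta>0" using e(2) mult_left_mono[OF x'(3) c(1)] by (simp add: mult.commute)
    have "mlb 1 (K * C0 * nm x) (G 1 x)" using flat[of 1 x] x' by simp
    from mlb_add[OF this mlb_cong[OF S(2)], of "poly_jet S 1 1 x"]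
    have "mlb 1 (K * C0 * nm x + \<beta>0) (\<lambda>vs. G 1 x vs + poly_jet S 1 1 x vs)" by (simp add: poly_jet_def)
    then have "mlb 1 (K * C0 * nm x + \<beta>0) (F 1 x)" by (simp add: G_def)
    moreover have "K * C0 * nm x \<le> c * nm x" using c by (intro mult_right_mono) auto
    ultimately show "mlb 1 \<beta> (F 1 x)" by (elim mlb_mono) (use cx in linarith)
    have "mlb 0 (K * C0\<^sup>2 * (nm x)\<^sup>2) (G 0 x)" using flat[of 0 x] x' by simp
    from mlbD[OF this one_W, of "[]" "[]"] have "nm (G 0 x []) \<le> K * C0\<^sup>2 * (nm x)\<^sup>2"
      by (simp add: pf_def nm_le_iff)
    also have "\<dots> \<le> c * (nm x * 1 * nm x)"
      using c(3) by (auto simp: power2_eq_square mult.assoc[symmetric] intro!: mult_right_mono)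
    also have "\<dots> = (c * nm x) * nm x" by simp
    also have "\<dots> \<le> (\<beta> - \<beta>0) * nm x" using cx by (intro mult_right_mono) auto
    finally have "nm (G 0 x []) + nm (M x) \<le> (\<beta> - \<beta>0) * nm x + \<beta>0 * nm x"
      using lb_nm[OF M(2), of x] by (intro add_mono)
    moreover have "F 0 x [] = G 0 x [] + M x" by (simp add: G_def pj[simplified])
    ultimately show "nm (F 0 x []) \<le> \<beta> * nm x" using nm_triangle[of "G 0 x []" "M x"] by (simp add: algebra_simps)
  qed
qed

text \<open>Adding a homogeneous polynomial of degree \<open>Suc m\<close> leaves the jet of the
  defect at \<open>0\<close> unchanged up to order \<open>m\<close>, since the lower derivatives of
  the polynomial vanish there. In order \<open>Suc m\<close> it adds
  \<open>L (S (map M vs)) - S vs\<close>, as the higher derivatives of \<open>F\<close> meet only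
  vanishing derivatives. Cancelling the defect, after applying \<open>M\<close>, is the homological
  equation with right-hand side \<open>G\<close>.\<close>

lemma formal_conjugacy:
  assumes F: "jet r {x. nm x < \<rho>} F" and q: "q \<le> r" and \<rho>: "0 < \<rho>" "\<rho> \<le> 1"
    and M: "linear M" "lb \<beta>0 M" and L: "linear L" "lb l L" "\<And>x. M (L x) = x" "\<And>x. L (M x) = x"
    and F0: "F 0 0 [] = 0" and F1: "\<And>h. F 1 0 [h] = M h"
    and FV: "\<And>x. nm x < \<rho> \<Longrightarrow> nm (F 0 x []) < \<rho>"
    and K: "\<And>k x. 1 \<le> k \<Longrightarrow> k \<le> r \<Longrightarrow> nm x < \<rho> \<Longrightarrow> mlb k K (F k x)" "1 \<le> K"
    and sylv: "\<And>j. 2 \<le> j \<Longrightarrow> j < q \<Longrightarrow> \<exists>C\<ge>0. \<forall>K Q. multilinear j Q \<longrightarrow> mlb j K Q \<longrightarrow>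
      (\<exists>P. multilinear j P \<and> mlb j (C * K) P \<and> (\<forall>vs. length vs = j \<longrightarrow> M (P vs) - P (map M vs) = Q vs))"
    and m: "1 \<le> m" "m < q"
  shows "\<exists>P B. jet r {x. nm x < \<rho>} P \<and> 0 \<le> B \<and> (\<forall>j\<le>r. \<forall>x. nm x < \<rho> \<longrightarrow> mlb j B (P j x)) \<and> P 0 0 [] = 0 \<and>
    (\<forall>h. P 1 0 [h] = h) \<and> (\<forall>i\<le>m. \<forall>vs. length vs = i \<longrightarrow> L (cmp P F i 0 vs) = P i 0 vs)"
  using m
proof (induction m rule: dec_induct)
  case base
  have hd: "multilinear 1 (hd :: ('m, 'n) linf list \<Rightarrow> _)" "mlb 1 1 hd" "symm 1 (hd :: ('m, 'n) linf list \<Rightarrow> _)"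
    unfolding mlb_1_iff lb_def symm_def multilinear_def by (auto simp: length_Suc_conv linear_id[unfolded id_def])
  let ?P = "poly_jet hd 1 :: nat \<Rightarrow> ('m, 'n) linf \<Rightarrow> ('m, 'n) linf list \<Rightarrow> ('m, 'n) linf"
  have P: "?P 0 x [] = x" "?P (Suc 0) x [h] = h" for x h by (simp_all add: poly_jet_def)
  have "jet r {x. nm x < \<rho>} ?P"
    by (rule jet_subset[OF jet_poly_jet[OF hd(1) mlb_opb[OF hd(2)] hd(3)]]) simp
  moreover have "\<forall>j\<le>r. \<forall>x. nm x < \<rho> \<longrightarrow> mlb j 1 (?P j x)"
    using mlb_poly_jet[OF hd(2)] \<rho> by simp
  moreover have "L (cmp ?P F i 0 vs) = ?P i 0 vs" if i: "i \<le> 1" "length vs = i" for i vs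
  proof (cases "i = 0")
    case True
    then show ?thesis using i linear_0[OF L(1)] by (simp add: cmp_0 P[simplified] F0)
  next
    case False
    then have "i = 1" using i by simp
    then obtain v where v: "vs = [v]" "i = 1" using i by (auto simp: length_Suc_conv)
    have "cmp ?P F 1 0 [v] = M v"
      using F1 by (simp add: cmp_split[of "[v]" 1, simplified] P[simplified] F0)
    then show ?thesis using v L(4) P(2) by simp
  qed
  ultimately show ?case by (intro exI[of _ ?P] exI[of _ 1]) (simp add: P[simplified])
next
  case (step m)
  let ?V = "{x. nm x < \<rho>}" and ?j = "Suc m"
  obtain P B where P: "jet r ?V P" "0 \<le> B" "\<And>j x. j \<le> r \<Longrightarrow> nm x < \<rho> \<Longrightarrow> mlb j B (P j x)"
      "P 0 0 [] = 0" "\<And>h. P 1 0 [h] = h" "\<And>i vs. i \<le> m \<Longrightarrow> length vs = i \<Longrightarrow> L (cmp P F i 0 vs) = P i 0 vs"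
    using step by (metis Suc_lessD)
  have jr: "?j \<le> r" using step q by simp
  have zV: "0 \<in> ?V" using \<rho> by simp
  have bL: "bounded_linear L" by (rule lb_bounded_linear[OF L(1,2)])
  have cj: "jet r ?V (\<lambda>j x vs. L (cmp P F j x vs))"
    using FV by (intro jet_compose[OF bL] jet_cmp[OF open_nm_ball open_nm_ball P(1) F]) auto
  define G where "G vs = M (L (cmp P F ?j 0 vs) - P ?j 0 vs)" for vs
  have sy: "symm ?j G"
    using jet_symm[OF cj open_nm_ball jr zV] jet_symm[OF P(1) open_nm_ball jr zV]
    unfolding symm_def G_def by metis
  have mlG: "multilinear ?j G"
    unfolding G_def[abs_def]
    by (intro multilinear_compose[OF M(1)] multilinear_diff jet_multilinear[OF cj jr zV] jet_multilinear[OF P(1) jr zV])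
  have bG: "\<exists>KG\<ge>0. mlb ?j KG G"
  proof -
    have "mlb ?j (real (length (parts ?j)) * (B * K ^ r)) (cmp P F ?j 0)"
    proof (rule mlb_cmp_general)
      show "\<And>k. 1 \<le> k \<Longrightarrow> k \<le> r \<Longrightarrow> mlb k K (F k 0)" using K zV by simp
      show "\<And>k. 1 \<le> k \<Longrightarrow> k \<le> r \<Longrightarrow> mlb k B (P k (F 0 0 []))" using P(3) zV by (simp add: F0)
    qed (use K P jr in auto)
    moreover have "nm 0 < \<rho>" using \<rho> by simp
    ultimately obtain KG where "mlb ?j KG G"
      unfolding G_def[abs_def] using mlb_compose[OF M(2) mlb_diff[OF mlb_compose[OF L(2)] P(3)[OF jr]]] by blast
    then show ?thesis by (intro exI[of _ "max KG 0"]) (auto elim: mlb_mono)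
  qed
  then obtain KG where KG: "0 \<le> KG" "mlb ?j KG G" by blast
  obtain C where C: "0 \<le> C" "\<And>K Q. multilinear ?j Q \<Longrightarrow> mlb ?j K Q \<Longrightarrow>
      \<exists>P. multilinear ?j P \<and> mlb ?j (C * K) P \<and> (\<forall>vs. length vs = ?j \<longrightarrow> M (P vs) - P (map M vs) = Q vs)"
    using sylv[of ?j] step by auto
  obtain S0 where S0: "multilinear ?j S0" "mlb ?j (C * KG) S0"
      "\<And>vs. length vs = ?j \<Longrightarrow> M (S0 vs) - S0 (map M vs) = G vs" using C(2)[OF mlG KG(2)] by blast
  define S where "S = symmetrize ?j S0"
  have S: "multilinear ?j S" "mlb ?j (C * KG) S" "symm ?j S"
    unfolding S_def using S0 by (auto intro: multilinear_symmetrize mlb_symmetrize symm_symmetrize)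
  have SG: "M (S vs) - S (map M vs) = G vs" if vs: "length vs = ?j" for vs
  proof -
    have "M (S vs) - S (map M vs) = (1 / fact ?j) *\<^sub>R (\<Sum>\<sigma> | \<sigma> permutes {..<?j}. M (S0 (permute_list \<sigma> vs)) - S0 (map M (permute_list \<sigma> vs)))"
      by (simp add: S_def symmetrize_def linear_scale[OF M(1)] linear_sum[OF M(1)] scaleR_diff_right
          sum_subtractf vs permute_list_map del: fact_Suc)
    also have "\<dots> = symmetrize ?j G vs" using S0(3) vs by (simp add: symmetrize_def del: fact_Suc)
    also have "\<dots> = G vs" by (rule symmetrize_symm[OF sy vs])
    finally show ?thesis .
  qed
  have pj0: "poly_jet S ?j i 0 vs = 0" if "i < ?j" "length vs = i" for i vs
    using that multilinear_eq_0[OF S(1), of "vs @ replicate (?j - i) 0"] by (simp add: poly_jet_def)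
  have cpj: "cmp (poly_jet S ?j) F i 0 vs = (if i = ?j then S (map M vs) else 0)" if i: "i \<le> ?j" "length vs = i" for i vs
  proof -
    have "(\<Sum>\<pi>\<leftarrow>filter (\<lambda>\<pi>. length \<pi> \<noteq> i) (parts i). poly_jet S ?j (length \<pi>) (F 0 0 []) (blocks F 0 vs \<pi>))
        = (\<Sum>\<pi>\<leftarrow>filter (\<lambda>\<pi>. length \<pi> \<noteq> i) (parts i). 0)"
    proof (intro arg_cong[of _ _ sum_list] map_cong refl)
      fix \<pi> assume "\<pi> \<in> set (filter (\<lambda>\<pi>. length \<pi> \<noteq> i) (parts i))"
      then have "length \<pi> < i" using parts_length[of \<pi> i] by auto
      then show "poly_jet S ?j (length \<pi>) (F 0 0 []) (blocks F 0 vs \<pi>) = 0"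
        using i by (simp add: F0 pj0)
    qed
    then have "cmp (poly_jet S ?j) F i 0 vs = poly_jet S ?j i 0 (map M vs)"
      using cmp_split[OF i(2), of "poly_jet S ?j" F 0] F1 by (simp add: F0)
    then show ?thesis using pj0[of i "map M vs"] i by (auto simp: poly_jet_def)
  qed
  let ?P = "\<lambda>i x vs. P i x vs + poly_jet S ?j i x vs"
  have "jet r ?V ?P"
    by (rule jet_add[OF P(1) jet_subset[OF jet_poly_jet[OF S(1) mlb_opb[OF S(2)] S(3)]]]) simp
  moreover have "\<forall>j\<le>r. \<forall>x. nm x < \<rho> \<longrightarrow> mlb j (B + C * KG) (?P j x)"
    using P(3) mlb_poly_jet[OF S(2)] C(1) KG(1) \<rho> by (intro allI impI mlb_add) auto
  moreover have "?P 0 0 [] = 0" "\<forall>h. ?P 1 0 [h] = h"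
    using P(4,5) pj0[of 0 "[]"] pj0[of 1 "[_]"] step by auto
  moreover have "L (cmp ?P F i 0 vs) = ?P i 0 vs" if i: "i \<le> ?j" "length vs = i" for i vs
  proof (cases "i = ?j")
    case True
    have "L (cmp ?P F i 0 vs) = L (cmp P F i 0 vs) + L (S (map M vs))"
      using cpj[OF i] True by (simp add: cmp_add linear_add[OF L(1)])
    also have "S (map M vs) = M (S vs) - G vs" using SG[of vs] i True by (simp add: algebra_simps)
    also have "L \<dots> = S vs - (L (cmp P F ?j 0 vs) - P ?j 0 vs)"
      by (simp add: linear_diff[OF L(1)] L(4) G_def)
    finally show ?thesis using True by (simp add: poly_jet_def)
  next
    case False
    then have "i < ?j" using i by simp
    then show ?thesis using cpj[OF i] P(6)[of i vs] pj0[of i vs] i False by (simp add: cmp_add linear_add[OF L(1)])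
  qed
  moreover have "0 \<le> B + C * KG" using P(2) C(1) KG(1) by simp
  ultimately show ?case by (intro exI[of _ ?P] exI[of _ "B + C * KG"]) blast
qed

text \<open>On the ball chosen by \<open>jet_small\<close>, \<open>F\<close> maps the ball into
  itself, so all compositions with iterates of \<open>F\<close> live on one domain and the series
  can be estimated there.\<close>

lemma local_conjugacy:
  assumes F: "jet r {x. nm x < \<rho>0} F" and q: "2 \<le> q" "q \<le> r" and \<rho>0: "0 < \<rho>0"
    and M: "linear M" "lb \<beta>0 M" "\<beta>0 < \<beta>" "0 \<le> \<beta>" "\<beta> \<le> 1"
    and L: "linear L" "lb l L" "0 \<le> l" "\<And>x. M (L x) = x" "\<And>x. L (M x) = x" and gap: "l * \<beta> ^ q < 1"
    and F0: "F 0 0 [] = 0" and F1: "\<And>h. F 1 0 [h] = M h"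
    and K: "\<And>k x. 1 \<le> k \<Longrightarrow> k \<le> r \<Longrightarrow> nm x < \<rho>0 \<Longrightarrow> mlb k K (F k x)" "1 \<le> K"
    and sylv: "\<And>j. 2 \<le> j \<Longrightarrow> j < q \<Longrightarrow> \<exists>C\<ge>0. \<forall>K Q. multilinear j Q \<longrightarrow> mlb j K Q \<longrightarrow>
      (\<exists>P. multilinear j P \<and> mlb j (C * K) P \<and> (\<forall>vs. length vs = j \<longrightarrow> M (P vs) - P (map M vs) = Q vs))"
  shows "\<exists>\<rho> R B. 0 < \<rho> \<and> \<rho> \<le> \<rho>0 \<and> jet r {x. nm x < \<rho>} R \<and> (\<forall>j\<le>r. \<forall>x. nm x < \<rho> \<longrightarrow> mlb j B (R j x)) \<and>
    R 0 0 [] = 0 \<and> (\<forall>h. R 1 0 [h] = h) \<and>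
    (\<forall>x. nm x < \<rho> \<longrightarrow> nm (F 0 x []) \<le> nm x \<and> R 0 (F 0 x []) [] = M (R 0 x []))"
proof -
  obtain \<rho> where \<rho>: "0 < \<rho>" "\<rho> \<le> \<rho>0" "\<rho> \<le> 1"
    and Fx: "\<And>x. nm x < \<rho> \<Longrightarrow> nm (F 0 x []) \<le> \<beta> * nm x" and F1b: "\<And>x. nm x < \<rho> \<Longrightarrow> mlb 1 \<beta> (F 1 x)"
    using jet_small[OF F _ \<rho>0 M(1-3) F0 F1, of K] K q by auto
  let ?V = "{x. nm x < \<rho>}"
  have FV: "jet r ?V F" by (rule jet_subset[OF F]) (use \<rho> in auto)
  have Fle: "nm (F 0 x []) \<le> nm x" if "nm x < \<rho>" for x
    using Fx[OF that] M(4,5) mult_right_mono[OF M(5), of "nm x"] by simp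
  then have Fin: "nm (F 0 x []) < \<rho>" if "nm x < \<rho>" for x using that by fastforce
  have KV: "mlb k K (F k x)" if "1 \<le> k" "k \<le> r" "nm x < \<rho>" for k x using K(1) that \<rho> by simp
  have bL: "bounded_linear L" by (rule lb_bounded_linear[OF L(1,2)])
  have "\<exists>P B. jet r ?V P \<and> 0 \<le> B \<and> (\<forall>j\<le>r. \<forall>x. nm x < \<rho> \<longrightarrow> mlb j B (P j x)) \<and> P 0 0 [] = 0 \<and>
      (\<forall>h. P 1 0 [h] = h) \<and> (\<forall>i\<le>q - 1. \<forall>vs. length vs = i \<longrightarrow> L (cmp P F i 0 vs) = P i 0 vs)"
    (is "\<exists>P B. ?C P B")
    by (rule formal_conjugacy[OF FV q(2) \<rho>(1,3) M(1,2) L(1,2,4,5) F0 F1 Fin KV K(2) sylv]) (use q(1) in auto)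
  then obtain P where "\<exists>B. ?C P B" ..
  then obtain B where PB: "?C P B" ..
  have P: "jet r ?V P" "0 \<le> B" "P 0 0 [] = 0" using PB by auto
  have P3: "mlb j B (P j x)" if "j \<le> r" "nm x < \<rho>" for j x using PB that by auto
  have P5: "P 1 0 [h] = h" for h using PB by auto
  have P6: "L (cmp P F i 0 vs) = P i 0 vs" if "i \<le> q - 1" "length vs = i" for i vs using PB that by auto
  \<comment> \<open>The jet of the defect of the polynomial; \<open>T n\<close> is the jet of its
    \<open>n\<close>-fold image under the transfer operator.\<close>
  define T0 where "T0 = (\<lambda>j x vs. L (cmp P F j x vs) - P j x vs)"
  define T where "T = rec_nat T0 (\<lambda>_ h j x vs. L (cmp h F j x vs))"
  have T: "T 0 = T0" "T (Suc n) = (\<lambda>j x vs. L (cmp (T n) F j x vs))" for n by (simp_all add: T_def)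
  have step: "jet r ?V (\<lambda>j x vs. L (cmp h F j x vs))" if "jet r ?V h" for h
    using Fin by (intro jet_compose[OF bL] jet_cmp[OF open_nm_ball open_nm_ball that FV]) auto
  have jT: "jet r ?V (T n)" for n
  proof (induction n)
    case 0
    show ?case unfolding T T0_def by (rule jet_diff[OF step[OF P(1)] P(1)])
  qed (unfold T, rule step)
  define Z where "Z = K ^ r * (\<Sum>j\<le>r. real (length (parts j)))"
  have "0 \<le> l * Z" using L(3) K(2) by (simp add: Z_def sum_nonneg)
  \<comment> \<open>The terms with lower derivatives may use up half of the gap
    \<open>1 - l * \<beta> ^ q\<close>, so \<open>\<kappa>\<close> stays below
    \<open>1\<close>.\<close>
  then obtain \<eta>0 where \<eta>0: "0 < \<eta>0" "\<eta>0 * (l * Z) \<le> (1 - l * \<beta> ^ q) / 2"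
    using small_multiple[of "(1 - l * \<beta> ^ q) / 2" "l * Z"] gap by auto
  define \<eta> where "\<eta> = min 1 \<eta>0"
  have \<eta>: "0 < \<eta>" "\<eta> \<le> 1" using \<eta>0 by (auto simp: \<eta>_def)
  define \<kappa> where "\<kappa> = l * (\<beta> ^ q + \<eta> * Z)"
  have "\<eta> * (l * Z) \<le> \<eta>0 * (l * Z)" using \<open>0 \<le> l * Z\<close> by (intro mult_right_mono) (auto simp: \<eta>_def)
  then have \<kappa>: "\<kappa> < 1" using \<eta>0(2) gap by (simp add: \<kappa>_def algebra_simps)
  have Z0: "0 \<le> Z" using K(2) by (simp add: Z_def sum_nonneg)
  have \<kappa>0: "0 \<le> \<kappa>" using L(3) M(4) \<eta> Z0 by (simp add: \<kappa>_def)
  have "\<exists>Kg\<ge>0. \<forall>i\<le>r. \<forall>x. nm x < \<rho> \<longrightarrow> mlb i Kg (T0 i x)"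
  proof (intro exI[of _ "l * ((\<Sum>j\<le>r. real (length (parts j))) * (B * K ^ r)) + B"] conjI allI impI)
    let ?s = "\<Sum>j\<le>r. real (length (parts j))"
    show "0 \<le> l * (?s * (B * K ^ r)) + B" using L(3) P(2) K(2) by (simp add: sum_nonneg)
    fix i x assume i: "i \<le> r" and x: "nm x < \<rho>"
    have "mlb i (?s * (B * K ^ r)) (cmp P F i x)"
    proof (cases "i = 0")
      case True
      have "mlb 0 B (cmp P F 0 x)"
        by (rule mlb_cong[OF P3[of 0, OF _ Fin[OF x]]]) (simp_all add: cmp_0)
      moreover have "B \<le> ?s * (B * K ^ r)"
      proof -
        have "1 \<le> ?s" using member_le_sum[of 0 "{..r}" "\<lambda>j. real (length (parts j))"] by simp
        moreover have "1 \<le> K ^ r" using K(2) by simp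
        ultimately have "1 * (B * 1) \<le> ?s * (B * K ^ r)" using P(2) by (intro mult_mono) auto
        then show ?thesis by simp
      qed
      ultimately show ?thesis using True by (auto elim: mlb_mono)
    next
      case False
      have "mlb i (real (length (parts i)) * (B * K ^ r)) (cmp P F i x)"
        by (rule mlb_cmp_general) (use KV x K(2) False i P(2) P3 Fin[OF x] in auto)
      moreover have "real (length (parts i)) \<le> ?s" using i by (intro member_le_sum) auto
      then have "real (length (parts i)) * (B * K ^ r) \<le> ?s * (B * K ^ r)" using P(2) K(2) by (intro mult_right_mono) auto
      ultimately show ?thesis by (rule mlb_mono)
    qed
    from mlb_diff[OF mlb_compose[OF L(2) this] P3[OF i x]]
    show "mlb i (l * (?s * (B * K ^ r)) + B) (T0 i x)" by (simp add: T0_def[abs_def])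
  qed
  then obtain Kg where Kg: "0 \<le> Kg" "\<And>i x. i \<le> r \<Longrightarrow> nm x < \<rho> \<Longrightarrow> mlb i Kg (T0 i x)" by blast
  \<comment> \<open>One constant for all orders: the power of \<open>max 1 C0\<close> covers the
    Taylor constants for \<open>i \<le> q\<close>, while for \<open>i > q\<close> the truncated
    exponent is \<open>0\<close> and \<open>Kg\<close> suffices.\<close>
  define H where "H = Kg * max 1 C0 ^ q"
  have H: "0 \<le> H" "Kg \<le> H" using Kg(1) mult_left_mono[of 1 "max 1 C0 ^ q" Kg] by (auto simp: H_def)
  have bT0: "mlb i (H * (1 / \<eta>) ^ i * nm x ^ (q - i)) (T0 i x)" if i: "i \<le> r" and x: "nm x < \<rho>" for i x
  proof -
    have "mlb i (H * nm x ^ (q - i)) (T0 i x)"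
    proof (cases "i \<le> q")
      case True
      have "mlb i (Kg * C0 ^ (q - i) * nm x ^ (q - i)) (T0 i x)"
      proof (rule jet_flat[OF jT[of 0, unfolded T] convex_nm_ball _ q(2) Kg(1)])
        show "T0 i 0 vs = 0" if "i < q" "length vs = i" for i vs using P6[of i vs] that by (simp add: T0_def)
        show "mlb q Kg (T0 q y)" if "y \<in> ?V" for y using Kg(2)[OF q(2)] that by simp
      qed (use True \<rho> x in auto)
      moreover have "C0 ^ (q - i) \<le> max 1 C0 ^ q"
        using power_mono[of C0 "max 1 C0" "q - i"] power_increasing[of "q - i" q "max 1 C0"] C0_pos by fastforce
      then have "Kg * C0 ^ (q - i) * nm x ^ (q - i) \<le> H * nm x ^ (q - i)"
        using Kg(1) by (auto simp: H_def intro!: mult_right_mono mult_left_mono)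
      ultimately show ?thesis by (rule mlb_mono)
    next
      case False
      then show ?thesis using mlb_mono[OF Kg(2)[OF i x] H(2)] by simp
    qed
    moreover have "H * nm x ^ (q - i) * 1 \<le> H * nm x ^ (q - i) * (1 / \<eta>) ^ i"
      using \<eta> H by (intro mult_left_mono one_le_power) auto
    ultimately show ?thesis by (elim mlb_mono) (simp add: mult_ac)
  qed
  have bT: "mlb i (\<kappa> ^ n * H * (1 / \<eta>) ^ i * nm x ^ (q - i)) (T n i x)" if "i \<le> r" "nm x < \<rho>" for i x n
    using that
  proof (induction n arbitrary: i x)
    case 0
    then show ?case using bT0 by (simp add: T)
  next
    case (Suc n)
    have "mlb i (l * (\<beta> ^ q + \<eta> * (K ^ r * (\<Sum>j\<le>r. real (length (parts j))))) * (\<kappa> ^ n * H) * (1 / \<eta>) ^ i * nm x ^ (q - i))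
        (\<lambda>vs. L (cmp (T n) F i x vs))"
    proof (rule mlb_transfer[OF L(2,3) M(4,5) K(2) \<eta>])
      show "mlb k (\<kappa> ^ n * H * (1 / \<eta>) ^ k * nm (F 0 x []) ^ (q - k)) (T n k (F 0 x []))" if "k \<le> r" for k
        using Suc.IH[OF that Fin[OF Suc.prems(2)]] .
    qed (use Suc.prems Fx F1b KV \<kappa>0 H \<rho> in auto)
    then show ?case by (rule mlb_eq) (simp_all add: T \<kappa>_def Z_def)
  qed
  define b where "b = H * (1 / \<eta>) ^ r"
  have bT': "mlb i (\<kappa> ^ n * b) (T n i x)" if "i \<le> r" "nm x < \<rho>" for i x n
  proof (rule mlb_mono[OF bT[OF that]])
    have "(1 / \<eta>) ^ i * nm x ^ (q - i) \<le> (1 / \<eta>) ^ r * 1"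
      using \<eta> that \<rho> by (intro mult_mono power_increasing power_le_one) auto
    then have "(\<kappa> ^ n * H) * ((1 / \<eta>) ^ i * nm x ^ (q - i)) \<le> (\<kappa> ^ n * H) * ((1 / \<eta>) ^ r * 1)"
      using \<kappa>0 H by (intro mult_left_mono) auto
    then show "\<kappa> ^ n * H * (1 / \<eta>) ^ i * nm x ^ (q - i) \<le> \<kappa> ^ n * b" by (simp add: b_def mult_ac)
  qed
  have b0: "0 \<le> b" using H \<eta> by (simp add: b_def)
  have geo: "summable (\<lambda>n. \<kappa> ^ n * c)" "(\<Sum>n. \<kappa> ^ n * c) = c / (1 - \<kappa>)" for c
    using \<kappa> \<kappa>0 summable_geometric[of \<kappa>] suminf_geometric[of \<kappa>] suminf_mult2[of "\<lambda>n. \<kappa> ^ n" c]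
    by (auto intro: summable_mult2)
  define c where "c = b * max 1 hi ^ r / lo"
  have c0: "0 \<le> c" using b0 lo_hi(1) by (simp add: c_def)
  have oT: "opb j (\<kappa> ^ n * c) (T n j x)" if j: "j \<le> r" and x: "x \<in> ?V" for n j x
  proof (rule opb_mono[OF mlb_opb[OF bT'[OF j]]])
    show "nm x < \<rho>" using x by simp
    have "hi ^ j \<le> max 1 hi ^ r"
      using power_mono[of hi "max 1 hi" j] power_increasing[OF j, of "max 1 hi"] lo_hi(2) by fastforce
    then have "\<kappa> ^ n * b * hi ^ j / lo \<le> \<kappa> ^ n * b * max 1 hi ^ r / lo"
      using \<kappa>0 b0 lo_hi(1) by (intro divide_right_mono mult_left_mono) auto
    then show "\<kappa> ^ n * b * hi ^ j / lo \<le> \<kappa> ^ n * c" by (simp add: c_def)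
  qed
  have sc: "\<And>n. 0 \<le> \<kappa> ^ n * c" using \<kappa>0 c0 by simp
  have jS: "jet r ?V (\<lambda>j x vs. \<Sum>n. T n j x vs)"
    by (rule jet_series(1)[OF open_nm_ball convex_nm_ball jT _ geo(1) sc]) (rule oT)
  have sums: "(\<lambda>n. T n j x vs) sums (\<Sum>n. T n j x vs)" if "j \<le> r" "nm x < \<rho>" "length vs = j" for j x vs
    by (rule jet_series(2)[OF open_nm_ball convex_nm_ball jT _ geo(1) sc that(1) _ that(3)])
      (use that(2) in \<open>auto intro: oT\<close>)
  define R where "R = (\<lambda>j x vs. P j x vs + (\<Sum>n. T n j x vs))"
  have jR: "jet r ?V R" unfolding R_def by (rule jet_add[OF P(1) jS])
  have bR: "mlb j (B + b / (1 - \<kappa>)) (R j x)" if "j \<le> r" "nm x < \<rho>" for j x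
    unfolding R_def
  proof (rule mlb_add[OF P3[OF that]])
    show "mlb j (b / (1 - \<kappa>)) (\<lambda>vs. \<Sum>n. T n j x vs)"
      unfolding mlb_def
    proof (intro ballI allI impI)
      fix \<omega> cs and vs :: "('m, 'n) linf list" assume \<omega>: "\<omega> \<in> W" and vs: "length vs = j" and pf: "pf \<omega> cs vs"
      have "wb \<omega> (\<Sum>n. \<kappa> ^ n * (b * prod_list cs)) (\<Sum>n. T n j x vs)"
        using mlbD[OF bT'[OF that] \<omega> vs pf] sums[OF that vs] geo(1)
        by (intro wb_series[OF \<omega>]) (auto simp: mult.assoc)
      then show "wb \<omega> (b / (1 - \<kappa>) * prod_list cs) (\<Sum>n. T n j x vs)" by (simp add: geo(2))
    qed
  qed
  \<comment> \<open>At \<open>x = 0\<close> the factor \<open>nm x ^ (q - i)\<close> makes the bound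
    zero. As \<open>2 \<le> q\<close>, the series changes neither the value nor the first derivative
    of the polynomial at \<open>0\<close>.\<close>
  have T00: "T n i 0 vs = 0" if "i < q" "length vs = i" for n i vs
  proof -
    have "mlb i 0 (T n i 0)" using bT[of i 0 n] that q \<rho> by (simp add: power_0_left)
    from opbD[OF mlb_opb[OF this] that(2)] show ?thesis by simp
  qed
  have R0: "R 0 0 [] = 0" "\<And>h. R 1 0 [h] = h"
    using T00[of 0 "[]"] T00[of 1 "[_]"] q P(3) P5 by (auto simp: R_def)
  \<comment> \<open>Applying the transfer operator to the series drops its first term, which is the
    defect of the polynomial; hence the sum is a fixed point.\<close>
  have conj: "R 0 (F 0 x []) [] = M (R 0 x [])" if x: "nm x < \<rho>" for x
  proof -
    have "(\<lambda>n. L (T n 0 (F 0 x []) [])) sums L (\<Sum>n. T n 0 (F 0 x []) [])"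
      using sums[OF _ Fin[OF x], of 0 "[]"] by (intro bounded_linear.sums[OF bL]) simp
    then have "(\<lambda>n. T (Suc n) 0 x []) sums L (\<Sum>n. T n 0 (F 0 x []) [])" by (simp add: T cmp_0)
    then have "(\<lambda>n. T n 0 x []) sums (L (\<Sum>n. T n 0 (F 0 x []) []) + T 0 0 x [])"
      by (rule sums_Suc)
    then have "(\<Sum>n. T n 0 x []) = L (\<Sum>n. T n 0 (F 0 x []) []) + (L (P 0 (F 0 x []) []) - P 0 x [])"
      by (simp add: sums_iff T T0_def cmp_0)
    then have "R 0 x [] = L (R 0 (F 0 x []) [])"
      by (simp add: R_def linear_add[OF L(1)] algebra_simps)
    then show ?thesis by (simp add: L(4))
  qed
  show ?thesis
    by (intro exI[of _ \<rho>] exI[of _ R] exI[of _ "B + b / (1 - \<kappa>)"]) (use \<rho> jR bR R0 conj Fle in auto)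
qed

end

section \<open>Cutoff\<close>

primrec smooth :: "nat \<Rightarrow> (real \<Rightarrow> real) \<Rightarrow> bool" where
  "smooth 0 f \<longleftrightarrow> True"
| "smooth (Suc k) f \<longleftrightarrow> (\<exists>f'. (\<forall>t. (f has_real_derivative f' t) (at t)) \<and> smooth k f')"

lemma smoothI: "(\<And>t. (f has_real_derivative f' t) (at t)) \<Longrightarrow> smooth k f' \<Longrightarrow> smooth (Suc k) f"
  by auto

lemma smooth_Suc_imp: "smooth (Suc k) f \<Longrightarrow> smooth k f"
proof (induction k arbitrary: f)
  case (Suc k)
  then obtain f' where "\<forall>t. (f has_real_derivative f' t) (at t)" "smooth (Suc k) f'" by (auto simp del: smooth.simps(1))
  then show ?case using Suc.IH by auto
qed simp

lemma smooth_const: "smooth k (\<lambda>_. c)"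
  by (induction k arbitrary: c) (auto intro!: exI[of _ "\<lambda>_. 0"])

lemma smooth_id: "smooth k (\<lambda>t. t)"
  by (cases k) (auto intro!: exI[of _ "\<lambda>_. 1"] smooth_const)

lemma smooth_add: "smooth k f \<Longrightarrow> smooth k g \<Longrightarrow> smooth k (\<lambda>t. f t + g t)"
proof (induction k arbitrary: f g)
  case (Suc k)
  then obtain f' g' where "\<forall>t. (f has_real_derivative f' t) (at t)" "smooth k f'"
    "\<forall>t. (g has_real_derivative g' t) (at t)" "smooth k g'" by auto
  then show ?case using Suc.IH by (auto intro!: exI[of _ "\<lambda>t. f' t + g' t"] DERIV_add)
qed simp

lemma smooth_mult: "smooth k f \<Longrightarrow> smooth k g \<Longrightarrow> smooth k (\<lambda>t. f t * g t)"
proof (induction k arbitrary: f g)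
  case (Suc k)
  then obtain f' g' where d: "\<And>t. (f has_real_derivative f' t) (at t)" "smooth k f'"
    "\<And>t. (g has_real_derivative g' t) (at t)" "smooth k g'" by auto
  have "((\<lambda>t. f t * g t) has_real_derivative f' t * g t + g' t * f t) (at t)" for t
    using DERIV_mult[OF d(1,3)] .
  moreover have "smooth k (\<lambda>t. f' t * g t + g' t * f t)"
    using Suc.prems smooth_Suc_imp d Suc.IH by (intro smooth_add) blast+
  ultimately show ?case by (rule smoothI)
qed simp

lemma smooth_inverse:
  assumes "\<And>t. g t \<noteq> 0" shows "smooth k g \<Longrightarrow> smooth k (\<lambda>t. inverse (g t))"
proof (induction k)
  case (Suc k)
  then obtain g' where d: "\<And>t. (g has_real_derivative g' t) (at t)" "smooth k g'" by auto
  have "((\<lambda>t. inverse (g t)) has_real_derivative (-1) * (g' t * (inverse (g t) * inverse (g t)))) (at t)" for t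
    using DERIV_inverse'[OF d(1) assms, of t] by (simp add: mult_ac)
  moreover have "smooth k (\<lambda>t. inverse (g t))" using Suc.IH smooth_Suc_imp[OF Suc.prems] by blast
  then have "smooth k (\<lambda>t. (-1) * (g' t * (inverse (g t) * inverse (g t))))"
    using d(2) by (intro smooth_mult smooth_const)
  ultimately show ?case by (rule smoothI)
qed simp

lemma DERIV_truncated_power:
  fixes u :: real
  shows "((\<lambda>u. max 0 u ^ (n + 2)) has_real_derivative real (n + 2) * max 0 u ^ (n + 1)) (at u)"
proof (cases u "0 :: real" rule: linorder_cases)
  case less
  have "((\<lambda>u. 0) has_real_derivative 0) (at u)" by simp
  then have "((\<lambda>u. max 0 u ^ (n + 2)) has_real_derivative 0) (at u)"
    by (rule has_field_derivative_transform_within_open[of _ _ _ "{..<0}"]) (use less in auto)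
  then show ?thesis using less by simp
next
  case greater
  have "((\<lambda>u. u ^ (n + 2)) has_real_derivative real (n + 2) * u ^ (n + 1)) (at u)"
    using DERIV_pow[of "n + 2" u] by simp
  then have "((\<lambda>u. max 0 u ^ (n + 2)) has_real_derivative real (n + 2) * u ^ (n + 1)) (at u)"
    by (rule has_field_derivative_transform_within_open[of _ _ _ "{0<..}"]) (use greater in auto)
  then show ?thesis using greater by simp
next
  case equal
  have "((\<lambda>u. max 0 u ^ (n + 2)) has_derivative (\<lambda>_. 0)) (at (0 :: real))"
  proof (rule has_derivative_zeroI)
    have "norm (max 0 y ^ (n + 2) - max 0 0 ^ (n + 2)) \<le> 1 * norm (y - 0) ^ 2" if "dist y 0 < 1" for y :: real
    proof -
      have "max 0 y ^ (n + 2) \<le> \<bar>y\<bar> ^ (n + 2)" by (intro power_mono) auto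
      also have "\<dots> \<le> \<bar>y\<bar> ^ 2" using that by (intro power_decreasing) (auto simp: dist_real_def)
      finally show ?thesis by simp
    qed
    then show "\<forall>\<^sub>F y in nhds 0. norm (max 0 y ^ (n + 2) - max 0 0 ^ (n + 2)) \<le> 1 * norm (y - (0::real)) ^ 2"
      unfolding eventually_nhds_metric by (intro exI[of _ 1]) auto
  qed
  moreover have "times (0 :: real) = (\<lambda>_. 0)" by auto
  ultimately show ?thesis using equal by (simp add: has_field_derivative_def)
qed

text \<open>Each differentiation uses up one power; the spare one keeps the kink at \<open>0\<close>
  differentiable to the last step.\<close>

lemma smooth_truncated_power: "smooth k f \<Longrightarrow> smooth k (\<lambda>t. max 0 (f t) ^ (k + 1))"
proof (induction k arbitrary: f)
  case (Suc k)
  then obtain f' where d: "\<And>t. (f has_real_derivative f' t) (at t)" "smooth k f'" by auto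
  have "((\<lambda>t. max 0 (f t) ^ (k + 2)) has_real_derivative (real (k + 2) * max 0 (f t) ^ (k + 1)) * f' t) (at t)" for t
    using DERIV_chain2[OF DERIV_truncated_power[of k "f t"] d(1)] by simp
  moreover have "smooth k (\<lambda>t. (real (k + 2) * max 0 (f t) ^ (k + 1)) * f' t)"
    using Suc.IH[of f] smooth_Suc_imp[OF Suc.prems] d(2) by (intro smooth_mult smooth_const) auto
  ultimately have "smooth (Suc k) (\<lambda>t. max 0 (f t) ^ (k + 2))" by (rule smoothI)
  then show ?case by simp
qed simp

lemma smooth_derivs:
  "smooth k f \<Longrightarrow> \<exists>D. D 0 = f \<and> (\<forall>j<k. \<forall>t. (D j has_real_derivative D (Suc j) t) (at t))"
proof (induction k arbitrary: f)
  case 0 then show ?case by (auto intro!: exI[of _ "\<lambda>_. f"])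
next
  case (Suc k)
  then obtain f' D where "\<And>t. (f has_real_derivative f' t) (at t)" "D 0 = f'"
    "\<And>j t. j < k \<Longrightarrow> (D j has_real_derivative D (Suc j) t) (at t)" by (metis smooth.simps(2))
  then show ?case
    by (intro exI[of _ "case_nat f D"]) (auto split: nat.splits simp: less_Suc_eq_0_disj)
qed

text \<open>The function is \<open>t * A / (A + B)\<close>: near \<open>0\<close> the truncated
  power \<open>B\<close> vanishes and leaves \<open>t\<close>, far out \<open>A\<close> vanishes and
  leaves \<open>0\<close>, and the two are never zero together. All derivatives vanish outside a
  compact interval, so they are bounded.\<close>

lemma cutoff_function:
  assumes \<delta>: "0 < \<delta>"
  obtains D c where "0 < c" "\<And>j t. j \<le> k \<Longrightarrow> (D j has_real_derivative D (Suc j) t) (at t)"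
    "\<And>j t. j \<le> k \<Longrightarrow> \<bar>D j t\<bar> \<le> (c :: real)" "\<And>t. \<bar>t\<bar> \<le> \<delta> \<Longrightarrow> D 0 t = t" "\<And>t. \<bar>D 0 t\<bar> \<le> 2 * \<delta>"
proof -
  define A where "A t = max 0 (4 * \<delta> * \<delta> + (-1) * (t * t)) ^ (Suc k + 1)" for t :: real
  define B where "B t = max 0 (t * t + (-1) * (\<delta> * \<delta>)) ^ (Suc k + 1)" for t :: real
  have AB: "0 \<le> A t" "0 \<le> B t" for t by (simp_all add: A_def B_def)
  have pos: "A t + B t \<noteq> 0" for t
  proof -
    have "\<delta> * \<delta> < t * t \<or> t * t < 4 * \<delta> * \<delta>" using mult_pos_pos[OF \<delta> \<delta>] by linarith
    then have "0 < A t \<or> 0 < B t" by (auto simp: A_def B_def)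
    then show ?thesis using AB[of t] by linarith
  qed
  define f where "f t = t * (A t * inverse (A t + B t))" for t
  have sA: "smooth (Suc k) A" "smooth (Suc k) B"
    unfolding A_def[abs_def] B_def[abs_def]
    by (intro smooth_truncated_power smooth_add smooth_mult smooth_const smooth_id)+
  have "smooth (Suc k) f"
    unfolding f_def[abs_def] by (intro smooth_mult smooth_id sA smooth_inverse smooth_add pos)
  from smooth_derivs[OF this] obtain D where D: "D 0 = f"
    "\<And>j t. j \<le> k \<Longrightarrow> (D j has_real_derivative D (Suc j) t) (at t)" by (auto simp: less_Suc_eq_le)
  have far: "A t = 0" if "2 * \<delta> < \<bar>t\<bar>" for t
  proof -
    have "2 * \<delta> * (2 * \<delta>) < \<bar>t\<bar> * \<bar>t\<bar>" using that \<delta> by (intro mult_strict_mono) auto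
    then show ?thesis by (simp add: A_def)
  qed
  have open_far: "open {t :: real. 2 * \<delta> < \<bar>t\<bar>}" by (intro open_Collect_less continuous_intros)
  have zero: "D j t = 0" if "j \<le> Suc k" "2 * \<delta> < \<bar>t\<bar>" for j t
    using that
  proof (induction j arbitrary: t)
    case 0 then show ?case by (simp add: D(1) f_def far)
  next
    case (Suc j)
    have "((\<lambda>_. 0) has_real_derivative D (Suc j) t) (at t)"
      using Suc by (intro has_field_derivative_transform_within_open[OF D(2) open_far]) auto
    then show ?case using DERIV_unique DERIV_const by blast
  qed
  have "\<exists>c. \<forall>t. \<bar>D j t\<bar> \<le> c" if "j \<le> k" for j
  proof -
    have "continuous_on {- (2 * \<delta>)..2 * \<delta>} (D j)"
      using D(2)[OF that] by (intro DERIV_continuous_on) (auto intro: has_field_derivative_at_within)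
    then have "bounded (D j ` {- (2 * \<delta>)..2 * \<delta>})" by (intro compact_imp_bounded compact_continuous_image) auto
    then obtain c where c: "\<forall>t\<in>{- (2 * \<delta>)..2 * \<delta>}. \<bar>D j t\<bar> \<le> c" by (auto simp: bounded_iff)
    have "\<bar>D j t\<bar> \<le> max c 0" for t
    proof (cases "2 * \<delta> < \<bar>t\<bar>")
      case False
      then have "t \<in> {- (2 * \<delta>)..2 * \<delta>}" by auto
      from bspec[OF c this] show ?thesis by simp
    qed (use zero[of j t] that in simp)
    then show ?thesis by blast
  qed
  then obtain c where c: "\<And>j t. j \<le> k \<Longrightarrow> \<bar>D j t\<bar> \<le> c j" by metis
  define C where "C = 1 + (\<Sum>j\<le>k. \<bar>c j\<bar>)"
  have "\<bar>D j t\<bar> \<le> C" if "j \<le> k" for j t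
    using c[OF that, of t] member_le_sum[of j "{..k}" "\<lambda>j. \<bar>c j\<bar>"] that by (simp add: C_def)
  moreover have "0 < C" by (simp add: C_def add_pos_nonneg sum_nonneg)
  moreover have "D 0 t = t" if "\<bar>t\<bar> \<le> \<delta>" for t
  proof -
    have "\<bar>t\<bar> * \<bar>t\<bar> \<le> \<delta> * \<delta>" using that by (intro mult_mono) auto
    then have "B t = 0" by (simp add: B_def)
    then show ?thesis using pos[of t] by (simp add: D(1) f_def)
  qed
  moreover have "\<bar>D 0 t\<bar> \<le> 2 * \<delta>" for t
  proof (cases "2 * \<delta> < \<bar>t\<bar>")
    case True then show ?thesis using zero[of 0 t] \<delta> by simp
  next
    case False
    have "A t * inverse (A t + B t) \<le> 1" "0 \<le> A t * inverse (A t + B t)"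
      using AB[of t] pos[of t] by (auto simp: field_simps divide_le_eq)
    then have "\<bar>t\<bar> * \<bar>A t * inverse (A t + B t)\<bar> \<le> \<bar>t\<bar> * 1" by (intro mult_left_mono) auto
    then show ?thesis using False by (simp add: D(1) f_def abs_mult)
  qed
  ultimately show ?thesis using that D(2) by blast
qed

section \<open>The cutoff in every coordinate of every node\<close>

lemma norm_vec_le: "(\<And>s. \<bar>y $ s\<bar> \<le> e) \<Longrightarrow> norm (y :: real^'n) \<le> real CARD('n) * e"
  using norm_le_l1_cart[of y] sum_mono[of UNIV "\<lambda>s. \<bar>y $ s\<bar>" "\<lambda>_. e"] by simp

lemma prod_component:
  fixes vs :: "('m::finite, 'n::finite) linf list"
  shows "\<bar>\<Prod>v\<leftarrow>vs. apply_bcontfun v i $ s\<bar> \<le> (\<Prod>v\<leftarrow>vs. norm (apply_bcontfun v i))"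
proof (induction vs)
  case (Cons v vs)
  then show ?case by (simp add: abs_mult mult_mono component_le_norm_cart)
qed simp

lemma prod_component_norm:
  fixes vs :: "('m::finite, 'n::finite) linf list"
  shows "(\<Prod>v\<leftarrow>vs. norm (apply_bcontfun v i)) \<le> prod_list (map norm vs)"
  by (rule prod_list_mono_real) (auto simp: norm_bounded)

lemma prod_component_le:
  fixes vs :: "('m::finite, 'n::finite) linf list"
  shows "\<bar>\<Prod>v\<leftarrow>vs. apply_bcontfun v i $ s\<bar> \<le> prod_list (map norm vs)"
  using prod_component prod_component_norm order_trans by blast

lemma norm_bcontfun_le:
  fixes z :: "('m::finite, 'n::finite) linf"
  assumes "\<And>i s. \<bar>apply_bcontfun z i $ s\<bar> \<le> e" shows "norm z \<le> real CARD('n) * e"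
  by (rule norm_bound) (rule norm_vec_le[OF assms])

context
  fixes D :: "nat \<Rightarrow> real \<Rightarrow> real" and c :: real and k :: nat
  assumes c: "0 < c" and D: "\<And>j t. j \<le> k \<Longrightarrow> (D j has_real_derivative D (Suc j) t) (at t)"
    and b: "\<And>j t. j \<le> k \<Longrightarrow> \<bar>D j t\<bar> \<le> c"
begin

lemma cutoff_lipschitz: assumes "Suc j \<le> k" shows "\<bar>D j (t + h) - D j t\<bar> \<le> c * \<bar>h\<bar>"
proof -
  have "norm (D j (t + 1 *\<^sub>R h) - D j (t + 0 *\<^sub>R h)) \<le> c * \<bar>h\<bar>"
  proof (rule mvt_norm_bound)
    fix \<tau> :: real
    have "(D j has_derivative times (D (Suc j) (t + \<tau> *\<^sub>R h))) (at (t + \<tau> *\<^sub>R h))"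
      using D[of j "t + \<tau> *\<^sub>R h"] assms by (simp add: has_field_derivative_def)
    from has_vector_derivative_line[OF this]
    show "((\<lambda>\<tau>. D j (t + \<tau> *\<^sub>R h)) has_vector_derivative D (Suc j) (t + \<tau> *\<^sub>R h) * h) (at \<tau> within {0..1})" .
    show "norm (D (Suc j) (t + \<tau> *\<^sub>R h) * h) \<le> c * \<bar>h\<bar>"
      using b[OF assms] by (simp add: abs_mult mult_right_mono)
  qed
  then show ?thesis by simp
qed

lemma cutoff_taylor: assumes "Suc (Suc j) \<le> k" shows "\<bar>D j (t + h) - D j t - D (Suc j) t * h\<bar> \<le> c * \<bar>h\<bar>\<^sup>2"
proof -
  let ?g = "\<lambda>\<tau>. D j (t + \<tau> *\<^sub>R h) - \<tau> *\<^sub>R (D (Suc j) t * h)"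
  have "norm (?g 1 - ?g 0) \<le> c * \<bar>h\<bar>\<^sup>2"
  proof (rule mvt_norm_bound)
    fix \<tau> :: real assume \<tau>: "\<tau> \<in> {0..1}"
    have "(D j has_derivative times (D (Suc j) (t + \<tau> *\<^sub>R h))) (at (t + \<tau> *\<^sub>R h))"
      using D[of j "t + \<tau> *\<^sub>R h"] assms by (simp add: has_field_derivative_def)
    from has_vector_derivative_line[OF this]
    show "(?g has_vector_derivative D (Suc j) (t + \<tau> *\<^sub>R h) * h - D (Suc j) t * h) (at \<tau> within {0..1})"
      by (rule has_vector_derivative_diff) (auto intro!: derivative_eq_intros)
    have "\<bar>D (Suc j) (t + \<tau> * h) - D (Suc j) t\<bar> \<le> c * \<bar>\<tau> * h\<bar>" by (rule cutoff_lipschitz[OF assms])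
    also have "\<dots> \<le> c * \<bar>h\<bar>" using c \<tau> by (simp add: abs_mult mult_left_le_one_le)
    finally have "\<bar>D (Suc j) (t + \<tau> * h) - D (Suc j) t\<bar> * \<bar>h\<bar> \<le> c * \<bar>h\<bar> * \<bar>h\<bar>" by (rule mult_right_mono) simp
    then show "norm (D (Suc j) (t + \<tau> *\<^sub>R h) * h - D (Suc j) t * h) \<le> c * \<bar>h\<bar>\<^sup>2"
      by (simp add: left_diff_distrib[symmetric] abs_mult power2_eq_square mult.assoc)
  qed
  then show ?thesis by simp
qed

text \<open>The derivative of order \<open>j\<close> of the map that applies \<open>D 0\<close> to
  each coordinate of each node. It multiplies its arguments coordinatewise, so each node depends
  only on itself and every weighted norm is respected.\<close>

definition phi :: "nat \<Rightarrow> ('m::finite, 'n::finite) linf \<Rightarrow> ('m, 'n) linf list \<Rightarrow> ('m, 'n) linf" where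
  "phi j x vs = Bcontfun (\<lambda>i. \<chi> s. D j (apply_bcontfun x i $ s) * (\<Prod>v\<leftarrow>vs. apply_bcontfun v i $ s))"

lemma apply_phi:
  fixes x :: "('m::finite, 'n::finite) linf"
  assumes "j \<le> k"
  shows "apply_bcontfun (phi j x vs) i $ s = D j (apply_bcontfun x i $ s) * (\<Prod>v\<leftarrow>vs. apply_bcontfun v i $ s)"
proof -
  let ?f = "\<lambda>i. \<chi> s. D j (apply_bcontfun x i $ s) * (\<Prod>v\<leftarrow>vs. apply_bcontfun v i $ s)"
  have "norm (?f i) \<le> real CARD('n) * (c * prod_list (map norm vs))" for i
    by (rule norm_vec_le)
      (use b[OF assms] c prod_component_le in \<open>auto simp: abs_mult intro!: mult_mono\<close>)
  then have "?f \<in> bcontfun" unfolding bounded_family bounded_iff by auto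
  then show ?thesis by (simp add: phi_def Bcontfun_inverse)
qed

text \<open>Differentiability in the sup norm requires Taylor estimates uniform over all
  coordinates, and the single constant \<open>c\<close> provides them. The additional order in
  \<open>Suc r \<le> k\<close> gives the Lipschitz bound for the top derivative.\<close>

lemma jet_phi:
  assumes r: "Suc r \<le> k"
  shows "jet r UNIV (phi :: nat \<Rightarrow> ('m::finite, 'n::finite) linf \<Rightarrow> _)"
proof (rule jetI)
  let ?n = "real CARD('n)"
  fix j
  have op: "opb j (?n * c) (phi j x)" if "j \<le> k" for x :: "('m, 'n) linf" and j
    unfolding opb_def
  proof (intro allI impI)
    fix vs :: "('m, 'n) linf list"
    have "norm (phi j x vs) \<le> ?n * (c * prod_list (map norm vs))"
      by (rule norm_bcontfun_le)
        (use b[OF that] c prod_component_le that in \<open>auto simp: apply_phi abs_mult intro!: mult_mono\<close>)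
    then show "norm (phi j x vs) \<le> ?n * c * prod_list (map norm vs)" by (simp add: mult.assoc)
  qed
  show "\<exists>K. opb j K (phi j x)" if "j \<le> r" for x :: "('m, 'n) linf" using op[of j x] that r by auto
  show "opcont j UNIV (phi j :: ('m, 'n) linf \<Rightarrow> _)" if j: "j \<le> r"
    unfolding opcont_def
  proof (intro ballI allI impI)
    fix x :: "('m, 'n) linf" and e :: real assume e: "0 < e"
    have "opb j e (\<lambda>vs. phi j y vs - phi j x vs)" if y: "norm (y - x) < e / (?n * c)" for y
      unfolding opb_def
    proof (intro allI impI)
      fix vs :: "('m, 'n) linf list"
      have "norm (phi j y vs - phi j x vs) \<le> ?n * (c * norm (y - x) * prod_list (map norm vs))"
      proof (rule norm_bcontfun_le)
        fix i s
        let ?t = "apply_bcontfun x i $ s" and ?h = "apply_bcontfun (y - x) i $ s"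
        let ?p = "\<Prod>v\<leftarrow>vs. apply_bcontfun v i $ s"
        have "\<bar>?h\<bar> \<le> norm (y - x)" by (meson component_le_norm_cart norm_bounded order_trans)
        then have "c * \<bar>?h\<bar> \<le> c * norm (y - x)" using c by simp
        moreover have "\<bar>D j (?t + ?h) - D j ?t\<bar> \<le> c * \<bar>?h\<bar>" using j r by (intro cutoff_lipschitz) simp
        ultimately have 1: "\<bar>D j (?t + ?h) - D j ?t\<bar> \<le> c * norm (y - x)" by linarith
        have "\<bar>?p\<bar> \<le> prod_list (map norm vs)" by (rule prod_component_le)
        with 1 have "\<bar>D j (?t + ?h) - D j ?t\<bar> * \<bar>?p\<bar> \<le> (c * norm (y - x)) * prod_list (map norm vs)"
          using c by (intro mult_mono) auto
        then show "\<bar>apply_bcontfun (phi j y vs - phi j x vs) i $ s\<bar> \<le> c * norm (y - x) * prod_list (map norm vs)"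
          using j r by (simp add: apply_phi left_diff_distrib[symmetric] abs_mult)
      qed
      also have "\<dots> = (?n * c * norm (y - x)) * prod_list (map norm vs)" by simp
      also have "\<dots> \<le> e * prod_list (map norm vs)"
        using y c by (intro mult_right_mono) (auto simp: pos_less_divide_eq mult.commute)
      finally show "norm (phi j y vs - phi j x vs) \<le> e * prod_list (map norm vs)" .
    qed
    then show "\<exists>d>0. \<forall>y\<in>UNIV. norm (y - x) < d \<longrightarrow> opb j e (\<lambda>vs. phi j y vs - phi j x vs)"
      using e c by (intro exI[of _ "e / (?n * c)"]) auto
  qed
  fix x :: "('m, 'n) linf" and vs :: "('m, 'n) linf list" assume j: "j < r" and vs: "length vs = j"
  let ?L = "\<lambda>h. phi (Suc j) x (h # vs)"
  have L: "bounded_linear ?L"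
  proof (rule bounded_linear_intro)
    show "?L (u + v) = ?L u + ?L v" for u v
      using j r by (intro bcontfun_eqI) (simp add: vec_eq_iff apply_phi algebra_simps)
    show "?L (t *\<^sub>R u) = t *\<^sub>R ?L u" for t u
      using j r by (intro bcontfun_eqI) (simp add: vec_eq_iff apply_phi)
    show "norm (?L u) \<le> norm u * (?n * c * prod_list (map norm vs))" for u
      using opbD[OF op[of "Suc j" x], of "u # vs"] j r vs by (simp add: mult_ac)
  qed
  have "((\<lambda>y. phi j y vs - ?L (y - x)) has_derivative (\<lambda>_. 0)) (at x)"
  proof (rule has_derivative_zeroI, intro always_eventually allI)
    fix y
    have "norm (phi j y vs - phi j x vs - ?L (y - x)) \<le> ?n * (c * norm (y - x) ^ 2 * prod_list (map norm vs))"
    proof (rule norm_bcontfun_le)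
      fix i s
      let ?t = "apply_bcontfun x i $ s" and ?h = "apply_bcontfun (y - x) i $ s"
      let ?p = "\<Prod>v\<leftarrow>vs. apply_bcontfun v i $ s"
      have "\<bar>?h\<bar> \<le> norm (y - x)" by (meson component_le_norm_cart norm_bounded order_trans)
      then have "c * \<bar>?h\<bar>\<^sup>2 \<le> c * norm (y - x) ^ 2" using c by (intro mult_left_mono power_mono) auto
      moreover have "\<bar>D j (?t + ?h) - D j ?t - D (Suc j) ?t * ?h\<bar> \<le> c * \<bar>?h\<bar>\<^sup>2" using j r by (intro cutoff_taylor) simp
      ultimately have 1: "\<bar>D j (?t + ?h) - D j ?t - D (Suc j) ?t * ?h\<bar> \<le> c * norm (y - x) ^ 2" by linarith
      have "\<bar>?p\<bar> \<le> prod_list (map norm vs)" by (rule prod_component_le)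
      with 1 have "\<bar>D j (?t + ?h) - D j ?t - D (Suc j) ?t * ?h\<bar> * \<bar>?p\<bar> \<le> (c * norm (y - x) ^ 2) * prod_list (map norm vs)"
        using c by (intro mult_mono) auto
      moreover have "apply_bcontfun (phi j y vs - phi j x vs - ?L (y - x)) i $ s
          = (D j (?t + ?h) - D j ?t - D (Suc j) ?t * ?h) * ?p"
        using j r by (simp add: apply_phi algebra_simps)
      ultimately show "\<bar>apply_bcontfun (phi j y vs - phi j x vs - ?L (y - x)) i $ s\<bar> \<le> c * norm (y - x) ^ 2 * prod_list (map norm vs)"
        by (simp only: abs_mult)
    qed
    then show "norm (phi j y vs - ?L (y - x) - (phi j x vs - ?L (x - x)))
        \<le> (?n * c * prod_list (map norm vs)) * norm (y - x) ^ 2"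
      using linear_0[OF bounded_linear.linear[OF L]] by (simp add: algebra_simps)
  qed
  moreover have "((\<lambda>y. ?L (y - x)) has_derivative ?L) (at x)"
    by (rule bounded_linear.has_derivative[OF L]) (auto intro!: derivative_eq_intros)
  ultimately have "((\<lambda>y. (phi j y vs - ?L (y - x)) + ?L (y - x)) has_derivative (\<lambda>h. 0 + ?L h)) (at x)"
    by (rule has_derivative_add)
  then show "((\<lambda>y. phi j y vs) has_derivative ?L) (at x)" by simp
qed simp

end

context weights
begin

text \<open>At a fixed node the one weighted argument contributes the factor
  \<open>\<omega> i\<close>, the others only constants.\<close>

lemma pf_prod_norm:
  assumes \<omega>: "\<omega> \<in> W" and pf: "pf \<omega> cs vs"
  shows "(\<Prod>v\<leftarrow>vs. norm (apply_bcontfun v i)) \<le> (1 / lo) ^ length vs * (prod_list cs * \<omega> i)"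
proof -
  have n: "norm (apply_bcontfun v i) \<le> (1 / lo) * (d * \<omega>' i)" if "wb \<omega>' d v" for v d \<omega>'
    using norm_apply_le_wb[OF that, of i] by simp
  have main: "(\<Prod>v\<leftarrow>vs. norm (apply_bcontfun v i)) \<le> (1 / lo) ^ length vs * prod_list ds"
    if l: "length ds = length vs" and d: "\<And>q. q < length vs \<Longrightarrow> norm (apply_bcontfun (vs ! q) i) \<le> (1 / lo) * ds ! q" for ds
  proof -
    have "(\<Prod>v\<leftarrow>vs. norm (apply_bcontfun v i)) \<le> prod_list (map (\<lambda>d. (1 / lo) * d) ds)"
      using l d by (intro prod_list_mono_real) auto
    also have "\<dots> = (1 / lo) ^ length ds * prod_list ds" by (induction ds) auto
    finally show ?thesis using l by simp
  qed
  have l: "length cs = length vs" using pf by (simp add: pf_def)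
  consider "\<omega> = one" "\<forall>q<length vs. wb one (cs ! q) (vs ! q)"
    | p where "p < length vs" "wb \<omega> (cs ! p) (vs ! p)" "\<And>q. q < length vs \<Longrightarrow> q \<noteq> p \<Longrightarrow> wb one (cs ! q) (vs ! q)"
    using pf unfolding pf_def by blast
  then show ?thesis
  proof cases
    case 1
    then show ?thesis using main[OF l] n by fastforce
  next
    case (2 p)
    have "prod_list (cs[p := \<omega> i * cs ! p]) = \<omega> i * prod_list cs"
      using 2(1) l by (intro prod_list_update_mult) simp
    moreover have "norm (apply_bcontfun (vs ! q) i) \<le> (1 / lo) * cs[p := \<omega> i * cs ! p] ! q" if "q < length vs" for q
      using n[OF 2(2)] n[OF 2(3)[OF that]] that l by (cases "q = p") (auto simp: mult.commute)
    ultimately show ?thesis using main[of "cs[p := \<omega> i * cs ! p]"] l by (simp add: mult.commute)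
  qed
qed

lemma mlb_phi:
  assumes c: "0 < c" and D: "\<And>j t. j \<le> k \<Longrightarrow> (D j has_real_derivative D (Suc j) t) (at t)"
    and b: "\<And>j t. j \<le> k \<Longrightarrow> \<bar>D j t\<bar> \<le> c" and j: "j \<le> k"
  shows "mlb j (hi * (real CARD('n) * (c * (1 / lo) ^ j))) (phi D j x)"
  unfolding mlb_def wb_def
proof (intro ballI allI impI)
  fix \<omega> cs i and vs :: "('m, 'n) linf list" assume \<omega>: "\<omega> \<in> W" and vs: "length vs = j" and pf: "pf \<omega> cs vs"
  have ap: "apply_bcontfun (phi D j x vs) i $ s = D j (apply_bcontfun x i $ s) * (\<Prod>v\<leftarrow>vs. apply_bcontfun v i $ s)" for s
    by (rule apply_phi[where c = c and k = k]) (use c D b j in auto)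
  have "norm (apply_bcontfun (phi D j x vs) i) \<le> real CARD('n) * (c * ((1 / lo) ^ j * (prod_list cs * \<omega> i)))"
  proof (rule norm_vec_le)
    fix s
    have "\<bar>\<Prod>v\<leftarrow>vs. apply_bcontfun v i $ s\<bar> \<le> (1 / lo) ^ j * (prod_list cs * \<omega> i)"
      using order_trans[OF prod_component pf_prod_norm[OF \<omega> pf]] vs by simp
    then have "\<bar>D j (apply_bcontfun x i $ s)\<bar> * \<bar>\<Prod>v\<leftarrow>vs. apply_bcontfun v i $ s\<bar> \<le> c * ((1 / lo) ^ j * (prod_list cs * \<omega> i))"
      using b[OF j] c by (intro mult_mono) auto
    then show "\<bar>apply_bcontfun (phi D j x vs) i $ s\<bar> \<le> c * ((1 / lo) ^ j * (prod_list cs * \<omega> i))"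
      by (simp add: ap abs_mult)
  qed
  then have "hi * norm (apply_bcontfun (phi D j x vs) i) \<le> hi * (real CARD('n) * (c * ((1 / lo) ^ j * (prod_list cs * \<omega> i))))"
    using lo_hi(2) by (intro mult_left_mono) auto
  then show "N (apply_bcontfun (phi D j x vs) i) \<le> hi * (real CARD('n) * (c * (1 / lo) ^ j)) * prod_list cs * \<omega> i"
    using order_trans[OF lo_hi(4)] by (simp add: mult_ac)
qed

lemma mlb_K_nonneg: assumes "mlb j K A" shows "0 \<le> K"
proof -
  have "pf one (replicate j 1) (replicate j 0)"
    by (rule pf_one) (auto intro: wb_zero[OF one_W])
  from mlbD[OF assms one_W _ this] have "wb one K (A (replicate j 0))" by (simp add: prod_list_replicate)
  then show ?thesis by (rule wb_one_nonneg)
qed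

text \<open>The solution for \<open>A\<close> is an approximate one for \<open>A + B\<close>. Its
  residual consists of \<open>j\<close> telescoped terms with \<open>B\<close> in one slot and one
  term with \<open>B\<close> outside, whence the condition on
  \<open>real (Suc j) * b * C\<close>.\<close>

lemma perturbed_sylvester:
  assumes A: "linear A" "lb 1 A" and B: "linear B" "lb b B" "0 \<le> b" and M: "lb 1 (\<lambda>x. A x + B x)"
    and C: "0 \<le> C" "real (Suc j) * b * C \<le> 1 / 2"
    and sylv: "\<And>K Q. multilinear j Q \<Longrightarrow> mlb j K Q \<Longrightarrow>
      \<exists>P. multilinear j P \<and> mlb j (C * K) P \<and> (\<forall>vs. length vs = j \<longrightarrow> A (P vs) - P (map A vs) = Q vs)"
    and Q: "multilinear j Q" "mlb j K Q"
  shows "\<exists>P. multilinear j P \<and> mlb j (2 * C * K) P \<and>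
    (\<forall>vs. length vs = j \<longrightarrow> (A (P vs) + B (P vs)) - P (map (\<lambda>x. A x + B x) vs) = Q vs)"
proof -
  let ?M = "\<lambda>x. A x + B x"
  have lM: "linear ?M" by (rule linear_compose_add[OF A(1) B(1)])
  have bM: "bounded_linear ?M" by (rule lb_bounded_linear[OF lM M])
  have "\<exists>P. multilinear j P \<and> mlb j (C * K / (1 - 1 / 2)) P \<and>
      (\<forall>vs. length vs = j \<longrightarrow> ?M (P vs) - P (map ?M vs) = Q vs)"
  proof (rule solve_by_approximation[OF bM lM _ _ _ Q])
    fix K and Q :: "('m, 'n) linf list \<Rightarrow> ('m, 'n) linf" assume Q: "multilinear j Q" "mlb j K Q"
    obtain P where P: "multilinear j P" "mlb j (C * K) P" "\<And>vs. length vs = j \<Longrightarrow> A (P vs) - P (map A vs) = Q vs"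
      using sylv[OF Q] by blast
    have t: "mlb j (C * K * b) (\<lambda>vs. P (take p (map ?M vs) @ B (vs ! p) # drop (Suc p) (map A vs)))" if p: "p < j" for p
      unfolding mlb_def
    proof (intro ballI allI impI)
      fix \<omega> cs and vs :: "('m, 'n) linf list" assume \<omega>: "\<omega> \<in> W" and vs: "length vs = j" and pf: "pf \<omega> cs vs"
      let ?ws = "take p (map ?M vs) @ B (vs ! p) # drop (Suc p) (map A vs)" and ?cs = "cs[p := b * cs ! p]"
      have l: "length cs = j" using pf vs by (simp add: pf_def)
      have w: "wb \<omega>' (?cs ! q) (?ws ! q)" if "\<omega>' \<in> W" "q < j" "wb \<omega>' (cs ! q) (vs ! q)" for \<omega>' q
        using lbD[OF M that(1,3)] lbD[OF A(2) that(1,3)] lbD[OF B(2) that(1,3)] that(2) p vs l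
        by (cases q p rule: linorder_cases) (auto simp: nth_append nth_Cons')
      have "pf \<omega> ?cs ?ws"
      proof -
        have lw: "length ?ws = j" using p vs by simp
        consider "\<omega> = one" "\<forall>q<j. wb one (cs ! q) (vs ! q)"
          | p' where "p' < j" "wb \<omega> (cs ! p') (vs ! p')" "\<And>q. q < j \<Longrightarrow> q \<noteq> p' \<Longrightarrow> wb one (cs ! q) (vs ! q)"
          using pf vs unfolding pf_def by auto
        then show ?thesis
        proof cases
          case 1
          then show ?thesis using w[OF one_W] lw l unfolding pf_def by simp
        next
          case (2 p')
          then show ?thesis using w[OF one_W] w[OF \<omega>] lw l unfolding pf_def
            by (intro conjI disjI2 exI[of _ p']) simp_all
        qed
      qed
      from mlbD[OF P(2) \<omega> _ this] p vs l
      have "wb \<omega> (C * K * prod_list ?cs) (P ?ws)" by simp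
      then show "wb \<omega> (C * K * b * prod_list cs) (P ?ws)"
        using prod_list_update_mult[of p cs b] p l by (simp add: mult.assoc)
    qed
    have "mlb j (\<Sum>p<j. C * K * b) (\<lambda>vs. \<Sum>p<j. P (take p (map ?M vs) @ B (vs ! p) # drop (Suc p) (map A vs)))"
      by (rule mlb_sum) (use t in auto)
    moreover have "(\<Sum>p<j. P (take p (map ?M vs) @ B (vs ! p) # drop (Suc p) (map A vs))) = P (map ?M vs) - P (map A vs)"
      if "length vs = j" for vs
    proof -
      have "P (map ?M vs) - P (map A vs) = (\<Sum>p<j. P (take p (map ?M vs) @ (map ?M vs ! p - map A vs ! p) # drop (Suc p) (map A vs)))"
        using that by (intro multilinear_telescope[OF P(1)]) auto
      also have "\<dots> = (\<Sum>p<j. P (take p (map ?M vs) @ B (vs ! p) # drop (Suc p) (map A vs)))"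
        using that by (intro sum.cong) auto
      finally show ?thesis by simp
    qed
    ultimately have d: "mlb j (\<Sum>p<j. C * K * b) (\<lambda>vs. P (map ?M vs) - P (map A vs))" by (rule mlb_cong)
    have "mlb j ((\<Sum>p<j. C * K * b) + b * (C * K)) (\<lambda>vs. (P (map ?M vs) - P (map A vs)) - B (P vs))"
      by (rule mlb_diff[OF d mlb_compose[OF B(2) P(2)]])
    moreover have "(\<Sum>p<j. C * K * b) + b * (C * K) \<le> 1 / 2 * K"
    proof -
      have "(\<Sum>p<j. C * K * b) + b * (C * K) = real (Suc j) * b * C * K" by (simp add: algebra_simps)
      also have "\<dots> \<le> 1 / 2 * K" using C(2) mlb_K_nonneg[OF Q(2)] by (rule mult_right_mono)
      finally show ?thesis .
    qed
    ultimately have "mlb j (1 / 2 * K) (\<lambda>vs. (P (map ?M vs) - P (map A vs)) - B (P vs))" by (rule mlb_mono)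
    then have "mlb j (1 / 2 * K) (\<lambda>vs. Q vs - (?M (P vs) - P (map ?M vs)))"
      by (rule mlb_cong) (simp flip: P(3))
    then show "\<exists>P. multilinear j P \<and> mlb j (C * K) P \<and> mlb j (1 / 2 * K) (\<lambda>vs. Q vs - (?M (P vs) - P (map ?M vs)))"
      using P by blast
  qed auto
  then show ?thesis by (simp add: mult_ac)
qed

end

section \<open>Translation between the norms of the statement and \<open>mlb\<close>\<close>

lemma multilinear_scale_all:
  assumes A: "multilinear j A" and "length vs = j" "length ss = j"
  shows "A (map2 (\<lambda>s v. s *\<^sub>R v) ss vs) = prod_list ss *\<^sub>R A vs"
proof -
  have "A (map2 (\<lambda>s v. s *\<^sub>R v) (take k ss) (take k vs) @ drop k vs) = prod_list (take k ss) *\<^sub>R A vs" if "k \<le> j" for k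
    using that
  proof (induction k)
    case (Suc k)
    let ?u = "map2 (\<lambda>s v. s *\<^sub>R v) (take k ss) (take k vs) @ drop k vs"
    have k: "k < j" using Suc.prems by simp
    have l: "length ?u = j" "?u ! k = vs ! k" using assms k by (auto simp: nth_append)
    have "map2 (\<lambda>s v. s *\<^sub>R v) (take (Suc k) ss) (take (Suc k) vs) @ drop (Suc k) vs = ?u[k := (ss ! k) *\<^sub>R (vs ! k)]"
      using assms k by (simp add: take_Suc_conv_app_nth list_update_append Cons_nth_drop_Suc[symmetric])
    moreover have "A (?u[k := (ss ! k) *\<^sub>R (vs ! k)]) = (ss ! k) *\<^sub>R A ?u"
      using linear_scale[OF multilinearD[OF A l(1) k], of "ss ! k" "vs ! k"] l(2) by (metis list_update_id)
    ultimately show ?case using Suc assms by (simp add: take_Suc_conv_app_nth mult.commute)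
  qed simp
  from this[of j] show ?thesis using assms by simp
qed

lemma prod_list_inverse: "0 \<notin> set cs \<Longrightarrow> prod_list cs * prod_list (map inverse cs) = (1 :: real)"
proof (induction cs)
  case (Cons c cs)
  have "prod_list (c # cs) * prod_list (map inverse (c # cs)) = (c * inverse c) * (prod_list cs * prod_list (map inverse cs))"
    by (simp only: prod_list.Cons list.map mult_ac)
  also have "\<dots> = 1" using Cons by simp
  finally show ?case .
qed simp

section \<open>Decay functions and the weights they define\<close>

lemma decay_le_1:
  assumes "decay_function \<Gamma>" shows "\<Gamma> k \<le> 1"
proof -
  have "sum \<Gamma> {k} \<le> (\<Sum>\<^sub>\<infinity>k. \<Gamma> k)"
    using assms by (intro finite_sum_le_infsum) (auto simp: decay_function_def less_imp_le)
  then show ?thesis using assms by (auto simp: decay_function_def)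
qed

text \<open>More than \<open>1 / e\<close> such indices would push the sum of
  \<open>\<Gamma>\<close> above \<open>1\<close>.\<close>

lemma decay_finite:
  fixes \<Gamma> :: "int^'m::finite \<Rightarrow> real"
  assumes \<Gamma>: "decay_function \<Gamma>" and e: "0 < e" shows "finite {k. e < \<Gamma> k}"
proof (rule ccontr)
  assume inf: "infinite {k. e < \<Gamma> k}"
  obtain n :: nat where n: "1 / e < real n" using reals_Archimedean2 by blast
  obtain S where S: "S \<subseteq> {k. e < \<Gamma> k}" "finite S" "card S = n" using infinite_arbitrarily_large[OF inf] by metis
  have "e \<le> \<Gamma> k" if "k \<in> S" for k using S(1) that by force
  then have "real n * e \<le> sum \<Gamma> S" using sum_bounded_below[of S e \<Gamma>] S(3) by simp
  also have "\<dots> \<le> (\<Sum>\<^sub>\<infinity>k. \<Gamma> k)"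
    using \<Gamma> S by (intro finite_sum_le_infsum) (auto simp: decay_function_def less_imp_le)
  also have "\<dots> \<le> 1" using \<Gamma> by (simp add: decay_function_def)
  finally show False using n e by (simp add: field_simps)
qed

lemma decay_convolution:
  fixes \<Gamma> :: "int^'m::finite \<Rightarrow> real"
  assumes \<Gamma>: "decay_function \<Gamma>" and S: "finite S"
  shows "(\<Sum>k\<in>S. \<Gamma> (i - k) * \<Gamma> (k - j)) \<le> \<Gamma> (i - j)"
proof -
  have pos: "0 < \<Gamma> k" for k using \<Gamma> by (simp add: decay_function_def)
  have "bij (\<lambda>k. i - k)" by (rule o_bij[of "\<lambda>k. i - k"]) (auto simp: fun_eq_iff)
  then have "(\<lambda>k. \<Gamma> (i - k)) summable_on UNIV"
    using \<Gamma> summable_on_reindex_bij_betw[of "\<lambda>k. i - k" UNIV UNIV \<Gamma>] by (simp add: decay_function_def)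
  then have "(\<lambda>k. \<Gamma> (i - k) * \<Gamma> (k - j)) summable_on UNIV"
    by (rule summable_on_comparison_test)
      (use pos decay_le_1[OF \<Gamma>] in \<open>auto simp: less_imp_le mult_left_le\<close>)
  then have "(\<Sum>k\<in>S. \<Gamma> (i - k) * \<Gamma> (k - j)) \<le> (\<Sum>\<^sub>\<infinity>k. \<Gamma> (i - k) * \<Gamma> (k - j))"
    using S pos by (intro finite_sum_le_infsum) (auto simp: less_imp_le)
  then show ?thesis using \<Gamma> by (auto simp: decay_function_def intro: order_trans)
qed

definition weight_set :: "(int^'m \<Rightarrow> real) \<Rightarrow> (int^'m \<Rightarrow> real) set" where
  "weight_set \<Gamma> = insert (\<lambda>_. 1) (range (\<lambda>l i. \<Gamma> (i - l)))"

lemma weights_weight_set: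
  assumes "is_norm N" "decay_function \<Gamma>" shows "weights N (weight_set \<Gamma>)"
  using assms by unfold_locales (auto simp: weight_set_def decay_function_def)

context weights
begin

lemma N_sum: "N (sum f S) \<le> (\<Sum>s\<in>S. N (f s))"
  by (induction S rule: infinite_finite_induct) (auto intro: order_trans[OF N_triangle])

text \<open>Homogeneity reduces to arguments in the unit ball. A majorant zero cannot be scaled
  away, but it forces its argument to be zero.\<close>

lemma ml_norm_bound:
  assumes A: "multilinear j A" and b: "ml_norm N j A \<le> ennreal K" and K: "0 \<le> K"
    and vs: "length vs = j" "length cs = j" and w: "\<And>q. q < j \<Longrightarrow> wb one (cs ! q) (vs ! q)"
  shows "wb one (K * prod_list cs) (A vs)"
proof (cases "0 \<in> set cs")
  case True
  then obtain q where q: "q < j" "cs ! q = 0" using vs by (auto simp: in_set_conv_nth)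
  have "nm (vs ! q) \<le> 0" using w[OF q(1)] q(2) nm_le_iff by simp
  then have "lo * norm (vs ! q) \<le> 0" using norm_le_nm order_trans by blast
  then have "vs ! q = 0" using lo_hi(1) by (simp add: mult_le_0_iff)
  then have "A vs = 0" using multilinear_eq_0[OF A vs(1)] q vs nth_mem by metis
  moreover have "prod_list cs = 0" using True by (induction cs) auto
  ultimately show ?thesis by (simp add: wb_zero[OF one_W])
next
  case False
  have cpos: "0 < cs ! q" if "q < j" for q
    using wb_one_nonneg[OF w[OF that]] False vs(2) that by (metis order_le_less nth_mem)
  let ?us = "map2 (\<lambda>s v. s *\<^sub>R v) (map inverse cs) vs"
  have "nm u \<le> 1" if u: "u \<in> set ?us" for u
  proof -
    obtain q where q: "q < j" "u = inverse (cs ! q) *\<^sub>R (vs ! q)" using u vs by (auto simp: in_set_conv_nth)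
    show ?thesis unfolding nm_le_iff q(2)
      using wb_scale[OF w[OF q(1)], of "inverse (cs ! q)"] cpos[OF q(1)] by simp
  qed
  then have "ennreal (nm (A ?us)) \<le> ml_norm N j A"
    unfolding ml_norm_def using vs by (intro SUP_upper) auto
  from order_trans[OF this b] have "nm (A ?us) \<le> K" by (simp add: ennreal_le_iff[OF K])
  then have "wb one K (A ?us)" by (simp add: nm_le_iff)
  moreover have "A vs = prod_list cs *\<^sub>R A ?us"
  proof -
    have "A ?us = prod_list (map inverse cs) *\<^sub>R A vs" using vs by (intro multilinear_scale_all[OF A]) auto
    moreover have "prod_list cs * prod_list (map inverse cs) = 1" using False by (rule prod_list_inverse)
    ultimately show ?thesis by simp
  qed
  moreover have "0 \<le> prod_list cs" using cpos vs by (intro prod_list_nonneg_real) (force simp: in_set_conv_nth less_imp_le)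
  ultimately show ?thesis using wb_scale[of one K "A ?us" "prod_list cs"] by (simp add: mult.commute)
qed

lemma ml_norm_opb:
  fixes A :: "('m, 'n) linf list \<Rightarrow> ('m, 'n) linf"
  assumes A: "multilinear j A" "ml_norm N j A \<le> ennreal K" "0 \<le> K" shows "opb j (K * hi ^ j / lo) A"
  unfolding opb_def
proof (intro allI impI)
  fix vs :: "('m, 'n) linf list" assume vs: "length vs = j"
  have "wb one (K * prod_list (map (\<lambda>v. hi * norm v) vs)) (A vs)"
    using vs by (intro ml_norm_bound[OF A]) (auto simp: wb_norm)
  then have "lo * norm (A vs) \<le> K * prod_list (map (\<lambda>v. hi * norm v) vs)" by (rule norm_le_wb)
  also have "prod_list (map (\<lambda>v. hi * norm v) vs) = hi ^ length vs * prod_list (map norm vs)"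
    by (induction vs) auto
  finally show "norm (A vs) \<le> K * hi ^ j / lo * prod_list (map norm vs)"
    using vs lo_hi(1) by (simp add: field_simps)
qed

lemma opb_ml_norm:
  fixes A :: "('m, 'n) linf list \<Rightarrow> ('m, 'n) linf"
  assumes A: "opb j e A" and e: "0 \<le> e" shows "ml_norm N j A \<le> ennreal (hi * (1 / lo) ^ j * e)"
  unfolding ml_norm_def
proof (rule SUP_least)
  fix vs assume "vs \<in> {vs. length vs = j \<and> (\<forall>v\<in>set vs. nm v \<le> 1)}"
  then have vs: "length vs = j" "\<And>v. v \<in> set vs \<Longrightarrow> nm v \<le> 1" by auto
  have "norm (A vs) \<le> e * prod_list (replicate j (1 / lo))"
  proof (rule opb_list[OF A e vs(1)])
    fix p assume "p < j"
    then have "lo * norm (vs ! p) \<le> 1" using norm_le_nm[of "vs ! p"] vs(2)[of "vs ! p"] vs(1) by fastforce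
    then show "norm (vs ! p) \<le> replicate j (1 / lo) ! p" using \<open>p < j\<close> lo_hi(1) by (simp add: field_simps)
  qed simp
  then have "hi * norm (A vs) \<le> hi * (e * (1 / lo) ^ j)"
    using lo_hi(2) by (intro mult_left_mono) (auto simp: prod_list_replicate)
  then show "ennreal (nm (A vs)) \<le> ennreal (hi * (1 / lo) ^ j * e)"
    using nm_le_norm[of "A vs"] by (intro ennreal_leI) (simp add: mult_ac)
qed

lemma mlb_ml_norm: assumes "mlb j K A" shows "ml_norm N j A \<le> ennreal K"
  unfolding ml_norm_def
proof (rule SUP_least)
  fix vs assume "vs \<in> {vs. length vs = j \<and> (\<forall>v\<in>set vs. nm v \<le> 1)}"
  then have vs: "length vs = j" "\<And>v. v \<in> set vs \<Longrightarrow> nm v \<le> 1" by auto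
  have "pf one (replicate j 1) vs" using vs by (intro pf_one) (auto simp: nm_le_iff)
  from mlbD[OF assms one_W vs(1) this] show "ennreal (nm (A vs)) \<le> ennreal K"
    by (intro ennreal_leI) (simp add: nm_le_iff prod_list_replicate)
qed

end

text \<open>The quantity \<open>\<gamma>\<close> controls only arguments supported at a single node.
  A weighted argument is split at the finitely many nodes where its weight exceeds a threshold, and
  the convolution inequality for \<open>\<Gamma>\<close> sums these contributions. The remainder is
  small in the sup norm, where the operator norm suffices.\<close>

lemma (in weights) mlb_of_ml_Gamma_norm:
  assumes \<Gamma>: "decay_function \<Gamma>" and W: "W = weight_set \<Gamma>"
    and A: "multilinear j A" and b: "ml_Gamma_norm N \<Gamma> j A \<le> ennreal K" and K: "0 \<le> K"
  shows "mlb j K A"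
  unfolding mlb_def
proof (intro ballI allI impI)
  fix \<omega> cs and vs :: "('m, 'n) linf list" assume \<omega>: "\<omega> \<in> W" and vs: "length vs = j" and pf: "pf \<omega> cs vs"
  have bn: "ml_norm N j A \<le> ennreal K" and bg: "ml_gamma N \<Gamma> j A \<le> ennreal K"
    using b by (auto simp: ml_Gamma_norm_def)
  have l: "length cs = j" using pf vs by (simp add: pf_def)
  have gpos: "0 < \<Gamma> k" for k using \<Gamma> by (simp add: decay_function_def)
  consider "\<omega> = one" "\<forall>q<j. wb one (cs ! q) (vs ! q)"
    | p where "p < j" "wb \<omega> (cs ! p) (vs ! p)" "\<And>q. q < j \<Longrightarrow> q \<noteq> p \<Longrightarrow> wb one (cs ! q) (vs ! q)"
    using pf vs unfolding pf_def by auto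
  then show "wb \<omega> (K * prod_list cs) (A vs)"
  proof cases
    case 1
    then show ?thesis using ml_norm_bound[OF A bn K vs l] by simp
  next
    case (2 p)
    show ?thesis
    proof (cases "\<omega> = one")
      case True
      then have "wb one (cs ! q) (vs ! q)" if "q < j" for q using 2 that by (cases "q = p") auto
      then show ?thesis using True ml_norm_bound[OF A bn K vs l] by simp
    next
      case False
      then obtain l' where \<omega>l: "\<omega> = (\<lambda>i. \<Gamma> (i - l'))" using \<omega> W by (auto simp: weight_set_def)
      show ?thesis
      proof (cases "0 \<in> set cs")
        case True
        then obtain q where q: "q < j" "cs ! q = 0" using l by (auto simp: in_set_conv_nth)
        have "wb one (cs ! q) (vs ! q) \<or> wb \<omega> (cs ! q) (vs ! q)" using 2 q by blast
        then have "\<forall>i. N (apply_bcontfun (vs ! q) i) \<le> 0" using q by (auto simp: wb_def)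
        then have "apply_bcontfun (vs ! q) i = 0" for i by (metis N_eq_0 N_nonneg order_antisym)
        then have "vs ! q = 0" by (intro bcontfun_eqI) simp
        then have "A vs = 0" using multilinear_eq_0[OF A vs] q vs nth_mem by metis
        moreover have "prod_list cs = 0" using True by (induction cs) auto
        ultimately show ?thesis by (simp add: wb_zero[OF \<omega>])
      next
        case nz: False
        have cpos: "0 < cs ! q" if "q < j" for q
        proof -
          have "wb one (cs ! q) (vs ! q) \<or> wb \<omega> (cs ! q) (vs ! q)" using 2 that by blast
          then have "0 \<le> cs ! q" using wb_one_nonneg wb_nonneg[OF \<omega>] by blast
          then show ?thesis using nz l that by (metis order_le_less nth_mem)
        qed
        define us where "us = map2 (\<lambda>s v. s *\<^sub>R v) (map inverse cs) vs"
        have us: "length us = j" using vs l by (simp add: us_def)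
        have un: "us ! q = inverse (cs ! q) *\<^sub>R (vs ! q)" if "q < j" for q using that vs l by (simp add: us_def)
        have u1: "nm (us ! q) \<le> 1" if "q < j" "q \<noteq> p" for q
          unfolding nm_le_iff un[OF that(1)]
          using wb_scale[OF 2(3)[OF that], of "inverse (cs ! q)"] cpos[OF that(1)] by simp
        have up: "wb \<omega> 1 (us ! p)"
          unfolding un[OF 2(1)] using wb_scale[OF 2(2), of "inverse (cs ! p)"] cpos[OF 2(1)] by simp
        let ?w = "us ! p"
        have lin: "linear (\<lambda>w. A (us[p := w]))" by (rule multilinearD[OF A us 2(1)])
        have emb_b: "N (apply_bcontfun (A (us[p := emb k y])) i) \<le> K * \<Gamma> (i - k) * N y" for i k y
        proof (cases "y = 0")
          case True
          have "emb k (0 :: real^'n) = 0" by (rule bcontfun_eqI) (simp add: apply_emb)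
          then show ?thesis using True linear_0[OF lin] by simp
        next
          case False
          then have Ny: "0 < N y" using N_eq_0 N_nonneg by (metis order_le_less)
          define w where "w = inverse (N y) *\<^sub>R emb k y"
          have "nm w \<le> 1" unfolding nm_le_iff wb_def w_def using Ny by (simp add: apply_emb N_scale)
          moreover have "apply_bcontfun w i' = 0" if "i' \<noteq> k" for i' using that by (simp add: w_def apply_emb)
          moreover have "take p us @ drop (Suc p) us \<in> {vs. length vs = j - 1 \<and> (\<forall>v\<in>set vs. nm v \<le> 1)}"
            using us 2(1) u1 by (auto simp: in_set_conv_nth)
          ultimately have "ennreal (N (apply_bcontfun (A (take p (take p us @ drop (Suc p) us) @ w # drop p (take p us @ drop (Suc p) us))) i) * inverse (\<Gamma> (i - k)))
              \<le> ml_gamma N \<Gamma> j A"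
            unfolding ml_gamma_def using 2(1)
            by (intro SUP_upper2[of p] SUP_upper2[of i] SUP_upper2[of k] SUP_upper2[of w] SUP_upper2[of "take p us @ drop (Suc p) us"]) auto
          moreover have "take p (take p us @ drop (Suc p) us) @ w # drop p (take p us @ drop (Suc p) us) = us[p := w]"
            using us 2(1) by (simp add: upd_conv_take_nth_drop)
          ultimately have "ennreal (N (apply_bcontfun (A (us[p := w])) i) * inverse (\<Gamma> (i - k))) \<le> ennreal K"
            using bg order_trans by metis
          then have "N (apply_bcontfun (A (us[p := w])) i) * inverse (\<Gamma> (i - k)) \<le> K"
            using K by (simp add: ennreal_le_iff)
          then have "N (apply_bcontfun (A (us[p := w])) i) \<le> K * \<Gamma> (i - k)"
            using gpos[of "i - k"] by (simp add: field_simps)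
          moreover have "A (us[p := w]) = inverse (N y) *\<^sub>R A (us[p := emb k y])"
            unfolding w_def by (rule linear_scale[OF lin])
          ultimately show ?thesis using Ny by (simp add: N_scale field_simps)
        qed
        have "N (apply_bcontfun (A us) i) \<le> K * \<Gamma> (i - l')" for i
        proof (rule field_le_epsilon)
          fix e :: real assume e: "0 < e"
          obtain e' where e': "0 < e'" "e' * K \<le> e" using small_multiple[OF e K] by blast
          \<comment> \<open>The nodes at which \<open>?w\<close> may exceed \<open>e'\<close>;
            outside them the weight itself is at most \<open>e'\<close>.\<close>
          define J where "J = (\<lambda>k. k + l') ` {k. e' < \<Gamma> k}"
          have J: "finite J" unfolding J_def by (intro finite_imageI decay_finite[OF \<Gamma> e'(1)])
          have nJ: "\<Gamma> (k - l') \<le> e'" if "k \<notin> J" for k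
          proof (rule ccontr)
            assume "\<not> \<Gamma> (k - l') \<le> e'"
            then have "k - l' \<in> {k. e' < \<Gamma> k}" by simp
            then have "(k - l') + l' \<in> J" unfolding J_def by (rule imageI)
            then show False using that by simp
          qed
          define w1 where "w1 = (\<Sum>k\<in>J. emb k (apply_bcontfun ?w k))"
          have ac: "apply_bcontfun (sum f S) i = (\<Sum>k\<in>S. apply_bcontfun (f k) i)"
            for f :: "int^'m \<Rightarrow> ('m, 'n) linf" and S i
            by (induction S rule: infinite_finite_induct) auto
          have w1: "apply_bcontfun w1 i = (if i \<in> J then apply_bcontfun ?w i else 0)" for i
            using J by (simp add: w1_def ac apply_emb sum.delta)
          have upb: "N (apply_bcontfun ?w k) \<le> \<Gamma> (k - l')" for k using up by (simp add: wb_def \<omega>l)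
          have "nm (?w - w1) \<le> e'"
            unfolding nm_le_iff wb_def
          proof
            fix k show "N (apply_bcontfun (?w - w1) k) \<le> e' * 1"
              using order_trans[OF upb nJ, of k] e' by (simp add: w1)
          qed
          then have "wb one (K * prod_list ((replicate j 1)[p := e'])) (A (us[p := ?w - w1]))"
            using u1 us 2(1) by (intro ml_norm_bound[OF A bn K]) (auto simp: nth_list_update nm_le_iff)
          moreover have "prod_list ((replicate j 1)[p := e']) = e'"
            using prod_list_update_mult[of p "replicate j 1" e'] 2(1) by (simp add: prod_list_replicate)
          ultimately have r: "N (apply_bcontfun (A (us[p := ?w - w1])) i) \<le> K * e'" by (simp add: wb_def)
          have "A (us[p := w1]) = (\<Sum>k\<in>J. A (us[p := emb k (apply_bcontfun ?w k)]))"
            unfolding w1_def by (rule linear_sum[OF lin])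
          then have "N (apply_bcontfun (A (us[p := w1])) i) \<le> (\<Sum>k\<in>J. N (apply_bcontfun (A (us[p := emb k (apply_bcontfun ?w k)])) i))"
            by (simp add: ac N_sum)
          also have "\<dots> \<le> (\<Sum>k\<in>J. K * (\<Gamma> (i - k) * \<Gamma> (k - l')))"
          proof (rule sum_mono)
            fix k
            have "K * \<Gamma> (i - k) * N (apply_bcontfun ?w k) \<le> K * \<Gamma> (i - k) * \<Gamma> (k - l')"
              using K gpos[of "i - k"] upb by (intro mult_left_mono) auto
            then show "N (apply_bcontfun (A (us[p := emb k (apply_bcontfun ?w k)])) i) \<le> K * (\<Gamma> (i - k) * \<Gamma> (k - l'))"
              using order_trans[OF emb_b] by (simp add: mult.assoc)
          qed
          also have "\<dots> \<le> K * \<Gamma> (i - l')"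
            unfolding sum_distrib_left[symmetric] using decay_convolution[OF \<Gamma> J] K by (intro mult_left_mono)
          finally have s: "N (apply_bcontfun (A (us[p := w1])) i) \<le> K * \<Gamma> (i - l')" .
          have "A us = A (us[p := w1]) + A (us[p := ?w - w1])"
            using linear_add[OF lin, of w1 "?w - w1"] by simp
          then have "N (apply_bcontfun (A us) i) \<le> N (apply_bcontfun (A (us[p := w1])) i) + N (apply_bcontfun (A (us[p := ?w - w1])) i)"
            using N_triangle by simp
          also have "\<dots> \<le> K * \<Gamma> (i - l') + e" using s r e'(2) by (simp add: mult.commute)
          finally show "N (apply_bcontfun (A us) i) \<le> K * \<Gamma> (i - l') + e" .
        qed
        then have "wb \<omega> K (A us)" by (simp add: wb_def \<omega>l)
        moreover have "A vs = prod_list cs *\<^sub>R A us"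
        proof -
          have "A us = prod_list (map inverse cs) *\<^sub>R A vs" unfolding us_def using vs l by (intro multilinear_scale_all[OF A]) auto
          moreover have "prod_list cs * prod_list (map inverse cs) = 1" using nz by (rule prod_list_inverse)
          ultimately show ?thesis by simp
        qed
        moreover have "0 \<le> prod_list cs" using cpos l by (intro prod_list_nonneg_real) (force simp: in_set_conv_nth less_imp_le)
        ultimately show ?thesis using wb_scale[of \<omega> K "A us" "prod_list cs"] by (simp add: mult.commute)
      qed
    qed
  qed
qed

text \<open>An argument of norm at most \<open>1\<close> supported at node \<open>l\<close> has norm
  at most \<open>1 / \<Gamma> 0\<close> with respect to the weight
  \<open>\<Gamma> (\<cdot> - l)\<close>; hence the second constant.\<close>

lemma (in weights) ml_Gamma_norm_of_mlb:
  assumes \<Gamma>: "decay_function \<Gamma>" and W: "W = weight_set \<Gamma>" and A: "mlb j K A"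
  shows "ml_Gamma_norm N \<Gamma> j A \<le> ennreal (max K (K / \<Gamma> 0))"
proof -
  have gpos: "0 < \<Gamma> k" for k using \<Gamma> by (simp add: decay_function_def)
  have "ml_gamma N \<Gamma> j A \<le> ennreal (K / \<Gamma> 0)"
    unfolding ml_gamma_def
  proof (intro SUP_least)
    fix p i l w and vs :: "('m, 'n) linf list"
    assume p: "p \<in> {..<j}" and w: "w \<in> {w. nm w \<le> 1 \<and> (\<forall>j. j \<noteq> l \<longrightarrow> apply_bcontfun w j = 0)}"
      and vs: "vs \<in> {vs. length vs = j - 1 \<and> (\<forall>v\<in>set vs. nm v \<le> 1)}"
    let ?\<omega> = "\<lambda>i. \<Gamma> (i - l)" and ?cs = "(replicate j 1)[p := 1 / \<Gamma> 0]" and ?vs = "take p vs @ w # drop p vs"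
    have \<omega>: "?\<omega> \<in> W" unfolding W weight_set_def by blast
    have ww: "wb ?\<omega> (1 / \<Gamma> 0) w"
      unfolding wb_def
    proof
      fix i show "N (apply_bcontfun w i) \<le> 1 / \<Gamma> 0 * \<Gamma> (i - l)"
      proof (cases "i = l")
        case True
        have "wb one 1 w" using w nm_le_iff by simp
        then show ?thesis using True gpos[of 0] by (simp add: wb_def)
      qed (use w gpos[of 0] gpos[of "i - l"] in simp)
    qed
    have lv: "length ?vs = j" using vs p by auto
    have "wb one (?cs ! q) (?vs ! q)" if "q < j" "q \<noteq> p" for q
    proof -
      have "?vs ! q = vs ! (if q < p then q else q - 1)" using that vs p by (auto simp: nth_append nth_Cons')
      moreover have "(if q < p then q else q - 1) < length vs" using that vs p by auto
      ultimately have "?vs ! q \<in> set vs" using nth_mem by metis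
      then have "nm (?vs ! q) \<le> 1" using vs by blast
      then show ?thesis using that by (simp add: nm_le_iff)
    qed
    moreover have "?vs ! p = w" using vs p by (auto simp: nth_append)
    ultimately have "pf ?\<omega> ?cs ?vs"
      unfolding pf_def using lv p ww by (intro conjI disjI2 exI[of _ p]) auto
    from mlbD[OF A \<omega> lv this] have "wb ?\<omega> (K * (1 / \<Gamma> 0)) (A ?vs)"
      using prod_list_update_mult[of p "replicate j 1" "1 / \<Gamma> 0"] p by (simp add: prod_list_replicate)
    then have "N (apply_bcontfun (A ?vs) i) \<le> K / \<Gamma> 0 * \<Gamma> (i - l)" by (simp add: wb_def)
    then show "ennreal (N (apply_bcontfun (A ?vs) i) * inverse (\<Gamma> (i - l))) \<le> ennreal (K / \<Gamma> 0)"
      using gpos[of "i - l"] by (intro ennreal_leI) (simp add: field_simps)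
  qed
  then have "ml_gamma N \<Gamma> j A \<le> ennreal (max K (K / \<Gamma> 0))"
    by (rule order_trans) (intro ennreal_leI max.cobounded2)
  moreover have "ml_norm N j A \<le> ennreal (max K (K / \<Gamma> 0))"
    by (rule order_trans[OF mlb_ml_norm[OF A]]) (intro ennreal_leI max.cobounded1)
  ultimately show ?thesis by (simp add: ml_Gamma_norm_def)
qed

lemma (in weights) jet_of_Cr_derivs:
  fixes F :: "('m, 'n) linf \<Rightarrow> ('m, 'n) linf"
  assumes D: "Cr_derivs N r V F D" and V: "open V"
  shows "jet r V D"
proof -
  have ml: "multilinear j (D j x)" and fin: "ml_norm N j (D j x) < \<infinity>" if "j \<le> r" "x \<in> V" for j x
    using D that by (auto simp: Cr_derivs_def)
  have diff: "\<exists>d>0. \<forall>y\<in>V. nm (y - x) < d \<longrightarrow>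
        ml_norm N j (\<lambda>vs. D j y vs - D j x vs - D (Suc j) x ((y - x) # vs)) \<le> ennreal (e * nm (y - x))"
    if "j < r" "x \<in> V" "0 < e" for j x e
    using D that unfolding Cr_derivs_def by blast
  have cont: "\<exists>d>0. \<forall>y\<in>V. nm (y - x) < d \<longrightarrow> ml_norm N j (\<lambda>vs. D j y vs - D j x vs) \<le> ennreal e"
    if "j \<le> r" "x \<in> V" "0 < e" for j x e
    using D that unfolding Cr_derivs_def by blast
  have op: "\<exists>K. opb j K (D j x)" if j: "j \<le> r" and x: "x \<in> V" for j x
  proof -
    obtain K where "ml_norm N j (D j x) = ennreal K" "0 \<le> K" using fin[OF j x] by (cases "ml_norm N j (D j x)") auto
    then have "opb j (K * hi ^ j / lo) (D j x)" by (intro ml_norm_opb[OF ml[OF j x]]) auto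
    then show ?thesis ..
  qed
  have nmd: "nm z < d" if "norm z < d / hi" for z d
    using le_less_trans[OF nm_le_norm[of z], of d] that lo_hi(2) by (simp add: field_simps)
  show ?thesis
  proof (rule jetI[OF V op])
    fix j assume j: "j \<le> r"
    show "opcont j V (D j)"
      unfolding opcont_def
    proof (intro ballI allI impI)
      fix x and e :: real assume x: "x \<in> V" and e: "0 < e"
      have c: "0 \<le> hi ^ j / lo" using lo_hi by simp
      obtain e' where e': "0 < e'" "e' * (hi ^ j / lo) \<le> e" using small_multiple[OF e c] by blast
      obtain d where d: "0 < d" "\<forall>y\<in>V. nm (y - x) < d \<longrightarrow> ml_norm N j (\<lambda>vs. D j y vs - D j x vs) \<le> ennreal e'"
        using cont[OF j x e'(1)] by blast
      have "opb j e (\<lambda>vs. D j y vs - D j x vs)" if y: "y \<in> V" "norm (y - x) < d / hi" for y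
      proof (rule opb_mono)
        show "opb j (e' * hi ^ j / lo) (\<lambda>vs. D j y vs - D j x vs)"
          using d(2) y nmd e'(1) by (intro ml_norm_opb multilinear_diff ml[OF j] x) auto
      qed (use e'(2) in simp)
      then show "\<exists>d>0. \<forall>y\<in>V. norm (y - x) < d \<longrightarrow> opb j e (\<lambda>vs. D j y vs - D j x vs)"
        using d(1) lo_hi(2) by (intro exI[of _ "d / hi"]) auto
    qed
  next
    fix j x and vs :: "('m, 'n) linf list" assume j: "j < r" and x: "x \<in> V" and vs: "length vs = j"
    have j': "Suc j \<le> r" "j \<le> r" using j by auto
    obtain K where "opb (Suc j) K (D (Suc j) x)" using op[OF j'(1) x] by blast
    from bounded_linear_slot[OF ml[OF j'(1) x] this, of "0 # vs" 0] vs
    have bl: "bounded_linear (\<lambda>h. D (Suc j) x (h # vs))" by simp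
    show "((\<lambda>y. D j y vs) has_derivative (\<lambda>h. D (Suc j) x (h # vs))) (at x)"
      unfolding has_derivative_at_alt
    proof (intro conjI bl allI impI)
      fix e :: real assume e: "0 < e"
      let ?c = "hi * (hi ^ j / lo) * prod_list (map norm vs)"
      have c: "0 \<le> ?c" using lo_hi by (intro mult_nonneg_nonneg) auto
      obtain e' where e': "0 < e'" "e' * ?c \<le> e" using small_multiple[OF e c] by blast
      obtain d where d: "0 < d" "\<forall>y\<in>V. nm (y - x) < d \<longrightarrow>
          ml_norm N j (\<lambda>vs. D j y vs - D j x vs - D (Suc j) x ((y - x) # vs)) \<le> ennreal (e' * nm (y - x))"
        using diff[OF j x e'(1)] by blast
      obtain d0 where d0: "0 < d0" "ball x d0 \<subseteq> V" using V x openE by blast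
      have "norm (D j y vs - D j x vs - D (Suc j) x ((y - x) # vs)) \<le> e * norm (y - x)"
        if y: "norm (y - x) < min d0 (d / hi)" for y
      proof -
        have yV: "y \<in> V" using y d0(2) by (auto simp: dist_norm norm_minus_commute)
        have "opb j (e' * nm (y - x) * hi ^ j / lo) (\<lambda>vs. D j y vs - D j x vs - D (Suc j) x ((y - x) # vs))"
          using d(2) y nmd yV e'(1)
          by (intro ml_norm_opb multilinear_diff ml[OF j'(2)] x multilinear_Cons[OF ml[OF j'(1) x]]) auto
        from opbD[OF this vs]
        have "norm (D j y vs - D j x vs - D (Suc j) x ((y - x) # vs)) \<le> nm (y - x) * (e' * (hi ^ j / lo) * prod_list (map norm vs))"
          by (simp add: mult_ac)
        also have "\<dots> \<le> (hi * norm (y - x)) * (e' * (hi ^ j / lo) * prod_list (map norm vs))"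
          using nm_le_norm e'(1) lo_hi by (intro mult_right_mono mult_nonneg_nonneg) auto
        also have "\<dots> = (e' * ?c) * norm (y - x)" by (simp add: mult_ac)
        also have "\<dots> \<le> e * norm (y - x)" using e'(2) by (rule mult_right_mono) simp
        finally show ?thesis .
      qed
      then show "\<exists>d>0. \<forall>y. norm (y - x) < d \<longrightarrow>
          norm (D j y vs - D j x vs - D (Suc j) x ((y - x) # vs)) \<le> e * norm (y - x)"
        using d(1) d0(1) lo_hi(2) by (intro exI[of _ "min d0 (d / hi)"]) auto
    qed
  qed
qed

text \<open>Differentiability in the operator norm comes from \<open>jet_opdiff\<close>; the rest
  compares \<open>N\<close> with the Euclidean norm.\<close>

lemma (in weights) Cr_derivs_of_jet:
  fixes D :: "nat \<Rightarrow> ('m, 'n) linf \<Rightarrow> ('m, 'n) linf list \<Rightarrow> ('m, 'n) linf"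
  assumes D: "jet r UNIV D" shows "Cr_derivs N r UNIV (\<lambda>x. D 0 x []) D"
proof -
  have nd: "norm z < d" if "nm z < lo * d" for z d
    using le_less_trans[OF norm_le_nm that] lo_hi(1) by simp
  have conv: "ml_norm N j A \<le> ennreal e" if "opb j e' A" "0 \<le> e'" "e' * (hi * (1 / lo) ^ j) \<le> e" for j e e' and A :: "('m, 'n) linf list \<Rightarrow> ('m, 'n) linf"
    by (rule order_trans[OF opb_ml_norm[OF that(1,2)] ennreal_leI]) (use that(3) in \<open>simp add: mult_ac\<close>)
  have c0: "0 \<le> hi * (1 / lo) ^ j" for j using lo_hi by simp
  show ?thesis
    unfolding Cr_derivs_def
  proof (intro conjI ballI allI impI)
    fix j x assume j: "j \<le> r"
    show "multilinear j (D j x)" by (rule jet_multilinear[OF D j]) simp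
    obtain K where K: "opb j K (D j x)" using jet_opb[OF D j] by blast
    have "ml_norm N j (D j x) \<le> ennreal (hi * (1 / lo) ^ j * max K 0)"
      by (rule opb_ml_norm[OF opb_mono[OF K max.cobounded1]]) simp
    then show "ml_norm N j (D j x) < \<infinity>" by (simp add: le_less_trans)
  next
    fix j x and e :: real assume j: "j < r" and e: "0 < e"
    have c1: "0 \<le> hi * (1 / lo) ^ j * (1 / lo)" using lo_hi by simp
    obtain e' where e': "0 < e'" "e' * (hi * (1 / lo) ^ j * (1 / lo)) \<le> e" using small_multiple[OF e c1] by blast
    have "\<exists>d>0. \<forall>y. norm (y - x) < d \<longrightarrow>
        opb j (e' * norm (y - x)) (\<lambda>vs. D j y vs - D j x vs - D (Suc j) x ((y - x) # vs))" (is "\<exists>d>0. ?P d")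
      by (rule jet_opdiff[OF D open_UNIV j UNIV_I e'(1)])
    then obtain d where d: "0 < d" "?P d" by (elim exE conjE)
    note d = d(1) d(2)[rule_format]
    have "ml_norm N j (\<lambda>vs. D j y vs - D j x vs - D (Suc j) x ((y - x) # vs)) \<le> ennreal (e * nm (y - x))"
      if y: "nm (y - x) < lo * d" for y
    proof (rule conv[OF d(2)[OF nd[OF y]]])
      show "0 \<le> e' * norm (y - x)" using e'(1) by simp
      have "norm (y - x) \<le> (1 / lo) * nm (y - x)" using norm_le_nm[of "y - x"] lo_hi(1) by (simp add: field_simps)
      then have "e' * (hi * (1 / lo) ^ j) * norm (y - x) \<le> e' * (hi * (1 / lo) ^ j) * ((1 / lo) * nm (y - x))"
        using e'(1) lo_hi by (intro mult_left_mono) auto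
      also have "\<dots> = (e' * (hi * (1 / lo) ^ j * (1 / lo))) * nm (y - x)" by (simp add: mult_ac)
      also have "\<dots> \<le> e * nm (y - x)" using e'(2) by (rule mult_right_mono) simp
      finally show "e' * norm (y - x) * (hi * (1 / lo) ^ j) \<le> e * nm (y - x)" by (simp add: mult_ac)
    qed
    then show "\<exists>d>0. \<forall>y\<in>UNIV. nm (y - x) < d \<longrightarrow>
        ml_norm N j (\<lambda>vs. D j y vs - D j x vs - D (Suc j) x ((y - x) # vs)) \<le> ennreal (e * nm (y - x))"
      using d(1) lo_hi(1) by (intro exI[of _ "lo * d"]) auto
  next
    fix j x and e :: real assume j: "j \<le> r" and e: "0 < e"
    obtain e' where e': "0 < e'" "e' * (hi * (1 / lo) ^ j) \<le> e" using small_multiple[OF e c0] by blast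
    obtain d where d: "0 < d" "\<forall>y\<in>UNIV. norm (y - x) < d \<longrightarrow> opb j e' (\<lambda>vs. D j y vs - D j x vs)"
      using opcontD[OF jet_opcont[OF D j] UNIV_I e'(1)] by blast
    have "ml_norm N j (\<lambda>vs. D j y vs - D j x vs) \<le> ennreal e" if "nm (y - x) < lo * d" for y
      using d(2) nd[OF that] e' by (intro conv[of j e']) auto
    then show "\<exists>d>0. \<forall>y\<in>UNIV. nm (y - x) < d \<longrightarrow> ml_norm N j (\<lambda>vs. D j y vs - D j x vs) \<le> ennreal e"
      using d(1) lo_hi(1) by (intro exI[of _ "lo * d"]) auto
  qed simp
qed

lemma (in weights) C_Gamma_of_jet:
  fixes D :: "nat \<Rightarrow> ('m, 'n) linf \<Rightarrow> ('m, 'n) linf list \<Rightarrow> ('m, 'n) linf"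
  assumes \<Gamma>: "decay_function \<Gamma>" and W: "W = weight_set \<Gamma>"
    and D: "jet r UNIV D" and b: "\<And>j x. j \<le> r \<Longrightarrow> mlb j K (D j x)"
  shows "(\<lambda>x. D 0 x []) \<in> C_Gamma N \<Gamma> r UNIV"
  unfolding C_Gamma_def mem_Collect_eq
proof (intro exI[of _ D] conjI ballI)
  show "Cr_derivs N r UNIV (\<lambda>x. D 0 x []) D" by (rule Cr_derivs_of_jet[OF D])
  have "nm (D 0 x []) \<le> K" for x
    using mlbD[OF b[of 0 x] one_W, of "[]" "[]"] by (simp add: nm_le_iff pf_def)
  then have "(SUP x\<in>UNIV. ennreal (nm (D 0 x []))) \<le> ennreal K" by (intro SUP_least ennreal_leI)
  then show "(SUP x\<in>UNIV. ennreal (nm (D 0 x []))) < \<infinity>" by (simp add: le_less_trans)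
  fix j assume j: "j \<in> {1..r}"
  have g: "ml_Gamma_norm N \<Gamma> j (D j x) \<le> ennreal (max K (K / \<Gamma> 0))" for x
    using j by (intro ml_Gamma_norm_of_mlb[OF \<Gamma> W] b) auto
  then have "(SUP x\<in>UNIV. ml_Gamma_norm N \<Gamma> j (D j x)) \<le> ennreal (max K (K / \<Gamma> 0))" by (intro SUP_least)
  then show "(SUP x\<in>UNIV. ml_Gamma_norm N \<Gamma> j (D j x)) < \<infinity>" by (simp add: le_less_trans)
  fix x
  have "ml_Gamma_norm N \<Gamma> j (D j x) < \<infinity>" using g[of x] by (simp add: le_less_trans)
  then show "D j x \<in> L_Gamma N \<Gamma> j"
    using jet_multilinear[OF D, of j x] j by (auto simp: L_Gamma_def ml_Gamma_norm_def)
qed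

text \<open>One factor \<open>s\<close> for the value and one factor \<open>t\<close> for each of
  the \<open>j\<close> arguments; the weights are the same on both sides.\<close>

lemma mlb_change_norm:
  fixes N N' :: "real^'n::finite \<Rightarrow> real" and W :: "(int^'m::finite \<Rightarrow> real) set"
  assumes w: "weights N W" "weights N' W" and s: "0 < s" "\<And>y. N' y \<le> s * N y" and t: "\<And>y. N y \<le> t * N' y"
    and A: "weights.mlb N W j K A"
  shows "weights.mlb N' W j (s * t ^ j * K) A"
proof -
  interpret w: weights N W by (rule w)
  interpret w': weights N' W by (rule w)
  have t0: "0 \<le> t"
  proof -
    obtain y :: "real^'n" where "norm y = 1" using vector_choose_size[of 1] by auto
    then have "0 < N y" "0 < N' y" using w.lo_hi(3)[of y] w'.lo_hi(3)[of y] w.lo_hi(1) w'.lo_hi(1) by auto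
    then have "0 < t * N' y" "0 < N' y" using t[of y] by auto
    then show ?thesis by (simp add: zero_less_mult_iff)
  qed
  have wb: "w.wb \<omega> (t * c) x" if "w'.wb \<omega> c x" "\<omega> \<in> W" for \<omega> c x
  proof -
    have "N (apply_bcontfun x i) \<le> t * (c * \<omega> i)" for i
      using order_trans[OF t mult_left_mono[OF _ t0]] that(1) unfolding w'.wb_def by blast
    then show ?thesis by (simp add: w.wb_def mult.assoc)
  qed
  show ?thesis
    unfolding w'.mlb_def
  proof (intro ballI allI impI)
    fix \<omega> cs and vs :: "('m, 'n) linf list" assume \<omega>: "\<omega> \<in> W" and vs: "length vs = j" and pf: "w'.pf \<omega> cs vs"
    have "w.pf \<omega> (map (\<lambda>c. t * c) cs) vs"
    proof -
      have l: "length cs = length vs" using pf by (simp add: w'.pf_def)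
      consider "\<omega> = w.one" "\<forall>q<length vs. w'.wb w.one (cs ! q) (vs ! q)"
        | p where "p < length vs" "w'.wb \<omega> (cs ! p) (vs ! p)" "\<And>q. q < length vs \<Longrightarrow> q \<noteq> p \<Longrightarrow> w'.wb w.one (cs ! q) (vs ! q)"
        using pf unfolding w'.pf_def by blast
      then show ?thesis
      proof cases
        case 1
        then show ?thesis unfolding w.pf_def using wb[OF _ w.one_W] l by simp
      next
        case (2 p)
        then show ?thesis unfolding w.pf_def using wb[OF _ w.one_W] wb[OF _ \<omega>] l
          by (intro conjI disjI2 exI[of _ p]) simp_all
      qed
    qed
    from w.mlbD[OF A \<omega> vs this]
    have "w.wb \<omega> (K * prod_list (map (\<lambda>c. t * c) cs)) (A vs)" .
    moreover have "prod_list (map (\<lambda>c. t * c) cs) = t ^ length cs * prod_list cs" by (induction cs) auto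
    moreover have "length cs = j" using pf vs by (simp add: w'.pf_def)
    ultimately have "N (apply_bcontfun (A vs) i) \<le> K * (t ^ j * prod_list cs) * \<omega> i" for i by (simp add: w.wb_def)
    then have "s * N (apply_bcontfun (A vs) i) \<le> s * (K * (t ^ j * prod_list cs) * \<omega> i)" for i
      using s(1) by (simp add: mult_left_mono)
    then show "w'.wb \<omega> (s * t ^ j * K * prod_list cs) (A vs)"
      unfolding w'.wb_def using order_trans[OF s(2)] by (simp add: mult_ac)
  qed
qed

text \<open>The blocks alone do not determine a bounded operator, since finitely supported families
  are not dense in the sup norm. Being uncoupled closes the gap: along a direction that vanishes at
  node \<open>i\<close>, the component \<open>i\<close> of \<open>F\<close> is constant, so that of
  its derivative is zero.\<close>

lemma uncoupled_derivative:
  fixes F :: "('m::finite, 'n::finite) linf \<Rightarrow> ('m, 'n) linf"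
  assumes U: "open U" "0 \<in> U" "uncoupled U F" and d: "(F has_derivative A) (at 0)"
    and emb: "\<And>i j v. apply_bcontfun (A (emb j v)) i = (if i = j then a v else 0)"
  shows "apply_bcontfun (A x) i = a (apply_bcontfun x i)"
proof -
  define y where "y = x - emb i (apply_bcontfun x i)"
  have y: "apply_bcontfun y i = 0" by (simp add: y_def apply_emb)
  have lin: "linear A" using d by (simp add: bounded_linear.linear has_derivative_bounded_linear)
  have bl: "bounded_linear (\<lambda>x :: ('m, 'n) linf. apply_bcontfun x i)"
    by (rule bounded_linear_intro[where K = 1]) (auto simp: norm_bounded)
  have "((\<lambda>t. F (0 + t *\<^sub>R y)) has_vector_derivative A y) (at 0)"
    using d by (intro has_vector_derivative_line) simp
  from bounded_linear.has_vector_derivative[OF bl this]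
  have 1: "((\<lambda>t. apply_bcontfun (F (t *\<^sub>R y)) i) has_vector_derivative apply_bcontfun (A y) i) (at 0)" by simp
  have S: "open ((\<lambda>t. t *\<^sub>R y) -` U)" by (rule open_vimage[OF U(1)]) (intro continuous_intros)
  have "apply_bcontfun (F (t *\<^sub>R y)) i = apply_bcontfun (F 0) i" if "t \<in> (\<lambda>t. t *\<^sub>R y) -` U" for t
    using U(3)[unfolded uncoupled_def, rule_format, of "t *\<^sub>R y" 0 i] U(2) that y by simp
  then have "((\<lambda>t. apply_bcontfun (F (t *\<^sub>R y)) i) has_vector_derivative 0) (at 0)"
    by (intro has_vector_derivative_transform_within_open[OF has_vector_derivative_const S, of 0 "apply_bcontfun (F 0) i"]) (use U(2) in auto)
  from vector_derivative_unique_at[OF 1 this] have "apply_bcontfun (A y) i = 0" .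
  moreover have "A x = A y + A (emb i (apply_bcontfun x i))"
    by (simp flip: linear_add[OF lin] add: y_def)
  ultimately show ?thesis by (simp add: emb)
qed

section \<open>Spectral gap and conclusion\<close>

text \<open>\<open>q\<close> exceeds \<open>ln \<alpha> / ln \<beta>\<close>, and multiplication by
  \<open>ln \<beta> < 0\<close> reverses the inequality.\<close>

lemma resonance_order:
  fixes \<alpha> \<beta> :: real
  assumes "0 < \<alpha>" "\<alpha> \<le> \<beta>" "\<beta> < 1" and q: "int q = \<lfloor>ln \<alpha> / ln \<beta>\<rfloor> + 1"
  shows "2 \<le> q" "\<beta> ^ q < \<alpha>"
proof -
  have ln: "ln \<beta> < 0" "ln \<alpha> \<le> ln \<beta>" using assms by auto
  then have "1 \<le> ln \<alpha> / ln \<beta>" by (simp add: le_divide_eq)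
  then have "1 \<le> \<lfloor>ln \<alpha> / ln \<beta>\<rfloor>" by simp
  then show "2 \<le> q" using q by linarith
  have "ln \<alpha> / ln \<beta> < real q" using q by linarith
  then have "real q * ln \<beta> < ln \<alpha>" using ln(1) by (simp add: divide_less_eq)
  then have "ln (\<beta> ^ q) < ln \<alpha>" using assms by (simp add: ln_realpow)
  then show "\<beta> ^ q < \<alpha>" using assms by simp
qed

text \<open>Strict inequalities that hold at \<open>\<delta> = 0\<close> persist for small
  \<open>\<delta>\<close>. The three units added to \<open>\<beta>\<close> are spent on the adapted
  norm, on \<open>B\<close> and on the nonlinear part; the two taken from \<open>\<alpha>\<close> on
  the first two of these.\<close>

lemma spectral_gap_room:
  fixes \<alpha> \<beta> :: real
  assumes "0 < \<alpha>" "\<beta> < 1" "\<beta> ^ q < \<alpha>"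
  obtains \<delta> where "0 < \<delta>" "2 * \<delta> < \<alpha>" "\<beta> + 3 * \<delta> < 1" "(\<beta> + 3 * \<delta>) ^ q < \<alpha> - 2 * \<delta>"
proof -
  have t: "((\<lambda>\<delta>. \<alpha> - 2 * \<delta>) \<longlongrightarrow> \<alpha> - 2 * 0) (at_right 0)" "((\<lambda>\<delta>. \<beta> + 3 * \<delta>) \<longlongrightarrow> \<beta> + 3 * 0) (at_right 0)"
    "((\<lambda>\<delta>. (\<alpha> - 2 * \<delta>) - (\<beta> + 3 * \<delta>) ^ q) \<longlongrightarrow> (\<alpha> - 2 * 0) - (\<beta> + 3 * 0) ^ q) (at_right 0)"
    by (intro tendsto_intros)+
  have "eventually (\<lambda>\<delta>. 0 < \<alpha> - 2 * \<delta>) (at_right 0)" "eventually (\<lambda>\<delta>. \<beta> + 3 * \<delta> < 1) (at_right 0)"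
    "eventually (\<lambda>\<delta>. 0 < (\<alpha> - 2 * \<delta>) - (\<beta> + 3 * \<delta>) ^ q) (at_right 0)"
    using order_tendstoD(1)[OF t(1), of 0] order_tendstoD(2)[OF t(2), of 1] order_tendstoD(1)[OF t(3), of 0] assms by auto
  then have "eventually (\<lambda>\<delta>. 0 < \<delta> \<and> 0 < \<alpha> - 2 * \<delta> \<and> \<beta> + 3 * \<delta> < 1 \<and> 0 < (\<alpha> - 2 * \<delta>) - (\<beta> + 3 * \<delta>) ^ q) (at_right 0)"
    using eventually_at_right_less[of "0 :: real"] by eventually_elim simp
  then obtain \<delta> where "0 < \<delta> \<and> 0 < \<alpha> - 2 * \<delta> \<and> \<beta> + 3 * \<delta> < 1 \<and> 0 < (\<alpha> - 2 * \<delta>) - (\<beta> + 3 * \<delta>) ^ q"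
    using eventually_happens'[OF trivial_limit_at_right_real] by blast
  then show thesis by (intro that[of \<delta>]) auto
qed

text \<open>Turns a product over a list of eigenvalues into a monomial with multiplicities, the form
  in which nonresonance is assumed.\<close>

lemma prod_list_count:
  fixes f :: "'a::finite \<Rightarrow> 'b::comm_monoid_mult"
  shows "prod_list (map f xs) = (\<Prod>x\<in>UNIV. f x ^ count_list xs x)"
proof (induction xs)
  case (Cons x xs)
  have "(\<Prod>y\<in>UNIV. f y ^ count_list (x # xs) y) = (\<Prod>y\<in>UNIV. (if y = x then f x else 1) * f y ^ count_list xs y)"
    by (rule prod.cong) auto
  also have "\<dots> = f x * (\<Prod>y\<in>UNIV. f y ^ count_list xs y)" by (simp add: prod.distrib)
  finally show ?case using Cons by simp
qed simp

definition nodewise :: "(real^'n \<Rightarrow> real^'n) \<Rightarrow> ('m::finite, 'n::finite) linf \<Rightarrow> ('m, 'n) linf" where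
  "nodewise a x = Bcontfun (\<lambda>i. a (apply_bcontfun x i))"

lemma apply_nodewise: assumes "linear a" shows "apply_bcontfun (nodewise a x) i = a (apply_bcontfun x i)"
proof -
  have "bounded (a ` range (apply_bcontfun x))"
    by (intro bounded_linear_image bounded_apply_bcontfun) (use assms in \<open>simp add: linear_conv_bounded_linear\<close>)
  then show ?thesis by (simp add: nodewise_def bounded_family image_comp comp_def Bcontfun_inverse)
qed

lemma linear_nodewise: "linear a \<Longrightarrow> linear (nodewise a)"
  by (intro linearI bcontfun_eqI) (simp_all add: apply_nodewise linear_add linear_scale)

lemma (in weights) lb_nodewise:
  assumes "linear a" "\<And>y. N (a y) \<le> c * N y" "0 \<le> c" shows "lb c (nodewise a)"
  unfolding lb_def wb_def
  using order_trans[OF assms(2) mult_left_mono[OF _ assms(3)]] by (simp add: apply_nodewise assms(1) mult.assoc)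

text \<open>Collects all smallness conditions on \<open>B\<close> into one number \<open>b\<close>,
  fixed before \<open>B\<close>. Only finitely many degrees \<open>j < q\<close> are involved, so
  one bound serves all of them.\<close>

lemma (in weights) perturbed_linear_part:
  assumes a: "linear a" and up: "\<And>y. N (a y) \<le> (\<beta> + \<delta>) * N y" and low: "\<And>y. (\<alpha> - \<delta>) * N y \<le> N (a y)"
    and \<delta>: "0 < \<delta>" "2 * \<delta> < \<alpha>" "\<beta> + 3 * \<delta> < 1" "0 \<le> \<beta>"
    and nonres: "\<And>j \<mu>s. 2 \<le> j \<Longrightarrow> j < q \<Longrightarrow> length \<mu>s = j \<Longrightarrow> set \<mu>s \<subseteq> Spec a \<Longrightarrow> prod_list \<mu>s \<notin> Spec a"
  obtains b where "0 < b" "\<And>B. linear B \<Longrightarrow> lb b B \<Longrightarrow> lb (\<beta> + 2 * \<delta>) (\<lambda>x. nodewise a x + B x)"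
    "\<And>B. linear B \<Longrightarrow> lb b B \<Longrightarrow> \<exists>L. linear L \<and> lb (1 / (\<alpha> - 2 * \<delta>)) L \<and>
      (\<forall>x. nodewise a (L x) + B (L x) = x) \<and> (\<forall>x. L (nodewise a x + B x) = x)"
    "\<And>B j. linear B \<Longrightarrow> lb b B \<Longrightarrow> 2 \<le> j \<Longrightarrow> j < q \<Longrightarrow> \<exists>C\<ge>0. \<forall>K Q. multilinear j Q \<longrightarrow> mlb j K Q \<longrightarrow>
      (\<exists>P. multilinear j P \<and> mlb j (C * K) P \<and> (\<forall>vs. length vs = j \<longrightarrow>
        (nodewise a (P vs) + B (P vs)) - P (map (\<lambda>x. nodewise a x + B x) vs) = Q vs))"
proof -
  let ?A = "nodewise a :: ('m, 'n) linf \<Rightarrow> ('m, 'n) linf"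
  note A = linear_nodewise[OF a]
  have "(\<beta> + \<delta>) * N y \<le> 1 * N y" for y using \<delta> by (intro mult_right_mono) auto
  then have contr: "N (a y) \<le> N y" for y using up[of y] by (metis mult_1 order_trans)
  have lbA: "lb (\<beta> + \<delta>) ?A" using \<delta> by (intro lb_nodewise a up) auto
  then have lbA1: "lb 1 ?A" by (rule lb_mono) (use \<delta> in auto)
  have "inj a"
  proof (rule linear_injective_0[OF a, THEN iffD2], intro allI impI)
    fix y assume "a y = 0"
    then have "(\<alpha> - \<delta>) * N y \<le> 0" using low[of y] by simp
    then show "y = 0" using \<delta> N_nonneg[of y] N_eq_0[of y] by (simp add: mult_le_0_iff)
  qed
  then obtain ai where ai: "linear ai" "\<And>x. ai (a x) = x" "\<And>x. a (ai x) = x"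
    using linear_injective_isomorphism[OF a] by blast
  have "N (ai y) \<le> 1 / (\<alpha> - \<delta>) * N y" for y
    using low[of "ai y"] \<delta> by (simp add: ai(3) field_simps)
  then have lbAi: "lb (1 / (\<alpha> - \<delta>)) (nodewise ai)" using \<delta> by (intro lb_nodewise ai) auto
  have inv: "?A (nodewise ai x) = x" "nodewise ai (?A x) = x" for x
    by (rule bcontfun_eqI; simp add: apply_nodewise a ai)+
  have "\<forall>j. \<exists>C. 2 \<le> j \<and> j < q \<longrightarrow> C \<ge> 0 \<and> (\<forall>K Q. multilinear j Q \<longrightarrow> mlb j K Q \<longrightarrow>
    (\<exists>P. multilinear j P \<and> mlb j (C * K) P \<and> (\<forall>vs. length vs = j \<longrightarrow> ?A (P vs) - P (map ?A vs) = Q vs)))"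
    (is "\<forall>j. \<exists>C. ?sol j C")
  proof
    fix j show "\<exists>C. ?sol j C"
    proof (cases "2 \<le> j \<and> j < q")
      case True
      have "\<exists>C\<ge>0. \<forall>K Q. multilinear j Q \<longrightarrow> mlb j K Q \<longrightarrow>
        (\<exists>P. multilinear j P \<and> mlb j (C * K) P \<and> (\<forall>vs. length vs = j \<longrightarrow> ?A (P vs) - P (map ?A vs) = Q vs))"
        by (rule sylvester[OF a _ contr nonres]) (use True in \<open>simp_all add: apply_nodewise a\<close>)
      then show ?thesis by (elim exE conjE) (intro exI conjI impI, assumption+)
    next
      case False
      then have "?sol j 0" by (intro impI) (elim notE)
      then show ?thesis ..
    qed
  qed
  then obtain C where "\<forall>j. ?sol j (C j)" by (rule choice[THEN exE])
  then have C: "0 \<le> C j" "\<And>K Q. multilinear j Q \<Longrightarrow> mlb j K Q \<Longrightarrow>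
    \<exists>P. multilinear j P \<and> mlb j (C j * K) P \<and> (\<forall>vs. length vs = j \<longrightarrow> ?A (P vs) - P (map ?A vs) = Q vs)"
    if "2 \<le> j" "j < q" for j using that by simp_all
  \<comment> \<open>Dominates \<open>real (Suc j) * C j\<close> for every relevant \<open>j\<close>,
    because \<open>Suc j \<le> q\<close> and each \<open>C j\<close> is at most the sum.\<close>
  define c where "c = real q * (\<Sum>j=2..<q. C j)"
  have c0: "0 \<le> c" unfolding c_def by (intro mult_nonneg_nonneg sum_nonneg C) auto
  have cj: "real (Suc j) * C j \<le> c" if "2 \<le> j" "j < q" for j
    unfolding c_def using that C(1) by (intro mult_mono member_le_sum) auto
  obtain b0 where b0: "0 < b0" "b0 * c \<le> 1 / 2" using small_multiple[OF _ c0, of "1 / 2"] by auto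
  define b where "b = min \<delta> b0"
  have b: "0 < b" "b \<le> \<delta>" "b * c \<le> 1 / 2"
    using b0 \<delta> mult_right_mono[OF _ c0, of b b0] by (auto simp: b_def)
  have lbM: "lb (\<beta> + 2 * \<delta>) (\<lambda>x. ?A x + B x)" if "lb b B" for B
    by (rule lb_mono[OF lb_add[OF lbA that]]) (use b in simp)
  show thesis
  proof (rule that[OF b(1) lbM])
    fix B :: "('m, 'n) linf \<Rightarrow> ('m, 'n) linf" assume B: "linear B" "lb b B"
    obtain L where L: "linear L" "lb (1 / (\<alpha> - \<delta>) / (1 - 1 / (\<alpha> - \<delta>) * b)) L" "\<And>x. ?A (L x) + B (L x) = x" "\<And>x. L (?A x + B x) = x"
      by (rule perturbed_inverse[OF lb_bounded_linear[OF A lbA] B linear_nodewise[OF ai(1)] lbAi _ inv]) (use b \<delta> in \<open>auto simp: field_simps\<close>)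
    have "1 / (\<alpha> - \<delta>) / (1 - 1 / (\<alpha> - \<delta>) * b) = 1 / (\<alpha> - \<delta> - b)" using \<delta> b by (simp add: field_simps)
    also have "\<dots> \<le> 1 / (\<alpha> - 2 * \<delta>)" using \<delta> b by (intro divide_left_mono) auto
    finally show "\<exists>L. linear L \<and> lb (1 / (\<alpha> - 2 * \<delta>)) L \<and> (\<forall>x. ?A (L x) + B (L x) = x) \<and> (\<forall>x. L (?A x + B x) = x)"
      using L lb_mono[OF L(2)] by blast
  next
    fix B :: "('m, 'n) linf \<Rightarrow> ('m, 'n) linf" and j assume B: "linear B" "lb b B" and j: "2 \<le> j" "j < q"
    have m: "lb 1 (\<lambda>x. ?A x + B x)" by (rule lb_mono[OF lbM[OF B(2)]]) (use \<delta> in simp)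
    have "real (Suc j) * C j * b \<le> c * b" using cj[OF j] b(1) by (intro mult_right_mono) auto
    then have cb: "real (Suc j) * b * C j \<le> 1 / 2" using b(3) by (simp only: mult.commute mult.left_commute)
    show "\<exists>C\<ge>0. \<forall>K Q. multilinear j Q \<longrightarrow> mlb j K Q \<longrightarrow>
      (\<exists>P. multilinear j P \<and> mlb j (C * K) P \<and> (\<forall>vs. length vs = j \<longrightarrow> (?A (P vs) + B (P vs)) - P (map (\<lambda>x. ?A x + B x) vs) = Q vs))"
      by (intro exI[of _ "2 * C j"] conjI allI impI perturbed_sylvester[OF A lbA1 B _ m C(1)[OF j] cb C(2)[OF j]])
        (use b(1) C(1)[OF j] in simp_all)
  qed
qed

text \<open>The cutoff sends the whole space into the ball on which \<open>R\<close> lives and is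
  the identity near \<open>0\<close>; its derivatives respect all weights, so the weighted bounds
  pass to the composition.\<close>

lemma (in weights) jet_extension:
  assumes R: "jet r {x. nm x < \<rho>} R" and \<rho>: "0 < \<rho>" and b: "\<And>j x. j \<le> r \<Longrightarrow> nm x < \<rho> \<Longrightarrow> mlb j B (R j x)"
  obtains D K \<delta> where "0 < \<delta>" "jet r UNIV D" "\<And>j x. j \<le> r \<Longrightarrow> mlb j K (D j x)"
    "\<And>x. nm x < \<delta> \<Longrightarrow> D 0 x [] = R 0 x []"
proof -
  let ?n = "real CARD('n)"
  \<comment> \<open>The coordinates after the cutoff are at most \<open>2 * \<delta>\<close>; the
    factors \<open>?n\<close> and \<open>hi\<close> convert this into a bound for
    \<open>nm\<close>.\<close>
  obtain \<delta> where \<delta>: "0 < \<delta>" "hi * (?n * (2 * \<delta>)) < \<rho>"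
  proof -
    have "0 < hi * (?n * 2) " using lo_hi(2) by simp
    then show thesis using that[of "\<rho> / (2 * (hi * (?n * 2)))"] \<rho> by (simp add: field_simps)
  qed
  obtain \<psi> c where \<psi>: "0 < c" "\<And>j t. j \<le> Suc r \<Longrightarrow> (\<psi> j has_real_derivative \<psi> (Suc j) t) (at t)"
    "\<And>j t. j \<le> Suc r \<Longrightarrow> \<bar>\<psi> j t\<bar> \<le> c" "\<And>t. \<bar>t\<bar> \<le> \<delta> \<Longrightarrow> \<psi> 0 t = t" "\<And>t. \<bar>\<psi> 0 t\<bar> \<le> 2 * \<delta>"
    by (rule cutoff_function[OF \<delta>(1), where k = "Suc r"]) (rule that)
  let ?phi = "phi \<psi> :: nat \<Rightarrow> ('m, 'n) linf \<Rightarrow> _"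
  have ap: "apply_bcontfun (?phi 0 x []) i $ s = \<psi> 0 (apply_bcontfun x i $ s)" for x i s
    using apply_phi[where D = \<psi> and c = c and k = "Suc r", OF \<psi>(1-3), of 0 x "[]" i s] by simp
  have jphi: "jet r UNIV ?phi" by (rule jet_phi[where c = c and k = "Suc r"]) (use \<psi> in auto)
  have in_ball: "nm (?phi 0 x []) < \<rho>" for x
  proof -
    have "norm (?phi 0 x []) \<le> ?n * (2 * \<delta>)" by (rule norm_bcontfun_le) (simp add: ap \<psi>(5))
    then have "hi * norm (?phi 0 x []) \<le> hi * (?n * (2 * \<delta>))" using lo_hi(2) by (intro mult_left_mono) auto
    then show ?thesis using nm_le_norm[of "?phi 0 x []"] \<delta>(2) by linarith
  qed
  have jD: "jet r UNIV (cmp R ?phi)" by (rule jet_cmp[OF open_UNIV open_nm_ball R jphi]) (simp add: in_ball)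
  define K where "K = (\<Sum>j\<le>r. hi * (?n * (c * (1 / lo) ^ j))) + 1"
  have kj: "hi * (?n * (c * (1 / lo) ^ j)) \<le> K" if "j \<le> r" for j
    unfolding K_def using that lo_hi \<psi>(1) 
    by (intro order_trans[OF member_le_sum[of j "{..r}" "\<lambda>j. hi * (?n * (c * (1 / lo) ^ j))"]]) auto
  have K1: "1 \<le> K" unfolding K_def using lo_hi \<psi>(1) by (simp add: sum_nonneg)
  have mphi: "mlb j K (?phi j x)" if "j \<le> r" for j x
    by (rule mlb_mono[OF mlb_phi[where D = \<psi> and c = c and k = "Suc r", OF \<psi>(1-3)] kj]) (use that in auto)
  define B' where "B' = max B 0"
  have b': "mlb j B' (R j x)" if "j \<le> r" "nm x < \<rho>" for j x using mlb_mono[OF b[OF that]] by (simp add: B'_def)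
  have B'0: "0 \<le> B'" by (simp add: B'_def)
  define H where "H = B' + (\<Sum>j\<le>r. real (length (parts j)) * (B' * K ^ r))"
  have H: "real (length (parts j)) * (B' * K ^ r) \<le> H" if "j \<le> r" for j
    using member_le_sum[of j "{..r}" "\<lambda>j. real (length (parts j)) * (B' * K ^ r)"] that B'0 K1
    by (simp add: H_def)
  have H': "B' \<le> H" using B'0 K1 by (simp add: H_def sum_nonneg)
  have mD: "mlb j H (cmp R ?phi j x)" if j: "j \<le> r" for j x
  proof (cases j)
    case 0
    have "mlb 0 H (R 0 (?phi 0 x []))" by (rule mlb_mono[OF b'[OF _ in_ball] H']) simp
    then show ?thesis unfolding 0 by (rule mlb_cong) (simp add: cmp_0)
  next
    case (Suc i)
    have "mlb j (real (length (parts j)) * (B' * K ^ r)) (cmp R ?phi j x)"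
      by (rule mlb_cmp_general) (use mphi K1 j b' in_ball B'0 Suc in auto)
    then show ?thesis using H[OF j] by (rule mlb_mono)
  qed
  \<comment> \<open>Below \<open>lo * \<delta>\<close> every coordinate of \<open>x\<close> is in
    the range where the cutoff is the identity.\<close>
  have "cmp R ?phi 0 x [] = R 0 x []" if x: "nm x < lo * \<delta>" for x
  proof -
    have "norm x < \<delta>" using le_less_trans[OF norm_le_nm x] lo_hi(1) by simp
    then have "\<bar>apply_bcontfun x i $ s\<bar> \<le> \<delta>" for i s
      using component_le_norm_cart[of "apply_bcontfun x i" s] norm_bounded[of x i] by linarith
    then have "?phi 0 x [] = x" by (intro bcontfun_eqI) (simp add: vec_eq_iff ap \<psi>(4))
    then show ?thesis by (simp add: cmp_0)
  qed
  then show thesis using \<delta>(1) lo_hi(1) by (intro that[OF _ jD mD, of "lo * \<delta>"]) auto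
qed

lemma (in weights) jet_of_C_Gamma:
  fixes F :: "('m, 'n) linf \<Rightarrow> ('m, 'n) linf"
  assumes \<Gamma>: "decay_function \<Gamma>" and W: "W = weight_set \<Gamma>" and F: "F \<in> C_Gamma N \<Gamma> r U" and U: "open U"
  obtains D K where "Cr_derivs N r U F D" "jet r U D" "1 \<le> K"
    "\<And>j x. 1 \<le> j \<Longrightarrow> j \<le> r \<Longrightarrow> x \<in> U \<Longrightarrow> mlb j K (D j x)"
proof -
  obtain D where D: "Cr_derivs N r U F D" and fin: "\<And>j. j \<in> {1..r} \<Longrightarrow> (SUP x\<in>U. ml_Gamma_norm N \<Gamma> j (D j x)) < \<infinity>"
    using F unfolding C_Gamma_def by blast
  have jD: "jet r U D" by (rule jet_of_Cr_derivs[OF D U])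
  define k where "k j = enn2real (SUP x\<in>U. ml_Gamma_norm N \<Gamma> j (D j x))" for j
  define K where "K = 1 + (\<Sum>j\<in>{1..r}. k j)"
  have k0: "0 \<le> k j" for j by (simp add: k_def)
  have K1: "1 \<le> K" unfolding K_def using k0 by (simp add: sum_nonneg)
  have "mlb j K (D j x)" if j: "1 \<le> j" "j \<le> r" and x: "x \<in> U" for j x
  proof (rule mlb_of_ml_Gamma_norm[OF \<Gamma> W])
    show "multilinear j (D j x)" by (rule jet_multilinear[OF jD j(2) x])
    have "ml_Gamma_norm N \<Gamma> j (D j x) \<le> (SUP x\<in>U. ml_Gamma_norm N \<Gamma> j (D j x))" using x by (rule SUP_upper)
    also have "\<dots> = ennreal (k j)" using fin[of j] j by (simp add: k_def)
    also have "\<dots> \<le> ennreal K"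
      using member_le_sum[of j "{1..r}" k] j k0 by (intro ennreal_leI) (simp add: K_def)
    finally show "ml_Gamma_norm N \<Gamma> j (D j x) \<le> ennreal K" .
  qed (use K1 in simp)
  then show thesis using that D jD K1 by blast
qed

lemma norm_comparison:
  fixes N N' :: "real^'n \<Rightarrow> real"
  assumes "is_norm N" "is_norm N'"
  obtains s where "1 \<le> s" "\<And>y. N' y \<le> s * N y"
proof -
  obtain c C where c: "0 < c" "0 < C" "\<And>x. c * norm x \<le> N x" "\<And>x. N x \<le> C * norm x" using is_norm_equivalent[OF assms(1)] by blast
  obtain c' C' where c': "0 < c'" "0 < C'" "\<And>x. c' * norm x \<le> N' x" "\<And>x. N' x \<le> C' * norm x" using is_norm_equivalent[OF assms(2)] by blast
  have "N' y \<le> max 1 (C' / c) * N y" for y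
  proof -
    have "N' y \<le> (C' / c) * (c * norm y)" using c'(4)[of y] c(1) by simp
    also have "\<dots> \<le> (C' / c) * N y" using c(1) c'(2) by (intro mult_left_mono c(3)) auto
    also have "\<dots> \<le> max 1 (C' / c) * N y" using assms(1) by (intro mult_right_mono) (auto simp: is_norm_def)
    finally show ?thesis .
  qed
  then show thesis by (intro that[of "max 1 (C' / c)"]) auto
qed

theorem theorem1:
  fixes N :: "real^'n \<Rightarrow> real"
    and \<Gamma> :: "int^'m \<Rightarrow> real"
    and a :: "real^'n \<Rightarrow> real^'n"
    and lam :: "'n \<Rightarrow> complex"
    and \<alpha> \<beta> \<nu> :: real
    and r0 r :: nat
  assumes "is_norm N"
    and "decay_function \<Gamma>"
    and "linear a"
    and "Spec a = range lam"
    and "\<alpha> = Min (range (\<lambda>i. cmod (lam i)))"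
    and "\<beta> = Max (range (\<lambda>i. cmod (lam i)))"
    and "\<nu> = ln \<alpha> / ln \<beta>"
    and "int r0 = \<lfloor>\<nu>\<rfloor> + 1"
    and H1: "\<And>i. 0 < cmod (lam i) \<and> cmod (lam i) < 1"
    and H2: "\<And>i (k :: 'n \<Rightarrow> nat). 2 \<le> (\<Sum>j\<in>UNIV. k j) \<Longrightarrow> (\<Sum>j\<in>UNIV. k j) \<le> r0 \<Longrightarrow>
               lam i \<noteq> (\<Prod>j\<in>UNIV. lam j ^ k j)"
    and "r0 \<le> r"
  shows "\<exists>\<epsilon>>0. \<forall>(U :: ('m, 'n) linf set) F F0 F1 A B.
           open U \<longrightarrow> 0 \<in> U \<longrightarrow>
           F \<in> C_Gamma N \<Gamma> r U \<longrightarrow>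
           (\<forall>x\<in>U. F x = F0 x + F1 x) \<longrightarrow>
           uncoupled U F0 \<longrightarrow>
           F0 0 = 0 \<longrightarrow> F1 0 = 0 \<longrightarrow>
           (F0 has_derivative A) (at 0) \<longrightarrow> (F1 has_derivative B) (at 0) \<longrightarrow>
           (\<forall>i j v. apply_bcontfun (A (emb j v)) i = (if i = j then a v else 0)) \<longrightarrow>
           Gamma_norm N \<Gamma> B < ennreal \<epsilon> \<longrightarrow>
           (\<exists>R\<in>C_Gamma N \<Gamma> r UNIV.
              R 0 = 0 \<and> (R has_derivative (\<lambda>x. x)) (at 0) \<and>
              (\<exists>U1. open U1 \<and> 0 \<in> U1 \<and> U1 \<subseteq> U \<and>
                 (\<forall>x\<in>U1. R (F x) = A (R x) + B (R x))))"
proof -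
  have H1: "0 < cmod (lam i)" "cmod (lam i) < 1" for i using H1 by auto
  have \<alpha>\<beta>: "\<alpha> \<le> cmod (lam i)" "cmod (lam i) \<le> \<beta>" for i using assms(5,6) by auto
  have "\<alpha> \<in> range (\<lambda>i. cmod (lam i))" "\<beta> \<in> range (\<lambda>i. cmod (lam i))" unfolding assms(5,6) by (intro Min_in Max_in; simp)+
  then have \<alpha>0: "0 < \<alpha>" and \<beta>1: "\<beta> < 1" using H1 by auto
  have le: "\<alpha> \<le> \<beta>" using \<alpha>\<beta> order_trans by blast
  have q: "2 \<le> r0" "\<beta> ^ r0 < \<alpha>" using resonance_order[OF \<alpha>0 le \<beta>1] assms(7,8) by auto
  obtain \<delta> where \<delta>: "0 < \<delta>" "2 * \<delta> < \<alpha>" "\<beta> + 3 * \<delta> < 1" "(\<beta> + 3 * \<delta>) ^ r0 < \<alpha> - 2 * \<delta>"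
    by (rule spectral_gap_room[OF \<alpha>0 \<beta>1 q(2)])
  have "\<alpha> \<le> cmod z \<and> cmod z \<le> \<beta>" if "z \<in> Spec a" for z using that \<alpha>\<beta> assms(4) by auto
  then obtain N1 where N1: "is_norm N1" "\<And>y. N1 (a y) \<le> (\<beta> + \<delta>) * N1 y" "\<And>y. (\<alpha> - \<delta>) * N1 y \<le> N1 (a y)"
    using adapted_norm[OF assms(3) \<delta>(1)] by blast
  note ww = weights_weight_set[OF N1(1) assms(2)] and ww0 = weights_weight_set[OF assms(1,2)]
  interpret w: weights N1 "weight_set \<Gamma>" by (rule ww)
  interpret w0: weights N "weight_set \<Gamma>" by (rule ww0)
  have nonres: "prod_list \<mu>s \<notin> Spec a" if j: "2 \<le> j" "j < r0" and \<mu>s: "length \<mu>s = j" "set \<mu>s \<subseteq> Spec a" for j \<mu>s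
  proof -
    have "\<mu>s \<in> lists (range lam)" using \<mu>s(2) assms(4) by auto
    then obtain xs where xs: "\<mu>s = map lam xs" unfolding lists_image by blast
    have "(\<Sum>i\<in>UNIV. count_list xs i) = j" using sum_count_set[of xs UNIV] \<mu>s(1) xs by simp
    then have "lam i \<noteq> prod_list \<mu>s" for i
      unfolding xs prod_list_count using H2[of "count_list xs" i] j by simp
    then show ?thesis using assms(4) by force
  qed
  have \<beta>0: "0 \<le> \<beta>" using \<alpha>0 le by simp
  obtain b where b: "0 < b" "\<And>B. linear B \<Longrightarrow> w.lb b B \<Longrightarrow> w.lb (\<beta> + 2 * \<delta>) (\<lambda>x. nodewise a x + B x)"
    "\<And>B. linear B \<Longrightarrow> w.lb b B \<Longrightarrow> \<exists>L. linear L \<and> w.lb (1 / (\<alpha> - 2 * \<delta>)) L \<and>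
      (\<forall>x. nodewise a (L x) + B (L x) = x) \<and> (\<forall>x. L (nodewise a x + B x) = x)"
    "\<And>B j. linear B \<Longrightarrow> w.lb b B \<Longrightarrow> 2 \<le> j \<Longrightarrow> j < r0 \<Longrightarrow> \<exists>C\<ge>0. \<forall>K Q. multilinear j Q \<longrightarrow> w.mlb j K Q \<longrightarrow>
      (\<exists>P. multilinear j P \<and> w.mlb j (C * K) P \<and> (\<forall>vs. length vs = j \<longrightarrow>
        (nodewise a (P vs) + B (P vs)) - P (map (\<lambda>x. nodewise a x + B x) vs) = Q vs))"
    by (rule w.perturbed_linear_part[OF assms(3) N1(2,3) \<delta>(1-3) \<beta>0 nonres]) (assumption | rule that)+
  obtain s where s: "1 \<le> s" "\<And>y. N1 y \<le> s * N y" by (rule norm_comparison[OF assms(1) N1(1)]) (rule that)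
  obtain t where t: "1 \<le> t" "\<And>y. N y \<le> t * N1 y" by (rule norm_comparison[OF N1(1) assms(1)]) (rule that)
  \<comment> \<open>Passing from \<open>N\<close> to the adapted norm multiplies the bound on
    \<open>B\<close> by at most \<open>s * t\<close>, one factor for the value and one for the
    argument.\<close>
  define \<epsilon> where "\<epsilon> = b / (s * t)"
  have \<epsilon>: "0 < \<epsilon>" "s * t ^ 1 * \<epsilon> = b" using b(1) s(1) t(1) by (auto simp: \<epsilon>_def)
  show ?thesis
  proof (intro exI[of _ \<epsilon>] conjI \<epsilon>(1) allI impI)
    fix U :: "('m, 'n) linf set" and F F0 F1 A B
    assume U: "open U" "0 \<in> U" and F: "F \<in> C_Gamma N \<Gamma> r U" and F01: "\<forall>x\<in>U. F x = F0 x + F1 x"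
      and unc: "uncoupled U F0" and z: "F0 0 = 0" "F1 0 = 0" and dA: "(F0 has_derivative A) (at 0)"
      and dB: "(F1 has_derivative B) (at 0)"
      and blk: "\<forall>i j v. apply_bcontfun (A (emb j v)) i = (if i = j then a v else 0)"
      and small: "Gamma_norm N \<Gamma> B < ennreal \<epsilon>"
    have A: "A = nodewise a"
      by (intro ext bcontfun_eqI) (simp add: apply_nodewise assms(3) uncoupled_derivative[OF U unc dA blk[rule_format]])
    have B: "linear B" using dB by (simp add: bounded_linear.linear has_derivative_bounded_linear)
    have "w0.mlb 1 \<epsilon> (\<lambda>vs. B (hd vs))"
      by (rule w0.mlb_of_ml_Gamma_norm[OF assms(2) refl])
        (use B small \<epsilon>(1) in \<open>auto simp: multilinear_def length_Suc_conv ml_Gamma_norm_1[unfolded One_nat_def]\<close>)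
    then have "w.mlb 1 (s * t ^ 1 * \<epsilon>) (\<lambda>vs. B (hd vs))"
      using s(1) by (intro mlb_change_norm[OF ww0 ww _ s(2) t(2)]) auto
    then have lbB: "w.lb b B" unfolding \<epsilon>(2) w.mlb_1_iff by simp
    define M where "M x = nodewise a x + B x" for x
    note bM = b(2-4)[OF B lbB, folded M_def]
    have lM: "linear M" unfolding M_def by (intro linear_compose_add linear_nodewise assms(3) B)
    obtain L where L: "linear L" "w.lb (1 / (\<alpha> - 2 * \<delta>)) L" "\<And>x. M (L x) = x" "\<And>x. L (M x) = x"
      using bM(2) by blast
    obtain D K where D: "Cr_derivs N r U F D" "jet r U D" "1 \<le> K"
      "\<And>j x. 1 \<le> j \<Longrightarrow> j \<le> r \<Longrightarrow> x \<in> U \<Longrightarrow> w0.mlb j K (D j x)"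
      by (rule w0.jet_of_C_Gamma[OF assms(2) refl F U(1)]) (rule that)
    have DF: "D 0 x [] = F x" if "x \<in> U" for x using D(1) that by (simp add: Cr_derivs_def)
    obtain e where e: "0 < e" "ball 0 e \<subseteq> U" using U openE by blast
    have sub: "{x. w.nm x < w.lo * e} \<subseteq> U"
    proof
      fix x assume "x \<in> {x. w.nm x < w.lo * e}"
      then have "norm x < e" using le_less_trans[OF w.norm_le_nm, of x "w.lo * e"] w.lo_hi(1) by simp
      then show "x \<in> U" using e(2) by (auto simp: dist_norm)
    qed
    have r1: "1 \<le> r" using q(1) assms(11) by simp
    have "((\<lambda>x. F0 x + F1 x) has_derivative (\<lambda>h. A h + B h)) (at 0)" by (rule has_derivative_add[OF dA dB])
    then have "(F has_derivative M) (at 0)"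
      unfolding A M_def by (rule has_derivative_transform_within_open[OF _ U]) (simp add: F01)
    with Cr_derivs_has_derivative[OF assms(1) D(1) r1 U] have "(\<lambda>h. D 1 0 [h]) = M" by (rule has_derivative_unique)
    then have D1: "D 1 0 [h] = M h" for h by metis
    \<comment> \<open>As \<open>1 \<le> t\<close>, the exponent \<open>r\<close> serves all orders
      up to \<open>r\<close>.\<close>
    define K' where "K' = s * t ^ r * K"
    have K': "1 \<le> K'"
      unfolding K'_def using mult_mono[OF mult_mono[OF s(1) one_le_power[OF t(1), of r]] D(3)] s(1) t(1) by simp
    have bD: "w.mlb j K' (D j x)" if j: "1 \<le> j" "j \<le> r" and x: "w.nm x < w.lo * e" for j x
    proof (rule w.mlb_mono)
      show "w.mlb j (s * t ^ j * K) (D j x)"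
        using s(1) sub x by (intro mlb_change_norm[OF ww0 ww _ s(2) t(2)] D(4) j) auto
      show "s * t ^ j * K \<le> K'"
        unfolding K'_def using s(1) t(1) D(3) j by (intro mult_right_mono mult_left_mono power_increasing) auto
    qed
    have gap: "1 / (\<alpha> - 2 * \<delta>) * (\<beta> + 3 * \<delta>) ^ r0 < 1" using \<delta> by (simp add: field_simps)
    have "\<exists>\<rho> R H. 0 < \<rho> \<and> \<rho> \<le> w.lo * e \<and> jet r {x. w.nm x < \<rho>} R \<and> (\<forall>j\<le>r. \<forall>x. w.nm x < \<rho> \<longrightarrow> w.mlb j H (R j x)) \<and>
      R 0 0 [] = 0 \<and> (\<forall>h. R 1 0 [h] = h) \<and>
      (\<forall>x. w.nm x < \<rho> \<longrightarrow> w.nm (D 0 x []) \<le> w.nm x \<and> R 0 (D 0 x []) [] = M (R 0 x []))"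
    proof (rule w.local_conjugacy[OF jet_subset[OF D(2) sub] q(1) assms(11) _ lM bM(1) _ _ _ L(1,2) _ L(3,4) gap _ D1 bD K'])
      show "D 0 0 [] = 0" using DF[OF U(2)] F01 U(2) z by simp
      show "\<exists>C\<ge>0. \<forall>K Q. multilinear j Q \<longrightarrow> w.mlb j K Q \<longrightarrow> (\<exists>P. multilinear j P \<and> w.mlb j (C * K) P \<and>
          (\<forall>vs. length vs = j \<longrightarrow> M (P vs) - P (map M vs) = Q vs))" if "2 \<le> j" "j < r0" for j
        using bM(3)[OF that] unfolding M_def .
    qed (use w.lo_hi(1) e(1) \<delta> \<beta>0 in auto)
    then obtain \<rho> R H where \<rho>: "0 < \<rho>" "\<rho> \<le> w.lo * e" and R: "jet r {x. w.nm x < \<rho>} R"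
      and H': "\<forall>j\<le>r. \<forall>x. w.nm x < \<rho> \<longrightarrow> w.mlb j H (R j x)"
      and R0: "R 0 0 [] = 0" and R1': "\<forall>h. R 1 0 [h] = h"
      and conj': "\<forall>x. w.nm x < \<rho> \<longrightarrow> w.nm (D 0 x []) \<le> w.nm x \<and> R 0 (D 0 x []) [] = M (R 0 x [])"
      by (elim exE conjE)
    note H = H'[rule_format] and R1 = R1'[rule_format] and conj = conj'[rule_format]
    obtain E G d where d: "0 < d" and E: "jet r UNIV E" and G: "\<And>j x. j \<le> r \<Longrightarrow> w.mlb j G (E j x)"
      and ER: "\<And>x. w.nm x < d \<Longrightarrow> E 0 x [] = R 0 x []"
      by (rule w.jet_extension[OF R \<rho>(1) H]) (assumption | rule that)+
    define G' where "G' = t * s ^ r * max G 0"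
    have "w0.mlb j G' (E j x)" if j: "j \<le> r" for j x
    proof (rule w0.mlb_mono)
      show "w0.mlb j (t * s ^ j * G) (E j x)" using t(1) by (intro mlb_change_norm[OF ww ww0 _ t(2) s(2)] G j) auto
      have "t * s ^ j * G \<le> t * s ^ j * max G 0" using s(1) t(1) by (intro mult_left_mono) auto
      also have "\<dots> \<le> G'"
        unfolding G'_def using s(1) t(1) j by (intro mult_right_mono mult_left_mono power_increasing) auto
      finally show "t * s ^ j * G \<le> G'" .
    qed
    then have CG: "(\<lambda>x. E 0 x []) \<in> C_Gamma N \<Gamma> r UNIV" by (rule w0.C_Gamma_of_jet[OF assms(2) refl E])
    have "((\<lambda>x. R 0 x []) has_derivative (\<lambda>h. R 1 0 [h])) (at 0)"
      using jet_has_derivative[OF R, of 0 0 "[]"] r1 \<rho>(1) by simp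
    then have "((\<lambda>x. R 0 x []) has_derivative (\<lambda>h. h)) (at 0)" by (simp only: R1)
    then have dE: "((\<lambda>x. E 0 x []) has_derivative (\<lambda>h. h)) (at 0)"
      by (rule has_derivative_transform_within_open[OF _ w.open_nm_ball[of d]]) (use d ER in auto)
    show "\<exists>R\<in>C_Gamma N \<Gamma> r UNIV. R 0 = 0 \<and> (R has_derivative (\<lambda>x. x)) (at 0) \<and>
      (\<exists>U1. open U1 \<and> 0 \<in> U1 \<and> U1 \<subseteq> U \<and> (\<forall>x\<in>U1. R (F x) = A (R x) + B (R x)))"
    proof (intro bexI[OF _ CG] conjI dE exI[of _ "{x. w.nm x < min \<rho> d}"] ballI w.open_nm_ball)
      show "E 0 0 [] = 0" using ER[of 0] R0 d by simp
      show "0 \<in> {x. w.nm x < min \<rho> d}" using \<rho>(1) d by simp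
      show "{x. w.nm x < min \<rho> d} \<subseteq> U" using sub \<rho>(2) by force
      fix x assume x: "x \<in> {x. w.nm x < min \<rho> d}"
      then have xU: "x \<in> U" using sub \<rho>(2) by force
      \<comment> \<open>\<open>E\<close> agrees with \<open>R\<close> only on a ball, so the
        conjugacy carries over because \<open>F x\<close> stays in the ball of
        \<open>x\<close>.\<close>
      from x have "w.nm (F x) \<le> w.nm x" "R 0 (F x) [] = M (R 0 x [])" using conj[of x] DF[OF xU] by auto
      then show "E 0 (F x) [] = A (E 0 x []) + B (E 0 x [])" using x ER[of x] ER[of "F x"] by (simp add: A M_def)
    qed
  qed
qed

end
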